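(* Let $\mathscr{O}$ be a graded operad over a field $\mathbb{K}$ generated by a $\Sigma$-module $G$, regarded as a differential graded operad with trivial differential. Let $\mathrm{lu}_G(\mathscr{O})$ be its universal linking operad and let $\mathscr{R}_G(\mathscr{O})$ be the operad defined in the context, formed with any choice of the chain map $\iota$ described there. Then there is an isomorphism of operads $$H_*(\mathrm{lu}_G\,\mathscr{O})\to \mathscr{R}_G(\mathscr{O}).$$
   Context: Operads are symmetric operads in graded $\mathbb{K}$-vector spaces; a dg operad is an operad in chain complexes (differential of degree $-1$). $U$ is the forgetful functor from operads to graded $\Sigma$-modules, $\langle M\rangle$ is the free operad on the $\Sigma$-module $M$, and $\langle G|R\rangle$ is the quotient of $\langle G\rangle$ by the operadic ideal generated by the image of a given map $R\to U\langle G\rangle$. $s$ is suspension (raising degree by one) and $s^{-1}$ is desuspension. $a(\otimes_{i=1}^n b_i)$ denotes the operadic composite of an element $a$ of arity $n$ with $b_1,\dots,b_n$. The functor $\mathrm{ch}$. For an operad $\mathscr{O}$, let $\iota$ and $\partial$ be the maps from $U(\mathscr{O})$ into $\langle U(\mathscr{O})\oplus s^{-1}U(\mathscr{O})\rangle$ identifying $\mathscr{O}$ with the first and second summand respectively. Then $\mathrm{ch}\,\mathscr{O}$ is the quotient of $\langle U(\mathscr{O})\oplus s^{-1}U(\mathscr{O})\rangle$ by the ideal generated by the relations $$\partial(a(\otimes_{i=1}^n b_i))=\partial a(\otimes_{i=1}^n\iota b_i)+\sum_{i=1}^n(-1)^{|a|+\sum_{j=1}^{i-1}|b_j|}\,\iota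 a(\otimes_{j=1}^n\varphi_{ij}b_j),\qquad \iota(a(\otimes_{i=1}^n b_i))=\iota a(\otimes_{i=1}^n\iota b_i),$$ where $\varphi_{ij}=\partial$ if $i=j$ and $\varphi_{ij}=\iota$ otherwise, with $\iota$ preserving the operad unit. It is a dg operad with differential determined by $\iota a\mapsto\partial a$, $\partial a\mapsto 0$ (the "chainification differential", also denoted $\partial$). $\mathrm{ch}$ is left adjoint to the functor forgetting the differential. Universal linking operads. Let $\mathscr{P}=\langle G|R\rangle$ and $\mathscr{Q}=\langle G'|R'\rangle$ be operads, $\mathscr{Q}$ equipped with a differential (the trivial one if none is specified), and let $\varphi:s^{-1}G\to U\langle G'\rangle$ be a map of $\Sigma$-modules. The composite $s^{-1}G\to U\langle G'\rangle\to U\mathscr{Q}$ and the map $s^{-1}G\to\mathrm{ch}(\mathscr{P})$, $s^{-1}g\mapsto\partial g$, induce morphisms of dg operads $\mathscr{Q}\leftarrow\mathrm{ch}\langle s^{-1}G\rangle\to\mathrm{ch}(\mathscr{P})$. The universal linking operad $\mathrm{lu}_\varphi(\mathscr{P},\mathscr{Q})$ is the pushout of these morphisms in dg operads. For $\mathscr{O}$ generated by $G$, $\mathrm{lu}_G(\mathscr{O})=\mathrm{lu}(\langle sG\rangle,\mathscr{O})$ with $\varphi:s^{-1}sG=G\to U\langle G\rangle$ the canonical inclusion. The operad $\mathscr{R}_G(\mathscr{O})$. Let $p:\mathrm{ch}\langle sG\rangle\to\mathrm{lu}_G(\mathscr{O})$ be the canonical map. Let $\partial R$ denote the $\Sigma$-module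 $\ker\partial\cap\ker p\subseteq\mathrm{ch}\langle sG\rangle$ and let $R$ be its suspension, so that $\partial R$ is the desuspension of $R$; view $R\oplus\partial R$ as a complex of $\Sigma$-modules with differential the canonical identification $R\to\partial R$. Choose a chain map $\iota:R\oplus\partial R\to\mathrm{ch}\langle sG\rangle$ whose restriction to $\partial R$ is the inclusion of $\ker\partial\cap\ker p$. Let $a:\ker p\to\mathrm{ch}\langle sG\rangle$ and $b:\ker\partial\to\mathrm{ch}\langle sG\rangle$ be the inclusions, let $f=a+b:\ker p\oplus\ker\partial\to\mathrm{ch}\langle sG\rangle$, and let $g:\langle R\rangle\to\mathrm{ch}\langle sG\rangle$ be the operad map induced by $\iota|_R$. Let $g^*f$ be the pullback of $f$ along $g$, a map with target $\langle R\rangle$. Then $\mathscr{R}_G(\mathscr{O})=\mathrm{coker}(g^*f)$, i.e. the quotient of $\langle R\rangle$ by the operadic ideal generated by the image of $g^*f$.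
   Formalization: In the definition of R_G(O), ker ∂ (the source of b) is replaced by the cycles in the augmentation ideal of ch⟨sG⟩; with the full kernel the unit lies in the image of g^*f, so R_G(O)=0, while H_*(lu_G O) is nonzero (e.g. G=0, O the unit operad). *)

theory Defs
  imports "HOL-Algebra.Module" "HOL-Combinatorics.Permutations"
begin

section \<open>Graded Sigma-modules\<close>

text \<open>
  A graded Sigma-module is given by its homogeneous elements: the component of arity \<open>n\<close> and
  degree \<open>d\<close> consists of the elements with these values of \<^term>\<open>arity\<close> and \<^term>\<open>deg\<close>, so that the
  components are disjoint and each has its own zero \<open>nul n d\<close>.  Inputs are numbered from 0.  The
  symmetric groups act from the left: on the multilinear operations of a graded vector space,
  \<open>perm \<sigma> f\<close> is \<open>x \<mapsto> \<plusminus> f (x\<^bsub>\<sigma>(0)\<^esub>, \<dots>, x\<^bsub>\<sigma>(n-1)\<^esub>)\<close> with the Koszul sign; the right action is by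
  inverses.
\<close>

record ('k, 'a) smod =
  elts :: "'a set"
  arity :: "'a \<Rightarrow> nat"
  deg :: "'a \<Rightarrow> int"
  nul :: "nat \<Rightarrow> int \<Rightarrow> 'a"
  pls :: "'a \<Rightarrow> 'a \<Rightarrow> 'a"
  scale :: "'k \<Rightarrow> 'a \<Rightarrow> 'a"
  perm :: "(nat \<Rightarrow> nat) \<Rightarrow> 'a \<Rightarrow> 'a"

definition same_grade :: "('k, 'a, 'm) smod_scheme \<Rightarrow> 'a \<Rightarrow> 'a \<Rightarrow> bool" where
  "same_grade M x y \<longleftrightarrow> arity M x = arity M y \<and> deg M x = deg M y"

text \<open>The ring operations of the record type of modules are irrelevant here.\<close>

definition component :: "('k, 'a, 'm) smod_scheme \<Rightarrow> nat \<Rightarrow> int \<Rightarrow> ('k, 'a) module" where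
  "component M n d =
    \<lparr>carrier = {x \<in> elts M. arity M x = n \<and> deg M x = d},
     monoid.mult = (\<lambda>_ _. undefined), one = undefined,
     zero = nul M n d, add = pls M, smult = scale M\<rparr>"

locale smodule =
  fixes K :: "('k, 'z) ring_scheme" (structure) and M :: "('k, 'a, 'm) smod_scheme"
  assumes component_module: "module K (component M n d)"
    and perm_closed: "\<lbrakk>x \<in> elts M; \<sigma> permutes {..<arity M x}\<rbrakk> \<Longrightarrow>
          perm M \<sigma> x \<in> elts M \<and> same_grade M (perm M \<sigma> x) x"
    and perm_id: "x \<in> elts M \<Longrightarrow> perm M id x = x"
    and perm_comp: "\<lbrakk>x \<in> elts M; \<sigma> permutes {..<arity M x}; \<tau> permutes {..<arity M x}\<rbrakk> \<Longrightarrow>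
          perm M \<sigma> (perm M \<tau> x) = perm M (\<sigma> \<circ> \<tau>) x"
    and perm_plus: "\<lbrakk>x \<in> elts M; y \<in> elts M; same_grade M x y; \<sigma> permutes {..<arity M x}\<rbrakk> \<Longrightarrow>
          perm M \<sigma> (pls M x y) = pls M (perm M \<sigma> x) (perm M \<sigma> y)"
    and perm_scale: "\<lbrakk>c \<in> carrier K; x \<in> elts M; \<sigma> permutes {..<arity M x}\<rbrakk> \<Longrightarrow>
          perm M \<sigma> (scale M c x) = scale M c (perm M \<sigma> x)"

definition smod_hom :: "('k, 'z) ring_scheme \<Rightarrow> ('k, 'a, 'm) smod_scheme \<Rightarrow>
    ('k, 'b, 'n) smod_scheme \<Rightarrow> ('a \<Rightarrow> 'b) \<Rightarrow> bool" where
  "smod_hom K M N f \<longleftrightarrow>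
    (\<forall>x\<in>elts M. f x \<in> elts N \<and> arity N (f x) = arity M x \<and> deg N (f x) = deg M x) \<and>
    (\<forall>x\<in>elts M. \<forall>y\<in>elts M. same_grade M x y \<longrightarrow> f (pls M x y) = pls N (f x) (f y)) \<and>
    (\<forall>c\<in>carrier K. \<forall>x\<in>elts M. f (scale M c x) = scale N c (f x)) \<and>
    (\<forall>x\<in>elts M. \<forall>\<sigma>. \<sigma> permutes {..<arity M x} \<longrightarrow> f (perm M \<sigma> x) = perm N \<sigma> (f x))"

text \<open>The sign \<open>(-1)\<^sup>e\<close>, and subtraction.\<close>

definition signed :: "('k, 'z) ring_scheme \<Rightarrow> ('k, 'a, 'm) smod_scheme \<Rightarrow> int \<Rightarrow> 'a \<Rightarrow> 'a" where
  "signed K M e x = (if even e then x else scale M (\<ominus>\<^bsub>K\<^esub> \<one>\<^bsub>K\<^esub>) x)"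

definition mns :: "('k, 'z) ring_scheme \<Rightarrow> ('k, 'a, 'm) smod_scheme \<Rightarrow> 'a \<Rightarrow> 'a \<Rightarrow> 'a" where
  "mns K M x y = pls M x (scale M (\<ominus>\<^bsub>K\<^esub> \<one>\<^bsub>K\<^esub>) y)"

text \<open>\<open>shift 1\<close> is the suspension and \<open>shift (-1)\<close> the desuspension; the elements are unchanged.\<close>

definition shift :: "int \<Rightarrow> ('k, 'a, 'm) smod_scheme \<Rightarrow> ('k, 'a) smod" where
  "shift k M = \<lparr>elts = elts M, arity = arity M, deg = (\<lambda>x. deg M x + k),
     nul = (\<lambda>n d. nul M n (d - k)), pls = pls M, scale = scale M, perm = perm M\<rparr>"

definition dsum :: "('k, 'a, 'm) smod_scheme \<Rightarrow> ('k, 'b, 'n) smod_scheme \<Rightarrow>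
    ('k, 'a \<times> 'b) smod" where
  "dsum M N =
    \<lparr>elts = {(x, y). x \<in> elts M \<and> y \<in> elts N \<and> arity M x = arity N y \<and> deg M x = deg N y},
     arity = arity M \<circ> fst, deg = deg M \<circ> fst,
     nul = (\<lambda>n d. (nul M n d, nul N n d)),
     pls = (\<lambda>(x, y) (x', y'). (pls M x x', pls N y y')),
     scale = (\<lambda>c. map_prod (scale M c) (scale N c)),
     perm = (\<lambda>\<sigma>. map_prod (perm M \<sigma>) (perm N \<sigma>))\<rparr>"

definition inj1 :: "('k, 'a, 'm) smod_scheme \<Rightarrow> ('k, 'b, 'n) smod_scheme \<Rightarrow> 'a \<Rightarrow> 'a \<times> 'b" where
  "inj1 M N x = (x, nul N (arity M x) (deg M x))"

definition inj2 :: "('k, 'a, 'm) smod_scheme \<Rightarrow> ('k, 'b, 'n) smod_scheme \<Rightarrow> 'b \<Rightarrow> 'a \<times> 'b" where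
  "inj2 M N y = (nul M (arity N y) (deg N y), y)"


section \<open>Operads\<close>

record ('k, 'a) operad = "('k, 'a) smod" +
  unt :: 'a
  cmp :: "'a \<Rightarrow> 'a list \<Rightarrow> 'a"

definition composable :: "('k, 'a, 'm) smod_scheme \<Rightarrow> 'a \<Rightarrow> 'a list \<Rightarrow> bool" where
  "composable P a bs \<longleftrightarrow> a \<in> elts P \<and> set bs \<subseteq> elts P \<and> length bs = arity P a"

text \<open>
  If the inputs are divided into consecutive blocks of lengths \<open>ks\<close>, then \<open>block_perm ks \<sigma>\<close> sends the
  places of the rearranged sequence of blocks \<open>\<sigma>(0), \<sigma>(1), \<dots>\<close> to their places in the original one,
  and \<open>sum_perm ks \<tau>s\<close> permutes the \<open>j\<close>-th block by \<open>\<tau>s ! j\<close>.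
\<close>

definition block_start :: "nat list \<Rightarrow> nat \<Rightarrow> nat" where
  "block_start ks j = sum_list (take j ks)"

definition list_perm :: "nat list \<Rightarrow> nat \<Rightarrow> nat" where
  "list_perm l m = (if m < length l then l ! m else m)"

definition block_perm :: "nat list \<Rightarrow> (nat \<Rightarrow> nat) \<Rightarrow> nat \<Rightarrow> nat" where
  "block_perm ks \<sigma> =
    list_perm (concat (map (\<lambda>j. map (\<lambda>r. block_start ks (\<sigma> j) + r) [0..<ks ! \<sigma> j]) [0..<length ks]))"

definition sum_perm :: "nat list \<Rightarrow> (nat \<Rightarrow> nat) list \<Rightarrow> nat \<Rightarrow> nat" where
  "sum_perm ks \<tau>s =
    list_perm (concat (map (\<lambda>j. map (\<lambda>r. block_start ks j + (\<tau>s ! j) r) [0..<ks ! j]) [0..<length ks]))"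

text \<open>Exponent of the Koszul sign of rearranging elements of degrees \<open>d\<^bsub>0\<^esub>, d\<^bsub>1\<^esub>, \<dots>\<close> into the
  order \<open>\<sigma>(0), \<sigma>(1), \<dots>\<close>.\<close>

definition koszul :: "(nat \<Rightarrow> nat) \<Rightarrow> int list \<Rightarrow> int" where
  "koszul \<sigma> ds = (\<Sum>j<length ds. \<Sum>i<j. if \<sigma> j < \<sigma> i then ds ! \<sigma> i * ds ! \<sigma> j else 0)"

locale operad = smodule K P
  for K :: "('k, 'z) ring_scheme" (structure) and P :: "('k, 'a, 'm) operad_scheme" +
  assumes unit_closed: "unt P \<in> elts P"
    and arity_unit: "arity P (unt P) = 1"
    and deg_unit: "deg P (unt P) = 0"
    and comp_closed: "composable P a bs \<Longrightarrow> cmp P a bs \<in> elts P"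
    and arity_comp: "composable P a bs \<Longrightarrow>
          arity P (cmp P a bs) = sum_list (map (arity P) bs)"
    and deg_comp: "composable P a bs \<Longrightarrow>
          deg P (cmp P a bs) = deg P a + sum_list (map (deg P) bs)"
    and comp_plus_left: "\<lbrakk>composable P a bs; a' \<in> elts P; same_grade P a a'\<rbrakk> \<Longrightarrow>
          cmp P (pls P a a') bs
            = pls P (cmp P a bs) (cmp P a' bs)"
    and comp_scale_left: "\<lbrakk>composable P a bs; c \<in> carrier K\<rbrakk> \<Longrightarrow>
          cmp P (scale P c a) bs = scale P c (cmp P a bs)"
    and comp_plus_right:
          "\<lbrakk>composable P a bs; i < length bs; b \<in> elts P; same_grade P b (bs ! i)\<rbrakk> \<Longrightarrow>
          cmp P a (bs[i := pls P (bs ! i) b])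
            = pls P (cmp P a bs) (cmp P a (bs[i := b]))"
    and comp_scale_right: "\<lbrakk>composable P a bs; i < length bs; c \<in> carrier K\<rbrakk> \<Longrightarrow>
          cmp P a (bs[i := scale P c (bs ! i)]) = scale P c (cmp P a bs)"
    and unit_left: "a \<in> elts P \<Longrightarrow> cmp P (unt P) [a] = a"
    and unit_right: "a \<in> elts P \<Longrightarrow>
          cmp P a (replicate (arity P a) (unt P)) = a"
    and assoc: "\<lbrakk>composable P a bs; length css = length bs;
          \<And>i. i < length bs \<Longrightarrow> composable P (bs ! i) (css ! i)\<rbrakk> \<Longrightarrow>
          cmp P (cmp P a bs) (concat css)
            = signed K P (\<Sum>i<length bs. \<Sum>j<i. deg P (bs ! i) * sum_list (map (deg P) (css ! j)))
                (cmp P a (map2 (cmp P) bs css))"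
    and equivariant_left: "\<lbrakk>composable P a bs; \<sigma> permutes {..<arity P a}\<rbrakk> \<Longrightarrow>
          cmp P (perm P \<sigma> a) bs
            = signed K P (koszul \<sigma> (map (deg P) bs))
                (perm P (block_perm (map (arity P) bs) \<sigma>)
                  (cmp P a (map (\<lambda>j. bs ! \<sigma> j) [0..<length bs])))"
    and equivariant_right: "\<lbrakk>composable P a bs; length \<tau>s = length bs;
          \<And>i. i < length bs \<Longrightarrow> (\<tau>s ! i) permutes {..<arity P (bs ! i)}\<rbrakk> \<Longrightarrow>
          cmp P a (map2 (perm P) \<tau>s bs)
            = perm P (sum_perm (map (arity P) bs) \<tau>s) (cmp P a bs)"

definition operad_hom :: "('k, 'z) ring_scheme \<Rightarrow> ('k, 'a, 'm) operad_scheme \<Rightarrow>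
    ('k, 'b, 'n) operad_scheme \<Rightarrow> ('a \<Rightarrow> 'b) \<Rightarrow> bool" where
  "operad_hom K P Q f \<longleftrightarrow> smod_hom K P Q f \<and> f (unt P) = unt Q \<and>
    (\<forall>a bs. composable P a bs \<longrightarrow> f (cmp P a bs) = cmp Q (f a) (map f bs))"

definition operad_iso :: "('k, 'z) ring_scheme \<Rightarrow> ('k, 'a, 'm) operad_scheme \<Rightarrow>
    ('k, 'b, 'n) operad_scheme \<Rightarrow> ('a \<Rightarrow> 'b) \<Rightarrow> bool" where
  "operad_iso K P Q f \<longleftrightarrow> operad_hom K P Q f \<and> bij_betw f (elts P) (elts Q)"


subsection \<open>Quotients\<close>

definition op_congruence :: "('k, 'z) ring_scheme \<Rightarrow> ('k, 'a, 'm) operad_scheme \<Rightarrow> 'a rel \<Rightarrow> bool" where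
  "op_congruence K P R \<longleftrightarrow> equiv (elts P) R \<and>
    (\<forall>(x, x')\<in>R. same_grade P x x') \<and>
    (\<forall>(x, x')\<in>R. \<forall>(y, y')\<in>R. same_grade P x y \<longrightarrow> (pls P x y, pls P x' y') \<in> R) \<and>
    (\<forall>(x, x')\<in>R. \<forall>c\<in>carrier K. (scale P c x, scale P c x') \<in> R) \<and>
    (\<forall>(x, x')\<in>R. \<forall>\<sigma>. \<sigma> permutes {..<arity P x} \<longrightarrow> (perm P \<sigma> x, perm P \<sigma> x') \<in> R) \<and>
    (\<forall>(a, a')\<in>R. \<forall>bs bs'. list_all2 (\<lambda>b b'. (b, b') \<in> R) bs bs' \<longrightarrow> length bs = arity P a \<longrightarrow>
      (cmp P a bs, cmp P a' bs') \<in> R)"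

definition rep :: "'a set \<Rightarrow> 'a" where
  "rep X = (SOME x. x \<in> X)"

definition quot :: "('k, 'a, 'm) operad_scheme \<Rightarrow> 'a rel \<Rightarrow> ('k, 'a set) operad" where
  "quot P R =
    \<lparr>elts = elts P // R, arity = arity P \<circ> rep, deg = deg P \<circ> rep,
     nul = (\<lambda>n d. R `` {nul P n d}),
     pls = (\<lambda>X Y. R `` {pls P (rep X) (rep Y)}),
     scale = (\<lambda>c X. R `` {scale P c (rep X)}),
     perm = (\<lambda>\<sigma> X. R `` {perm P \<sigma> (rep X)}),
     unt = R `` {unt P},
     cmp = (\<lambda>A Bs. R `` {cmp P (rep A) (map rep Bs)})\<rparr>"

inductive_set op_ideal :: "('k, 'z) ring_scheme \<Rightarrow> ('k, 'a, 'm) operad_scheme \<Rightarrow> 'a set \<Rightarrow> 'a set"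
  for K and P and S where
  generator: "x \<in> S \<Longrightarrow> x \<in> op_ideal K P S"
| nul: "nul P n d \<in> op_ideal K P S"
| plus: "\<lbrakk>x \<in> op_ideal K P S; y \<in> op_ideal K P S; same_grade P x y\<rbrakk> \<Longrightarrow> pls P x y \<in> op_ideal K P S"
| scale: "\<lbrakk>x \<in> op_ideal K P S; c \<in> carrier K\<rbrakk> \<Longrightarrow> scale P c x \<in> op_ideal K P S"
| perm: "\<lbrakk>x \<in> op_ideal K P S; \<sigma> permutes {..<arity P x}\<rbrakk> \<Longrightarrow> perm P \<sigma> x \<in> op_ideal K P S"
| comp_left: "\<lbrakk>a \<in> op_ideal K P S; composable P a bs\<rbrakk> \<Longrightarrow> cmp P a bs \<in> op_ideal K P S"
| comp_right: "\<lbrakk>b \<in> op_ideal K P S; b \<in> set bs; composable P a bs\<rbrakk> \<Longrightarrow>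
    cmp P a bs \<in> op_ideal K P S"

definition ideal_rel :: "('k, 'z) ring_scheme \<Rightarrow> ('k, 'a, 'm) smod_scheme \<Rightarrow> 'a set \<Rightarrow> 'a rel" where
  "ideal_rel K P I =
    {(x, y). x \<in> elts P \<and> y \<in> elts P \<and> same_grade P x y \<and> mns K P x y \<in> I}"

text \<open>The quotient by the operadic ideal generated by \<open>S\<close>, and its projection.\<close>

definition quotient_op :: "('k, 'z) ring_scheme \<Rightarrow> ('k, 'a, 'm) operad_scheme \<Rightarrow> 'a set \<Rightarrow>
    ('k, 'a set) operad" where
  "quotient_op K P S = quot P (ideal_rel K P (op_ideal K P S))"

definition quotient_proj :: "('k, 'z) ring_scheme \<Rightarrow> ('k, 'a, 'm) operad_scheme \<Rightarrow> 'a set \<Rightarrow> 'a \<Rightarrow> 'a set" where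
  "quotient_proj K P S x = ideal_rel K P (op_ideal K P S) `` {x}"


subsection \<open>Free operads\<close>

datatype ('k, 'a) tm =
    Gen 'a
  | Unit
  | Nul nat int
  | Plus "('k, 'a) tm" "('k, 'a) tm"
  | Scale 'k "('k, 'a) tm"
  | Perm "nat \<Rightarrow> nat" "('k, 'a) tm"
  | Comp "('k, 'a) tm" "('k, 'a) tm list"

primrec tm_arity :: "('k, 'a, 'm) smod_scheme \<Rightarrow> ('k, 'a) tm \<Rightarrow> nat" where
  "tm_arity M (Gen x) = arity M x"
| "tm_arity M Unit = 1"
| "tm_arity M (Nul n d) = n"
| "tm_arity M (Plus t u) = tm_arity M t"
| "tm_arity M (Scale c t) = tm_arity M t"
| "tm_arity M (Perm \<sigma> t) = tm_arity M t"
| "tm_arity M (Comp t us) = sum_list (map (tm_arity M) us)"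

primrec tm_deg :: "('k, 'a, 'm) smod_scheme \<Rightarrow> ('k, 'a) tm \<Rightarrow> int" where
  "tm_deg M (Gen x) = deg M x"
| "tm_deg M Unit = 0"
| "tm_deg M (Nul n d) = d"
| "tm_deg M (Plus t u) = tm_deg M t"
| "tm_deg M (Scale c t) = tm_deg M t"
| "tm_deg M (Perm \<sigma> t) = tm_deg M t"
| "tm_deg M (Comp t us) = tm_deg M t + sum_list (map (tm_deg M) us)"

inductive_set tms :: "('k, 'z) ring_scheme \<Rightarrow> ('k, 'a, 'm) smod_scheme \<Rightarrow> ('k, 'a) tm set"
  for K and M where
  "x \<in> elts M \<Longrightarrow> Gen x \<in> tms K M"
| "Unit \<in> tms K M"
| "Nul n d \<in> tms K M"
| "\<lbrakk>t \<in> tms K M; u \<in> tms K M; tm_arity M t = tm_arity M u; tm_deg M t = tm_deg M u\<rbrakk> \<Longrightarrow>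
    Plus t u \<in> tms K M"
| "\<lbrakk>c \<in> carrier K; t \<in> tms K M\<rbrakk> \<Longrightarrow> Scale c t \<in> tms K M"
| "\<lbrakk>t \<in> tms K M; \<sigma> permutes {..<tm_arity M t}\<rbrakk> \<Longrightarrow> Perm \<sigma> t \<in> tms K M"
| "\<lbrakk>t \<in> tms K M; \<forall>u\<in>set us. u \<in> tms K M; length us = tm_arity M t\<rbrakk> \<Longrightarrow> Comp t us \<in> tms K M"

text \<open>The algebra of formal operadic expressions in the elements of \<open>M\<close>; it has the signature of an
  operad but satisfies none of the equations.\<close>

definition tm_alg :: "('k, 'z) ring_scheme \<Rightarrow> ('k, 'a, 'm) smod_scheme \<Rightarrow>
    ('k, ('k, 'a) tm) operad" where
  "tm_alg K M = \<lparr>elts = tms K M, arity = tm_arity M, deg = tm_deg M, nul = Nul, pls = Plus,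
     scale = Scale, perm = Perm, unt = Unit, cmp = Comp\<rparr>"

text \<open>The free operad: expressions modulo the least congruence whose quotient is an operad
  receiving \<open>M\<close> by a map of Sigma-modules.\<close>

definition free_rel :: "('k, 'z) ring_scheme \<Rightarrow> ('k, 'a, 'm) smod_scheme \<Rightarrow> ('k, 'a) tm rel" where
  "free_rel K M = \<Inter> {R. op_congruence K (tm_alg K M) R \<and> operad K (quot (tm_alg K M) R) \<and>
     smod_hom K M (quot (tm_alg K M) R) (\<lambda>x. R `` {Gen x})}"

definition free :: "('k, 'z) ring_scheme \<Rightarrow> ('k, 'a, 'm) smod_scheme \<Rightarrow>
    ('k, ('k, 'a) tm set) operad" where
  "free K M = quot (tm_alg K M) (free_rel K M)"

definition gen :: "('k, 'z) ring_scheme \<Rightarrow> ('k, 'a, 'm) smod_scheme \<Rightarrow> 'a \<Rightarrow> ('k, 'a) tm set" where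
  "gen K M x = free_rel K M `` {Gen x}"

text \<open>The operad morphism from the free operad induced by \<open>f\<close>.\<close>

definition free_map :: "('k, 'z) ring_scheme \<Rightarrow> ('k, 'a, 'm) smod_scheme \<Rightarrow>
    ('k, 'b, 'n) operad_scheme \<Rightarrow> ('a \<Rightarrow> 'b) \<Rightarrow> ('k, 'a) tm set \<Rightarrow> 'b" where
  "free_map K M P f = (THE h. h \<in> extensional (elts (free K M)) \<and> operad_hom K (free K M) P h \<and>
     (\<forall>x\<in>elts M. h (gen K M x) = f x))"

locale generated_by = G: smodule K G + O: operad K Q
  for K :: "('k, 'z) ring_scheme" (structure) and G :: "('k, 'g, 'm) smod_scheme"
    and \<gamma> :: "'g \<Rightarrow> 'a" and Q :: "('k, 'a, 'n) operad_scheme" +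
  assumes gamma_hom: "smod_hom K G Q \<gamma>"
    and generates: "free_map K G Q \<gamma> ` elts (free K G) = elts Q"


section \<open>Differential graded operads\<close>

record ('k, 'a) dgoperad = "('k, 'a) operad" +
  dif :: "'a \<Rightarrow> 'a"

definition with_dif :: "('k, 'a, 'm) operad_scheme \<Rightarrow> ('a \<Rightarrow> 'a) \<Rightarrow> ('k, 'a) dgoperad" where
  "with_dif P D = operad.extend (operad.truncate P) (dgoperad.fields D)"

definition trivial_dif :: "('k, 'a, 'm) operad_scheme \<Rightarrow> ('k, 'a) dgoperad" where
  "trivial_dif P = with_dif P (\<lambda>x. nul P (arity P x) (deg P x - 1))"

text \<open>Derivations of degree -1; the target \<open>shift 1 P\<close> encodes the lowering of degrees.\<close>

definition derivation :: "('k, 'z) ring_scheme \<Rightarrow> ('k, 'a, 'm) operad_scheme \<Rightarrow> ('a \<Rightarrow> 'a) \<Rightarrow> bool" where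
  "derivation K P D \<longleftrightarrow> smod_hom K P (shift 1 P) D \<and>
    (\<forall>a bs. composable P a bs \<longrightarrow>
      D (cmp P a bs)
      = pls P (cmp P (D a) bs)
          (\<Oplus>\<^bsub>component P (sum_list (map (arity P) bs)) (deg P a + sum_list (map (deg P) bs) - 1)\<^esub>
            i\<in>{..<length bs}.
              signed K P (deg P a + (\<Sum>j<i. deg P (bs ! j))) (cmp P a (bs[i := D (bs ! i)]))))"

locale dg_operad = operad K P
  for K :: "('k, 'z) ring_scheme" (structure) and P :: "('k, 'a, 'm) dgoperad_scheme" +
  assumes dif_derivation: "derivation K P (dif P)"
    and dif_dif: "x \<in> elts P \<Longrightarrow> dif P (dif P x) = nul P (arity P x) (deg P x - 2)"

definition dg_hom :: "('k, 'z) ring_scheme \<Rightarrow> ('k, 'a, 'm) dgoperad_scheme \<Rightarrow>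
    ('k, 'b, 'n) dgoperad_scheme \<Rightarrow> ('a \<Rightarrow> 'b) \<Rightarrow> bool" where
  "dg_hom K P Q f \<longleftrightarrow> operad_hom K P Q f \<and> (\<forall>x\<in>elts P. f (dif P x) = dif Q (f x))"

definition cycles :: "('k, 'a, 'm) dgoperad_scheme \<Rightarrow> 'a set" where
  "cycles P = {x \<in> elts P. dif P x = nul P (arity P x) (deg P x - 1)}"

definition homology :: "('k, 'z) ring_scheme \<Rightarrow> ('k, 'a, 'm) dgoperad_scheme \<Rightarrow>
    ('k, 'a set) operad" where
  "homology K P =
    (let Z = P\<lparr>elts := cycles P\<rparr> in quot Z (ideal_rel K Z (dif P ` elts P)))"


subsection \<open>Chainification\<close>

definition ch_base :: "('k, 'z) ring_scheme \<Rightarrow> ('k, 'a, 'm) operad_scheme \<Rightarrow>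
    ('k, ('k, 'a \<times> 'a) tm set) operad" where
  "ch_base K P = free K (dsum P (shift (-1) P))"

definition ch_iota0 :: "('k, 'z) ring_scheme \<Rightarrow> ('k, 'a, 'm) operad_scheme \<Rightarrow> 'a \<Rightarrow>
    ('k, 'a \<times> 'a) tm set" where
  "ch_iota0 K P a = gen K (dsum P (shift (-1) P)) (inj1 P (shift (-1) P) a)"

definition ch_del0 :: "('k, 'z) ring_scheme \<Rightarrow> ('k, 'a, 'm) operad_scheme \<Rightarrow> 'a \<Rightarrow>
    ('k, 'a \<times> 'a) tm set" where
  "ch_del0 K P a = gen K (dsum P (shift (-1) P)) (inj2 P (shift (-1) P) a)"

definition ch_rels :: "('k, 'z) ring_scheme \<Rightarrow> ('k, 'a, 'm) operad_scheme \<Rightarrow>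
    ('k, 'a \<times> 'a) tm set set" where
  "ch_rels K P =
    (let B = ch_base K P; \<iota> = ch_iota0 K P; \<delta> = ch_del0 K P in
     {mns K B (\<delta> (cmp P a bs))
        (pls B (cmp B (\<delta> a) (map \<iota> bs))
          (\<Oplus>\<^bsub>component B (sum_list (map (arity P) bs)) (deg P a + sum_list (map (deg P) bs) - 1)\<^esub>
            i\<in>{..<length bs}.
              signed K B (deg P a + (\<Sum>j<i. deg P (bs ! j)))
                (cmp B (\<iota> a)
                  (map (\<lambda>j. if i = j then \<delta> (bs ! j) else \<iota> (bs ! j)) [0..<length bs]))))
      | a bs. composable P a bs} \<union>
     {mns K B (\<iota> (cmp P a bs)) (cmp B (\<iota> a) (map \<iota> bs))
      | a bs. composable P a bs} \<union>
     {mns K B (\<iota> (unt P)) (unt B)})"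

definition ch_iota :: "('k, 'z) ring_scheme \<Rightarrow> ('k, 'a, 'm) operad_scheme \<Rightarrow> 'a \<Rightarrow>
    ('k, 'a \<times> 'a) tm set set" where
  "ch_iota K P a = quotient_proj K (ch_base K P) (ch_rels K P) (ch_iota0 K P a)"

definition ch_del :: "('k, 'z) ring_scheme \<Rightarrow> ('k, 'a, 'm) operad_scheme \<Rightarrow> 'a \<Rightarrow>
    ('k, 'a \<times> 'a) tm set set" where
  "ch_del K P a = quotient_proj K (ch_base K P) (ch_rels K P) (ch_del0 K P a)"

definition ch :: "('k, 'z) ring_scheme \<Rightarrow> ('k, 'a, 'm) operad_scheme \<Rightarrow>
    ('k, ('k, 'a \<times> 'a) tm set set) dgoperad" where
  "ch K P =
    (let C = quotient_op K (ch_base K P) (ch_rels K P) in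
     with_dif C (THE D. D \<in> extensional (elts C) \<and> derivation K C D \<and>
       (\<forall>a\<in>elts P. D (ch_iota K P a) = ch_del K P a \<and>
                   D (ch_del K P a) = nul C (arity P a) (deg P a - 2))))"

text \<open>The morphism of dg operads from the chainification of the free operad on \<open>M\<close> induced by a map
  of Sigma-modules \<open>f\<close>.\<close>

definition ch_free_map :: "('k, 'z) ring_scheme \<Rightarrow> ('k, 'a, 'm) smod_scheme \<Rightarrow>
    ('k, 'b, 'n) dgoperad_scheme \<Rightarrow> ('a \<Rightarrow> 'b) \<Rightarrow>
    ('k, ('k, 'a) tm set \<times> ('k, 'a) tm set) tm set set \<Rightarrow> 'b" where
  "ch_free_map K M Q f =
    (let C = ch K (free K M) in
     THE h. h \<in> extensional (elts C) \<and> dg_hom K C Q h \<and>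
       (\<forall>x\<in>elts M. h (ch_iota K (free K M) (gen K M x)) = f x))"


subsection \<open>Pushouts\<close>

text \<open>
  The pushout of \<open>P\<close> and \<open>Q\<close> along \<open>f\<close> from \<open>A\<close> to \<open>P\<close> and \<open>g\<close> from \<open>A\<close> to \<open>Q\<close>, presented by the
  elements of \<open>P\<close> and \<open>Q\<close> as generators, the relations making the two inclusions operad morphisms,
  and the relations identifying the two images of \<open>A\<close>.
\<close>

definition po_base :: "('k, 'z) ring_scheme \<Rightarrow> ('k, 'a, 'm) operad_scheme \<Rightarrow>
    ('k, 'b, 'n) operad_scheme \<Rightarrow> ('k, ('k, 'a \<times> 'b) tm set) operad" where
  "po_base K P Q = free K (dsum P Q)"

definition po_rels :: "('k, 'z) ring_scheme \<Rightarrow> ('k, 'c, 'l) operad_scheme \<Rightarrow>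
    ('k, 'a, 'm) operad_scheme \<Rightarrow> ('k, 'b, 'n) operad_scheme \<Rightarrow> ('c \<Rightarrow> 'a) \<Rightarrow> ('c \<Rightarrow> 'b) \<Rightarrow>
    ('k, 'a \<times> 'b) tm set set" where
  "po_rels K A P Q f g =
    (let B = po_base K P Q;
         i = (\<lambda>x. gen K (dsum P Q) (inj1 P Q x)); j = (\<lambda>y. gen K (dsum P Q) (inj2 P Q y)) in
     {mns K B (i (cmp P a bs)) (cmp B (i a) (map i bs))
      | a bs. composable P a bs} \<union>
     {mns K B (j (cmp Q a bs)) (cmp B (j a) (map j bs))
      | a bs. composable Q a bs} \<union>
     {mns K B (i (unt P)) (unt B),
      mns K B (j (unt Q)) (unt B)} \<union>
     {mns K B (i (f x)) (j (g x)) | x. x \<in> elts A})"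

definition po_in1 :: "('k, 'z) ring_scheme \<Rightarrow> ('k, 'c, 'l) operad_scheme \<Rightarrow>
    ('k, 'a, 'm) operad_scheme \<Rightarrow> ('k, 'b, 'n) operad_scheme \<Rightarrow> ('c \<Rightarrow> 'a) \<Rightarrow> ('c \<Rightarrow> 'b) \<Rightarrow>
    'a \<Rightarrow> ('k, 'a \<times> 'b) tm set set" where
  "po_in1 K A P Q f g x =
    quotient_proj K (po_base K P Q) (po_rels K A P Q f g) (gen K (dsum P Q) (inj1 P Q x))"

definition po_in2 :: "('k, 'z) ring_scheme \<Rightarrow> ('k, 'c, 'l) operad_scheme \<Rightarrow>
    ('k, 'a, 'm) operad_scheme \<Rightarrow> ('k, 'b, 'n) operad_scheme \<Rightarrow> ('c \<Rightarrow> 'a) \<Rightarrow> ('c \<Rightarrow> 'b) \<Rightarrow>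
    'b \<Rightarrow> ('k, 'a \<times> 'b) tm set set" where
  "po_in2 K A P Q f g y =
    quotient_proj K (po_base K P Q) (po_rels K A P Q f g) (gen K (dsum P Q) (inj2 P Q y))"

definition pushout :: "('k, 'z) ring_scheme \<Rightarrow> ('k, 'c, 'l) dgoperad_scheme \<Rightarrow>
    ('k, 'a, 'm) dgoperad_scheme \<Rightarrow> ('k, 'b, 'n) dgoperad_scheme \<Rightarrow> ('c \<Rightarrow> 'a) \<Rightarrow> ('c \<Rightarrow> 'b) \<Rightarrow>
    ('k, ('k, 'a \<times> 'b) tm set set) dgoperad" where
  "pushout K A P Q f g =
    (let L = quotient_op K (po_base K P Q) (po_rels K A P Q f g) in
     with_dif L (THE D. D \<in> extensional (elts L) \<and> derivation K L D \<and>
       (\<forall>x\<in>elts P. D (po_in1 K A P Q f g x) = po_in1 K A P Q f g (dif P x)) \<and>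
       (\<forall>y\<in>elts Q. D (po_in2 K A P Q f g y) = po_in2 K A P Q f g (dif Q y))))"


section \<open>Universal linking operads\<close>

text \<open>
  \<open>P\<close> is generated by \<open>\<gamma>\<close> from \<open>G\<close>, the dg operad \<open>Q\<close> by \<open>\<gamma>'\<close> from \<open>G'\<close>, and \<open>\<phi>\<close> is a map from the
  desuspension of \<open>G\<close> to the free operad on \<open>G'\<close>.
\<close>

definition lu_left :: "('k, 'z) ring_scheme \<Rightarrow> ('k, 'g, 'm) smod_scheme \<Rightarrow>
    ('k, 'h, 'n) smod_scheme \<Rightarrow> ('h \<Rightarrow> 'b) \<Rightarrow> ('k, 'b, 'l) dgoperad_scheme \<Rightarrow>
    ('g \<Rightarrow> ('k, 'h) tm set) \<Rightarrow>
    ('k, ('k, 'g) tm set \<times> ('k, 'g) tm set) tm set set \<Rightarrow> 'b" where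
  "lu_left K G G' \<gamma>' Q \<phi> = ch_free_map K (shift (-1) G) Q (\<lambda>x. free_map K G' Q \<gamma>' (\<phi> x))"

definition lu_right :: "('k, 'z) ring_scheme \<Rightarrow> ('k, 'g, 'm) smod_scheme \<Rightarrow> ('g \<Rightarrow> 'a) \<Rightarrow>
    ('k, 'a, 'n) operad_scheme \<Rightarrow> ('k, ('k, 'g) tm set \<times> ('k, 'g) tm set) tm set set \<Rightarrow>
    ('k, 'a \<times> 'a) tm set set" where
  "lu_right K G \<gamma> P = ch_free_map K (shift (-1) G) (ch K P) (\<lambda>x. ch_del K P (\<gamma> x))"

definition lu :: "('k, 'z) ring_scheme \<Rightarrow>
    ('k, 'g, 'm) smod_scheme \<Rightarrow> ('g \<Rightarrow> 'a) \<Rightarrow> ('k, 'a, 'n) operad_scheme \<Rightarrow>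
    ('k, 'h, 'p) smod_scheme \<Rightarrow> ('h \<Rightarrow> 'b) \<Rightarrow> ('k, 'b, 'q) dgoperad_scheme \<Rightarrow>
    ('g \<Rightarrow> ('k, 'h) tm set) \<Rightarrow>
    ('k, ('k, 'b \<times> ('k, 'a \<times> 'a) tm set set) tm set set) dgoperad" where
  "lu K G \<gamma> P G' \<gamma>' Q \<phi> =
    pushout K (ch K (free K (shift (-1) G))) Q (ch K P) (lu_left K G G' \<gamma>' Q \<phi>) (lu_right K G \<gamma> P)"

definition lu_in2 :: "('k, 'z) ring_scheme \<Rightarrow>
    ('k, 'g, 'm) smod_scheme \<Rightarrow> ('g \<Rightarrow> 'a) \<Rightarrow> ('k, 'a, 'n) operad_scheme \<Rightarrow>
    ('k, 'h, 'p) smod_scheme \<Rightarrow> ('h \<Rightarrow> 'b) \<Rightarrow> ('k, 'b, 'q) dgoperad_scheme \<Rightarrow>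
    ('g \<Rightarrow> ('k, 'h) tm set) \<Rightarrow> ('k, 'a \<times> 'a) tm set set \<Rightarrow>
    ('k, 'b \<times> ('k, 'a \<times> 'a) tm set set) tm set set" where
  "lu_in2 K G \<gamma> P G' \<gamma>' Q \<phi> =
    po_in2 K (ch K (free K (shift (-1) G))) Q (ch K P) (lu_left K G G' \<gamma>' Q \<phi>) (lu_right K G \<gamma> P)"

text \<open>\<open>ch \<langle>sG\<rangle>\<close>, its generators, \<open>lu\<^bsub>G\<^esub>(Q)\<close> and the canonical map \<open>p\<close>, for an operad \<open>Q\<close> generated by
  \<open>\<gamma>\<close> from \<open>G\<close>.\<close>

definition chs :: "('k, 'z) ring_scheme \<Rightarrow> ('k, 'g, 'm) smod_scheme \<Rightarrow>
    ('k, ('k, ('k, 'g) tm set \<times> ('k, 'g) tm set) tm set set) dgoperad" where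
  "chs K G = ch K (free K (shift 1 G))"

definition chs_gens :: "('k, 'z) ring_scheme \<Rightarrow> ('k, 'g, 'm) smod_scheme \<Rightarrow>
    ('k, ('k, 'g) tm set \<times> ('k, 'g) tm set) tm set set set" where
  "chs_gens K G =
    (\<lambda>x. ch_iota K (free K (shift 1 G)) (gen K (shift 1 G) x)) ` elts G \<union>
    (\<lambda>x. ch_del K (free K (shift 1 G)) (gen K (shift 1 G) x)) ` elts G"

definition lu_gen :: "('k, 'z) ring_scheme \<Rightarrow> ('k, 'g, 'm) smod_scheme \<Rightarrow> ('g \<Rightarrow> 'a) \<Rightarrow>
    ('k, 'a, 'n) operad_scheme \<Rightarrow>
    ('k, ('k, 'a \<times> ('k, ('k, 'g) tm set \<times> ('k, 'g) tm set) tm set set) tm set set) dgoperad" where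
  "lu_gen K G \<gamma> Q =
    lu K (shift 1 G) (gen K (shift 1 G)) (free K (shift 1 G)) G \<gamma> (trivial_dif Q) (gen K G)"

definition lu_proj :: "('k, 'z) ring_scheme \<Rightarrow> ('k, 'g, 'm) smod_scheme \<Rightarrow> ('g \<Rightarrow> 'a) \<Rightarrow>
    ('k, 'a, 'n) operad_scheme \<Rightarrow> ('k, ('k, 'g) tm set \<times> ('k, 'g) tm set) tm set set \<Rightarrow>
    ('k, 'a \<times> ('k, ('k, 'g) tm set \<times> ('k, 'g) tm set) tm set set) tm set set" where
  "lu_proj K G \<gamma> Q =
    lu_in2 K (shift 1 G) (gen K (shift 1 G)) (free K (shift 1 G)) G \<gamma> (trivial_dif Q) (gen K G)"


subsection \<open>The operad R\<close>

definition ker_p :: "('k, 'z) ring_scheme \<Rightarrow> ('k, 'g, 'm) smod_scheme \<Rightarrow> ('g \<Rightarrow> 'a) \<Rightarrow>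
    ('k, 'a, 'n) operad_scheme \<Rightarrow>
    ('k, ('k, ('k, 'g) tm set \<times> ('k, 'g) tm set) tm set set) dgoperad" where
  "ker_p K G \<gamma> Q =
    (chs K G)\<lparr>elts := {x \<in> elts (chs K G).
       lu_proj K G \<gamma> Q x = nul (lu_gen K G \<gamma> Q) (arity (chs K G) x) (deg (chs K G) x)}\<rparr>"

definition del_R :: "('k, 'z) ring_scheme \<Rightarrow> ('k, 'g, 'm) smod_scheme \<Rightarrow> ('g \<Rightarrow> 'a) \<Rightarrow>
    ('k, 'a, 'n) operad_scheme \<Rightarrow>
    ('k, ('k, ('k, 'g) tm set \<times> ('k, 'g) tm set) tm set set) dgoperad" where
  "del_R K G \<gamma> Q = (chs K G)\<lparr>elts := cycles (chs K G) \<inter> elts (ker_p K G \<gamma> Q)\<rparr>"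

definition susp_R :: "('k, 'z) ring_scheme \<Rightarrow> ('k, 'g, 'm) smod_scheme \<Rightarrow> ('g \<Rightarrow> 'a) \<Rightarrow>
    ('k, 'a, 'n) operad_scheme \<Rightarrow>
    ('k, ('k, ('k, 'g) tm set \<times> ('k, 'g) tm set) tm set set) smod" where
  "susp_R K G \<gamma> Q = shift 1 (del_R K G \<gamma> Q)"

text \<open>\<open>\<iota>\<close> is a chain map from \<open>R \<oplus> \<partial>R\<close>, with the differential \<open>(r, r') \<mapsto> (0, r)\<close>, to \<open>ch \<langle>sG\<rangle>\<close>, and
  is the inclusion on \<open>\<partial>R\<close>.\<close>

definition linking_choice :: "('k, 'z) ring_scheme \<Rightarrow> ('k, 'g, 'm) smod_scheme \<Rightarrow> ('g \<Rightarrow> 'a) \<Rightarrow>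
    ('k, 'a, 'n) operad_scheme \<Rightarrow>
    (('k, ('k, 'g) tm set \<times> ('k, 'g) tm set) tm set set \<times>
     ('k, ('k, 'g) tm set \<times> ('k, 'g) tm set) tm set set \<Rightarrow>
     ('k, ('k, 'g) tm set \<times> ('k, 'g) tm set) tm set set) \<Rightarrow> bool" where
  "linking_choice K G \<gamma> Q \<iota> \<longleftrightarrow>
    (let R = susp_R K G \<gamma> Q; dR = del_R K G \<gamma> Q; C = chs K G in
     smod_hom K (dsum R dR) C \<iota> \<and>
     (\<forall>z\<in>elts (dsum R dR). dif C (\<iota> z) = \<iota> (inj2 R dR (fst z))) \<and>
     (\<forall>x\<in>elts dR. \<iota> (inj2 R dR x) = x))"

text \<open>
  In \<open>R_op\<close> below, \<open>ker \<partial>\<close> has to be taken in the augmentation ideal of \<open>ch \<langle>sG\<rangle>\<close>, the ideal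
  generated by all \<open>\<iota>g\<close> and \<open>\<partial>g\<close>.  The operad unit is a cycle outside this ideal which is not a
  boundary; were it allowed, the unit of \<open>\<langle>R\<rangle>\<close> would lie in the image of \<open>g\<^sup>*f\<close>, and the cokernel
  would be the zero operad for every \<open>Q\<close>.
\<close>

definition ker_del :: "('k, 'z) ring_scheme \<Rightarrow> ('k, 'g, 'm) smod_scheme \<Rightarrow>
    ('k, ('k, ('k, 'g) tm set \<times> ('k, 'g) tm set) tm set set) dgoperad" where
  "ker_del K G = (chs K G)\<lparr>elts := cycles (chs K G) \<inter> op_ideal K (chs K G) (chs_gens K G)\<rparr>"

text \<open>The map of which \<open>R_op\<close> is the cokernel is the projection to \<open>\<langle>R\<rangle>\<close> of the pullback of
  \<open>f = a + b\<close> along \<open>g\<close>.\<close>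

definition pullback_image :: "('k, 'a, 'm) smod_scheme \<Rightarrow> ('a \<Rightarrow> 'c) \<Rightarrow> ('k, 'b, 'n) smod_scheme \<Rightarrow>
    ('b \<Rightarrow> 'c) \<Rightarrow> 'a set" where
  "pullback_image M g N f =
    fst ` {(x, z). x \<in> elts M \<and> z \<in> elts N \<and> arity M x = arity N z \<and> deg M x = deg N z \<and> g x = f z}"

definition R_op :: "('k, 'z) ring_scheme \<Rightarrow> ('k, 'g, 'm) smod_scheme \<Rightarrow> ('g \<Rightarrow> 'a) \<Rightarrow>
    ('k, 'a, 'n) operad_scheme \<Rightarrow>
    (('k, ('k, 'g) tm set \<times> ('k, 'g) tm set) tm set set \<times>
     ('k, ('k, 'g) tm set \<times> ('k, 'g) tm set) tm set set \<Rightarrow>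
     ('k, ('k, 'g) tm set \<times> ('k, 'g) tm set) tm set set) \<Rightarrow>
    ('k, ('k, ('k, ('k, 'g) tm set \<times> ('k, 'g) tm set) tm set set) tm set set) operad" where
  "R_op K G \<gamma> Q \<iota> =
    (let R = susp_R K G \<gamma> Q; C = chs K G;
         g = free_map K R C (\<lambda>r. \<iota> (inj1 R (del_R K G \<gamma> Q) r));
         f = (\<lambda>(x, y). pls C x y)
     in quotient_op K (free K R)
          (pullback_image (free K R) g (dsum (ker_p K G \<gamma> Q) (ker_del K G)) f))"

end

theory Submission
 imports Defs
begin

text \<open>
  Write \<open>C\<close> for \<open>ch \<langle>sG\<rangle>\<close>, \<open>L\<close> for the linking operad and \<open>p\<close> for the map from \<open>C\<close> to \<open>L\<close>.  The pushout
  identifies the generator \<open>\<gamma> x\<close> with \<open>p (\<partial> x)\<close>, so \<open>p\<close> is a surjective morphism of dg operads.  The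
  other ingredient is that the augmentation ideal of \<open>C\<close>, the ideal generated by all \<open>\<iota> x\<close> and \<open>\<partial> x\<close>,
  is contractible.  These two facts give the isomorphism, which is induced by \<open>p \<circ> g\<close>.

  Every cycle of \<open>L\<close> is \<open>p c\<close> for some \<open>c\<close>.  Then \<open>\<partial> c\<close> is a cycle in the kernel of \<open>p\<close>, that is, an
  element \<open>r\<close> of \<open>R\<close>, and \<open>c - \<iota> r\<close> is a cycle of \<open>C\<close>.  By contractibility it is the sum of a boundary
  and of a multiple of the unit.  Hence \<open>p c\<close> is homologous to the image under \<open>p \<circ> g\<close> of the sum of
  \<open>r\<close> and that multiple of the unit, and \<open>\<langle>R\<rangle>\<close> maps onto the homology (\<open>k_surj\<close>).  If \<open>p (g x)\<close> is a
  boundary, it is \<open>p (\<partial> c)\<close> for some \<open>c\<close>, and \<open>g x\<close> is the sum of \<open>g x - \<partial> c\<close>, which is in the kernel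
  of \<open>p\<close>, and of \<open>\<partial> c\<close>, a cycle of the augmentation ideal.  Conversely a cycle of the augmentation
  ideal is a boundary, and so is its image in \<open>L\<close>.  So the kernel of the map from \<open>\<langle>R\<rangle>\<close> to the
  homology is the projection of the pullback by which \<open>R_op\<close> is defined (\<open>k_nul_iff\<close>).

  For contractibility, let \<open>e\<close> be the endomorphism of \<open>C\<close> that sends all generators to zero.  Its
  values are multiples of the unit.  There is a map \<open>h\<close> of degree one with \<open>h (\<iota> x) = 0\<close> and
  \<open>h (\<partial> x) = \<iota> x\<close> that satisfies \<open>h (a (b\<^sub>1, \<dots>, b\<^sub>n)) = (h a) (b\<^sub>1, \<dots>, b\<^sub>n) + (e a) (h b\<^sub>1)\<close>, where the last
  term is present for \<open>n = 1\<close> only.  This asymmetric rule replaces an average over all positions, so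
  that the characteristic of the field does not matter, and it gives \<open>\<partial> h + h \<partial> = 1 - e\<close>
  (\<open>homotopy\<close>).

  Differentials and \<open>h\<close> have to be constructed on operads given by generators and relations.  Both
  are second components of morphisms to extensions by a square-zero ideal, in which the second
  component of a composite is twisted by a function \<open>\<Delta>\<close> of the first factor and of the pairs in the
  others.  For derivations \<open>\<Delta>\<close> is the Leibniz sum, for \<open>h\<close> it is the last term above.  Once the
  extension is known to be an operad (\<open>square_zero_leib\<close>, \<open>square_zero_hterm\<close>), the universal
  property of the presented operad yields the morphism.
\<close>

section \<open>Graded Sigma-modules\<close>

abbreviation tarity :: "('k, 'a, 'm) smod_scheme => 'a list => nat" where
 "tarity M xs \<equiv> sum_list (map (arity M) xs)"
abbreviation tdeg :: "('k, 'a, 'm) smod_scheme => 'a list => int" where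
 "tdeg M xs \<equiv> sum_list (map (deg M) xs)"

definition gr :: "('k, 'a, 'm) smod_scheme => nat => int => 'a set" where
 "gr M n d = {x : elts M. arity M x = n & deg M x = d}"
abbreviation comp_of :: "('k, 'a, 'm) smod_scheme => 'a => 'a set" where
 "comp_of M x \<equiv> gr M (arity M x) (deg M x)"
abbreviation zero_of :: "('k, 'a, 'm) smod_scheme => 'a => 'a" where
 "zero_of M x \<equiv> nul M (arity M x) (deg M x)"
abbreviation graph :: "('a => 'b) => 'a list => ('a \<times> 'b) list" where
 "graph f xs \<equiv> map (%x. (x, f x)) xs"
lemma gr_iff: "x : gr M n d \<longleftrightarrow> x : elts M & arity M x = n & deg M x = d"
 by (simp add: gr_def)
lemma elts_gr: "x : elts M ==> x : comp_of M x"
 by (simp add: gr_iff)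
lemma component_simps [simp]:
 "carrier (component M n d) = gr M n d"
 "zero (component M n d) = nul M n d"
 "add (component M n d) = pls M"
 "smult (component M n d) = scale M"
 by (simp_all add: component_def gr_def)

definition lsum :: "('k, 'a, 'm) smod_scheme => nat => int => 'a list => 'a" where
 "lsum M n d xs = foldr (pls M) xs (nul M n d)"
lemma lsum_simps [simp]:
 "lsum M n d [] = nul M n d"
 "lsum M n d (x # xs) = pls M x (lsum M n d xs)"
 by (simp_all add: lsum_def)
lemma map_upt_cong: "(!!i. i < n ==> f i = g i) ==> map f [0..<n] = map g [0..<n]"
 by simp
lemma permutes_lessThan_1: "\<pi> permutes {..<Suc 0} ==> \<pi> = id"
 by (metis lessThan_Suc lessThan_0 permutes_sing)

context smodule
begin
lemma cring_K: "cring K"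
 using component_module[of 0 0] by (simp add: module_def)
lemma nul_gr [simp]: "nul M n d : gr M n d"
proof -
 interpret c: module K "component M n d" by (rule component_module)
 show ?thesis using c.M.zero_closed by simp
qed
lemma nul_elts [simp]: "nul M n d : elts M" and arity_nul [simp]: "arity M (nul M n d) = n"
 and deg_nul [simp]: "deg M (nul M n d) = d"
 using nul_gr[of n d] by (simp_all add: gr_iff)
lemma pls_gr: assumes "x : gr M n d" "y : gr M n d" shows "pls M x y : gr M n d"
proof -
 interpret c: module K "component M n d" by (rule component_module)
 show ?thesis using c.M.a_closed assms by simp
qed
lemma scale_gr: assumes "c : carrier K" "x : gr M n d" shows "scale M c x : gr M n d"
proof -
 interpret c: module K "component M n d" by (rule component_module)
 show ?thesis using c.smult_closed assms by simp
qed
lemma perm_gr: "x : gr M n d ==> \<pi> permutes {..<n} ==> perm M \<pi> x : gr M n d"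
 using perm_closed[of x \<pi>] by (auto simp: gr_iff same_grade_def)
lemma pls_assoc:
 assumes "x : gr M n d" "y : gr M n d" "z : gr M n d"
 shows "pls M (pls M x y) z = pls M x (pls M y z)"
proof -
 interpret c: module K "component M n d" by (rule component_module)
 show ?thesis using c.M.a_assoc assms by simp
qed
lemma pls_comm: assumes "x : gr M n d" "y : gr M n d" shows "pls M x y = pls M y x"
proof -
 interpret c: module K "component M n d" by (rule component_module)
 show ?thesis using c.M.a_comm assms by simp
qed
lemma pls_lcomm:
 assumes "x : gr M n d" "y : gr M n d" "z : gr M n d"
 shows "pls M x (pls M y z) = pls M y (pls M x z)"
 unfolding pls_assoc[OF assms, symmetric] pls_assoc[OF assms(2,1,3), symmetric]
 by (simp only: pls_comm[OF assms(1,2)])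
lemma pls_swap:
 assumes "x : gr M n d" "y : gr M n d" "z : gr M n d" "w : gr M n d"
 shows "pls M (pls M x y) (pls M z w) = pls M (pls M x z) (pls M y w)"
 unfolding pls_assoc[OF assms(1,2) pls_gr[OF assms(3,4)]] pls_assoc[OF assms(1,3) pls_gr[OF assms(2,4)]]
 by (simp only: pls_lcomm[OF assms(2,3,4)])
lemma nul_pls [simp]: "x : gr M n d ==> pls M (nul M n d) x = x"
proof -
 assume a: "x : gr M n d"
 interpret c: module K "component M n d" by (rule component_module)
 show ?thesis using c.M.l_zero[of x] a by simp
qed
lemma pls_nul [simp]: "x : gr M n d ==> pls M x (nul M n d) = x"
 by (subst pls_comm[OF _ nul_gr]) simp_all
lemma scale_add:
 assumes "a : carrier K" "b : carrier K" "x : gr M n d"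
 shows "scale M (a \<oplus> b) x = pls M (scale M a x) (scale M b x)"
proof -
 interpret c: module K "component M n d" by (rule component_module)
 show ?thesis using c.smult_l_distr assms by simp
qed
lemma scale_pls:
 assumes "a : carrier K" "x : gr M n d" "y : gr M n d"
 shows "scale M a (pls M x y) = pls M (scale M a x) (scale M a y)"
proof -
 interpret c: module K "component M n d" by (rule component_module)
 show ?thesis using c.smult_r_distr assms by simp
qed
lemma scale_scale:
 assumes "a : carrier K" "b : carrier K" "x : elts M"
 shows "scale M a (scale M b x) = scale M (a \<otimes> b) x"
proof -
 interpret c: module K "component M (arity M x) (deg M x)" by (rule component_module)
 show ?thesis using c.smult_assoc1 assms by (simp add: gr_iff)
qed
lemma scale_comm:
 assumes "a : carrier K" "b : carrier K" "x : elts M"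
 shows "scale M a (scale M b x) = scale M b (scale M a x)"
 using assms cring.cring_simprules(14)[OF cring_K, of a b] by (simp add: scale_scale)
lemma scale_one [simp]: assumes "x : elts M" shows "scale M \<one> x = x"
proof -
 interpret c: module K "component M (arity M x) (deg M x)" by (rule component_module)
 show ?thesis using c.smult_one assms by (simp add: gr_iff)
qed
lemma scale_zero: assumes "x : gr M n d" shows "scale M \<zero> x = nul M n d"
proof -
 interpret c: module K "component M n d" by (rule component_module)
 show ?thesis using c.smult_l_null assms by simp
qed
lemma scale_nul [simp]: assumes "c : carrier K" shows "scale M c (nul M n d) = nul M n d"
proof -
 interpret c: module K "component M n d" by (rule component_module)
 show ?thesis using c.smult_r_null assms by simp
qed
lemma zero_K [simp]: "\<zero> : carrier K" and one_K [simp]: "\<one> : carrier K"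
 and minus_one_K [simp]: "\<ominus> \<one> : carrier K"
proof -
 interpret cring K by (rule cring_K)
 show "\<zero> : carrier K" "\<one> : carrier K" "\<ominus> \<one> : carrier K" by auto
qed
lemma minus_one_sq [simp]: "\<ominus> \<one> \<otimes> \<ominus> \<one> = \<one>"
proof -
 interpret cring K by (rule cring_K)
 show ?thesis by (simp add: l_minus)
qed
lemma pls_neg: assumes "x : gr M n d" shows "pls M x (scale M (\<ominus> \<one>) x) = nul M n d"
proof -
 interpret cring K by (rule cring_K)
 have "pls M x (scale M (\<ominus> \<one>) x) = scale M (\<one> \<oplus> \<ominus> \<one>) x"
 using assms by (subst scale_add) (auto simp: gr_iff)
 thus ?thesis using assms by (simp add: r_neg scale_zero)
qed
lemma neg_pls_cancel:
 assumes "x : gr M n d" "y : gr M n d"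
 shows "pls M (scale M (\<ominus> \<one>) x) (pls M x y) = y"
proof -
 have m: "scale M (\<ominus> \<one>) x : gr M n d" by (rule scale_gr) (use assms in auto)
 have "pls M (scale M (\<ominus> \<one>) x) (pls M x y) = pls M (pls M (scale M (\<ominus> \<one>) x) x) y"
 using pls_assoc[OF m assms] by simp
 also have "pls M (scale M (\<ominus> \<one>) x) x = nul M n d"
 using pls_comm[OF m assms(1)] pls_neg[OF assms(1)] by simp
 finally show ?thesis using assms by simp
qed
lemma pls_left_cancel:
 assumes "x : gr M n d" "y : gr M n d" "z : gr M n d" "pls M x y = pls M x z"
 shows "y = z"
proof -
 have "y = pls M (scale M (\<ominus> \<one>) x) (pls M x y)" by (rule neg_pls_cancel[OF assms(1,2), symmetric])
 also have "... = z" unfolding assms(4) by (rule neg_pls_cancel[OF assms(1,3)])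
 finally show ?thesis .
qed
lemma pls_eq_nul_iff:
 assumes "x : gr M n d" "y : gr M n d"
 shows "pls M x y = nul M n d \<longleftrightarrow> y = scale M (\<ominus> \<one>) x"
proof
 assume "pls M x y = nul M n d"
 hence "pls M x y = pls M x (scale M (\<ominus> \<one>) x)" using assms by (simp add: pls_neg)
 thus "y = scale M (\<ominus> \<one>) x"
 by (rule pls_left_cancel[OF assms scale_gr[OF minus_one_K assms(1)]])
qed (simp only: pls_neg[OF assms(1)])
lemma neg_neg [simp]: "x : elts M ==> scale M (\<ominus> \<one>) (scale M (\<ominus> \<one>) x) = x"
 by (simp add: scale_scale)
lemma mns_gr: "x : gr M n d ==> y : gr M n d ==> mns K M x y : gr M n d"
 by (simp add: mns_def pls_gr scale_gr)
lemma mns_self [simp]: "x : gr M n d ==> mns K M x x = nul M n d"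
 by (simp add: mns_def pls_neg)
lemma mns_eq_nul_iff:
 assumes "x : gr M n d" "y : gr M n d"
 shows "mns K M x y = nul M n d \<longleftrightarrow> x = y"
proof
 have m: "scale M (\<ominus> \<one>) y : gr M n d" by (rule scale_gr) (use assms in auto)
 assume "mns K M x y = nul M n d"
 hence "pls M (scale M (\<ominus> \<one>) y) x = nul M n d"
 using pls_comm[OF assms(1) m] by (simp add: mns_def)
 hence "x = scale M (\<ominus> \<one>) (scale M (\<ominus> \<one>) y)"
 by (simp add: pls_eq_nul_iff[OF m assms(1)])
 thus "x = y" using assms by (simp add: gr_iff)
qed (use assms in simp)
lemma mns_pls_cancel:
 assumes "x : gr M n d" "y : gr M n d"
 shows "pls M (mns K M x y) y = x"
proof -
 have m: "scale M (\<ominus> \<one>) y : gr M n d" by (rule scale_gr) (use assms in auto)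
 have "pls M (mns K M x y) y = pls M x (pls M (scale M (\<ominus> \<one>) y) y)"
 unfolding mns_def by (rule pls_assoc[OF assms(1) m assms(2)])
 also have "pls M (scale M (\<ominus> \<one>) y) y = nul M n d"
 using pls_comm[OF m assms(2)] pls_neg[OF assms(2)] by simp
 finally show ?thesis using assms by simp
qed
lemma mns_mns:
 assumes "x : gr M n d" "y : gr M n d" "z : gr M n d"
 shows "pls M (mns K M x y) (mns K M y z) = mns K M x z"
proof -
 have m: "scale M (\<ominus> \<one>) z : gr M n d" by (rule scale_gr) (use assms in auto)
 show ?thesis unfolding mns_def[of K M y z]
 using pls_assoc[OF mns_gr[OF assms(1,2)] assms(2) m] mns_pls_cancel[OF assms(1,2)]
 by (simp add: mns_def)
qed
lemma mns_pls:
 assumes "x : gr M n d" "y : gr M n d" "x' : gr M n d" "y' : gr M n d"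
 shows "mns K M (pls M x y) (pls M x' y') = pls M (mns K M x x') (mns K M y y')"
 unfolding mns_def scale_pls[OF minus_one_K assms(3,4)]
 by (rule pls_swap[OF assms(1,2) scale_gr[OF minus_one_K assms(3)] scale_gr[OF minus_one_K assms(4)]])
lemma mns_scale:
 assumes "x : gr M n d" "y : gr M n d" "c : carrier K"
 shows "mns K M (scale M c x) (scale M c y) = scale M c (mns K M x y)"
proof -
 have "scale M c (scale M (\<ominus> \<one>) y) = scale M (\<ominus> \<one>) (scale M c y)"
 using assms by (intro scale_comm) (auto simp: gr_iff)
 thus ?thesis unfolding mns_def
 using scale_pls[OF assms(3,1) scale_gr[OF minus_one_K assms(2)]] by simp
qed
lemma perm_nul [simp]:
 assumes "\<pi> permutes {..<n}" shows "perm M \<pi> (nul M n d) = nul M n d"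
proof -
 have "perm M \<pi> (nul M n d) = perm M \<pi> (scale M \<zero> (nul M n d))" by simp
 also have "... = scale M \<zero> (perm M \<pi> (nul M n d))"
 using assms by (intro perm_scale) auto
 also have "... = nul M n d" by (rule scale_zero) (simp add: perm_gr assms)
 finally show ?thesis .
qed
lemma perm_pls: "x : gr M n d ==> y : gr M n d ==> \<pi> permutes {..<n} ==>
 perm M \<pi> (pls M x y) = pls M (perm M \<pi> x) (perm M \<pi> y)"
 by (rule perm_plus) (auto simp: gr_iff same_grade_def)
lemma mns_perm:
 assumes "x : gr M n d" "y : gr M n d" "\<pi> permutes {..<n}"
 shows "mns K M (perm M \<pi> x) (perm M \<pi> y) = perm M \<pi> (mns K M x y)"
proof -
 have "perm M \<pi> (scale M (\<ominus> \<one>) y) = scale M (\<ominus> \<one>) (perm M \<pi> y)"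
 using assms by (intro perm_scale) (auto simp: gr_iff)
 thus ?thesis unfolding mns_def using assms by (simp add: perm_pls scale_gr)
qed

subsection \<open>Signs\<close>

lemma signed_gr: "x : gr M n d ==> signed K M e x : gr M n d"
 by (simp add: signed_def scale_gr)
lemma signed_elts: "x : elts M ==> signed K M e x : elts M"
 using signed_gr[OF elts_gr] by (simp add: gr_iff)
lemma signed_nul [simp]: "signed K M e (nul M n d) = nul M n d"
 by (simp add: signed_def)
lemma signed_0 [simp]: "signed K M 0 x = x"
 by (simp add: signed_def)
lemma signed_even: "even e ==> signed K M e x = x"
 by (simp add: signed_def)
lemma signed_cong: "even (e - e') ==> signed K M e x = signed K M e' x"
 by (simp add: signed_def)
lemma signed_signed [simp]:
 "x : elts M ==> signed K M e (signed K M e' x) = signed K M (e + e') x"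
 by (auto simp: signed_def)
lemma signed_pls: "x : gr M n d ==> y : gr M n d ==>
 signed K M e (pls M x y) = pls M (signed K M e x) (signed K M e y)"
 by (simp add: signed_def scale_pls)
lemma signed_scale: "x : elts M ==> c : carrier K ==>
 signed K M e (scale M c x) = scale M c (signed K M e x)"
 by (simp add: signed_def scale_comm)
lemma signed_perm: "x : gr M n d ==> \<pi> permutes {..<n} ==>
 signed K M e (perm M \<pi> x) = perm M \<pi> (signed K M e x)"
 by (auto simp: signed_def perm_scale gr_iff)
lemma signed_opposite:
 assumes "x : gr M n d" "odd (e + e')"
 shows "pls M (signed K M e x) (signed K M e' x) = nul M n d"
 using assms(2) pls_neg[OF assms(1)] pls_comm[OF scale_gr[OF minus_one_K assms(1)] assms(1)]
 by (auto simp: signed_def)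

subsection \<open>Sums\<close>

lemma lsum_gr: "set xs \<subseteq> gr M n d ==> lsum M n d xs : gr M n d"
 by (induction xs) (auto simp: pls_gr)
lemma lsum_map_gr: "(!!i. i : set is ==> f i : gr M n d) ==> lsum M n d (map f is) : gr M n d"
 by (rule lsum_gr) auto
lemma lsum_append: "set xs \<subseteq> gr M n d ==> set ys \<subseteq> gr M n d ==>
 lsum M n d (xs @ ys) = pls M (lsum M n d xs) (lsum M n d ys)"
proof (induction xs)
 case Nil
 thus ?case by (simp add: lsum_gr)
next
 case (Cons x xs)
 thus ?case using pls_assoc[of x n d "lsum M n d xs" "lsum M n d ys"] by (auto simp: lsum_gr)
qed
lemma lsum_concat: "(!!xs. xs : set xss ==> set xs \<subseteq> gr M n d) ==>
 lsum M n d (concat xss) = lsum M n d (map (lsum M n d) xss)"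
proof (induction xss)
 case (Cons xs xss)
 hence "set (concat xss) \<subseteq> gr M n d" by fastforce
 thus ?case using Cons by (simp add: lsum_append)
qed simp
lemma lsum_pls:
 assumes "!!i. i : set is ==> f i : gr M n d" "!!i. i : set is ==> g i : gr M n d"
 shows "lsum M n d (map (%i. pls M (f i) (g i)) is)
 = pls M (lsum M n d (map f is)) (lsum M n d (map g is))"
 using assms by (induction "is") (auto simp: lsum_map_gr intro!: pls_swap[of _ n d])
lemma lsum_scale:
 assumes "!!i. i : set is ==> f i : gr M n d" "c : carrier K"
 shows "lsum M n d (map (%i. scale M c (f i)) is) = scale M c (lsum M n d (map f is))"
 using assms(1) by (induction "is") (use assms(2) in "auto simp: scale_pls[of _ _ n d] lsum_map_gr")
lemma lsum_signed:
 assumes "!!i. i : set is ==> f i : gr M n d"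
 shows "lsum M n d (map (%i. signed K M e (f i)) is) = signed K M e (lsum M n d (map f is))"
 using assms by (induction "is") (auto simp: signed_pls[of _ n d] lsum_map_gr)
lemma lsum_perm:
 assumes "!!i. i : set is ==> f i : gr M n d" "\<pi> permutes {..<n}"
 shows "lsum M n d (map (%i. perm M \<pi> (f i)) is) = perm M \<pi> (lsum M n d (map f is))"
 using assms(1) by (induction "is") (use assms(2) in "auto simp: perm_pls[of _ n d] lsum_map_gr")
lemma lsum_nul: "(!!i. i : set is ==> f i = nul M n d) ==> lsum M n d (map f is) = nul M n d"
 by (induction "is") auto
lemma lsum_single:
 assumes "distinct is" "i : set is" "!!j. j : set is ==> j ~= i ==> f j = nul M n d" "f i : gr M n d"
 shows "lsum M n d (map f is) = f i"
 using assms
proof (induction "is")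
 case (Cons j js)
 show ?case
 proof (cases "j = i")
 case True
 hence "lsum M n d (map f js) = nul M n d" using Cons.prems by (intro lsum_nul) auto
 thus ?thesis using True Cons.prems by simp
 next
 case False
 thus ?thesis using Cons by simp
 qed
qed simp
lemma finsum_eq_lsum:
 assumes "!!i. i < m ==> f i : gr M n d"
 shows "(\<Oplus>\<^bsub>component M n d\<^esub>i\<in>{..<m}. f i) = lsum M n d (map f [0..<m])"
proof -
 interpret c: module K "component M n d" by (rule component_module)
 show ?thesis using assms
 proof (induction m)
 case (Suc m)
 have "(\<Oplus>\<^bsub>component M n d\<^esub>i\<in>{..<Suc m}. f i) = pls M (f m) (\<Oplus>\<^bsub>component M n d\<^esub>i\<in>{..<m}. f i)"
 unfolding lessThan_Suc using Suc.prems by (subst c.M.finsum_insert) auto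
 also have "... = pls M (lsum M n d (map f [0..<m])) (f m)"
 by (subst Suc.IH, use Suc.prems in simp, rule pls_comm[of _ n d]) (use Suc.prems in "auto intro!: lsum_map_gr")
 also have "... = lsum M n d (map f [0..<Suc m])"
 using Suc.prems by (simp add: lsum_append lsum_map_gr image_subset_iff)
 finally show ?case .
 qed simp
qed
lemma lsum_reindex:
 assumes "\<pi> permutes {..<m}" "!!i. i < m ==> f i : gr M n d"
 shows "lsum M n d (map (%i. f (\<pi> i)) [0..<m]) = lsum M n d (map f [0..<m])"
proof -
 interpret c: module K "component M n d" by (rule component_module)
 have im: "\<pi> ` {..<m} = {..<m}" using assms(1) by (rule permutes_image)
 hence lt: "i < m ==> \<pi> i < m" for i by auto
 have "(\<Oplus>\<^bsub>component M n d\<^esub>i\<in>\<pi> ` {..<m}. f i) = (\<Oplus>\<^bsub>component M n d\<^esub>i\<in>{..<m}. f (\<pi> i))"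
 using assms lt by (intro c.M.finsum_reindex) (auto simp: im permutes_inj_on)
 thus ?thesis using assms lt by (simp add: im finsum_eq_lsum)
qed
lemma lsum_antisymmetric:
 assumes g: "!!i j. i < m ==> j < m ==> f i j : gr M n d"
 and "!!i. i < m ==> f i i = nul M n d"
 and "!!i j. i < j ==> j < m ==> pls M (f i j) (f j i) = nul M n d"
 shows "lsum M n d (map (%i. lsum M n d (map (f i) [0..<m])) [0..<m]) = nul M n d"
 using assms
proof (induction m)
 case (Suc m)
 let ?S = "%g k. lsum M n d (map g [0..<k])"
 have snoc: "?S h (Suc k) = pls M (?S h k) (h k)" if "!!i. i \<le> k ==> h i : gr M n d" for h k
 using that by (simp add: lsum_append lsum_map_gr image_subset_iff)
 have grs: "!!i. i \<le> m ==> ?S (f i) (Suc m) : gr M n d" "!!i. i \<le> m ==> ?S (f i) m : gr M n d"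
 using Suc.prems(1) by (auto intro!: lsum_map_gr simp del: upt_Suc)
 have "?S (%i. ?S (f i) (Suc m)) (Suc m)
 = pls M (?S (%i. ?S (f i) (Suc m)) m) (?S (f m) (Suc m))"
 by (rule snoc) (use grs in auto)
 also have "map (%i. ?S (f i) (Suc m)) [0..<m] = map (%i. pls M (?S (f i) m) (f i m)) [0..<m]"
 by (rule map_upt_cong, rule snoc) (use Suc.prems(1) in auto)
 also have "lsum M n d ... = pls M (?S (%i. ?S (f i) m) m) (?S (%i. f i m) m)"
 by (rule lsum_pls) (use Suc.prems(1) grs in auto)
 also have "?S (%i. ?S (f i) m) m = nul M n d" by (rule Suc.IH) (use Suc.prems in auto)
 also have "pls M ... (?S (%i. f i m) m) = ?S (%i. f i m) m"
 by (rule nul_pls, rule lsum_map_gr) (use Suc.prems in auto)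
 also have "?S (f m) (Suc m) = pls M (?S (f m) m) (f m m)"
 by (rule snoc) (use Suc.prems(1) in auto)
 also have "... = ?S (f m) m" using Suc.prems grs(2)[of m] by simp
 also have "pls M (?S (%i. f i m) m) (?S (f m) m) = ?S (%i. pls M (f i m) (f m i)) m"
 by (rule lsum_pls[symmetric]) (use Suc.prems(1) in auto)
 also have "... = nul M n d" by (rule lsum_nul) (use Suc.prems(3) in auto)
 finally show ?case .
qed simp

end
lemma smoduleI:
 fixes K (structure)
 assumes "cring K"
 and n: "!!n d. nul M n d : gr M n d"
 and p: "!!n d x y. x : gr M n d ==> y : gr M n d ==> pls M x y : gr M n d"
 and s: "!!n d c x. c : carrier K ==> x : gr M n d ==> scale M c x : gr M n d"
 and r: "!!n d \<pi> x. x : gr M n d ==> \<pi> permutes {..<n} ==> perm M \<pi> x : gr M n d"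
 and "!!n d x y z. x : gr M n d ==> y : gr M n d ==> z : gr M n d ==>
 pls M (pls M x y) z = pls M x (pls M y z)"
 and "!!n d x y. x : gr M n d ==> y : gr M n d ==> pls M x y = pls M y x"
 and "!!n d x. x : gr M n d ==> pls M (nul M n d) x = x"
 and neg: "!!n d x. x : gr M n d ==> pls M (scale M (\<ominus> \<one>) x) x = nul M n d"
 and "!!n d a b x. a : carrier K ==> b : carrier K ==> x : gr M n d ==>
 scale M (a \<oplus> b) x = pls M (scale M a x) (scale M b x)"
 and "!!n d a x y. a : carrier K ==> x : gr M n d ==> y : gr M n d ==>
 scale M a (pls M x y) = pls M (scale M a x) (scale M a y)"
 and "!!n d a b x. a : carrier K ==> b : carrier K ==> x : gr M n d ==>
 scale M (a \<otimes> b) x = scale M a (scale M b x)"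
 and "!!n d x. x : gr M n d ==> scale M \<one> x = x"
 and "!!n d x. x : gr M n d ==> perm M id x = x"
 and "!!n d \<pi> \<tau> x. x : gr M n d ==> \<pi> permutes {..<n} ==> \<tau> permutes {..<n} ==>
 perm M \<pi> (perm M \<tau> x) = perm M (\<pi> \<circ> \<tau>) x"
 and "!!n d \<pi> x y. x : gr M n d ==> y : gr M n d ==> \<pi> permutes {..<n} ==>
 perm M \<pi> (pls M x y) = pls M (perm M \<pi> x) (perm M \<pi> y)"
 and "!!n d c \<pi> x. c : carrier K ==> x : gr M n d ==> \<pi> permutes {..<n} ==>
 perm M \<pi> (scale M c x) = scale M c (perm M \<pi> x)"
 shows "smodule K M"
proof (rule smodule.intro)
 interpret cring K by fact
 fix n d
 have "\<exists>y\<in>gr M n d. pls M y x = nul M n d" if "x : gr M n d" for x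
 using neg[OF that] s[of "\<ominus> \<one>" x n d] that by auto
 hence "abelian_group (component M n d)"
 by (intro abelian_groupI) (use assms(2-8) in auto)
 thus "module K (component M n d)"
 by (rule moduleI[OF \<open>cring K\<close>]) (use assms(2-13) in auto)
next
 fix x \<pi> assume "x : elts M" "\<pi> permutes {..<arity M x}"
 thus "perm M \<pi> x : elts M & same_grade M (perm M \<pi> x) x"
 using r[of x "arity M x" "deg M x" \<pi>] by (simp add: gr_iff same_grade_def)
qed (use assms(14-) in "auto simp: gr_iff same_grade_def")
lemma smodule_cong:
 assumes "smodule K M"
 and "elts N = elts M" "arity N = arity M" "deg N = deg M" "nul N = nul M" "pls N = pls M"
 "scale N = scale M" "perm N = perm M"
 shows "smodule K N"
proof -
 have "component N n d = component M n d" for n d using assms by (simp add: component_def)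
 thus ?thesis using assms unfolding smodule_def same_grade_def by simp
qed

subsection \<open>Morphisms\<close>

lemma smod_hom_gr: "smod_hom K M N f ==> x : gr M n d ==> f x : gr N n d"
 by (auto simp: smod_hom_def gr_iff)
lemma smod_hom_pls: "smod_hom K M N f ==> x : gr M n d ==> y : gr M n d ==>
 f (pls M x y) = pls N (f x) (f y)"
 by (auto simp: smod_hom_def gr_iff same_grade_def)
lemma smod_hom_scale: "smod_hom K M N f ==> c : carrier K ==> x : elts M ==>
 f (scale M c x) = scale N c (f x)"
 by (auto simp: smod_hom_def gr_iff)
lemma smod_hom_perm: "smod_hom K M N f ==> x : gr M n d ==> \<pi> permutes {..<n} ==>
 f (perm M \<pi> x) = perm N \<pi> (f x)"
 by (auto simp: smod_hom_def gr_iff)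
lemma smod_homI:
 assumes "!!n d x. x : gr M n d ==> f x : gr N n d"
 and "!!n d x y. x : gr M n d ==> y : gr M n d ==> f (pls M x y) = pls N (f x) (f y)"
 and "!!n d c x. c : carrier K ==> x : gr M n d ==> f (scale M c x) = scale N c (f x)"
 and "!!n d \<pi> x. x : gr M n d ==> \<pi> permutes {..<n} ==> f (perm M \<pi> x) = perm N \<pi> (f x)"
 shows "smod_hom K M N f"
 unfolding smod_hom_def same_grade_def using assms by (auto simp: gr_iff)
lemma smod_hom_comp: "smod_hom K M N f ==> smod_hom K N P g ==> smod_hom K M P (%x. g (f x))"
 unfolding smod_hom_def same_grade_def by simp
lemma smod_hom_id: "smod_hom K M M (%x. x)"
 unfolding smod_hom_def by simp
lemma smod_hom_cong:
 assumes "smod_hom K M N f" "smodule K M" "!!x. x : elts M ==> g x = f x"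
 shows "smod_hom K M N g"
proof -
 interpret smodule K M by fact
 show ?thesis
 apply (rule smod_homI)
 subgoal using assms(3) smod_hom_gr[OF assms(1)] by (auto simp: gr_iff)
 subgoal for n d x y
 using assms(3) smod_hom_pls[OF assms(1)] pls_gr[of x n d y] by (auto simp: gr_iff)
 subgoal for n d c x
 using assms(3) smod_hom_scale[OF assms(1)] scale_gr[of c x n d] by (auto simp: gr_iff)
 subgoal for n d \<pi> x
 using assms(3) smod_hom_perm[OF assms(1), of x n d \<pi>] perm_gr[of x n d \<pi>] by (auto simp: gr_iff)
 done
qed

locale smodule_hom = M: smodule K M + N: smodule K N
 for K :: "('k, 'z) ring_scheme" (structure) and M :: "('k, 'a, 'm) smod_scheme"
 and N :: "('k, 'b, 'n) smod_scheme" and f +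
 assumes hom: "smod_hom K M N f"
begin

lemmas hom_gr = smod_hom_gr[OF hom]
 and hom_pls = smod_hom_pls[OF hom]
 and hom_scale = smod_hom_scale[OF hom]
 and hom_perm = smod_hom_perm[OF hom]
lemma hom_nul [simp]: "f (nul M n d) = nul N n d"
proof -
 have "f (nul M n d) = f (scale M \<zero> (nul M n d))" by simp
 also have "... = scale N \<zero> (f (nul M n d))" by (rule hom_scale) auto
 also have "... = nul N n d" by (rule N.scale_zero, rule hom_gr) simp
 finally show ?thesis .
qed
lemma hom_mns: "x : gr M n d ==> y : gr M n d ==> f (mns K M x y) = mns K N (f x) (f y)"
 unfolding mns_def
 using hom_pls[of x n d "scale M (\<ominus> \<one>) y"] hom_scale[of "\<ominus> \<one>" y] M.scale_gr[of "\<ominus> \<one>" y n d]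
 by (simp add: gr_iff)
lemma hom_signed: "x : elts M ==> f (signed K M e x) = signed K N e (f x)"
 by (simp add: signed_def hom_scale)
lemma hom_lsum: "set xs \<subseteq> gr M n d ==> f (lsum M n d xs) = lsum N n d (map f xs)"
 by (induction xs) (auto simp: hom_pls[of _ n d] M.lsum_gr)

end
lemma smod_hom_pls_fun:
 assumes "smodule K N" "smod_hom K M N f" "smod_hom K M N g"
 shows "smod_hom K M N (%x. pls N (f x) (g x))"
proof -
 interpret smodule K N by fact
 note f = smod_hom_gr[OF assms(2)] and g = smod_hom_gr[OF assms(3)]
 show ?thesis
 apply (rule smod_homI)
 subgoal by (simp add: f g pls_gr)
 subgoal for n d x y
 using smod_hom_pls[OF assms(2), of x n d y] smod_hom_pls[OF assms(3), of x n d y] f g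
 by (simp add: pls_swap[of _ n d])
 subgoal for n d c x
 using smod_hom_scale[OF assms(2), of c x] smod_hom_scale[OF assms(3), of c x] f[of x n d] g[of x n d]
 by (simp add: scale_pls[of _ _ n d] gr_iff)
 subgoal for n d \<pi> x
 using smod_hom_perm[OF assms(2), of x n d \<pi>] smod_hom_perm[OF assms(3), of x n d \<pi>] f[of x n d] g[of x n d]
 by (simp add: perm_pls[of _ n d] gr_iff)
 done
qed
lemma smod_hom_nul_fun:
 assumes "smodule K M" "smodule K N"
 shows "smod_hom K M N (%x. nul N (arity M x) (deg M x))"
proof -
 interpret M: smodule K M by fact
 interpret N: smodule K N by fact
 show ?thesis
 apply (rule smod_homI)
 subgoal by (simp add: gr_iff)
 subgoal for n d x y
 using M.pls_gr[of x n d y] by (simp add: gr_iff N.nul_pls[OF N.nul_gr])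
 subgoal for n d c x using M.scale_gr[of c x n d] by (simp add: gr_iff)
 subgoal for n d \<pi> x using M.perm_gr[of x n d \<pi>] by (simp add: gr_iff)
 done
qed

subsection \<open>Shifts and direct sums\<close>

lemma shift_simps [simp]:
 "elts (shift k M) = elts M" "arity (shift k M) = arity M" "deg (shift k M) = (%x. deg M x + k)"
 "nul (shift k M) = (%n d. nul M n (d - k))" "pls (shift k M) = pls M"
 "scale (shift k M) = scale M" "perm (shift k M) = perm M"
 by (simp_all add: shift_def)
lemma gr_shift: "gr (shift k M) n d = gr M n (d - k)"
 by (auto simp: gr_def)
lemma signed_shift [simp]: "signed K (shift k M) = signed K M"
 by (intro ext) (simp add: signed_def)
lemma lsum_shift [simp]: "lsum (shift k M) n d xs = lsum M n (d - k) xs"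
 by (simp add: lsum_def)
lemma smodule_shift: assumes "smodule K M" shows "smodule K (shift k M)"
proof -
 interpret smodule K M by fact
 show ?thesis
 apply (rule smoduleI[OF cring_K])
 subgoal by (simp add: gr_shift)
 subgoal by (simp add: gr_shift pls_gr)
 subgoal by (simp add: gr_shift scale_gr)
 subgoal by (simp add: gr_shift perm_gr)
 subgoal for n d by (simp add: gr_shift pls_assoc[of _ n "d - k"])
 subgoal for n d by (simp add: gr_shift pls_comm[of _ n "d - k"])
 subgoal by (simp add: gr_shift)
 subgoal for n d x
 using pls_neg[of x n "d - k"] pls_comm[OF scale_gr[OF minus_one_K], of x n "d - k" x]
 by (simp add: gr_shift)
 subgoal for n d by (simp add: gr_shift scale_add[of _ _ _ n "d - k"])
 subgoal for n d by (simp add: gr_shift scale_pls[of _ _ n "d - k"])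
 subgoal by (simp add: gr_iff scale_scale)
 subgoal by (simp add: gr_iff)
 subgoal by (simp add: gr_iff perm_id)
 subgoal by (simp add: gr_iff perm_comp)
 subgoal for n d by (simp add: gr_shift perm_pls[of _ n "d - k"])
 subgoal by (simp add: gr_iff perm_scale)
 done
qed
lemma shift_shift: "shift k (shift j M) = shift (k + j) M"
 by (auto simp: shift_def algebra_simps)
lemma shift_0: "shift 0 M = smod.truncate M"
 by (simp add: shift_def smod.truncate_def)
lemma smod_truncate_id: "smod.truncate (M :: ('k, 'a) smod) = M"
 by (simp add: smod.truncate_def)
lemma dsum_simps [simp]:
 "arity (dsum M N) = arity M \<circ> fst" "deg (dsum M N) = deg M \<circ> fst"
 "nul (dsum M N) n d = (nul M n d, nul N n d)"
 "pls (dsum M N) p q = (pls M (fst p) (fst q), pls N (snd p) (snd q))"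
 "scale (dsum M N) c p = (scale M c (fst p), scale N c (snd p))"
 "perm (dsum M N) \<pi> p = (perm M \<pi> (fst p), perm N \<pi> (snd p))"
 by (simp_all add: dsum_def split_beta map_prod_def)
lemma gr_dsum: "gr (dsum M N) n d = gr M n d \<times> gr N n d"
 by (auto simp: gr_def dsum_def)
lemma elts_dsum: "p : elts (dsum M N) \<longleftrightarrow>
 fst p : elts M & snd p : gr N (arity M (fst p)) (deg M (fst p))"
 by (auto simp: dsum_def gr_iff)
lemma smodule_dsum: assumes "smodule K M" "smodule K N" shows "smodule K (dsum M N)"
proof -
 interpret M: smodule K M by fact
 interpret N: smodule K N by fact
 show ?thesis
 apply (rule smoduleI[OF M.cring_K])
 subgoal by (simp add: gr_dsum)
 subgoal by (auto simp: gr_dsum M.pls_gr N.pls_gr)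
 subgoal by (auto simp: gr_dsum M.scale_gr N.scale_gr)
 subgoal by (auto simp: gr_dsum M.perm_gr N.perm_gr)
 subgoal for n d by (auto simp: gr_dsum M.pls_assoc[of _ n d] N.pls_assoc[of _ n d])
 subgoal for n d by (auto simp: gr_dsum M.pls_comm[of _ n d] N.pls_comm[of _ n d])
 subgoal for n d by (auto simp: gr_dsum)
 subgoal for n d x
 by (auto simp: gr_dsum M.pls_comm[OF M.scale_gr[OF M.minus_one_K]] M.pls_neg
 N.pls_comm[OF N.scale_gr[OF M.minus_one_K]] N.pls_neg)
 subgoal for n d by (auto simp: gr_dsum M.scale_add[of _ _ _ n d] N.scale_add[of _ _ _ n d])
 subgoal for n d by (auto simp: gr_dsum M.scale_pls[of _ _ n d] N.scale_pls[of _ _ n d])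
 subgoal by (auto simp: gr_dsum M.scale_scale N.scale_scale gr_iff)
 subgoal by (auto simp: gr_dsum gr_iff)
 subgoal by (auto simp: gr_dsum gr_iff M.perm_id N.perm_id)
 subgoal by (auto simp: gr_dsum gr_iff M.perm_comp N.perm_comp)
 subgoal for n d by (auto simp: gr_dsum M.perm_pls[of _ n d] N.perm_pls[of _ n d])
 subgoal by (auto simp: gr_dsum gr_iff M.perm_scale N.perm_scale)
 done
qed
lemma smod_hom_fst: "smod_hom K (dsum M N) M fst"
 by (rule smod_homI) (auto simp: gr_dsum)
lemma smod_hom_snd: "smod_hom K (dsum M N) N snd"
 by (rule smod_homI) (auto simp: gr_dsum)
lemma smod_hom_inj1: assumes "smodule K M" "smodule K N" shows "smod_hom K M (dsum M N) (inj1 M N)"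
proof -
 interpret M: smodule K M by fact
 interpret N: smodule K N by fact
 show ?thesis
 apply (rule smod_homI)
 subgoal by (auto simp: gr_dsum inj1_def gr_iff)
 subgoal for n d x y using M.pls_gr[of x n d y] by (auto simp: inj1_def gr_iff N.nul_pls[OF N.nul_gr])
 subgoal for n d c x using M.scale_gr[of c x n d] by (auto simp: inj1_def gr_iff)
 subgoal for n d \<pi> x using M.perm_gr[of x n d \<pi>] by (auto simp: inj1_def gr_iff)
 done
qed
lemma smod_hom_inj2: assumes "smodule K M" "smodule K N" shows "smod_hom K N (dsum M N) (inj2 M N)"
proof -
 interpret M: smodule K M by fact
 interpret N: smodule K N by fact
 show ?thesis
 apply (rule smod_homI)
 subgoal by (auto simp: gr_dsum inj2_def gr_iff)
 subgoal for n d x y using N.pls_gr[of x n d y] by (auto simp: inj2_def gr_iff M.nul_pls[OF M.nul_gr])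
 subgoal for n d c x using N.scale_gr[of c x n d] by (auto simp: inj2_def gr_iff)
 subgoal for n d \<pi> x using N.perm_gr[of x n d \<pi>] by (auto simp: inj2_def gr_iff)
 done
qed

text \<open>The universal property of the direct sum.\<close>

lemma smod_hom_copair:
 assumes "smodule K P" "smod_hom K M P f" "smod_hom K N P g"
 shows "smod_hom K (dsum M N) P (%p. pls P (f (fst p)) (g (snd p)))"
 by (rule smod_hom_pls_fun[OF assms(1) smod_hom_comp[OF smod_hom_fst assms(2)]
 smod_hom_comp[OF smod_hom_snd assms(3)]])
lemma dsum_decompose:
 assumes "smodule K M" "smodule K N" "p : elts (dsum M N)"
 shows "p = pls (dsum M N) (inj1 M N (fst p)) (inj2 M N (snd p))"
proof -
 interpret M: smodule K M by fact
 interpret N: smodule K N by fact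
 show ?thesis using assms(3)
 M.pls_nul[of "fst p" "arity M (fst p)" "deg M (fst p)"]
 N.nul_pls[of "snd p" "arity M (fst p)" "deg M (fst p)"]
 by (auto simp: elts_dsum inj1_def inj2_def gr_iff prod_eq_iff)
qed

section \<open>Operads as algebras for a signature with laws\<close>

locale sig_alg =
 fixes K :: "('k, 'z) ring_scheme" (structure) and P :: "('k, 'a, 'm) operad_scheme"
 assumes nul_gr [simp]: "nul P n d : gr P n d"
 and pls_gr: "[|x : gr P n d; y : gr P n d|] ==> pls P x y : gr P n d"
 and scale_gr: "[|c : carrier K; x : gr P n d|] ==> scale P c x : gr P n d"
 and perm_gr: "[|x : gr P n d; \<pi> permutes {..<n}|] ==> perm P \<pi> x : gr P n d"
 and unt_gr: "unt P : gr P 1 0"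
 and cmp_gr: "composable P a bs ==>
 cmp P a bs : gr P (tarity P bs) (deg P a + tdeg P bs)"

text \<open>With the instances of all equational axioms in one relation, being an operad is a statement about
  a single relation, which can be transported along morphisms.\<close>

inductive law :: "('k, 'z) ring_scheme => ('k, 'a, 'm) operad_scheme => 'a => 'a => bool"
 for K :: "('k, 'z) ring_scheme" (structure) and P where
 pls_assoc: "[|x : gr P n d; y : gr P n d; z : gr P n d|] ==>
 law K P (pls P (pls P x y) z) (pls P x (pls P y z))"
| pls_comm: "[|x : gr P n d; y : gr P n d|] ==> law K P (pls P x y) (pls P y x)"
| nul_pls: "x : gr P n d ==> law K P (pls P (nul P n d) x) x"
| neg_pls: "x : gr P n d ==> law K P (pls P (scale P (\<ominus> \<one>) x) x) (nul P n d)"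
| scale_add: "[|a : carrier K; b : carrier K; x : gr P n d|] ==>
 law K P (scale P (a \<oplus> b) x) (pls P (scale P a x) (scale P b x))"
| scale_pls: "[|a : carrier K; x : gr P n d; y : gr P n d|] ==>
 law K P (scale P a (pls P x y)) (pls P (scale P a x) (scale P a y))"
| scale_mult: "[|a : carrier K; b : carrier K; x : gr P n d|] ==>
 law K P (scale P (a \<otimes> b) x) (scale P a (scale P b x))"
| scale_one: "x : gr P n d ==> law K P (scale P \<one> x) x"
| perm_id: "x : gr P n d ==> law K P (perm P id x) x"
| perm_comp: "[|x : gr P n d; \<pi> permutes {..<n}; \<tau> permutes {..<n}|] ==>
 law K P (perm P \<pi> (perm P \<tau> x)) (perm P (\<pi> \<circ> \<tau>) x)"
| perm_pls: "[|x : gr P n d; y : gr P n d; \<pi> permutes {..<n}|] ==>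
 law K P (perm P \<pi> (pls P x y)) (pls P (perm P \<pi> x) (perm P \<pi> y))"
| perm_scale: "[|c : carrier K; x : gr P n d; \<pi> permutes {..<n}|] ==>
 law K P (perm P \<pi> (scale P c x)) (scale P c (perm P \<pi> x))"
| comp_plus_left: "[|composable P a bs; a' : comp_of P a|] ==>
 law K P (cmp P (pls P a a') bs) (pls P (cmp P a bs) (cmp P a' bs))"
| comp_scale_left: "[|composable P a bs; c : carrier K|] ==>
 law K P (cmp P (scale P c a) bs) (scale P c (cmp P a bs))"
| comp_plus_right: "[|composable P a bs; i < length bs; b : comp_of P (bs ! i)|] ==>
 law K P (cmp P a (bs[i := pls P (bs ! i) b])) (pls P (cmp P a bs) (cmp P a (bs[i := b])))"
| comp_scale_right: "[|composable P a bs; i < length bs; c : carrier K|] ==>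
 law K P (cmp P a (bs[i := scale P c (bs ! i)])) (scale P c (cmp P a bs))"
| unit_left: "a : elts P ==> law K P (cmp P (unt P) [a]) a"
| unit_right: "a : elts P ==> law K P (cmp P a (replicate (arity P a) (unt P))) a"
| assoc: "[|composable P a bs; length css = length bs;
 !!i. i < length bs ==> composable P (bs ! i) (css ! i)|] ==>
 law K P (cmp P (cmp P a bs) (concat css))
 (signed K P (\<Sum>i<length bs. \<Sum>j<i. deg P (bs ! i) * sum_list (map (deg P) (css ! j)))
 (cmp P a (map2 (cmp P) bs css)))"
| equivariant_left: "[|composable P a bs; \<pi> permutes {..<arity P a}|] ==>
 law K P (cmp P (perm P \<pi> a) bs)
 (signed K P (koszul \<pi> (map (deg P) bs))
 (perm P (block_perm (map (arity P) bs) \<pi>)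
 (cmp P a (map (%j. bs ! \<pi> j) [0..<length bs]))))"
| equivariant_right: "[|composable P a bs; length \<tau>s = length bs;
 !!i. i < length bs ==> (\<tau>s ! i) permutes {..<arity P (bs ! i)}|] ==>
 law K P (cmp P a (map2 (perm P) \<tau>s bs))
 (perm P (sum_perm (map (arity P) bs) \<tau>s) (cmp P a bs))"

subsection \<open>Block permutations\<close>

lemma list_perm_permutes:
 assumes "mset l = mset [0..<n]"
 shows "list_perm l permutes {..<n}"
proof -
 have l: "length l = n" using assms by (metis diff_zero length_upt size_mset)
 have d: "distinct l" using assms by (metis distinct_upt mset_eq_imp_distinct_iff)
 have s: "set l = {..<n}" using assms by (metis atLeast_upt set_mset_mset)
 have "inj_on (list_perm l) {..<n}"
 using d by (auto simp: inj_on_def list_perm_def l nth_eq_iff_index_eq)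
 moreover have "list_perm l ` {..<n} \<subseteq> {..<n}"
 proof (rule image_subsetI)
 fix m assume "m : {..<n}"
 thus "list_perm l m : {..<n}" using s l nth_mem[of m l] by (simp add: list_perm_def)
 qed
 ultimately have "bij_betw (list_perm l) {..<n} {..<n}"
 by (intro bij_betw_imageI endo_inj_surj) auto
 thus ?thesis by (rule bij_imp_permutes) (auto simp: list_perm_def l)
qed
lemma mset_blocks:
 "mset (concat (map (%j. map (%r. block_start ks j + r) [0..<ks ! j]) [0..<length ks]))
 = mset [0..<sum_list ks]"
proof (induction ks rule: rev_induct)
 case (snoc k ks)
 let ?f = "%ks j. map (%r. block_start ks j + r) [0..<ks ! j]"
 have A: "map (?f (ks @ [k])) [0..<length (ks @ [k])] = map (?f ks) [0..<length ks]
 @ [map (%r. sum_list ks + r) [0..<k]]"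
 by (auto simp: block_start_def nth_append)
 have B: "map (%r. sum_list ks + r) [0..<k] = [sum_list ks..<sum_list ks + k]"
 by (intro nth_equalityI) auto
 have "mset (concat (map (?f (ks @ [k])) [0..<length (ks @ [k])]))
 = mset (concat (map (?f ks) [0..<length ks])) + mset [sum_list ks..<sum_list ks + k]"
 by (simp only: A B concat_append mset_append concat.simps append_Nil2)
 also have "... = mset [0..<sum_list ks] + mset [sum_list ks..<sum_list ks + k]"
 by (simp only: snoc)
 also have "... = mset ([0..<sum_list ks] @ [sum_list ks..<sum_list ks + k])" by simp
 also have "[0..<sum_list ks] @ [sum_list ks..<sum_list ks + k] = [0..<sum_list (ks @ [k])]"
 using upt_add_eq_append[of 0 "sum_list ks" k] by simp
 finally show ?case .
qed simp
lemma mset_map_permutes: "\<pi> permutes {..<n} ==> mset (map \<pi> [0..<n]) = mset [0..<n]"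
 by (metis lessThan_atLeast0 mset_map mset_upt permutes_image_mset)
lemma mset_concat_map: "mset (concat (map f xs)) = (\<Sum>x\<in>#mset xs. mset (f x))"
 by (induction xs) auto
lemma block_perm_permutes:
 assumes "\<pi> permutes {..<length ks}"
 shows "block_perm ks \<pi> permutes {..<sum_list ks}"
 unfolding block_perm_def
proof (rule list_perm_permutes)
 let ?f = "%j. map (%r. block_start ks j + r) [0..<ks ! j]"
 have "map (%j. ?f (\<pi> j)) [0..<length ks] = map ?f (map \<pi> [0..<length ks])" by simp
 hence "mset (concat (map (%j. ?f (\<pi> j)) [0..<length ks]))
 = (\<Sum>j\<in>#mset (map \<pi> [0..<length ks]). mset (?f j))"
 by (simp only: mset_concat_map)
 also have "... = (\<Sum>j\<in>#mset [0..<length ks]. mset (?f j))"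
 by (simp only: mset_map_permutes[OF assms])
 also have "... = mset (concat (map ?f [0..<length ks]))"
 by (simp only: mset_concat_map)
 finally show "mset (concat (map (%j. ?f (\<pi> j)) [0..<length ks])) = mset [0..<sum_list ks]"
 by (simp only: mset_blocks)
qed
lemma sum_perm_permutes:
 assumes "length \<tau>s = length ks" "!!j. j < length ks ==> (\<tau>s ! j) permutes {..<ks ! j}"
 shows "sum_perm ks \<tau>s permutes {..<sum_list ks}"
 unfolding sum_perm_def
proof (rule list_perm_permutes)
 let ?f = "%j. map (%r. block_start ks j + r) [0..<ks ! j]"
 let ?g = "%j. map (%r. block_start ks j + (\<tau>s ! j) r) [0..<ks ! j]"
 have "mset (?g j) = mset (?f j)" if "j < length ks" for j
 proof -
 have "mset (?g j) = image_mset ((+) (block_start ks j)) (mset (map (\<tau>s ! j) [0..<ks ! j]))"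
 by (simp add: image_mset.compositionality comp_def)
 also have "mset (map (\<tau>s ! j) [0..<ks ! j]) = mset [0..<ks ! j]"
 by (rule mset_map_permutes[OF assms(2)[OF that]])
 finally show ?thesis by simp
 qed
 hence "mset (concat (map ?g [0..<length ks])) = mset (concat (map ?f [0..<length ks]))"
 unfolding mset_concat_map by (intro arg_cong[where f = sum_mset] image_mset_cong) auto
 thus "mset (concat (map ?g [0..<length ks])) = mset [0..<sum_list ks]"
 by (simp only: mset_blocks)
qed

subsection \<open>Morphisms for the signature\<close>

lemma composable_update: "composable P a bs ==> x : elts P ==> composable P a (bs[i := x])"
 using set_update_subset_insert[of bs i x] by (auto simp: composable_def)
lemma composable_nth: "composable P a bs ==> i < length bs ==> bs ! i : elts P"
 by (auto simp: composable_def)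
lemma composable_cong:
 "composable P a bs ==> a' : gr P (arity P a) d ==> composable P a' bs"
 by (auto simp: composable_def gr_iff)
lemma map_update_eq: "i < length bs ==> f x = f (bs ! i) ==> map f (bs[i := x]) = map f bs"
 by (simp add: map_update list_update_same_conv)
lemma composable_rearrange:
 fixes f :: "'a => 'b::comm_monoid_add"
 assumes "composable P a bs" "\<pi> permutes {..<arity P a}"
 shows "composable P a (map (%j. bs ! \<pi> j) [0..<length bs])"
 and "sum_list (map f (map (%j. bs ! \<pi> j) [0..<length bs])) = sum_list (map f bs)"
proof -
 have lt: "\<pi> j < length bs" if "j < length bs" for j
 using assms that permutes_in_image[OF assms(2), of j] by (simp add: composable_def)
 thus "composable P a (map (%j. bs ! \<pi> j) [0..<length bs])"
 using assms by (auto simp: composable_def)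
 have "sum_list (map f (map (%j. bs ! \<pi> j) [0..<length bs])) = sum_list (map (%j. f (bs ! j)) (map \<pi> [0..<length bs]))"
 by (simp add: comp_def)
 also have "... = sum_mset (image_mset (%j. f (bs ! j)) (mset (map \<pi> [0..<length bs])))"
 by (metis mset_map sum_mset_sum_list)
 also have "mset (map \<pi> [0..<length bs]) = mset [0..<length bs]"
 using assms by (intro mset_map_permutes) (simp add: composable_def)
 also have "sum_mset (image_mset (%j. f (bs ! j)) (mset [0..<length bs])) = sum_list (map (%j. f (bs ! j)) [0..<length bs])"
 by (metis mset_map sum_mset_sum_list)
 also have "map (%j. f (bs ! j)) [0..<length bs] = map f bs"
 by (rule nth_equalityI) simp_all
 finally show "sum_list (map f (map (%j. bs ! \<pi> j) [0..<length bs])) = sum_list (map f bs)" .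
qed

context sig_alg
begin
lemma cmp_gr': "composable P a bs ==> n = tarity P bs ==>
 d = deg P a + tdeg P bs ==> cmp P a bs : gr P n d"
 using cmp_gr by simp
lemma signed_gr: "x : gr P n d ==> \<ominus> \<one> : carrier K ==> signed K P e x : gr P n d"
 by (simp add: signed_def scale_gr)
lemma composable_map2_cmp:
 assumes "composable P a bs" "length css = length bs"
 "!!i. i < length bs ==> composable P (bs ! i) (css ! i)"
 shows "composable P a (map2 (cmp P) bs css)" "composable P (cmp P a bs) (concat css)"
proof -
 show "composable P a (map2 (cmp P) bs css)"
 using assms cmp_gr by (auto simp: composable_def gr_iff in_set_zip)
 have "length (concat css) = tarity P bs"
 unfolding length_concat
 by (rule arg_cong[where f = sum_list], rule nth_equalityI)
 (use assms in "auto simp: composable_def")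
 moreover have "set cs \<subseteq> elts P" if "cs : set css" for cs
 using that assms by (metis composable_def in_set_conv_nth)
 ultimately show "composable P (cmp P a bs) (concat css)"
 using cmp_gr[OF assms(1)] by (auto simp: composable_def gr_iff)
qed
lemma composable_map2_perm:
 assumes "composable P a bs" "length \<tau>s = length bs"
 "!!i. i < length bs ==> (\<tau>s ! i) permutes {..<arity P (bs ! i)}"
 shows "composable P a (map2 (perm P) \<tau>s bs)" "map (arity P) (map2 (perm P) \<tau>s bs) = map (arity P) bs"
 "map (deg P) (map2 (perm P) \<tau>s bs) = map (deg P) bs"
proof -
 have g: "perm P (\<tau>s ! i) (bs ! i) : comp_of P (bs ! i)" if "i < length bs" for i
 using assms that by (intro perm_gr elts_gr) (auto simp: composable_def)
 show "composable P a (map2 (perm P) \<tau>s bs)"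
 using assms g by (auto simp: composable_def in_set_zip gr_iff)
 show "map (arity P) (map2 (perm P) \<tau>s bs) = map (arity P) bs"
 "map (deg P) (map2 (perm P) \<tau>s bs) = map (deg P) bs"
 using assms g by (auto intro!: nth_equalityI simp: gr_iff)
qed
lemma law_elts:
 assumes "law K P l r" "cring K" shows "l : elts P & r : elts P"
proof -
 interpret cring K by fact
 have *: "x : elts P" if "x : gr P n d" for x n d using that by (simp add: gr_iff)
 note grI = pls_gr scale_gr perm_gr cmp_gr signed_gr
 show ?thesis using assms(1)
 proof cases
 case (assoc a bs css)
 note c = composable_map2_cmp[OF assoc(3-5)]
 show ?thesis unfolding assoc(1,2) using *[OF cmp_gr[OF c(2)]] *[OF signed_gr[OF cmp_gr[OF c(1)]]] by simp
 next
 case (equivariant_left a bs \<pi>)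
 note ra = composable_rearrange[OF equivariant_left(3,4)]
 have l: "\<pi> permutes {..<length (map (arity P) bs)}" using equivariant_left by (simp add: composable_def)
 have "cmp P a (map (%j. bs ! \<pi> j) [0..<length bs])
 : gr P (tarity P bs) (deg P a + tdeg P bs)"
 by (rule cmp_gr'[OF ra(1)]) (simp_all only: ra(2))
 from perm_gr[OF this block_perm_permutes[OF l]]
 have "perm P (block_perm (map (arity P) bs) \<pi>) (cmp P a (map (%j. bs ! \<pi> j) [0..<length bs]))
 : gr P (tarity P bs) (deg P a + tdeg P bs)" .
 from *[OF signed_gr[OF this]] moreover have "composable P (perm P \<pi> a) bs"
 using equivariant_left by (intro composable_cong[of P a bs, OF _ perm_gr[OF elts_gr]]) (auto simp: composable_def)
 ultimately show ?thesis unfolding equivariant_left(1,2) using *[OF cmp_gr] by simp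
 next
 case (equivariant_right a bs \<tau>s)
 hence "perm P (sum_perm (map (arity P) bs) \<tau>s) (cmp P a bs)
 : gr P (tarity P bs) (deg P a + tdeg P bs)"
 by (intro perm_gr sum_perm_permutes cmp_gr) auto
 thus ?thesis unfolding equivariant_right(1,2)
 using *[OF cmp_gr[OF composable_map2_perm(1)[OF equivariant_right(3-5)]]] * by simp
 next
 case unit_right
 hence "composable P r (replicate (arity P r) (unt P))" using unt_gr by (auto simp: composable_def gr_iff)
 thus ?thesis using unit_right *[OF cmp_gr] by simp
 next
 case unit_left
 hence "composable P (unt P) [r]" using unt_gr by (auto simp: composable_def gr_iff)
 thus ?thesis using unit_left *[OF cmp_gr] by simp
 next
 case (comp_plus_right a bs i b)
 have b: "bs ! i : comp_of P (bs ! i)"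
 using comp_plus_right by (auto intro!: elts_gr composable_nth)
 have c: "composable P a (bs[i := pls P (bs ! i) b])" "composable P a (bs[i := b])"
 using comp_plus_right *[OF pls_gr[OF b]] * by (auto intro!: composable_update)
 have "map (deg P) (bs[i := b]) = map (deg P) bs" "map (arity P) (bs[i := b]) = map (arity P) bs"
 using comp_plus_right by (auto intro!: map_update_eq simp: gr_iff)
 hence "cmp P a (bs[i := b]) : gr P (tarity P bs) (deg P a + tdeg P bs)"
 using cmp_gr[OF c(2)] by simp
 thus ?thesis unfolding comp_plus_right(1,2)
 using *[OF cmp_gr[OF c(1)]] *[OF pls_gr[OF cmp_gr[OF comp_plus_right(3)]]] by simp
 next
 case (comp_scale_right a bs i c)
 have "composable P a (bs[i := scale P c (bs ! i)])"
 using comp_scale_right *[OF scale_gr[OF _ elts_gr]]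
 by (auto intro!: composable_update composable_nth)
 thus ?thesis unfolding comp_scale_right(1,2)
 using comp_scale_right *[OF cmp_gr] *[OF scale_gr[OF _ cmp_gr]] by simp
 next
 case (comp_plus_left a bs a')
 have a: "a : comp_of P a" using comp_plus_left by (simp add: composable_def gr_iff)
 have c: "composable P (pls P a a') bs" "composable P a' bs"
 using comp_plus_left(3) pls_gr[OF a comp_plus_left(4)] comp_plus_left(4)
 by (auto intro!: composable_cong[of P a bs])
 have "deg P a' = deg P a" using comp_plus_left by (simp add: gr_iff)
 thus ?thesis unfolding comp_plus_left(1,2)
 using *[OF cmp_gr[OF c(1)]] *[OF pls_gr[OF cmp_gr[OF comp_plus_left(3)]]] cmp_gr[OF c(2)] by simp
 next
 case (comp_scale_left a bs c)
 have a: "a : comp_of P a" using comp_scale_left by (simp add: composable_def gr_iff)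
 have "composable P (scale P c a) bs"
 by (rule composable_cong[OF comp_scale_left(3) scale_gr[OF comp_scale_left(4) a]])
 thus ?thesis unfolding comp_scale_left(1,2)
 using comp_scale_left *[OF cmp_gr] *[OF scale_gr[OF _ cmp_gr]] by simp
 next
 case (perm_comp x n d \<pi> \<tau>)
 show ?thesis unfolding perm_comp(1,2)
 using *[OF perm_gr[OF perm_gr[OF perm_comp(3,5)] perm_comp(4)]]
 *[OF perm_gr[OF perm_comp(3) permutes_compose[OF perm_comp(5,4)]]] by simp
 qed (auto intro!: grI intro: * *[OF nul_gr] *[OF pls_gr[OF nul_gr]] permutes_id)
qed

end
lemma operad_hom_smod: "operad_hom K P Q f ==> smod_hom K P Q f"
 and operad_hom_unt: "operad_hom K P Q f ==> f (unt P) = unt Q"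
 and operad_hom_cmp: "operad_hom K P Q f ==> composable P a bs ==>
 f (cmp P a bs) = cmp Q (f a) (map f bs)"
 by (simp_all add: operad_hom_def)
lemma operad_homI:
 "smod_hom K P Q f ==> f (unt P) = unt Q ==>
 (!!a bs. composable P a bs ==> f (cmp P a bs) = cmp Q (f a) (map f bs)) ==> operad_hom K P Q f"
 by (simp add: operad_hom_def)
lemma smod_hom_composable:
 assumes "smod_hom K P Q f" "composable P a bs" shows "composable Q (f a) (map f bs)"
 using assms by (auto simp: smod_hom_def composable_def)
lemma operad_hom_comp:
 assumes "operad_hom K P Q f" "operad_hom K Q S g" shows "operad_hom K P S (%x. g (f x))"
proof (rule operad_homI)
 fix a bs assume "composable P a bs"
 thus "g (f (cmp P a bs)) = cmp S (g (f a)) (map (%x. g (f x)) bs)"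
 using operad_hom_cmp[OF assms(1)] operad_hom_cmp[OF assms(2)]
 smod_hom_composable[OF operad_hom_smod[OF assms(1)]] by (simp add: comp_def)
qed (use assms in "auto simp: operad_hom_def intro: smod_hom_comp")

text \<open>Maps between structures with the operations of an operad, of which no equation is required: the
  algebra of formal expressions is such a structure.\<close>

locale sig_hom = P: sig_alg K P + Q: sig_alg K Q
 for K :: "('k, 'z) ring_scheme" (structure) and P :: "('k, 'a, 'm) operad_scheme"
 and Q :: "('k, 'b, 'n) operad_scheme" and f +
 assumes hom: "operad_hom K P Q f" and hom_nul [simp]: "!!n d. f (nul P n d) = nul Q n d"
 and cring: "cring K"
begin

lemmas shom = operad_hom_smod[OF hom]
lemmas hom_gr = smod_hom_gr[OF shom]
 and hom_pls = smod_hom_pls[OF shom]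
 and hom_scale = smod_hom_scale[OF shom]
 and hom_perm = smod_hom_perm[OF shom]
 and hom_cmp = operad_hom_cmp[OF hom]
 and hom_unt = operad_hom_unt[OF hom]
 and hom_composable = smod_hom_composable[OF shom]
lemma hom_scale': "c : carrier K ==> x : gr P n d ==> f (scale P c x) = scale Q c (f x)"
 by (rule hom_scale) (auto simp: gr_iff)
lemma hom_grade: "x : elts P ==> arity Q (f x) = arity P x" "x : elts P ==> deg Q (f x) = deg P x"
 "x : elts P ==> f x : elts Q"
 using shom by (auto simp: smod_hom_def)
lemma minus_one_K: "\<ominus> \<one> : carrier K"
proof - interpret cring K by (rule cring) show ?thesis by simp qed
lemma hom_signed: "x : gr P n d ==> f (signed K P e x) = signed K Q e (f x)"
 by (simp add: signed_def hom_scale minus_one_K gr_iff)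
lemma map_hom_grade:
 "set bs \<subseteq> elts P ==> map (arity Q) (map f bs) = map (arity P) bs"
 "set bs \<subseteq> elts P ==> map (deg Q) (map f bs) = map (deg P) bs"
 by (auto simp: hom_grade subset_iff)
lemma composable_gr: "composable P a bs ==> a : comp_of P a"
 by (simp add: composable_def gr_iff)
lemma map_hom_grade': "composable P a bs ==> map (arity Q) (map f bs) = map (arity P) bs"
 "composable P a bs ==> map (deg Q) (map f bs) = map (deg P) bs"
 by (rule map_hom_grade, simp add: composable_def)+
lemma hom_comp_plus_left:
 assumes "composable P a bs" "a' : comp_of P a"
 shows "f (cmp P (pls P a a') bs) = cmp Q (pls Q (f a) (f a')) (map f bs)"
 "f (pls P (cmp P a bs) (cmp P a' bs)) = pls Q (cmp Q (f a) (map f bs)) (cmp Q (f a') (map f bs))"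
proof -
 have c: "composable P a' bs" "composable P (pls P a a') bs"
 using assms P.pls_gr[OF composable_gr] by (auto intro!: composable_cong[of P a bs])
 moreover have "cmp P a' bs : gr P (tarity P bs) (deg P a + tdeg P bs)"
 using assms by (intro P.cmp_gr' c) (auto simp: gr_iff)
 ultimately show "f (cmp P (pls P a a') bs) = cmp Q (pls Q (f a) (f a')) (map f bs)"
 "f (pls P (cmp P a bs) (cmp P a' bs)) = pls Q (cmp Q (f a) (map f bs)) (cmp Q (f a') (map f bs))"
 using assms by (simp_all add: hom_cmp hom_pls[OF P.cmp_gr] hom_pls[OF composable_gr])
qed
lemma hom_comp_scale_left:
 assumes "composable P a bs" "c : carrier K"
 shows "f (cmp P (scale P c a) bs) = cmp Q (scale Q c (f a)) (map f bs)"
 "f (scale P c (cmp P a bs)) = scale Q c (cmp Q (f a) (map f bs))"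
proof -
 have "composable P (scale P c a) bs"
 by (rule composable_cong[OF assms(1) P.scale_gr[OF assms(2) composable_gr[OF assms(1)]]])
 thus "f (cmp P (scale P c a) bs) = cmp Q (scale Q c (f a)) (map f bs)"
 "f (scale P c (cmp P a bs)) = scale Q c (cmp Q (f a) (map f bs))"
 using assms by (simp_all add: hom_cmp hom_scale'[OF _ P.cmp_gr] hom_scale'[OF _ composable_gr])
qed
lemma hom_comp_plus_right:
 assumes "composable P a bs" "i < length bs" "b : comp_of P (bs ! i)"
 shows "f (cmp P a (bs[i := pls P (bs ! i) b])) = cmp Q (f a) ((map f bs)[i := pls Q (map f bs ! i) (f b)])"
 "f (pls P (cmp P a bs) (cmp P a (bs[i := b]))) =
 pls Q (cmp Q (f a) (map f bs)) (cmp Q (f a) ((map f bs)[i := f b]))"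
proof -
 have bi: "bs ! i : comp_of P (bs ! i)"
 using assms by (auto intro!: elts_gr composable_nth)
 have c: "composable P a (bs[i := pls P (bs ! i) b])" "composable P a (bs[i := b])"
 using assms P.pls_gr[OF bi] by (auto intro!: composable_update simp: gr_iff)
 have "map (deg P) (bs[i := b]) = map (deg P) bs" "map (arity P) (bs[i := b]) = map (arity P) bs"
 using assms by (auto intro!: map_update_eq simp: gr_iff)
 hence "cmp P a (bs[i := b]) : gr P (tarity P bs) (deg P a + tdeg P bs)"
 using P.cmp_gr[OF c(2)] by simp
 thus "f (pls P (cmp P a bs) (cmp P a (bs[i := b]))) =
 pls Q (cmp Q (f a) (map f bs)) (cmp Q (f a) ((map f bs)[i := f b]))"
 using assms c by (simp add: hom_pls[OF P.cmp_gr] hom_cmp map_update)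
 show "f (cmp P a (bs[i := pls P (bs ! i) b])) = cmp Q (f a) ((map f bs)[i := pls Q (map f bs ! i) (f b)])"
 using assms c by (simp add: hom_pls[OF bi] hom_cmp map_update)
qed
lemma hom_comp_scale_right:
 assumes "composable P a bs" "i < length bs" "c : carrier K"
 shows "f (cmp P a (bs[i := scale P c (bs ! i)])) = cmp Q (f a) ((map f bs)[i := scale Q c (map f bs ! i)])"
proof -
 have bi: "bs ! i : elts P"
 using assms by (auto intro!: composable_nth)
 have "composable P a (bs[i := scale P c (bs ! i)])"
 using assms P.scale_gr[OF assms(3) elts_gr[OF bi]]
 by (auto intro!: composable_update simp: gr_iff)
 thus ?thesis using assms bi by (simp add: hom_scale hom_cmp map_update)
qed
lemma hom_unit_left: "a : elts P ==> f (cmp P (unt P) [a]) = cmp Q (unt Q) [f a]"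
 using P.unt_gr by (subst hom_cmp) (auto simp: composable_def gr_iff hom_unt)
lemma hom_unit_right: "a : elts P ==>
 f (cmp P a (replicate (arity P a) (unt P))) = cmp Q (f a) (replicate (arity Q (f a)) (unt Q))"
 using P.unt_gr by (subst hom_cmp) (auto simp: composable_def gr_iff hom_unt hom_grade)
lemma hom_assoc:
 assumes "composable P a bs" "length css = length bs"
 "!!i. i < length bs ==> composable P (bs ! i) (css ! i)"
 shows "f (cmp P (cmp P a bs) (concat css)) = cmp Q (cmp Q (f a) (map f bs)) (concat (map (map f) css))"
 "f (signed K P (\<Sum>i<length bs. \<Sum>j<i. deg P (bs ! i) * sum_list (map (deg P) (css ! j)))
 (cmp P a (map2 (cmp P) bs css)))
 = signed K Q (\<Sum>i<length (map f bs). \<Sum>j<i. deg Q (map f bs ! i) * sum_list (map (deg Q) (map (map f) css ! j)))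
 (cmp Q (f a) (map2 (cmp Q) (map f bs) (map (map f) css)))"
proof -
 note c = P.composable_map2_cmp[OF assms]
 have m: "map f (map2 (cmp P) bs css) = map2 (cmp Q) (map f bs) (map (map f) css)"
 using assms by (intro nth_equalityI) (auto simp: hom_cmp)
 have s: "(\<Sum>i<length (map f bs). \<Sum>j<i. deg Q (map f bs ! i) * sum_list (map (deg Q) (map (map f) css ! j)))
 = (\<Sum>i<length bs. \<Sum>j<i. deg P (bs ! i) * sum_list (map (deg P) (css ! j)))"
 proof (rule sum.cong[OF _ sum.cong[OF refl]])
 fix i j assume i: "i : {..<length bs}" and j: "j : {..<i}"
 hence "composable P (bs ! j) (css ! j)" "j < length css" using assms by auto
 hence "map (deg Q) (map (map f) css ! j) = map (deg P) (css ! j)"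
 using map_hom_grade'(2) by simp
 thus "deg Q (map f bs ! i) * sum_list (map (deg Q) (map (map f) css ! j))
 = deg P (bs ! i) * sum_list (map (deg P) (css ! j))"
 using i assms by (simp add: hom_grade composable_nth)
 qed simp
 show "f (cmp P (cmp P a bs) (concat css)) = cmp Q (cmp Q (f a) (map f bs)) (concat (map (map f) css))"
 using c assms(1) by (simp add: hom_cmp map_concat)
 show "f (signed K P (\<Sum>i<length bs. \<Sum>j<i. deg P (bs ! i) * sum_list (map (deg P) (css ! j)))
 (cmp P a (map2 (cmp P) bs css)))
 = signed K Q (\<Sum>i<length (map f bs). \<Sum>j<i. deg Q (map f bs ! i) * sum_list (map (deg Q) (map (map f) css ! j)))
 (cmp Q (f a) (map2 (cmp Q) (map f bs) (map (map f) css)))"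
 unfolding s m[symmetric] using c assms(1) by (simp add: hom_cmp hom_signed[OF P.cmp_gr])
qed
lemma hom_equivariant_left:
 assumes "composable P a bs" "\<pi> permutes {..<arity P a}"
 shows "f (cmp P (perm P \<pi> a) bs) = cmp Q (perm Q \<pi> (f a)) (map f bs)"
 "f (signed K P (koszul \<pi> (map (deg P) bs)) (perm P (block_perm (map (arity P) bs) \<pi>)
 (cmp P a (map (%j. bs ! \<pi> j) [0..<length bs]))))
 = signed K Q (koszul \<pi> (map (deg Q) (map f bs)))
 (perm Q (block_perm (map (arity Q) (map f bs)) \<pi>)
 (cmp Q (f a) (map (%j. map f bs ! \<pi> j) [0..<length (map f bs)])))"
proof -
 note ra = composable_rearrange[OF assms]
 note a = composable_gr[OF assms(1)]
 have l: "\<pi> permutes {..<length (map (arity P) bs)}" using assms by (simp add: composable_def)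
 have lt: "\<pi> j < length bs" if "j < length bs" for j
 using l that permutes_in_image[of \<pi> "{..<length bs}" j] by simp
 let ?c = "cmp P a (map (%j. bs ! \<pi> j) [0..<length bs])"
 have g: "?c : gr P (tarity P bs) (deg P a + tdeg P bs)"
 by (rule P.cmp_gr'[OF ra(1)]) (simp_all only: ra(2))
 note p = block_perm_permutes[OF l]
 have "f ?c = cmp Q (f a) (map (%j. map f bs ! \<pi> j) [0..<length (map f bs)])"
 unfolding hom_cmp[OF ra(1)] map_map length_map
 by (intro arg_cong[where f = "cmp Q (f a)"] map_upt_cong) (simp add: lt)
 thus "f (signed K P (koszul \<pi> (map (deg P) bs)) (perm P (block_perm (map (arity P) bs) \<pi>) ?c))
 = signed K Q (koszul \<pi> (map (deg Q) (map f bs)))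
 (perm Q (block_perm (map (arity Q) (map f bs)) \<pi>)
 (cmp Q (f a) (map (%j. map f bs ! \<pi> j) [0..<length (map f bs)])))"
 unfolding map_hom_grade'[OF assms(1)]
 using g p by (simp add: hom_signed[OF P.perm_gr[OF g p]] hom_perm[OF g p])
 have "composable P (perm P \<pi> a) bs"
 using assms by (intro composable_cong[of P a bs, OF _ P.perm_gr[OF a]])
 thus "f (cmp P (perm P \<pi> a) bs) = cmp Q (perm Q \<pi> (f a)) (map f bs)"
 using assms by (simp add: hom_cmp hom_perm[OF a])
qed
lemma hom_equivariant_right:
 assumes "composable P a bs" "length \<tau>s = length bs"
 "!!i. i < length bs ==> (\<tau>s ! i) permutes {..<arity P (bs ! i)}"
 shows "f (cmp P a (map2 (perm P) \<tau>s bs)) = cmp Q (f a) (map2 (perm Q) \<tau>s (map f bs))"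
 "f (perm P (sum_perm (map (arity P) bs) \<tau>s) (cmp P a bs))
 = perm Q (sum_perm (map (arity Q) (map f bs)) \<tau>s) (cmp Q (f a) (map f bs))"
proof -
 note c = P.composable_map2_perm[OF assms]
 have p: "sum_perm (map (arity P) bs) \<tau>s permutes {..<tarity P bs}"
 using assms by (intro sum_perm_permutes) auto
 have m: "map f (map2 (perm P) \<tau>s bs) = map2 (perm Q) \<tau>s (map f bs)"
 using assms by (intro nth_equalityI) (auto simp: hom_perm[OF elts_gr] composable_nth)
 show "f (cmp P a (map2 (perm P) \<tau>s bs)) = cmp Q (f a) (map2 (perm Q) \<tau>s (map f bs))"
 by (simp only: hom_cmp[OF c(1)] m)
 show "f (perm P (sum_perm (map (arity P) bs) \<tau>s) (cmp P a bs))
 = perm Q (sum_perm (map (arity Q) (map f bs)) \<tau>s) (cmp Q (f a) (map f bs))"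
 by (simp only: map_hom_grade'[OF assms(1)] hom_perm[OF P.cmp_gr[OF assms(1)] p] hom_cmp[OF assms(1)])
qed
lemma law_image:
 assumes "law K P l r" shows "law K Q (f l) (f r)"
proof -
 interpret cring K by (rule cring)
 show ?thesis using assms
 proof cases
 case (comp_plus_left a bs a')
 hence "f a' : comp_of Q (f a)"
 using hom_gr[of a'] composable_gr[of a bs] by (simp add: hom_grade gr_iff)
 thus ?thesis unfolding comp_plus_left(1,2) hom_comp_plus_left[OF comp_plus_left(3,4)]
 by (intro law.comp_plus_left hom_composable comp_plus_left)
 next
 case (comp_scale_left a bs c)
 thus ?thesis unfolding comp_scale_left(1,2) hom_comp_scale_left[OF comp_scale_left(3,4)]
 by (intro law.comp_scale_left hom_composable)
 next
 case (comp_plus_right a bs i b)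
 hence "f b : gr Q (arity Q (map f bs ! i)) (deg Q (map f bs ! i))"
 using hom_gr[OF comp_plus_right(5)] by (simp add: hom_grade composable_nth)
 thus ?thesis unfolding comp_plus_right(1,2) hom_comp_plus_right[OF comp_plus_right(3-5)]
 using comp_plus_right by (intro law.comp_plus_right hom_composable) auto
 next
 case (comp_scale_right a bs i c)
 thus ?thesis
 unfolding comp_scale_right(1,2) hom_comp_scale_right[OF comp_scale_right(3-5)] hom_comp_scale_left[OF comp_scale_right(3,5)]
 by (intro law.comp_scale_right hom_composable) auto
 next
 case unit_left
 thus ?thesis using law.unit_left[of "f r" Q K] by (simp add: hom_unit_left hom_grade)
 next
 case unit_right
 thus ?thesis using law.unit_right[of "f r" Q K] by (simp add: hom_unit_right hom_grade)
 next
 case (assoc a bs css)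
 have "law K Q (cmp Q (cmp Q (f a) (map f bs)) (concat (map (map f) css)))
 (signed K Q (\<Sum>i<length (map f bs). \<Sum>j<i. deg Q (map f bs ! i) * sum_list (map (deg Q) (map (map f) css ! j)))
 (cmp Q (f a) (map2 (cmp Q) (map f bs) (map (map f) css))))"
 using assoc by (intro law.assoc) (auto simp: hom_composable)
 thus ?thesis unfolding assoc(1,2) using hom_assoc[OF assoc(3-5)] by simp
 next
 case (equivariant_left a bs \<pi>)
 hence "\<pi> permutes {..<arity Q (f a)}" by (simp add: composable_def hom_grade)
 thus ?thesis unfolding equivariant_left(1,2) hom_equivariant_left[OF equivariant_left(3,4)]
 by (intro law.equivariant_left hom_composable equivariant_left)
 next
 case (equivariant_right a bs \<tau>s)
 have "law K Q (cmp Q (f a) (map2 (perm Q) \<tau>s (map f bs)))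
 (perm Q (sum_perm (map (arity Q) (map f bs)) \<tau>s) (cmp Q (f a) (map f bs)))"
 using equivariant_right
 by (intro law.equivariant_right hom_composable) (auto simp: hom_grade composable_nth)
 thus ?thesis unfolding equivariant_right(1,2)
 using hom_equivariant_right[OF equivariant_right(3-5)] by simp
 next
 case (perm_id n d)
 thus ?thesis using law.perm_id[of "f r" Q n d K] hom_perm[of r n d id]
 by (simp add: hom_gr permutes_id)
 next
 case (perm_comp x n d \<pi> \<tau>)
 thus ?thesis using law.perm_comp[of "f x" Q n d \<pi> \<tau> K] permutes_compose[of \<tau> "{..<n}" \<pi>]
 by (simp add: hom_perm[of _ n d] P.perm_gr hom_gr)
 next
 case (perm_pls x n d y \<pi>)
 thus ?thesis using law.perm_pls[of "f x" Q n d "f y" \<pi> K]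
 by (simp add: hom_perm[of _ n d] hom_pls[of _ n d] P.perm_gr P.pls_gr hom_gr)
 next
 case (perm_scale c x n d \<pi>)
 thus ?thesis using law.perm_scale[of c K "f x" Q n d \<pi>]
 by (simp add: hom_perm[of _ n d] P.scale_gr P.perm_gr hom_gr hom_scale'[of _ _ n d])
 next
 case (pls_assoc x n d y z)
 thus ?thesis using law.pls_assoc[of "f x" Q n d "f y" "f z" K]
 by (simp add: hom_pls[of _ n d] P.pls_gr hom_gr)
 next
 case (pls_comm x n d y)
 thus ?thesis using law.pls_comm[of "f x" Q n d "f y" K]
 by (simp add: hom_pls[of _ n d] hom_gr)
 next
 case (nul_pls n d)
 thus ?thesis using law.nul_pls[of "f r" Q n d K]
 by (simp add: hom_pls[of _ n d] hom_gr)
 next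
 case (neg_pls x n d)
 thus ?thesis using law.neg_pls[of "f x" Q n d K]
 by (simp add: hom_pls[of _ n d] P.scale_gr hom_gr minus_one_K hom_scale'[of _ _ n d])
 next
 case (scale_add a b x n d)
 thus ?thesis using law.scale_add[of a K b "f x" Q n d]
 by (simp add: hom_pls[of _ n d] P.scale_gr hom_gr hom_scale'[of _ _ n d])
 next
 case (scale_pls a x n d y)
 thus ?thesis using law.scale_pls[of a K "f x" Q n d "f y"]
 by (simp add: hom_pls[of _ n d] P.pls_gr P.scale_gr hom_gr hom_scale'[of _ _ n d])
 next
 case (scale_mult a b x n d)
 thus ?thesis using law.scale_mult[of a K b "f x" Q n d]
 by (simp add: hom_gr hom_scale'[of _ _ n d] P.scale_gr)
 next
 case (scale_one n d)
 thus ?thesis using law.scale_one[of "f r" Q n d K]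
 by (simp add: hom_gr hom_scale'[of _ _ n d])
 qed
qed
lemma surj_gr:
 assumes "f ` elts P = elts Q" "y : gr Q n d" shows "\<exists>x\<in>gr P n d. y = f x"
proof -
 have "y : f ` elts P" using assms by (simp add: gr_iff)
 then obtain x where "x : elts P" "y = f x" by blast
 thus ?thesis using assms by (auto simp: gr_iff hom_grade)
qed
lemma surj_list:
 assumes "f ` elts P = elts Q" "set bs \<subseteq> elts Q" shows "\<exists>bs'. set bs' \<subseteq> elts P & bs = map f bs'"
 using assms(2)
proof (induction bs)
 case (Cons b bs)
 then obtain bs' where "set bs' \<subseteq> elts P" "bs = map f bs'" by auto
 moreover have "b : f ` elts P" using Cons assms by simp
 then obtain b' where "b' : elts P" "b = f b'" by blast
 ultimately show ?case by (intro exI[of _ "b' # bs'"]) auto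
qed simp
lemma surj_composable:
 assumes "f ` elts P = elts Q" and c: "composable Q a bs"
 shows "\<exists>a' bs'. composable P a' bs' & a = f a' & bs = map f bs'"
proof -
 obtain a' bs' where "a' : elts P" "a = f a'" "set bs' \<subseteq> elts P" "bs = map f bs'"
 using c assms(1) surj_list[of bs] unfolding composable_def by blast
 with c show ?thesis by (intro exI[of _ a'] exI[of _ bs']) (auto simp: composable_def hom_grade)
qed
lemma law_lift:
 assumes surj: "f ` elts P = elts Q" and "law K Q l r"
 shows "\<exists>l' r'. law K P l' r' & f l' = l & f r' = r"
proof -
 interpret cring K by (rule cring)
 note lift = surj_gr[OF surj] and lift_list = surj_list[OF surj] and lift_comp = surj_composable[OF surj]
 show ?thesis using assms(2)
 proof cases
 case (comp_plus_left a bs a')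
 obtain u us where u: "composable P u us" "a = f u" "bs = map f us" using lift_comp comp_plus_left(3) by blast
 hence "u : elts P" by (simp add: composable_def)
 with u obtain u' where u': "u' : comp_of P u" "a' = f u'"
 using lift comp_plus_left(4) hom_grade[of u] by metis
 show ?thesis unfolding comp_plus_left(1,2) u(2,3) u'(2)
 by (intro exI conjI, rule law.comp_plus_left[OF u(1) u'(1)]) (simp_all only: hom_comp_plus_left[OF u(1) u'(1)])
 next
 case (comp_scale_left a bs c)
 obtain u us where u: "composable P u us" "a = f u" "bs = map f us" using lift_comp comp_scale_left(3) by blast
 show ?thesis unfolding comp_scale_left(1,2) u(2,3)
 by (intro exI conjI, rule law.comp_scale_left[OF u(1) comp_scale_left(4)])
 (simp_all only: hom_comp_scale_left[OF u(1) comp_scale_left(4)])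
 next
 case (comp_plus_right a bs i b)
 obtain u us where u: "composable P u us" "a = f u" "bs = map f us" using lift_comp comp_plus_right(3) by blast
 hence i: "i < length us" using comp_plus_right by simp
 have "us ! i : elts P" by (rule composable_nth[OF u(1) i])
 with u i obtain u' where u': "u' : comp_of P (us ! i)" "b = f u'"
 using lift[of b "arity Q (bs ! i)" "deg Q (bs ! i)"] comp_plus_right(5) hom_grade[of "us ! i"] by auto
 show ?thesis unfolding comp_plus_right(1,2) u(2,3) u'(2)
 by (intro exI conjI, rule law.comp_plus_right[OF u(1) i u'(1)])
 (simp_all only: hom_comp_plus_right[OF u(1) i u'(1)])
 next
 case (comp_scale_right a bs i c)
 obtain u us where u: "composable P u us" "a = f u" "bs = map f us" using lift_comp comp_scale_right(3) by blast
 hence i: "i < length us" using comp_scale_right by simp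
 show ?thesis unfolding comp_scale_right(1,2) u(2,3)
 by (intro exI conjI, rule law.comp_scale_right[OF u(1) i comp_scale_right(5)])
 (simp_all only: hom_comp_scale_right[OF u(1) i comp_scale_right(5)] hom_comp_scale_left[OF u(1) comp_scale_right(5)])
 next
 case unit_left
 then obtain u where u: "u : elts P" "r = f u" using surj by blast
 show ?thesis unfolding unit_left(1) u(2)
 by (intro exI conjI, rule law.unit_left[OF u(1)]) (simp_all only: hom_unit_left[OF u(1)])
 next
 case unit_right
 then obtain u where u: "u : elts P" "r = f u" using surj by blast
 show ?thesis unfolding unit_right(1) u(2)
 by (intro exI conjI, rule law.unit_right[OF u(1)]) (simp_all only: hom_unit_right[OF u(1)])
 next
 case (assoc a bs css)
 obtain u us where u: "composable P u us" "a = f u" "bs = map f us" using lift_comp assoc(3) by blast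
 have len: "length css = length us" using assoc u by simp
 have "\<exists>vs. set vs \<subseteq> elts P & css ! i = map f vs" if "i < length css" for i
 using that assoc by (intro lift_list) (auto simp: composable_def)
 then obtain v where v: "!!i. i < length css ==> set (v i) \<subseteq> elts P & css ! i = map f (v i)" by metis
 let ?vs = "map v [0..<length us]"
 have css: "css = map (map f) ?vs" using v len by (intro nth_equalityI) auto
 have c: "length ?vs = length us" "composable P (us ! i) (?vs ! i)" if "i < length us" for i
 using that assoc(5)[of i] v[of i] len u(3) composable_nth[OF u(1) that] by (auto simp: composable_def hom_grade)
 have c': "length ?vs = length us" "!!i. i < length us ==> composable P (us ! i) (?vs ! i)"
 using c by simp_all
 show ?thesis unfolding assoc(1,2) unfolding css u(2,3)
 by (intro exI conjI, rule law.assoc[OF u(1) c']) (simp_all only: hom_assoc[OF u(1) c'])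
 next
 case (equivariant_left a bs \<pi>)
 obtain u us where u: "composable P u us" "a = f u" "bs = map f us" using lift_comp equivariant_left(3) by blast
 hence s: "\<pi> permutes {..<arity P u}" using equivariant_left by (simp add: composable_def hom_grade)
 show ?thesis unfolding equivariant_left(1,2) u(2,3)
 by (intro exI conjI, rule law.equivariant_left[OF u(1) s]) (simp_all only: hom_equivariant_left[OF u(1) s])
 next
 case (equivariant_right a bs \<tau>s)
 obtain u us where u: "composable P u us" "a = f u" "bs = map f us" using lift_comp equivariant_right(3) by blast
 hence c: "length \<tau>s = length us" "!!i. i < length us ==> (\<tau>s ! i) permutes {..<arity P (us ! i)}"
 using equivariant_right by (auto simp: hom_grade composable_nth)
 show ?thesis unfolding equivariant_right(1,2) u(2,3)
 by (intro exI conjI, rule law.equivariant_right[OF u(1) c]) (simp_all only: hom_equivariant_right[OF u(1) c])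
 next
 case (pls_assoc x n d y z)
 then obtain x' y' z' where *: "x' : gr P n d" "y' : gr P n d" "z' : gr P n d" "x = f x'" "y = f y'" "z = f z'"
 using lift by metis
 show ?thesis unfolding pls_assoc(1,2) *(4-6)
 by (intro exI conjI, rule law.pls_assoc[OF *(1-3)]) (simp_all add: * P.pls_gr hom_pls[of _ n d])
 next
 case (pls_comm x n d y)
 then obtain x' y' where *: "x' : gr P n d" "y' : gr P n d" "x = f x'" "y = f y'"
 using lift by metis
 show ?thesis unfolding pls_comm(1,2) *(3-4)
 by (intro exI conjI, rule law.pls_comm[OF *(1,2)]) (simp_all add: * hom_pls[of _ n d])
 next
 case (nul_pls n d)
 then obtain x' where *: "x' : gr P n d" "r = f x'" using lift by metis
 show ?thesis unfolding nul_pls(1) *(2)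
 by (intro exI conjI, rule law.nul_pls[OF *(1)]) (simp_all add: * hom_pls[of _ n d])
 next
 case (neg_pls x n d)
 then obtain x' where *: "x' : gr P n d" "x = f x'" using lift by metis
 show ?thesis unfolding neg_pls(1,2) *(2)
 by (intro exI conjI, rule law.neg_pls[OF *(1)])
 (simp_all add: * hom_pls[of _ n d] minus_one_K P.scale_gr hom_scale'[of _ _ n d])
 next
 case (scale_add a b x n d)
 then obtain x' where *: "x' : gr P n d" "x = f x'" using lift by metis
 show ?thesis unfolding scale_add(1,2) *(2)
 by (intro exI conjI, rule law.scale_add[OF scale_add(3,4) *(1)])
 (simp_all add: * scale_add(3,4) hom_pls[of _ n d] P.scale_gr hom_scale'[of _ _ n d])
 next
 case (scale_pls a x n d y)
 then obtain x' y' where *: "x' : gr P n d" "y' : gr P n d" "x = f x'" "y = f y'"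
 using lift by metis
 show ?thesis unfolding scale_pls(1,2) *(3,4)
 by (intro exI conjI, rule law.scale_pls[OF scale_pls(3) *(1,2)])
 (simp_all add: * scale_pls(3) hom_pls[of _ n d] P.pls_gr P.scale_gr hom_scale'[of _ _ n d])
 next
 case (scale_mult a b x n d)
 then obtain x' where *: "x' : gr P n d" "x = f x'" using lift by metis
 show ?thesis unfolding scale_mult(1,2) *(2)
 by (intro exI conjI, rule law.scale_mult[OF scale_mult(3,4) *(1)])
 (simp_all add: * scale_mult(3,4) P.scale_gr hom_scale'[of _ _ n d])
 next
 case (scale_one n d)
 then obtain x' where *: "x' : gr P n d" "r = f x'" using lift by metis
 show ?thesis unfolding scale_one(1) *(2)
 by (intro exI conjI, rule law.scale_one[OF *(1)]) (simp_all add: * hom_scale'[of _ _ n d])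
 next
 case (perm_id n d)
 then obtain x' where *: "x' : gr P n d" "r = f x'" using lift by metis
 show ?thesis unfolding perm_id(1) *(2)
 by (intro exI conjI, rule law.perm_id[OF *(1)]) (simp_all add: * hom_perm[of _ n d] permutes_id)
 next
 case (perm_comp x n d \<pi> \<tau>)
 then obtain x' where *: "x' : gr P n d" "x = f x'" using lift by metis
 show ?thesis unfolding perm_comp(1,2) *(2)
 by (intro exI conjI, rule law.perm_comp[OF *(1) perm_comp(4,5)])
 (simp_all add: * perm_comp(4,5) hom_perm[of _ n d] P.perm_gr permutes_compose)
 next
 case (perm_pls x n d y \<pi>)
 then obtain x' y' where *: "x' : gr P n d" "y' : gr P n d" "x = f x'" "y = f y'"
 using lift by metis
 show ?thesis unfolding perm_pls(1,2) *(3,4)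
 by (intro exI conjI, rule law.perm_pls[OF *(1,2) perm_pls(5)])
 (simp_all add: * perm_pls(5) hom_perm[of _ n d] hom_pls[of _ n d] P.perm_gr P.pls_gr)
 next
 case (perm_scale c x n d \<pi>)
 then obtain x' where *: "x' : gr P n d" "x = f x'" using lift by metis
 show ?thesis unfolding perm_scale(1,2) *(2)
 by (intro exI conjI, rule law.perm_scale[OF perm_scale(3) *(1) perm_scale(5)])
 (simp_all add: * perm_scale(3,5) hom_perm[of _ n d] P.perm_gr P.scale_gr hom_scale'[of _ _ n d])
 qed
qed

end

context operad
begin
lemma unt_gr: "unt P : gr P 1 0"
 by (simp add: gr_iff unit_closed arity_unit deg_unit)
lemma cmp_gr: "composable P a bs ==> n = tarity P bs ==>
 d = deg P a + tdeg P bs ==> cmp P a bs : gr P n d"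
 by (simp add: gr_iff comp_closed arity_comp deg_comp)
lemma sig_alg: "sig_alg K P"
 by unfold_locales (simp_all add: pls_gr scale_gr perm_gr unt_gr[simplified] cmp_gr)
lemma law_eq: assumes "law K P l r" shows "l = r"
 using assms
proof cases
 case (neg_pls x n d)
 thus ?thesis using pls_neg[of x n d] pls_comm[OF scale_gr[OF minus_one_K], of x n d x] by simp
next
 case (pls_comm x n d y)
 show ?thesis unfolding pls_comm(1,2) by (rule smodule.pls_comm[OF smodule_axioms pls_comm(3,4)])
qed (simp_all add: pls_assoc[of _ _ _ ] scale_add scale_pls scale_scale perm_id perm_comp perm_pls
 perm_scale comp_plus_left comp_scale_left comp_plus_right comp_scale_right unit_left unit_right
 assoc equivariant_left equivariant_right gr_iff same_grade_def)

end
lemma operadI_laws: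
 fixes K (structure)
 assumes "cring K" "sig_alg K P" and eq: "!!l r. law K P l r ==> l = r"
 shows "operad K P"
proof -
 interpret cring K by fact
 interpret sig_alg K P by fact
 have sm: "smodule K P"
 by (rule smoduleI[OF \<open>cring K\<close>])
 (simp_all add: pls_gr scale_gr perm_gr law.intros[THEN eq])
 show ?thesis
 by (intro operad.intro sm operad_axioms.intro)
 (use unt_gr cmp_gr in "auto simp: gr_iff same_grade_def intro!: law.intros[THEN eq]")
qed

subsection \<open>Quotients by congruences\<close>

locale op_cong = sig_alg K P for K :: "('k, 'z) ring_scheme" (structure)
 and P :: "('k, 'a, 'm) operad_scheme" +
 fixes R
 assumes cong: "op_congruence K P R" and cring: "cring K"
begin
lemma R_equiv: "equiv (elts P) R"
 using cong by (simp add: op_congruence_def)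
lemma R_elts: "(x, y) : R ==> x : elts P & y : elts P"
 using R_equiv by (auto simp: equiv_def refl_on_def)
lemma R_refl: "x : elts P ==> (x, x) : R"
 using R_equiv by (simp add: equiv_def refl_on_def)
lemma R_grade: "(x, y) : R ==> same_grade P x y"
 and R_pls: "(x, x') : R ==> (y, y') : R ==> same_grade P x y ==> (pls P x y, pls P x' y') : R"
 and R_scale: "(x, x') : R ==> c : carrier K ==> (scale P c x, scale P c x') : R"
 and R_perm: "(x, x') : R ==> \<pi> permutes {..<arity P x} ==> (perm P \<pi> x, perm P \<pi> x') : R"
 and R_cmp: "(a, a') : R ==> list_all2 (%b b'. (b, b') : R) bs bs' ==> length bs = arity P a ==>
 (cmp P a bs, cmp P a' bs') : R"
 using cong unfolding op_congruence_def by blast+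
lemma R_sym: "(x, y) : R ==> (y, x) : R"
 using R_equiv by (meson equiv_def symE)
lemma cls_eq: "x : elts P ==> y : elts P ==> R `` {x} = R `` {y} \<longleftrightarrow> (x, y) : R"
 by (rule eq_equiv_class_iff[OF R_equiv])
lemma cls_eqI: "(x, y) : R ==> R `` {x} = R `` {y}"
 by (rule equiv_class_eq[OF R_equiv])
lemma rep_cls: assumes "x : elts P" shows "(rep (R `` {x}), x) : R"
proof -
 have "rep (R `` {x}) : R `` {x}"
 unfolding rep_def by (rule someI[of _ x]) (simp add: R_refl assms)
 thus ?thesis using R_sym by auto
qed
lemma rep_grade:
 assumes "x : elts P"
 shows "arity P (rep (R `` {x})) = arity P x" "deg P (rep (R `` {x})) = deg P x" "rep (R `` {x}) : elts P"
 using R_grade[OF rep_cls[OF assms]] R_elts[OF rep_cls[OF assms]] by (simp_all add: same_grade_def)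
lemma quot_elts: "elts (quot P R) = (%x. R `` {x}) ` elts P"
 by (auto simp: quot_def quotient_def)
lemma quot_sel:
 "arity (quot P R) = arity P \<circ> rep" "deg (quot P R) = deg P \<circ> rep"
 "nul (quot P R) = (%n d. R `` {nul P n d})"
 "pls (quot P R) = (%X Y. R `` {pls P (rep X) (rep Y)})"
 "scale (quot P R) = (%c X. R `` {scale P c (rep X)})"
 "perm (quot P R) = (%\<pi> X. R `` {perm P \<pi> (rep X)})"
 "unt (quot P R) = R `` {unt P}"
 "cmp (quot P R) = (%A Bs. R `` {cmp P (rep A) (map rep Bs)})"
 by (simp_all add: quot_def)
lemma quot_hom: "operad_hom K P (quot P R) (%x. R `` {x})"
proof (rule operad_homI)
 show "smod_hom K P (quot P R) (%x. R `` {x})"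
 unfolding smod_hom_def
 proof (intro conjI ballI allI impI)
 fix x y assume xy: "x : elts P" "y : elts P" "same_grade P x y"
 hence "(pls P (rep (R `` {x})) (rep (R `` {y})), pls P x y) : R"
 by (intro R_pls rep_cls) (simp_all add: same_grade_def rep_grade)
 thus "R `` {pls P x y} = pls (quot P R) (R `` {x}) (R `` {y})"
 unfolding quot_sel by (rule cls_eqI[symmetric])
 next
 fix c x assume x: "c : carrier K" "x : elts P"
 hence "(scale P c (rep (R `` {x})), scale P c x) : R"
 by (intro R_scale rep_cls)
 thus "R `` {scale P c x} = scale (quot P R) c (R `` {x})"
 unfolding quot_sel by (rule cls_eqI[symmetric])
 next
 fix \<pi> x assume x: "x : elts P" "\<pi> permutes {..<arity P x}"
 hence "(perm P \<pi> (rep (R `` {x})), perm P \<pi> x) : R"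
 by (intro R_perm rep_cls) (simp_all add: rep_grade)
 thus "R `` {perm P \<pi> x} = perm (quot P R) \<pi> (R `` {x})"
 unfolding quot_sel by (rule cls_eqI[symmetric])
 qed (auto simp: quot_elts quot_sel rep_grade)
next
 show "R `` {unt P} = unt (quot P R)" by (simp add: quot_sel)
next
 fix a bs assume c: "composable P a bs"
 hence a: "a : elts P" and bs: "set bs \<subseteq> elts P" and len: "length bs = arity P a"
 by (auto simp: composable_def)
 have "list_all2 (%b b'. (b, b') : R) (map rep (map (%x. R `` {x}) bs)) bs"
 using bs by (auto simp: list_all2_conv_all_nth intro!: rep_cls)
 moreover have "length (map rep (map (%x. R `` {x}) bs)) = arity P (rep (R `` {a}))"
 using len a by (simp add: rep_grade)
 ultimately have "(cmp P (rep (R `` {a})) (map rep (map (%x. R `` {x}) bs)), cmp P a bs) : R"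
 by (rule R_cmp[OF rep_cls[OF a]])
 thus "R `` {cmp P a bs} = cmp (quot P R) (R `` {a}) (map (%x. R `` {x}) bs)"
 unfolding quot_sel by (rule cls_eqI[symmetric])
qed

end

text \<open>A signature algebra passes to the target of a surjection that respects the operations.\<close>

lemma sig_alg_surj_image:
 assumes "sig_alg K P" "operad_hom K P Q f" "f ` elts P = elts Q"
 and nul: "!!n d. f (nul P n d) = nul Q n d"
 shows "sig_alg K Q"
proof -
 interpret sig_alg K P by fact
 note sh = operad_hom_smod[OF assms(2)]
 have gr: "\<exists>x\<in>gr P n d. y = f x" if "y : gr Q n d" for y n d
 proof -
 have "y : f ` elts P" using that assms by (simp add: gr_iff)
 then obtain x where "x : elts P" "y = f x" by blast
 thus ?thesis using that sh by (auto simp: gr_iff smod_hom_def)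
 qed
 have list: "\<exists>bs'. set bs' \<subseteq> elts P & bs = map f bs'" if "set bs \<subseteq> elts Q" for bs
 using that
 proof (induction bs)
 case (Cons b bs)
 then obtain bs' where "set bs' \<subseteq> elts P" "bs = map f bs'" by auto
 moreover have "b : f ` elts P" using Cons assms by simp
 then obtain b' where "b' : elts P" "b = f b'" by blast
 ultimately show ?case by (intro exI[of _ "b' # bs'"]) auto
 qed simp
 show ?thesis
 proof
 show "nul Q n d : gr Q n d" for n d using smod_hom_gr[OF sh, of "nul P n d"] nul by simp
 show "pls Q x y : gr Q n d" if xy: "x : gr Q n d" "y : gr Q n d" for x y n d
 proof -
 obtain x' y' where "x' : gr P n d" "x = f x'" "y' : gr P n d" "y = f y'" using gr xy by metis
 thus ?thesis using smod_hom_pls[OF sh, of x' n d y'] smod_hom_gr[OF sh pls_gr, of x' n d y'] by simp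
 qed
 show "scale Q c x : gr Q n d" if x: "c : carrier K" "x : gr Q n d" for c x n d
 proof -
 obtain x' where "x' : gr P n d" "x = f x'" using gr x by metis
 thus ?thesis using x smod_hom_scale[OF sh, of c x'] smod_hom_gr[OF sh scale_gr, of c x' n d]
 by (simp add: gr_iff)
 qed
 show "perm Q \<pi> x : gr Q n d" if x: "x : gr Q n d" "\<pi> permutes {..<n}" for \<pi> x n d
 proof -
 obtain x' where "x' : gr P n d" "x = f x'" using gr x by metis
 thus ?thesis using x smod_hom_perm[OF sh, of x' n d \<pi>] smod_hom_gr[OF sh perm_gr, of x' n d \<pi>]
 by simp
 qed
 show "unt Q : gr Q 1 0" using smod_hom_gr[OF sh unt_gr] operad_hom_unt[OF assms(2)] by simp
 fix a bs assume c: "composable Q a bs"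
 hence "a : f ` elts P" using assms(3) by (simp add: composable_def)
 then obtain a' where a': "a' : elts P" "a = f a'" by blast
 obtain bs' where bs': "set bs' \<subseteq> elts P" "bs = map f bs'" using list[of bs] c by (auto simp: composable_def)
 have g: "arity Q (f x) = arity P x" "deg Q (f x) = deg P x" if "x : elts P" for x
 using that sh by (auto simp: smod_hom_def)
 have m: "map (arity Q) bs = map (arity P) bs'" "map (deg Q) bs = map (deg P) bs'"
 using bs' g by (auto simp: subset_iff)
 have "composable P a' bs'" using c a' bs' g by (auto simp: composable_def)
 thus "cmp Q a bs : gr Q (tarity Q bs) (deg Q a + tdeg Q bs)"
 using operad_hom_cmp[OF assms(2), of a' bs'] smod_hom_gr[OF sh cmp_gr, of a' bs'] a' bs' g
 unfolding m by simp
 qed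
qed

context op_cong
begin
lemma quot_sig_hom: "sig_hom K P (quot P R) (%x. R `` {x})"
proof -
 have "sig_alg K (quot P R)"
 by (rule sig_alg_surj_image[OF sig_alg_axioms quot_hom]) (simp_all add: quot_elts quot_sel)
 thus ?thesis
 by (intro sig_hom.intro sig_hom_axioms.intro sig_alg_axioms quot_hom cring) (auto simp: quot_sel)
qed

text \<open>The axioms of an operad are equations between expressions, so a quotient is an operad as soon as
  the congruence identifies the two sides of every instance.  This condition is stable under
  intersections; that is why the free operad, an intersection of congruences, is an operad.\<close>

lemma operad_quot_iff: "operad K (quot P R) \<longleftrightarrow> (\<forall>l r. law K P l r --> (l, r) : R)"
proof -
 interpret q: sig_hom K P "quot P R" "%x. R `` {x}" by (rule quot_sig_hom)
 show ?thesis
 proof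
 assume "operad K (quot P R)"
 thus "\<forall>l r. law K P l r --> (l, r) : R"
 using operad.law_eq q.law_image law_elts cls_eq cring by metis
 next
 assume *: "\<forall>l r. law K P l r --> (l, r) : R"
 show "operad K (quot P R)"
 proof (rule operadI_laws[OF cring q.Q.sig_alg_axioms])
 fix l r assume "law K (quot P R) l r"
 then obtain l' r' where "law K P l' r'" "l = R `` {l'}" "r = R `` {r'}"
 using q.law_lift[OF quot_elts[symmetric]] by metis
 thus "l = r" using * cls_eqI by metis
 qed
 qed
qed

end
lemma hom_factor:
 assumes "sig_hom K P Q p" and surj: "p ` elts P = elts Q" and f: "operad_hom K P T f"
 and eq: "!!x y. x : elts P ==> y : elts P ==> p x = p y ==> f x = f y"
 shows "\<exists>f'. operad_hom K Q T f' & (\<forall>x\<in>elts P. f' (p x) = f x)"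
proof -
 interpret sig_hom K P Q p by fact
 define f' where "f' y = f (SOME x. x : elts P & p x = y)" for y
 have f': "f' (p x) = f x" if "x : elts P" for x
 proof -
 have "(SOME z. z : elts P & p z = p x) : elts P & p (SOME z. z : elts P & p z = p x) = p x"
 by (rule someI[of _ x]) (use that in simp)
 thus ?thesis unfolding f'_def using that by (intro eq) blast+
 qed
 note sf = operad_hom_smod[OF f]
 have "operad_hom K Q T f'"
 proof (rule operad_homI)
 show "smod_hom K Q T f'"
 proof (rule smod_homI)
 fix n d x assume "x : gr Q n d"
 then obtain u where u: "u : gr P n d" "x = p u" using surj_gr[OF surj] by blast
 hence ue: "u : elts P" by (simp add: gr_iff)
 show "f' x : gr T n d" using u ue f' smod_hom_gr[OF sf u(1)] by simp
 { fix y assume "y : gr Q n d"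
 then obtain v where v: "v : gr P n d" "y = p v" using surj_gr[OF surj] by blast
 hence "f' (p (pls P u v)) = pls T (f u) (f v)"
 using u P.pls_gr[of u n d v] f' smod_hom_pls[OF sf, of u n d v] by (simp add: gr_iff)
 thus "f' (pls Q x y) = pls T (f' x) (f' y)"
 using u v ue f' hom_pls[of u n d v] by (simp add: gr_iff) }
 { fix c assume c: "c : carrier K"
 hence "f' (p (scale P c u)) = scale T c (f u)"
 using u ue P.scale_gr[of c u n d] f' smod_hom_scale[OF sf, of c u] by (simp add: gr_iff)
 thus "f' (scale Q c x) = scale T c (f' x)"
 using u ue f' hom_scale[OF c ue] by simp }
 { fix \<pi> assume s: "\<pi> permutes {..<n}"
 hence "f' (p (perm P \<pi> u)) = perm T \<pi> (f u)"
 using u ue P.perm_gr[of u n d \<pi>] f' smod_hom_perm[OF sf u(1) s] by (simp add: gr_iff)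
 thus "f' (perm Q \<pi> x) = perm T \<pi> (f' x)"
 using u ue f' hom_perm[OF u(1) s] by simp }
 qed
 show "f' (unt Q) = unt T"
 using f'[of "unt P"] P.unt_gr hom_unt operad_hom_unt[OF f] by (simp add: gr_iff)
 fix a bs assume "composable Q a bs"
 then obtain u us where u: "composable P u us" "a = p u" "bs = map p us"
 using surj_composable[OF surj] by blast
 hence us: "\<forall>x\<in>set us. f' (p x) = f x" "f' (p u) = f u" using f' by (auto simp: composable_def)
 have "f' (cmp Q a bs) = f (cmp P u us)"
 unfolding u(2,3) hom_cmp[OF u(1), symmetric]
 by (rule f') (use P.cmp_gr[OF u(1)] in "simp add: gr_iff")
 thus "f' (cmp Q a bs) = cmp T (f' a) (map f' bs)"
 using operad_hom_cmp[OF f u(1)] us unfolding u(2,3) by (simp add: comp_def cong: map_cong)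
 qed
 thus ?thesis using f' by blast
qed

section \<open>Composition is multilinear\<close>

context operad
begin
lemma composable_elts: "composable P a bs ==> a : elts P"
 by (simp add: composable_def)
lemma composable_gr: "composable P a bs ==> a : comp_of P a"
 by (simp add: composable_def gr_iff)
lemma nth_gr: "composable P a bs ==> i < length bs ==> bs ! i : comp_of P (bs ! i)"
 by (simp add: composable_nth gr_iff)
lemma cmp_update_gr:
 assumes c: "composable P a bs" and i: "i < length bs" and x: "x : gr P (arity P (bs ! i)) e"
 shows "cmp P a (bs[i := x]) : gr P (tarity P bs)
 (deg P a + tdeg P bs - deg P (bs ! i) + e)"
proof (rule cmp_gr)
 show "composable P a (bs[i := x])" using c x by (auto intro!: composable_update simp: gr_iff)
 show "tarity P bs = sum_list (map (arity P) (bs[i := x]))"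
 using x i by (subst map_update_eq) (auto simp: gr_iff)
 have "sum_list (map (deg P) (bs[i := x])) = tdeg P bs - deg P (bs ! i) + e"
 using i
 proof (induction bs arbitrary: i)
 case (Cons b bs)
 thus ?case using x by (cases i) (auto simp: gr_iff)
 qed simp
 thus "deg P a + tdeg P bs - deg P (bs ! i) + e
 = deg P a + sum_list (map (deg P) (bs[i := x]))" by simp
qed
lemma cmp_pls_left:
 assumes "composable P a bs" "a' : comp_of P a"
 shows "cmp P (pls P a a') bs = pls P (cmp P a bs) (cmp P a' bs)"
 using assms by (intro comp_plus_left) (auto simp: gr_iff same_grade_def)
lemma cmp_pls_right:
 assumes c: "composable P a bs" and i: "i < length bs"
 and x: "x : gr P (arity P (bs ! i)) e" and y: "y : gr P (arity P (bs ! i)) e"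
 shows "cmp P a (bs[i := pls P x y]) = pls P (cmp P a (bs[i := x])) (cmp P a (bs[i := y]))"
proof -
 have "composable P a (bs[i := x])" using c x by (auto intro!: composable_update simp: gr_iff)
 hence "cmp P a ((bs[i := x])[i := pls P (bs[i := x] ! i) y])
 = pls P (cmp P a (bs[i := x])) (cmp P a ((bs[i := x])[i := y]))"
 by (rule comp_plus_right) (use i x y in "auto simp: gr_iff same_grade_def")
 thus ?thesis using i by simp
qed
lemma cmp_scale_right:
 assumes c: "composable P a bs" and i: "i < length bs"
 and x: "x : elts P" and k: "k : carrier K"
 shows "cmp P a (bs[i := scale P k x]) = scale P k (cmp P a (bs[i := x]))"
proof -
 have "composable P a (bs[i := x])" using c x by (auto intro!: composable_update)
 hence "cmp P a ((bs[i := x])[i := scale P k (bs[i := x] ! i)]) = scale P k (cmp P a (bs[i := x]))"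
 by (rule comp_scale_right) (use i k in auto)
 thus ?thesis using i by simp
qed
lemma cmp_signed_left: "composable P a bs ==> cmp P (signed K P e a) bs = signed K P e (cmp P a bs)"
 by (simp add: signed_def comp_scale_left)
lemma cmp_signed_right: "composable P a bs ==> i < length bs ==> x : elts P ==>
 cmp P a (bs[i := signed K P e x]) = signed K P e (cmp P a (bs[i := x]))"
 by (simp add: signed_def cmp_scale_right)
lemma cmp_mns_left:
 assumes "composable P a bs" "a' : comp_of P a"
 shows "cmp P (mns K P a a') bs = mns K P (cmp P a bs) (cmp P a' bs)"
 unfolding mns_def using assms comp_scale_left[OF composable_cong[OF assms] minus_one_K]
 by (simp add: cmp_pls_left scale_gr)
lemma cmp_mns_right:
 assumes c: "composable P a bs" and i: "i < length bs"
 and x: "x : gr P (arity P (bs ! i)) e" and y: "y : gr P (arity P (bs ! i)) e"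
 shows "cmp P a (bs[i := mns K P x y]) = mns K P (cmp P a (bs[i := x])) (cmp P a (bs[i := y]))"
 unfolding mns_def cmp_pls_right[OF c i x scale_gr[OF minus_one_K y]]
 using y by (simp add: cmp_scale_right[OF c i _ minus_one_K] gr_iff)
lemma cmp_nul_left:
 assumes "set bs \<subseteq> elts P"
 shows "cmp P (nul P (length bs) d) bs = nul P (tarity P bs) (d + tdeg P bs)"
proof -
 have c: "composable P (nul P (length bs) d) bs" using assms by (simp add: composable_def)
 have "cmp P (scale P \<zero> (nul P (length bs) d)) bs = scale P \<zero> (cmp P (nul P (length bs) d) bs)"
 by (rule comp_scale_left[OF c]) simp
 also have "... = nul P (tarity P bs) (d + tdeg P bs)"
 by (rule scale_zero, rule cmp_gr[OF c]) auto
 finally show ?thesis by simp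
qed
lemma cmp_nul_left': "composable P a bs ==> cmp P (nul P (arity P a) d) bs
 = nul P (tarity P bs) (d + tdeg P bs)"
 using cmp_nul_left[of bs d] by (simp add: composable_def)
lemma cmp_nul_right:
 assumes c: "composable P a bs" and i: "i < length bs"
 shows "cmp P a (bs[i := nul P (arity P (bs ! i)) e])
 = nul P (tarity P bs) (deg P a + tdeg P bs - deg P (bs ! i) + e)"
proof -
 have "cmp P a (bs[i := scale P \<zero> (nul P (arity P (bs ! i)) e)])
 = scale P \<zero> (cmp P a (bs[i := nul P (arity P (bs ! i)) e]))"
 by (rule cmp_scale_right[OF c i]) simp_all
 also have "... = nul P (tarity P bs) (deg P a + tdeg P bs - deg P (bs ! i) + e)"
 by (rule scale_zero, rule cmp_update_gr[OF c i]) simp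
 finally show ?thesis by simp
qed
lemma cmp_lsum_left:
 assumes bs: "set bs \<subseteq> elts P" and xs: "!!x. x : set xs ==> f x : gr P (length bs) d"
 shows "cmp P (lsum P (length bs) d (map f xs)) bs
 = lsum P (tarity P bs) (d + tdeg P bs) (map (%x. cmp P (f x) bs) xs)"
 using xs
proof (induction xs)
 case Nil
 thus ?case using cmp_nul_left[OF bs] by simp
next
 case (Cons x xs)
 have c: "composable P (f x) bs" using Cons.prems[of x] bs by (simp add: composable_def gr_iff)
 have "lsum P (length bs) d (map f xs) : comp_of P (f x)"
 using Cons.prems[of x] lsum_map_gr[of xs f "length bs" d] Cons.prems by (simp add: gr_iff)
 thus ?case using Cons cmp_pls_left[OF c] by simp
qed
lemma cmp_lsum_right:
 assumes c: "composable P a bs" and i: "i < length bs"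
 and xs: "!!x. x : set xs ==> f x : gr P (arity P (bs ! i)) e"
 shows "cmp P a (bs[i := lsum P (arity P (bs ! i)) e (map f xs)])
 = lsum P (tarity P bs) (deg P a + tdeg P bs - deg P (bs ! i) + e)
 (map (%x. cmp P a (bs[i := f x])) xs)"
 using xs
proof (induction xs)
 case Nil
 thus ?case using cmp_nul_right[OF c i] by simp
next
 case (Cons x xs)
 have "lsum P (arity P (bs ! i)) e (map f xs) : gr P (arity P (bs ! i)) e"
 by (rule lsum_map_gr) (use Cons.prems in auto)
 thus ?case using Cons cmp_pls_right[OF c i, of "f x" e] by simp
qed

end

section \<open>Ideals and quotient operads\<close>

definition ideal_closed :: "('k, 'z) ring_scheme => ('k, 'a, 'm) operad_scheme => 'a set => bool" where
 "ideal_closed K P I \<longleftrightarrow> I \<subseteq> elts P & (\<forall>n d. nul P n d : I) &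
 (\<forall>x\<in>I. \<forall>y\<in>I. same_grade P x y --> pls P x y : I) &
 (\<forall>c\<in>carrier K. \<forall>x\<in>I. scale P c x : I) &
 (\<forall>x\<in>I. \<forall>\<pi>. \<pi> permutes {..<arity P x} --> perm P \<pi> x : I) &
 (\<forall>a\<in>I. \<forall>bs. composable P a bs --> cmp P a bs : I) &
 (\<forall>a bs. \<forall>b\<in>I. b : set bs --> composable P a bs --> cmp P a bs : I)"
lemma (in operad) op_ideal_elts: assumes "S \<subseteq> elts P" "x : op_ideal K P S" shows "x : elts P"
 using assms(2)
proof (induction rule: op_ideal.induct)
 case (generator x)
 thus ?case using assms by auto
next
 case (plus x y)
 thus ?case using pls_gr[OF elts_gr, of x y] by (simp add: gr_iff same_grade_def)
next
 case (scale x c)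
 thus ?case using scale_gr[OF _ elts_gr, of c x] by (simp add: gr_iff)
next
 case (perm x \<pi>)
 thus ?case using perm_gr[OF elts_gr, of x \<pi>] by (simp add: gr_iff)
qed (simp_all add: comp_closed)
lemma (in operad) op_ideal_closed: "S \<subseteq> elts P ==> ideal_closed K P (op_ideal K P S)"
 unfolding ideal_closed_def using op_ideal_elts by (auto intro: op_ideal.intros)
lemma op_ideal_least:
 assumes "ideal_closed K P I" "S \<subseteq> I" shows "op_ideal K P S \<subseteq> I"
proof
 fix x assume "x : op_ideal K P S"
 thus "x : I"
 by (induction rule: op_ideal.induct) (use assms in "unfold ideal_closed_def, blast+")
qed

locale operad_ideal = operad K P for K :: "('k, 'z) ring_scheme" (structure)
 and P :: "('k, 'a, 'm) operad_scheme" +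
 fixes I
 assumes ideal: "ideal_closed K P I"
begin
lemma I_elts: "x : I ==> x : elts P"
 and I_nul: "nul P n d : I"
 and I_pls: "x : I ==> y : I ==> same_grade P x y ==> pls P x y : I"
 and I_scale: "c : carrier K ==> x : I ==> scale P c x : I"
 and I_perm: "x : I ==> \<pi> permutes {..<arity P x} ==> perm P \<pi> x : I"
 and I_cmp_left: "a : I ==> composable P a bs ==> cmp P a bs : I"
 and I_cmp_right: "b : I ==> b : set bs ==> composable P a bs ==> cmp P a bs : I"
 using ideal unfolding ideal_closed_def by blast+
abbreviation "R \<equiv> ideal_rel K P I"
lemma R_iff: "(x, y) : R \<longleftrightarrow> x : elts P & y : comp_of P x & mns K P x y : I"
 by (auto simp: ideal_rel_def same_grade_def gr_iff)
lemma R_trans: assumes "(x, y) : R" "(y, z) : R" shows "(x, z) : R"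
proof -
 have x: "x : comp_of P x" and y: "y : comp_of P x" and z: "z : comp_of P x"
 using assms by (auto simp: R_iff gr_iff)
 have "same_grade P (mns K P x y) (mns K P y z)"
 using mns_gr[OF x y] mns_gr[OF y z] by (simp add: gr_iff same_grade_def)
 hence "pls P (mns K P x y) (mns K P y z) : I" using assms by (intro I_pls) (simp_all add: R_iff)
 thus ?thesis using x z mns_mns[OF x y z] by (simp add: R_iff gr_iff)
qed
lemma ideal_rel_congruence: "op_congruence K P R"
 unfolding op_congruence_def
proof (intro conjI)
 have sym: "(y, x) : R" if "(x, y) : R" for x y
 proof -
 have x: "x : comp_of P x" and y: "y : comp_of P x" and m: "mns K P x y : I"
 using that by (auto simp: R_iff gr_iff)
 have "scale P (\<ominus> \<one>) (mns K P x y) = pls P (scale P (\<ominus> \<one>) x) (scale P (\<ominus> \<one>) (scale P (\<ominus> \<one>) y))"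
 unfolding mns_def by (rule scale_pls[OF minus_one_K x scale_gr[OF minus_one_K y]])
 also have "... = mns K P y x"
 unfolding mns_def using y pls_comm[OF scale_gr[OF minus_one_K x] y] by (simp add: gr_iff)
 finally show ?thesis using I_scale[OF minus_one_K m] x y by (simp add: R_iff gr_iff)
 qed
 have refl: "(x, x) : R" if "x : elts P" for x
 using that mns_self[OF elts_gr[OF that]] by (simp add: R_iff I_nul gr_iff)
 show "equiv (elts P) R"
 proof (rule equivI)
 show "R \<subseteq> elts P \<times> elts P" by (auto simp: ideal_rel_def)
 show "refl_on (elts P) R" by (rule refl_onI) (rule refl)
 show "sym R" by (rule symI) (rule sym)
 show "trans R" by (rule transI) (rule R_trans)
 qed
 show "\<forall>(x, x')\<in>R. same_grade P x x'" by (auto simp: ideal_rel_def)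
 show "\<forall>(x, x')\<in>R. \<forall>(y, y')\<in>R. same_grade P x y --> (pls P x y, pls P x' y') : R"
 proof clarify
 fix x x' y y' assume R: "(x, x') : R" "(y, y') : R" "same_grade P x y"
 let ?n = "arity P x" and ?d = "deg P x"
 have g: "x : gr P ?n ?d" "x' : gr P ?n ?d" "y : gr P ?n ?d" "y' : gr P ?n ?d"
 using R by (auto simp: R_iff gr_iff same_grade_def)
 have "pls P (mns K P x x') (mns K P y y') : I"
 using R mns_gr[OF g(1,2)] mns_gr[OF g(3,4)] by (intro I_pls) (auto simp: R_iff gr_iff same_grade_def)
 thus "(pls P x y, pls P x' y') : R"
 using mns_pls[OF g(1,3,2,4)] pls_gr[OF g(1,3)] pls_gr[OF g(2,4)] by (simp add: R_iff gr_iff)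
 qed
 show "\<forall>(x, x')\<in>R. \<forall>c\<in>carrier K. (scale P c x, scale P c x') : R"
 proof clarify
 fix x x' c assume R: "(x, x') : R" and c: "c : carrier K"
 have g: "x : comp_of P x" "x' : comp_of P x"
 using R by (auto simp: R_iff gr_iff)
 show "(scale P c x, scale P c x') : R"
 using R c mns_scale[OF g c] scale_gr[OF c g(1)] scale_gr[OF c g(2)] by (simp add: R_iff gr_iff I_scale)
 qed
 show "\<forall>(x, x')\<in>R. \<forall>\<pi>. \<pi> permutes {..<arity P x} --> (perm P \<pi> x, perm P \<pi> x') : R"
 proof clarify
 fix x x' \<pi> assume R: "(x, x') : R" and s: "\<pi> permutes {..<arity P x}"
 have g: "x : comp_of P x" "x' : comp_of P x"
 using R by (auto simp: R_iff gr_iff)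
 have "perm P \<pi> (mns K P x x') : I"
 using R s mns_gr[OF g] by (intro I_perm) (auto simp: R_iff gr_iff)
 thus "(perm P \<pi> x, perm P \<pi> x') : R"
 using mns_perm[OF g s] perm_gr[OF g(1) s] perm_gr[OF g(2) s] by (simp add: R_iff gr_iff)
 qed
 have left: "(cmp P a bs, cmp P a' bs) : R" if R: "(a, a') : R" and c: "composable P a bs" for a a' bs
 proof -
 have a': "a' : comp_of P a" and a: "a : comp_of P a"
 using R by (auto simp: R_iff gr_iff)
 have c': "composable P a' bs" "composable P (mns K P a a') bs"
 by (rule composable_cong[OF c a'], rule composable_cong[OF c mns_gr[OF a a']])
 have "mns K P (cmp P a bs) (cmp P a' bs) : I"
 using I_cmp_left[OF _ c'(2)] R cmp_mns_left[OF c a'] by (simp add: R_iff)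
 thus ?thesis using c c' a' by (simp add: R_iff gr_iff comp_closed arity_comp deg_comp)
 qed
 have right1: "(cmp P a bs, cmp P a (bs[i := b])) : R"
 if c: "composable P a bs" and i: "i < length bs" and R: "(bs ! i, b) : R" for a bs b i
 proof -
 have b: "b : comp_of P (bs ! i)" using R by (simp add: R_iff)
 have c': "composable P a (bs[i := mns K P (bs ! i) b])" "composable P a (bs[i := b])"
 using mns_gr[OF nth_gr[OF c i] b] b c by (auto intro!: composable_update simp: gr_iff)
 have "cmp P a (bs[i := mns K P (bs ! i) b]) : I"
 using R i c' by (intro I_cmp_right[of "mns K P (bs ! i) b"]) (auto simp: R_iff set_update_memI)
 hence "mns K P (cmp P a bs) (cmp P a (bs[i := b])) : I"
 using cmp_mns_right[OF c i nth_gr[OF c i] b] by simp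
 moreover have "cmp P a (bs[i := b]) : gr P (arity P (cmp P a bs)) (deg P (cmp P a bs))"
 using cmp_update_gr[OF c i b] c by (simp add: arity_comp deg_comp)
 ultimately show ?thesis using comp_closed[OF c] by (simp add: R_iff)
 qed
 have right: "(cmp P a (xs @ bs), cmp P a (xs @ bs')) : R"
 if "list_all2 (%b b'. (b, b') : R) bs bs'" "composable P a (xs @ bs)" for a xs bs bs'
 using that
 proof (induction bs bs' arbitrary: xs rule: list_all2_induct)
 case Nil
 thus ?case using refl comp_closed by simp
 next
 case (Cons b bs b' bs')
 have "(cmp P a (xs @ b # bs), cmp P a (xs @ b' # bs)) : R"
 using right1[OF Cons.prems, of "length xs" b'] Cons.hyps(1) by (simp add: list_update_append)
 moreover have "composable P a ((xs @ [b']) @ bs)"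
 using Cons.prems Cons.hyps(1) by (auto simp: composable_def R_iff gr_iff)
 hence "(cmp P a (xs @ b' # bs), cmp P a (xs @ b' # bs')) : R"
 using Cons.IH[of "xs @ [b']"] by simp
 ultimately show ?case by (rule R_trans)
 qed
 show "\<forall>(a, a')\<in>R. \<forall>bs bs'. list_all2 (%b b'. (b, b') : R) bs bs' --> length bs = arity P a -->
 (cmp P a bs, cmp P a' bs') : R"
 proof clarify
 fix a a' bs bs' assume R: "(a, a') : R" and l: "list_all2 (%b b'. (b, b') : R) bs bs'"
 and len: "length bs = arity P a"
 have "!!b. b : set bs ==> b : elts P"
 using l by (auto simp: list_all2_conv_all_nth in_set_conv_nth R_iff)
 hence c: "composable P a bs" using R len by (auto simp: composable_def R_iff)
 hence c': "composable P a' ([] @ bs)" using R by (auto simp: R_iff intro!: composable_cong[OF c])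
 show "(cmp P a bs, cmp P a' bs') : R"
 using R_trans[OF left[OF R c]] right[OF l c'] by simp
 qed
qed
sublocale op_cong K P R
 by (intro op_cong.intro op_cong_axioms.intro sig_alg ideal_rel_congruence cring_K)
lemma operad_quot: "operad K (quot P R)"
 using operad_quot_iff law_eq law_elts R_refl cring_K by metis
lemma cls_nul_iff: assumes "x : gr P n d" shows "R `` {x} = nul (quot P R) n d \<longleftrightarrow> x : I"
proof -
 have "R `` {x} = R `` {nul P n d} \<longleftrightarrow> (x, nul P n d) : R"
 using assms by (intro cls_eq) (auto simp: gr_iff)
 also have "... \<longleftrightarrow> mns K P x (nul P n d) : I" using assms by (auto simp: R_iff gr_iff)
 also have "mns K P x (nul P n d) = x" using assms by (simp add: mns_def)
 finally show ?thesis by (simp add: quot_sel)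
qed

end
lemma operad_hom_sig_hom:
 assumes "operad K P" "operad K Q" "operad_hom K P Q f" shows "sig_hom K P Q f"
proof -
 interpret P: operad K P by fact
 interpret Q: operad K Q by fact
 interpret smodule_hom K P Q f
 by (intro smodule_hom.intro smodule_hom_axioms.intro P.smodule_axioms Q.smodule_axioms
 operad_hom_smod assms)
 show ?thesis
 by (intro sig_hom.intro sig_hom_axioms.intro P.sig_alg Q.sig_alg P.cring_K assms) simp
qed

locale op_hom = P: operad K P + Q: operad K Q
 for K :: "('k, 'z) ring_scheme" (structure) and P :: "('k, 'a, 'm) operad_scheme"
 and Q :: "('k, 'b, 'n) operad_scheme" and f +
 assumes op_hom: "operad_hom K P Q f"
sublocale op_hom \<subseteq> sig_hom K P Q f
 by (rule operad_hom_sig_hom[OF P.operad_axioms Q.operad_axioms op_hom])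
sublocale op_hom \<subseteq> sm: smodule_hom K P Q f
 by (intro smodule_hom.intro smodule_hom_axioms.intro P.smodule_axioms Q.smodule_axioms shom)
lemma op_homI: "operad K P ==> operad K Q ==> operad_hom K P Q f ==> op_hom K P Q f"
 by (simp add: op_hom_def op_hom_axioms_def)
lemma operad_hom_cong:
 assumes "operad_hom K P Q f" "operad K P" "!!x. x : elts P ==> g x = f x"
 shows "operad_hom K P Q g"
proof (rule operad_homI)
 interpret operad K P by fact
 show "smod_hom K P Q g"
 by (rule smod_hom_cong[OF operad_hom_smod[OF assms(1)] smodule_axioms assms(3)])
 show "g (unt P) = unt Q" using assms unit_closed by (simp add: operad_hom_def)
 fix a bs assume c: "composable P a bs"
 hence "map g bs = map f bs" "g a = f a" using assms(3) by (auto simp: composable_def subset_iff)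
 thus "g (cmp P a bs) = cmp Q (g a) (map g bs)"
 by (simp only: operad_hom_cmp[OF assms(1) c] assms(3)[OF comp_closed[OF c]])
qed
lemma (in op_hom) kernel_ideal:
 "ideal_closed K P {x : elts P. f x = nul Q (arity P x) (deg P x)}"
proof -
 have cl: "x : gr P n d ==> y : gr P n d ==> pls P x y : gr P n d"
 "c : carrier K ==> x : gr P n d ==> scale P c x : gr P n d"
 "\<pi> permutes {..<n} ==> x : gr P n d ==> perm P \<pi> x : gr P n d" for x y n d c \<pi>
 by (simp_all add: P.pls_gr P.scale_gr P.perm_gr)
 show ?thesis unfolding ideal_closed_def
 proof (intro conjI ballI allI impI)
 fix x y assume a: "x : {x : elts P. f x = nul Q (arity P x) (deg P x)}"
 "y : {x : elts P. f x = nul Q (arity P x) (deg P x)}" "same_grade P x y"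
 hence "x : comp_of P x" "y : comp_of P x"
 by (auto simp: gr_iff same_grade_def)
 from cl(1)[OF this] hom_pls[OF this] show "pls P x y : {x : elts P. f x = nul Q (arity P x) (deg P x)}"
 using a Q.nul_pls[OF Q.nul_gr] by (simp add: gr_iff same_grade_def)
 next
 fix c x assume a: "c : carrier K" "x : {x : elts P. f x = nul Q (arity P x) (deg P x)}"
 thus "scale P c x : {x : elts P. f x = nul Q (arity P x) (deg P x)}"
 using cl(2)[of c x "arity P x" "deg P x"] by (simp add: gr_iff hom_scale)
 next
 fix \<pi> x assume a: "x : {x : elts P. f x = nul Q (arity P x) (deg P x)}" "\<pi> permutes {..<arity P x}"
 thus "perm P \<pi> x : {x : elts P. f x = nul Q (arity P x) (deg P x)}"
 using cl(3)[of \<pi> "arity P x" x "deg P x"] hom_perm[of x "arity P x" "deg P x" \<pi>] by (simp add: gr_iff)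
 next
 fix a bs assume a: "a : {x : elts P. f x = nul Q (arity P x) (deg P x)}" and c: "composable P a bs"
 have "f (cmp P a bs) = nul Q (tarity P bs) (deg P a + tdeg P bs)"
 using a hom_cmp[OF c] Q.cmp_nul_left'[OF hom_composable[OF c], of "deg P a"]
 by (simp del: map_map add: map_hom_grade'[OF c] hom_grade)
 thus "cmp P a bs : {x : elts P. f x = nul Q (arity P x) (deg P x)}"
 using c by (simp add: P.comp_closed P.arity_comp P.deg_comp)
 next
 fix a bs b assume b: "b : {x : elts P. f x = nul Q (arity P x) (deg P x)}" "b : set bs"
 and c: "composable P a bs"
 then obtain i where i: "i < length bs" "b = bs ! i" by (auto simp: in_set_conv_nth)
 hence u: "(map f bs)[i := nul Q (arity Q (map f bs ! i)) (deg Q (map f bs ! i))] = map f bs"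
 using b by (simp add: hom_grade list_update_same_conv)
 have "f (cmp P a bs) = cmp Q (f a) ((map f bs)[i := nul Q (arity Q (map f bs ! i)) (deg Q (map f bs ! i))])"
 by (simp only: hom_cmp[OF c] u)
 also have "... = nul Q (tarity P bs) (deg P a + tdeg P bs)"
 using Q.cmp_nul_right[OF hom_composable[OF c], of i] i
 by (simp del: map_map add: map_hom_grade'[OF c] hom_grade composable_nth[OF c] P.composable_elts[OF c])
 finally show "cmp P a bs : {x : elts P. f x = nul Q (arity P x) (deg P x)}"
 using c by (simp add: P.comp_closed P.arity_comp P.deg_comp)
 qed auto
qed
lemma (in op_hom) hom_eq_iff:
 assumes "x : gr P n d" "y : gr P n d" shows "f x = f y \<longleftrightarrow> f (mns K P x y) = nul Q n d"
 using sm.hom_mns[OF assms] Q.mns_eq_nul_iff[OF hom_gr[OF assms(1)] hom_gr[OF assms(2)]] by simp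

locale quotient_operad = operad K P for K :: "('k, 'z) ring_scheme" (structure)
 and P :: "('k, 'a, 'm) operad_scheme" +
 fixes S
 assumes S_elts: "S \<subseteq> elts P"
begin
sublocale i: operad_ideal K P "op_ideal K P S"
 by (intro operad_ideal.intro operad_ideal_axioms.intro operad_axioms op_ideal_closed S_elts)
lemma operad_quotient: "operad K (quotient_op K P S)"
 unfolding quotient_op_def by (rule i.operad_quot)
lemma proj_hom: "operad_hom K P (quotient_op K P S) (quotient_proj K P S)"
 using i.quot_hom unfolding quotient_op_def quotient_proj_def[abs_def] .
lemma proj_surj: "quotient_proj K P S ` elts P = elts (quotient_op K P S)"
 unfolding quotient_op_def quotient_proj_def[abs_def] by (simp add: i.quot_elts)
sublocale p: op_hom K P "quotient_op K P S" "quotient_proj K P S"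
 by (rule op_homI[OF operad_axioms operad_quotient proj_hom])
lemma proj_nul_iff:
 "x : gr P n d ==> quotient_proj K P S x = nul (quotient_op K P S) n d \<longleftrightarrow> x : op_ideal K P S"
 unfolding quotient_op_def quotient_proj_def by (rule i.cls_nul_iff)
lemma proj_nul: "x : S ==> quotient_proj K P S x = nul (quotient_op K P S) (arity P x) (deg P x)"
 using proj_nul_iff[OF elts_gr, of x] S_elts by (auto intro: op_ideal.generator)
lemma proj_eq:
 assumes "mns K P x y : S" "x : gr P n d" "y : gr P n d"
 shows "quotient_proj K P S x = quotient_proj K P S y"
 using p.hom_eq_iff[OF assms(2,3)] proj_nul[OF assms(1)] mns_gr[OF assms(2,3)] by (simp add: gr_iff)
lemma quotient_factor:
 assumes "operad K T" "operad_hom K P T f" and S: "!!x. x : S ==> f x = nul T (arity P x) (deg P x)"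
 shows "\<exists>f'. operad_hom K (quotient_op K P S) T f' & (\<forall>x\<in>elts P. f' (quotient_proj K P S x) = f x)"
proof (rule hom_factor[OF p.sig_hom_axioms proj_surj assms(2)])
 interpret f: op_hom K P T f by (rule op_homI[OF operad_axioms assms(1,2)])
 have ker: "op_ideal K P S \<subseteq> {x : elts P. f x = nul T (arity P x) (deg P x)}"
 by (rule op_ideal_least[OF f.kernel_ideal]) (use S S_elts in auto)
 fix x y assume xy: "x : elts P" "y : elts P" "quotient_proj K P S x = quotient_proj K P S y"
 hence g: "x : comp_of P x" "y : comp_of P x"
 using p.hom_grade[of x] p.hom_grade[of y] by (auto simp: gr_iff)
 have "mns K P x y : op_ideal K P S"
 using p.hom_eq_iff[OF g] xy proj_nul_iff[OF mns_gr[OF g]] by simp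
 thus "f x = f y" using ker f.hom_eq_iff[OF g] mns_gr[OF g] by (auto simp: gr_iff)
qed

end

section \<open>Generation\<close>

inductive_set opspan :: "('k, 'z) ring_scheme => ('k, 'a, 'm) operad_scheme => 'a set => 'a set"
 for K and P and X where
 gen: "x : X ==> x : opspan K P X"
| unt: "unt P : opspan K P X"
| nul: "nul P n d : opspan K P X"
| pls: "[|x : opspan K P X; y : opspan K P X; same_grade P x y|] ==> pls P x y : opspan K P X"
| scale: "[|x : opspan K P X; c : carrier K|] ==> scale P c x : opspan K P X"
| perm: "[|x : opspan K P X; \<pi> permutes {..<arity P x}|] ==> perm P \<pi> x : opspan K P X"
| cmp: "[|a : opspan K P X; \<forall>b\<in>set bs. b : opspan K P X; length bs = arity P a|] ==>
 cmp P a bs : opspan K P X"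
lemma (in operad) opspan_elts: assumes "X \<subseteq> elts P" shows "opspan K P X \<subseteq> elts P"
proof
 fix x assume "x : opspan K P X"
 thus "x : elts P"
 proof (induction rule: opspan.induct)
 case (gen x)
 thus ?case using assms by auto
 next
 case (pls x y)
 thus ?case using pls_gr[OF elts_gr, of x y] by (simp add: gr_iff same_grade_def)
 next
 case (scale x c)
 thus ?case using scale_gr[OF _ elts_gr, of c x] by (simp add: gr_iff)
 next
 case (perm x \<pi>)
 thus ?case using perm_gr[OF elts_gr, of x \<pi>] by (simp add: gr_iff)
 next
 case (cmp a bs)
 thus ?case by (intro comp_closed) (auto simp: composable_def)
 qed (simp_all add: unit_closed)
qed

text \<open>A proof principle for properties of the elements of an operad with given generators, in which
  all arguments are known to lie in the operad.\<close>

lemma (in operad) opspan_induct [consumes 2, case_names gen unt nul pls scale perm cmp]: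
 assumes "x : opspan K P X" and X: "X \<subseteq> elts P"
 and "!!x. x : X ==> Pr x" "Pr (unt P)" "!!n d. Pr (nul P n d)"
 and "!!n d x y. [|x : gr P n d; y : gr P n d; Pr x; Pr y|] ==> Pr (pls P x y)"
 and "!!c x. [|c : carrier K; x : elts P; Pr x|] ==> Pr (scale P c x)"
 and "!!\<pi> x. [|x : elts P; \<pi> permutes {..<arity P x}; Pr x|] ==> Pr (perm P \<pi> x)"
 and "!!a bs. [|composable P a bs; Pr a; !!b. b : set bs ==> Pr b|] ==> Pr (cmp P a bs)"
 shows "Pr x"
proof -
 have e: "y : elts P" if "y : opspan K P X" for y using opspan_elts[OF X] that by blast
 show ?thesis using assms(1)
 proof (induction rule: opspan.induct)
 case (pls x y)
 thus ?case using e
 by (intro assms(6)[of x "arity P x" "deg P x" y]) (auto simp: gr_iff same_grade_def)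
 next
 case (cmp a bs)
 thus ?case using e by (intro assms(9)) (auto simp: composable_def)
 qed (use assms e in auto)
qed
lemma (in op_hom) hom_opspan:
 assumes X: "X \<subseteq> elts P" shows "f ` opspan K P X \<subseteq> opspan K Q (f ` X)"
proof (rule image_subsetI)
 fix x assume "x : opspan K P X"
 thus "f x : opspan K Q (f ` X)" using X
 proof (induction rule: P.opspan_induct)
 case (pls n d x y)
 thus ?case using hom_gr[OF pls(1)] hom_gr[OF pls(2)]
 by (auto simp: hom_pls[OF pls(1,2)] gr_iff same_grade_def intro!: opspan.pls)
 next
 case (perm \<pi> x)
 thus ?case using hom_perm[OF elts_gr[OF perm(1)] perm(2)] by (auto intro!: opspan.perm simp: hom_grade)
 next
 case (cmp a bs)
 thus ?case using hom_composable[OF cmp(1)]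
 by (auto simp: hom_cmp[OF cmp(1)] composable_def intro!: opspan.cmp)
 qed (auto simp: hom_unt hom_scale intro: opspan.intros)
qed
lemma hom_eq_on_opspan:
 assumes "op_hom K P Q f" "op_hom K P Q g" "X \<subseteq> elts P" "!!x. x : X ==> f x = g x"
 and "x : opspan K P X"
 shows "f x = g x"
proof -
 interpret f: op_hom K P Q f by fact
 interpret g: op_hom K P Q g by fact
 show ?thesis using assms(5,3)
 proof (induction rule: f.P.opspan_induct)
 case (pls n d x y)
 thus ?case by (simp add: f.hom_pls[OF pls(1,2)] g.hom_pls[OF pls(1,2)])
 next
 case (perm \<pi> x)
 thus ?case using f.hom_perm[OF elts_gr[OF perm(1)] perm(2)] g.hom_perm[OF elts_gr[OF perm(1)] perm(2)] by simp
 next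
 case (cmp a bs)
 thus ?case by (simp add: f.hom_cmp g.hom_cmp cong: map_cong)
 qed (use assms(4) in "simp_all add: f.hom_unt g.hom_unt f.hom_scale g.hom_scale")
qed

text \<open>The image of an operad morphism contains everything that its values generate.\<close>

lemma (in op_hom) opspan_image:
 assumes "Y \<subseteq> f ` elts P" shows "opspan K Q Y \<subseteq> f ` elts P"
proof
 fix y assume "y : opspan K Q Y"
 thus "y : f ` elts P"
 proof (induction rule: opspan.induct)
 case (gen x)
 thus ?case using assms by auto
 next
 case unt
 show ?case using hom_unt P.unit_closed by (metis imageI)
 next
 case (nul n d)
 show ?case using hom_nul P.nul_elts by (metis imageI)
 next
 case (pls x y)
 then obtain u v where u: "u : elts P" "x = f u" "v : elts P" "y = f v" by blast
 hence g: "u : comp_of P u" "v : comp_of P u"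
 using pls by (auto simp: gr_iff same_grade_def hom_grade)
 thus ?case using hom_pls[OF g] u P.pls_gr[OF g] by (auto simp: gr_iff intro!: image_eqI[of _ _ "pls P u v"])
 next
 case (scale x c)
 then obtain u where u: "u : elts P" "x = f u" by blast
 thus ?case using hom_scale[of c u] scale P.scale_gr[OF _ elts_gr, of c u]
 by (auto simp: gr_iff intro!: image_eqI[of _ _ "scale P c u"])
 next
 case (perm x \<pi>)
 then obtain u where u: "u : elts P" "x = f u" by blast
 hence s: "\<pi> permutes {..<arity P u}" using perm by (simp add: hom_grade)
 thus ?case using hom_perm[OF elts_gr s] u P.perm_gr[OF elts_gr s]
 by (auto simp: gr_iff intro!: image_eqI[of _ _ "perm P \<pi> u"])
 next
 case (cmp a bs)
 then obtain u where u: "u : elts P" "a = f u" by blast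
 have "\<forall>b\<in>set bs. b : f ` elts P" using cmp by blast
 hence "\<exists>vs. set vs \<subseteq> elts P & bs = map f vs"
 proof (induction bs)
 case (Cons b bs)
 then obtain vs v where "set vs \<subseteq> elts P" "bs = map f vs" "v : elts P" "b = f v" by auto
 thus ?case by (intro exI[of _ "v # vs"]) auto
 qed simp
 then obtain vs where vs: "set vs \<subseteq> elts P" "bs = map f vs" by blast
 hence c: "composable P u vs" using u cmp by (simp add: composable_def hom_grade)
 thus ?case using u vs hom_cmp[OF c] P.comp_closed[OF c] by (auto intro!: image_eqI[of _ _ "cmp P u vs"])
 qed
qed

section \<open>Free operads\<close>

lemma tm_alg_sel [simp]:
 "elts (tm_alg K M) = tms K M" "arity (tm_alg K M) = tm_arity M" "deg (tm_alg K M) = tm_deg M"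
 "nul (tm_alg K M) = Nul" "pls (tm_alg K M) = Plus" "scale (tm_alg K M) = Scale"
 "perm (tm_alg K M) = Perm" "unt (tm_alg K M) = Unit" "cmp (tm_alg K M) = Comp"
 by (simp_all add: tm_alg_def)
lemma sig_alg_tm_alg: "sig_alg K (tm_alg K M)"
 by unfold_locales (auto simp: gr_iff composable_def intro!: tms.intros)

primrec tm_eval :: "('k, 'b, 'n) operad_scheme => ('a => 'b) => ('k, 'a) tm => 'b" where
 "tm_eval P f (Gen x) = f x"
| "tm_eval P f Unit = unt P"
| "tm_eval P f (Nul n d) = nul P n d"
| "tm_eval P f (Plus t u) = pls P (tm_eval P f t) (tm_eval P f u)"
| "tm_eval P f (Scale c t) = scale P c (tm_eval P f t)"
| "tm_eval P f (Perm \<pi> t) = perm P \<pi> (tm_eval P f t)"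
| "tm_eval P f (Comp t us) = cmp P (tm_eval P f t) (map (tm_eval P f) us)"
lemma tm_eval_gr:
 assumes "operad K P" "smod_hom K M P f" "t : tms K M"
 shows "tm_eval P f t : gr P (tm_arity M t) (tm_deg M t)"
proof -
 interpret operad K P by fact
 show ?thesis using assms(3)
 proof (induction rule: tms.induct)
 case (1 x)
 thus ?case using smod_hom_gr[OF assms(2) elts_gr] by simp
 next
 case (7 t us)
 hence u: "\<forall>u\<in>set us. tm_eval P f u : gr P (tm_arity M u) (tm_deg M u)" by blast
 hence "map (arity P) (map (tm_eval P f) us) = map (tm_arity M) us"
 "map (deg P) (map (tm_eval P f) us) = map (tm_deg M) us"
 by (auto simp: gr_iff)
 moreover have "composable P (tm_eval P f t) (map (tm_eval P f) us)"
 using 7 u by (auto simp: composable_def gr_iff)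
 ultimately show ?case using 7 by (simp del: map_map add: cmp_gr gr_iff[of "tm_eval P f t"])
 qed (auto simp: unt_gr[simplified] pls_gr scale_gr perm_gr)
qed
lemma tm_eval_sig_hom:
 assumes "operad K P" "smod_hom K M P f"
 shows "sig_hom K (tm_alg K M) P (tm_eval P f)"
proof -
 interpret operad K P by fact
 have "operad_hom K (tm_alg K M) P (tm_eval P f)"
 by (rule operad_homI, rule smod_homI) (use tm_eval_gr[OF assms] in "auto simp: gr_iff")
 thus ?thesis
 by (intro sig_hom.intro sig_hom_axioms.intro sig_alg_tm_alg sig_alg cring_K) simp_all
qed

text \<open>The equations that make the generators a map of Sigma-modules.\<close>

inductive gen_law :: "('k, 'z) ring_scheme => ('k, 'a, 'm) smod_scheme => ('k, 'a) tm => ('k, 'a) tm => bool"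
 for K and M where
 pls: "[|x : gr M n d; y : gr M n d|] ==> gen_law K M (Gen (pls M x y)) (Plus (Gen x) (Gen y))"
| scale: "[|c : carrier K; x : gr M n d|] ==> gen_law K M (Gen (scale M c x)) (Scale c (Gen x))"
| perm: "[|x : gr M n d; \<pi> permutes {..<n}|] ==> gen_law K M (Gen (perm M \<pi> x)) (Perm \<pi> (Gen x))"
lemma gen_smod_hom_iff:
 assumes "smodule K M" "op_congruence K (tm_alg K M) R"
 shows "smod_hom K M (quot (tm_alg K M) R) (%x. R `` {Gen x}) \<longleftrightarrow> (\<forall>l r. gen_law K M l r --> (l, r) : R)"
proof -
 interpret M: smodule K M by fact
 interpret op_cong K "tm_alg K M" R
 by (intro op_cong.intro op_cong_axioms.intro sig_alg_tm_alg assms M.cring_K)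
 note h = operad_hom_smod[OF quot_hom]
 have g: "Gen x : gr (tm_alg K M) n d" if "x : gr M n d" for x n d
 using that by (auto simp: gr_iff intro: tms.intros)
 have e: "t : gr (tm_alg K M) n d ==> t : elts (tm_alg K M)" for t n d by (simp add: gr_iff)
 note cl = M.pls_gr M.scale_gr M.perm_gr pls_gr[simplified] scale_gr[simplified] perm_gr[simplified]
 have epls: "R `` {Gen (pls M x y)} = pls (quot (tm_alg K M) R) (R `` {Gen x}) (R `` {Gen y})
 \<longleftrightarrow> (Gen (pls M x y), Plus (Gen x) (Gen y)) : R"
 if "x : gr M n d" "y : gr M n d" for x y n d
 using smod_hom_pls[OF h g[OF that(1)] g[OF that(2)]]
 cls_eq[OF e[OF g[OF cl(1)[OF that]]] e[OF cl(4)[OF g[OF that(1)] g[OF that(2)]]]] by simp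
 have escale: "R `` {Gen (scale M c x)} = scale (quot (tm_alg K M) R) c (R `` {Gen x})
 \<longleftrightarrow> (Gen (scale M c x), Scale c (Gen x)) : R"
 if "c : carrier K" "x : gr M n d" for x c n d
 using smod_hom_scale[OF h that(1) e[OF g[OF that(2)]]]
 cls_eq[OF e[OF g[OF cl(2)[OF that]]] e[OF cl(5)[OF that(1) g[OF that(2)]]]] by simp
 have eperm: "R `` {Gen (perm M \<pi> x)} = perm (quot (tm_alg K M) R) \<pi> (R `` {Gen x})
 \<longleftrightarrow> (Gen (perm M \<pi> x), Perm \<pi> (Gen x)) : R"
 if "x : gr M n d" "\<pi> permutes {..<n}" for x \<pi> n d
 using smod_hom_perm[OF h g[OF that(1)] that(2)]
 cls_eq[OF e[OF g[OF cl(3)[OF that]]] e[OF cl(6)[OF g[OF that(1)] that(2)]]] by simp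
 show ?thesis
 proof
 assume s: "smod_hom K M (quot (tm_alg K M) R) (%x. R `` {Gen x})"
 show "\<forall>l r. gen_law K M l r --> (l, r) : R"
 proof (intro allI impI)
 fix l r assume "gen_law K M l r"
 thus "(l, r) : R"
 proof cases
 case (pls x n d y)
 thus ?thesis using epls[OF pls(3,4)] smod_hom_pls[OF s pls(3,4)] by simp
 next
 case (scale c x n d)
 thus ?thesis using escale[OF scale(3,4)] smod_hom_scale[OF s scale(3), of x]
 by (simp add: gr_iff)
 next
 case (perm x n d \<pi>)
 thus ?thesis using eperm[OF perm(3,4)] smod_hom_perm[OF s perm(3,4)] by simp
 qed
 qed
 next
 assume *: "\<forall>l r. gen_law K M l r --> (l, r) : R"
 show "smod_hom K M (quot (tm_alg K M) R) (%x. R `` {Gen x})"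
 proof (rule smod_homI)
 show "R `` {Gen x} : gr (quot (tm_alg K M) R) n d" if "x : gr M n d" for n d x
 by (rule smod_hom_gr[OF h g[OF that]])
 qed (use * epls escale eperm in "blast intro: gen_law.intros")+
 qed
qed

subsection \<open>Existence\<close>

text \<open>The operad whose components are all zero; it provides a congruence to start from.\<close>

definition zero_operad :: "('k, nat \<times> int) operad" where
 "zero_operad = \<lparr>elts = UNIV, arity = fst, deg = snd, nul = Pair, pls = (%x y. x), scale = (%c x. x),
 perm = (%\<pi> x. x), unt = (1, 0), cmp = (%a bs. (sum_list (map fst bs), snd a + sum_list (map snd bs)))\<rparr>"
lemma sum_list_map_concat: "sum_list (map f (concat css)) = (\<Sum>cs\<leftarrow>css. sum_list (map f cs))"
 by (induction css) auto
lemma operad_zero_operad: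
 assumes "cring K" shows "operad K zero_operad"
proof (rule operadI_laws[OF assms])
 note z = zero_operad_def
 have sel: "elts zero_operad = UNIV" "arity zero_operad = fst" "deg zero_operad = snd" "nul zero_operad = Pair"
 "pls zero_operad = (%x y. x)" "scale zero_operad = (%c x. x)" "perm zero_operad = (%\<pi> x. x)"
 "unt zero_operad = (1, 0)"
 "cmp zero_operad = (%a bs. (sum_list (map fst bs), snd a + sum_list (map snd bs)))"
 by (simp_all add: z)
 show sig: "sig_alg K (zero_operad :: ('a, nat \<times> int) operad)"
 by unfold_locales (auto simp: gr_iff sel)
 interpret sig_alg K "zero_operad :: ('a, nat \<times> int) operad" by (rule sig)
 have s: "signed K zero_operad e x = x" for e x by (simp add: signed_def sel)
 fix l r assume "law K zero_operad l r"
 thus "l = r"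
 proof cases
 case (assoc a bs css)
 note sum_list_map_concat[of fst css] sum_list_map_concat[of snd css]
 moreover have "map fst (map2 (cmp zero_operad) bs css) = map (%cs. sum_list (map fst cs)) css"
 using assoc by (intro nth_equalityI) (auto simp: sel)
 moreover have "sum_list (map snd (map2 (cmp zero_operad) bs css))
 = sum_list (map snd bs) + (\<Sum>cs\<leftarrow>css. sum_list (map snd cs))"
 using assoc(4)[symmetric] by (induction bs css rule: list_induct2) (auto simp: sel)
 ultimately show ?thesis unfolding assoc(1,2) s by (simp add: sel)
 next
 case (equivariant_left a bs \<pi>)
 show ?thesis unfolding equivariant_left(1,2) s
 using composable_rearrange(2)[OF equivariant_left(3,4), of fst] composable_rearrange(2)[OF equivariant_left(3,4), of snd]
 by (simp only: sel)
 next
 case (equivariant_right a bs \<tau>s)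
 have "map2 (%\<pi> x. x) \<tau>s bs = bs"
 using equivariant_right by (intro nth_equalityI) auto
 thus ?thesis unfolding equivariant_right(1,2) by (simp only: sel)
 next
 case (comp_plus_right a bs i b)
 thus ?thesis by (simp add: sel)
 next
 case unit_right
 thus ?thesis by (cases r) (simp add: sel sum_list_replicate)
 next
 case (pls_comm x n d y)
 thus ?thesis by (auto simp: sel gr_iff prod_eq_iff)
 next
 case (nul_pls n d)
 thus ?thesis by (auto simp: sel gr_iff prod_eq_iff)
 next
 case (neg_pls x n d)
 thus ?thesis by (auto simp: sel gr_iff prod_eq_iff)
 next
 case unit_left
 thus ?thesis by (cases r) (simp add: sel)
 qed (simp_all add: sel)
qed
lemma eval_congruence:
 assumes "smodule K M" "operad K P" "smod_hom K M P f"
 defines "R \<equiv> {(t, u). t : tms K M & u : tms K M & tm_eval P f t = tm_eval P f u}"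
 shows "op_congruence K (tm_alg K M) R" "operad K (quot (tm_alg K M) R)"
 "smod_hom K M (quot (tm_alg K M) R) (%x. R `` {Gen x})"
proof -
 interpret M: smodule K M by fact
 interpret ev: sig_hom K "tm_alg K M" P "tm_eval P f" by (rule tm_eval_sig_hom[OF assms(2,3)])
 have gr: "tm_arity M t = tm_arity M u & tm_deg M t = tm_deg M u"
 if "t : tms K M" "u : tms K M" "tm_eval P f t = tm_eval P f u" for t u
 using tm_eval_gr[OF assms(2,3) that(1)] tm_eval_gr[OF assms(2,3) that(2)] that(3) by (simp add: gr_iff)
 show c: "op_congruence K (tm_alg K M) R"
 unfolding op_congruence_def
 proof (intro conjI)
 show "equiv (elts (tm_alg K M)) R"
 by (rule equivI) (auto simp: R_def refl_on_def sym_def trans_def)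
 show "\<forall>(a, a')\<in>R. \<forall>bs bs'. list_all2 (%b b'. (b, b') : R) bs bs' --> length bs = arity (tm_alg K M) a -->
 (cmp (tm_alg K M) a bs, cmp (tm_alg K M) a' bs') : R"
 proof clarify
 fix a a' bs bs' assume a: "(a, a') : R" "list_all2 (%b b'. (b, b') : R) bs bs'"
 "length bs = arity (tm_alg K M) a"
 hence "map (tm_eval P f) bs = map (tm_eval P f) bs'"
 by (intro nth_equalityI) (auto simp: list_all2_conv_all_nth R_def)
 moreover have "\<forall>b\<in>set bs. b : tms K M" "\<forall>b\<in>set bs'. b : tms K M" "length bs' = length bs"
 using a(2) by (auto simp: list_all2_conv_all_nth R_def in_set_conv_nth)
 ultimately show "(cmp (tm_alg K M) a bs, cmp (tm_alg K M) a' bs') : R"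
 using a(1,3) gr[of a a'] by (auto simp: R_def intro!: tms.intros simp del: map_eq_conv)
 qed
 show "\<forall>(x, x')\<in>R. same_grade (tm_alg K M) x x'"
 proof clarify
 fix x x' assume "(x, x') : R"
 thus "same_grade (tm_alg K M) x x'" using gr[of x x'] by (simp add: R_def same_grade_def)
 qed
 show "\<forall>(x, x')\<in>R. \<forall>(y, y')\<in>R. same_grade (tm_alg K M) x y -->
 (pls (tm_alg K M) x y, pls (tm_alg K M) x' y') : R"
 proof clarify
 fix x x' y y' assume "(x, x') : R" "(y, y') : R" "same_grade (tm_alg K M) x y"
 thus "(pls (tm_alg K M) x y, pls (tm_alg K M) x' y') : R"
 using gr[of x x'] gr[of y y'] by (simp add: R_def same_grade_def tms.intros)
 qed
 show "\<forall>(x, x')\<in>R. \<forall>c\<in>carrier K. (scale (tm_alg K M) c x, scale (tm_alg K M) c x') : R"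
 by (auto simp: R_def intro!: tms.intros)
 show "\<forall>(x, x')\<in>R. \<forall>\<pi>. \<pi> permutes {..<arity (tm_alg K M) x} -->
 (perm (tm_alg K M) \<pi> x, perm (tm_alg K M) \<pi> x') : R"
 proof clarify
 fix x x' \<pi> assume "(x, x') : R" "\<pi> permutes {..<arity (tm_alg K M) x}"
 thus "(perm (tm_alg K M) \<pi> x, perm (tm_alg K M) \<pi> x') : R"
 using gr[of x x'] by (simp add: R_def tms.intros)
 qed
 qed
 interpret op_cong K "tm_alg K M" R
 by (intro op_cong.intro op_cong_axioms.intro sig_alg_tm_alg c M.cring_K)
 show "operad K (quot (tm_alg K M) R)"
 proof -
 have "(l, r) : R" if "law K (tm_alg K M) l r" for l r
 using ev.P.law_elts[OF that M.cring_K] operad.law_eq[OF assms(2) ev.law_image[OF that]] by (simp add: R_def)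
 thus ?thesis by (simp add: operad_quot_iff)
 qed
 have "(l, r) : R" if "gen_law K M l r" for l r
 using that
 proof cases
 case (pls x n d y)
 thus ?thesis using smod_hom_pls[OF assms(3) pls(3,4)] M.pls_gr[OF pls(3,4)]
 by (auto simp: R_def gr_iff intro!: tms.intros)
 next
 case (scale c x n d)
 thus ?thesis using smod_hom_scale[OF assms(3) scale(3), of x] M.scale_gr[OF scale(3,4)]
 by (auto simp: R_def gr_iff intro!: tms.intros)
 next
 case (perm x n d \<pi>)
 thus ?thesis using smod_hom_perm[OF assms(3) perm(3,4)] M.perm_gr[OF perm(3,4)]
 by (auto simp: R_def gr_iff intro!: tms.intros)
 qed
 thus "smod_hom K M (quot (tm_alg K M) R) (%x. R `` {Gen x})"
 by (simp add: gen_smod_hom_iff[OF assms(1) c])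
qed
lemma op_congruence_Inter:
 assumes "\<F> ~= {}" "!!R. R : \<F> ==> op_congruence K P R" shows "op_congruence K P (\<Inter>\<F>)"
 unfolding op_congruence_def
proof (intro conjI)
 note c = assms(2)[unfolded op_congruence_def]
 have e: "equiv (elts P) R" if "R : \<F>" for R using c[OF that] by blast
 show "equiv (elts P) (\<Inter>\<F>)"
 proof (rule equivI)
 show "\<Inter>\<F> \<subseteq> elts P \<times> elts P"
 proof -
 obtain R where "R : \<F>" using assms(1) by blast
 moreover have "R \<subseteq> elts P \<times> elts P" using e[OF \<open>R : \<F>\<close>] by (simp add: equiv_def refl_on_def)
 ultimately show ?thesis by blast
 qed
 show "refl_on (elts P) (\<Inter>\<F>)"
 using e by (auto simp: equiv_def refl_on_def)
 show "sym (\<Inter>\<F>)" using e by (simp add: equiv_def sym_def)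
 show "trans (\<Inter>\<F>)" using e unfolding equiv_def trans_def by blast
 qed
 obtain R0 where R0: "R0 : \<F>" using assms(1) by blast
 show "\<forall>(x, x')\<in>\<Inter>\<F>. same_grade P x x'" using c[OF R0] R0 by blast
 show "\<forall>(x, x')\<in>\<Inter>\<F>. \<forall>(y, y')\<in>\<Inter>\<F>. same_grade P x y --> (pls P x y, pls P x' y') : \<Inter>\<F>"
 proof clarify
 fix x x' y y' R assume a: "(x, x') : \<Inter>\<F>" "(y, y') : \<Inter>\<F>" "same_grade P x y" "R : \<F>"
 hence "(x, x') : R" "(y, y') : R" by auto
 thus "(pls P x y, pls P x' y') : R" using c[OF a(4)] a(3) by blast
 qed
 show "\<forall>(x, x')\<in>\<Inter>\<F>. \<forall>c\<in>carrier K. (scale P c x, scale P c x') : \<Inter>\<F>"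
 proof clarify
 fix x x' k R assume a: "(x, x') : \<Inter>\<F>" "k : carrier K" "R : \<F>"
 hence "(x, x') : R" by auto
 thus "(scale P k x, scale P k x') : R" using c[OF a(3)] a(2) by blast
 qed
 show "\<forall>(x, x')\<in>\<Inter>\<F>. \<forall>\<pi>. \<pi> permutes {..<arity P x} --> (perm P \<pi> x, perm P \<pi> x') : \<Inter>\<F>"
 proof clarify
 fix x x' \<pi> R assume a: "(x, x') : \<Inter>\<F>" "\<pi> permutes {..<arity P x}" "R : \<F>"
 hence "(x, x') : R" by auto
 thus "(perm P \<pi> x, perm P \<pi> x') : R" using c[OF a(3)] a(2) by blast
 qed
 show "\<forall>(a, a')\<in>\<Inter>\<F>. \<forall>bs bs'. list_all2 (%b b'. (b, b') : \<Inter>\<F>) bs bs' --> length bs = arity P a -->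
 (cmp P a bs, cmp P a' bs') : \<Inter>\<F>"
 proof clarify
 fix a a' bs bs' R assume a: "(a, a') : \<Inter>\<F>" "list_all2 (%b b'. (b, b') : \<Inter>\<F>) bs bs'"
 "length bs = arity P a" "R : \<F>"
 hence "(a, a') : R" "list_all2 (%b b'. (b, b') : R) bs bs'"
 by (auto intro: list_all2_mono)
 thus "(cmp P a bs, cmp P a' bs') : R" using c[OF a(4)] a(3) by blast
 qed
qed

context smodule
begin
lemma free_rel_congruence: "op_congruence K (tm_alg K M) (free_rel K M)" (is ?c)
 and operad_free: "operad K (free K M)"
 and gen_smod_hom: "smod_hom K M (free K M) (gen K M)"
proof -
 define \<F> where "\<F> = {R. op_congruence K (tm_alg K M) R & operad K (quot (tm_alg K M) R) &
 smod_hom K M (quot (tm_alg K M) R) (%x. R `` {Gen x})}"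
 have eq: "free_rel K M = \<Inter>\<F>" by (simp add: free_rel_def \<F>_def)
 have "smod_hom K M (zero_operad :: (_, nat \<times> int) operad) (%x. (arity M x, deg M x))"
 using pls_gr scale_gr perm_gr by (intro smod_homI) (auto simp: zero_operad_def gr_iff)
 from eval_congruence[OF smodule_axioms operad_zero_operad[OF cring_K] this]
 have ne: "\<F> ~= {}" unfolding \<F>_def by blast
 have cong: "op_congruence K (tm_alg K M) (free_rel K M)"
 unfolding eq by (rule op_congruence_Inter[OF ne]) (simp add: \<F>_def)
 thus ?c .
 interpret op_cong K "tm_alg K M" "free_rel K M"
 by (intro op_cong.intro op_cong_axioms.intro sig_alg_tm_alg cong cring_K)
 have "(l, r) : free_rel K M" if "law K (tm_alg K M) l r" for l r
 unfolding eq
 proof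
 fix R assume R: "R : \<F>"
 then interpret r: op_cong K "tm_alg K M" R
 by (intro op_cong.intro op_cong_axioms.intro sig_alg_tm_alg cring_K) (simp add: \<F>_def)
 show "(l, r) : R" using r.operad_quot_iff R that by (simp add: \<F>_def)
 qed
 thus "operad K (free K M)" unfolding free_def operad_quot_iff by blast
 have "(l, r) : free_rel K M" if "gen_law K M l r" for l r
 unfolding eq
 proof
 fix R assume R: "R : \<F>"
 thus "(l, r) : R" using gen_smod_hom_iff[OF smodule_axioms, of R] that by (simp add: \<F>_def)
 qed
 hence "smod_hom K M (quot (tm_alg K M) (free_rel K M)) (%x. free_rel K M `` {Gen x})"
 by (simp add: gen_smod_hom_iff[OF smodule_axioms cong])
 thus "smod_hom K M (free K M) (gen K M)" unfolding free_def gen_def[abs_def] .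
qed
sublocale fc: op_cong K "tm_alg K M" "free_rel K M"
 by (intro op_cong.intro op_cong_axioms.intro sig_alg_tm_alg free_rel_congruence cring_K)
lemma gen_gr: "x : gr M n d ==> gen K M x : gr (free K M) n d"
 by (rule smod_hom_gr[OF gen_smod_hom])
lemma gens_elts: "gen K M ` elts M \<subseteq> elts (free K M)"
 using gen_gr[OF elts_gr] by (auto simp: gr_iff)
lemma free_generated: "elts (free K M) \<subseteq> opspan K (free K M) (gen K M ` elts M)"
proof -
 let ?p = "%t. free_rel K M `` {t}"
 interpret p: sig_hom K "tm_alg K M" "free K M" ?p
 unfolding free_def by (rule fc.quot_sig_hom)
 have "?p t : opspan K (free K M) (gen K M ` elts M)" if "t : tms K M" for t
 using that
 proof (induction rule: tms.induct)
 case (1 x)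
 thus ?case by (intro opspan.gen) (auto simp: gen_def)
 next
 case 2
 thus ?case using p.hom_unt by (simp add: opspan.unt)
 next
 case (3 n d)
 thus ?case using p.hom_nul[of n d] by (simp add: opspan.nul)
 next
 case (4 t u)
 hence "t : gr (tm_alg K M) (tm_arity M t) (tm_deg M t)" "u : gr (tm_alg K M) (tm_arity M t) (tm_deg M t)"
 by (simp_all add: gr_iff)
 from p.hom_pls[OF this] p.hom_gr[OF this(1)] p.hom_gr[OF this(2)] 4 show ?case
 by (auto intro!: opspan.pls simp: same_grade_def gr_iff)
 next
 case (5 c t)
 thus ?case using p.hom_scale[of c t] by (auto intro!: opspan.scale)
 next
 case (6 t \<pi>)
 hence g: "t : gr (tm_alg K M) (tm_arity M t) (tm_deg M t)" by (simp add: gr_iff)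
 thus ?case using p.hom_perm[OF g 6(2)] p.hom_gr[OF g] 6
 by (auto intro!: opspan.perm simp: gr_iff)
 next
 case (7 t us)
 hence c: "composable (tm_alg K M) t us" by (auto simp: composable_def)
 have t: "t : gr (tm_alg K M) (tm_arity M t) (tm_deg M t)" using 7 by (simp add: gr_iff)
 show ?case using p.hom_cmp[OF c] p.hom_gr[OF t] 7
 by (auto intro!: opspan.cmp simp: gr_iff)
 qed
 thus ?thesis unfolding free_def fc.quot_elts by auto
qed

text \<open>The kernel of the evaluation of expressions in \<open>P\<close> is one of the congruences whose intersection
  defines the free operad, so evaluation factors through the free operad.\<close>

lemma free_universal:
 assumes "operad K P" "smod_hom K M P f"
 shows "\<exists>h. operad_hom K (free K M) P h & (\<forall>x\<in>elts M. h (gen K M x) = f x)"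
proof -
 interpret p: sig_hom K "tm_alg K M" "free K M" "%t. free_rel K M `` {t}"
 unfolding free_def by (rule fc.quot_sig_hom)
 interpret ev: sig_hom K "tm_alg K M" P "tm_eval P f" by (rule tm_eval_sig_hom[OF assms])
 have "\<exists>h. operad_hom K (free K M) P h & (\<forall>t\<in>elts (tm_alg K M). h (free_rel K M `` {t}) = tm_eval P f t)"
 proof (rule hom_factor[OF p.sig_hom_axioms _ ev.hom])
 show "(%t. free_rel K M `` {t}) ` elts (tm_alg K M) = elts (free K M)"
 by (simp add: free_def fc.quot_elts)
 fix t u assume "t : elts (tm_alg K M)" "u : elts (tm_alg K M)" "free_rel K M `` {t} = free_rel K M `` {u}"
 hence "(t, u) : free_rel K M" by (simp add: fc.cls_eq)
 moreover have "free_rel K M \<subseteq> {(t, u). t : tms K M & u : tms K M & tm_eval P f t = tm_eval P f u}"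
 unfolding free_rel_def using eval_congruence[OF smodule_axioms assms] by blast
 ultimately show "tm_eval P f t = tm_eval P f u" by blast
 qed
 thus ?thesis using tms.intros(1)[of _ M K] by (auto simp: gen_def)
qed
lemma free_map_properties:
 assumes "operad K P" "smod_hom K M P f"
 shows "free_map K M P f : extensional (elts (free K M))" "operad_hom K (free K M) P (free_map K M P f)"
 "x : elts M ==> free_map K M P f (gen K M x) = f x"
proof -
 let ?Pr = "%h. h : extensional (elts (free K M)) & operad_hom K (free K M) P h &
 (\<forall>x\<in>elts M. h (gen K M x) = f x)"
 obtain h where h: "operad_hom K (free K M) P h" "!!x. x : elts M ==> h (gen K M x) = f x"
 using free_universal[OF assms] by blast
 have r: "?Pr (restrict h (elts (free K M)))"
 using h gens_elts operad_hom_cong[OF h(1) operad_free, of "restrict h (elts (free K M))"] by auto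
 have u: "h1 = h2" if "?Pr h1" "?Pr h2" for h1 h2
 proof (rule extensionalityI[of _ "elts (free K M)"])
 fix x assume "x : elts (free K M)"
 hence "x : opspan K (free K M) (gen K M ` elts M)" using free_generated by blast
 show "h1 x = h2 x"
 proof (rule hom_eq_on_opspan[OF _ _ gens_elts])
 show "op_hom K (free K M) P h1" "op_hom K (free K M) P h2"
 using that by (auto intro: op_homI operad_free assms(1))
 show "h1 y = h2 y" if "y : gen K M ` elts M" for y
 using that \<open>?Pr h1\<close> \<open>?Pr h2\<close> by auto
 qed fact
 qed (use that in auto)
 have "\<exists>!h. ?Pr h" by (rule ex1I[of ?Pr, OF r u[OF _ r]])
 hence "?Pr (free_map K M P f)" unfolding free_map_def by (rule theI')
 thus "free_map K M P f : extensional (elts (free K M))" "operad_hom K (free K M) P (free_map K M P f)"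
 "x : elts M ==> free_map K M P f (gen K M x) = f x" by auto
qed

end

section \<open>Square-zero extensions of operads\<close>

abbreviation pairs :: "('k, 'a, 'm) smod_scheme => int => ('k, 'a \<times> 'a) smod" where
 "pairs T k \<equiv> dsum T (shift (- k) T)"

text \<open>The elements are pairs \<open>(x, y)\<close> in which \<open>y\<close> is \<open>k\<close> degrees above \<open>x\<close>.  For a map \<open>D\<close> of
  Sigma-modules of degree \<open>k\<close>, the map \<open>x \<mapsto> (x, D x)\<close> is a morphism of operads if and only if \<open>D (a (b\<^sub>1, \<dots>, b\<^sub>n))\<close> is \<open>(D a) (b\<^sub>1, \<dots>, b\<^sub>n)\<close> plus the value of
  \<open>\<Delta>\<close> at \<open>a\<close> and the pairs \<open>(b\<^sub>i, D b\<^sub>i)\<close>; derivations and contracting homotopies are of this form.\<close>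

definition sqz :: "('k, 'a, 'm) operad_scheme => int => ('a => ('a \<times> 'a) list => 'a) =>
 ('k, 'a \<times> 'a) operad" where
 "sqz T k \<Delta> = smod.extend (pairs T k) (operad.fields (unt T, nul T 1 k)
 (%p zs. (cmp T (fst p) (map fst zs), pls T (cmp T (snd p) (map fst zs)) (\<Delta> (fst p) zs))))"
lemma sqz_sel [simp]:
 "elts (sqz T k \<Delta>) = elts (pairs T k)" "arity (sqz T k \<Delta>) = arity T \<circ> fst"
 "deg (sqz T k \<Delta>) = deg T \<circ> fst"
 "nul (sqz T k \<Delta>) n d = (nul T n d, nul T n (d + k))"
 "pls (sqz T k \<Delta>) p q = (pls T (fst p) (fst q), pls T (snd p) (snd q))"
 "scale (sqz T k \<Delta>) c p = (scale T c (fst p), scale T c (snd p))"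
 "perm (sqz T k \<Delta>) \<pi> p = (perm T \<pi> (fst p), perm T \<pi> (snd p))"
 "unt (sqz T k \<Delta>) = (unt T, nul T 1 k)"
 "cmp (sqz T k \<Delta>) p zs =
 (cmp T (fst p) (map fst zs), pls T (cmp T (snd p) (map fst zs)) (\<Delta> (fst p) zs))"
 by (simp_all add: sqz_def smod.extend_def operad.fields_def dsum_def split_beta map_prod_def)
lemma gr_pairs: "gr (pairs T k) n d = gr T n d \<times> gr T n (d + k)"
 by (simp add: gr_dsum gr_shift)
lemma gr_sqz: "gr (sqz T k \<Delta>) n d = gr T n d \<times> gr T n (d + k)"
proof -
 have "gr (sqz T k \<Delta>) n d = gr (pairs T k) n d" by (simp add: gr_def)
 thus ?thesis by (simp add: gr_pairs)
qed
lemma elts_pairs: "z : elts (pairs T k) \<longleftrightarrow>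
 fst z : elts T & snd z : gr T (arity T (fst z)) (deg T (fst z) + k)"
 by (simp add: elts_dsum gr_shift)

definition comp2 :: "('k, 'a, 'm) operad_scheme => int => 'a => ('a \<times> 'a) list => bool" where
 "comp2 T k a zs \<longleftrightarrow> a : elts T & set zs \<subseteq> elts (pairs T k) & length zs = arity T a"
lemma comp2_composable: "comp2 T k a zs ==> composable T a (map fst zs)"
 by (auto simp: comp2_def composable_def elts_pairs)
lemma comp2_nth:
 assumes "comp2 T k a zs" "i < length zs"
 shows "fst (zs ! i) : elts T & snd (zs ! i) : gr T (arity T (fst (zs ! i))) (deg T (fst (zs ! i)) + k)"
proof -
 have "zs ! i : elts (pairs T k)" using assms(1) nth_mem[OF assms(2)] unfolding comp2_def by blast
 thus ?thesis by (simp only: elts_pairs)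
qed
lemma composable_sqz: "composable (sqz T k \<Delta>) p zs \<longleftrightarrow>
 comp2 T k (fst p) zs & snd p : gr T (arity T (fst p)) (deg T (fst p) + k)"
 by (auto simp: composable_def comp2_def elts_pairs)
lemma signed_sqz: "signed K (sqz T k \<Delta>) e p = (signed K T e (fst p), signed K T e (snd p))"
 by (simp add: signed_def)

text \<open>What \<open>\<Delta>\<close> has to satisfy for the axioms of an operad to hold in the second component.\<close>

locale square_zero = operad K T for K :: "('k, 'z) ring_scheme" (structure)
 and T :: "('k, 'a, 'm) operad_scheme" +
 fixes k :: int and \<Delta> :: "'a => ('a \<times> 'a) list => 'a"
 assumes D_gr: "comp2 T k a zs ==> \<Delta> a zs : gr T (tarity T (map fst zs))
 (deg T a + tdeg T (map fst zs) + k)"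
 and D_pls_left: "[|comp2 T k a zs; a' : comp_of T a|] ==>
 \<Delta> (pls T a a') zs = pls T (\<Delta> a zs) (\<Delta> a' zs)"
 and D_scale_left: "[|comp2 T k a zs; c : carrier K|] ==> \<Delta> (scale T c a) zs = scale T c (\<Delta> a zs)"
 and D_pls_right: "[|comp2 T k a zs; i < length zs;
 w : gr (pairs T k) (arity T (fst (zs ! i))) (deg T (fst (zs ! i)))|] ==>
 \<Delta> a (zs[i := pls (pairs T k) (zs ! i) w]) = pls T (\<Delta> a zs) (\<Delta> a (zs[i := w]))"
 and D_scale_right: "[|comp2 T k a zs; i < length zs; c : carrier K|] ==>
 \<Delta> a (zs[i := scale (pairs T k) c (zs ! i)]) = scale T c (\<Delta> a zs)"
 and D_unit_left: "z : elts (pairs T k) ==> \<Delta> (unt T) [z] = snd z"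
 and D_unit_right: "a : elts T ==>
 \<Delta> a (replicate (arity T a) (unt T, nul T 1 k)) = nul T (arity T a) (deg T a + k)"
 and D_assoc: "[|comp2 T k a zs; length wss = length zs;
 !!i. i < length zs ==> comp2 T k (fst (zs ! i)) (wss ! i)|] ==>
 pls T (cmp T (\<Delta> a zs) (map fst (concat wss))) (\<Delta> (cmp T a (map fst zs)) (concat wss))
 = signed K T (\<Sum>i<length zs. \<Sum>j<i. deg T (fst (zs ! i)) * sum_list (map (deg T) (map fst (wss ! j))))
 (\<Delta> a (map2 (cmp (sqz T k \<Delta>)) zs wss))"
 and D_equivariant_left: "[|comp2 T k a zs; \<pi> permutes {..<arity T a}|] ==>
 \<Delta> (perm T \<pi> a) zs = signed K T (koszul \<pi> (map (deg T) (map fst zs)))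
 (perm T (block_perm (map (arity T) (map fst zs)) \<pi>) (\<Delta> a (map (%j. zs ! \<pi> j) [0..<length zs])))"
 and D_equivariant_right: "[|comp2 T k a zs; length \<tau>s = length zs;
 !!i. i < length zs ==> (\<tau>s ! i) permutes {..<arity T (fst (zs ! i))}|] ==>
 \<Delta> a (map2 (perm (pairs T k)) \<tau>s zs)
 = perm T (sum_perm (map (arity T) (map fst zs)) \<tau>s) (\<Delta> a zs)"
begin
abbreviation "X \<equiv> sqz T k \<Delta>"
lemma composable_snd:
 "comp2 T k a zs ==> x : gr T (arity T a) d ==> composable T x (map fst zs)"
 by (rule composable_cong[OF comp2_composable])
lemma snd_cmp_gr:
 assumes "comp2 T k a zs" "x : gr T (arity T a) (deg T a + k)"
 shows "cmp T x (map fst zs) : gr T (tarity T (map fst zs))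
 (deg T a + tdeg T (map fst zs) + k)"
 using assms(2) by (intro cmp_gr composable_snd[OF assms]) (auto simp: gr_iff)
lemma smodule_sqz: "smodule K X"
 by (rule smodule_cong[OF smodule_dsum[OF smodule_axioms smodule_shift[OF smodule_axioms, of "- k"]]])
 (auto simp: sqz_def smod.extend_def)
lemma cmp_X_gr:
 assumes "composable X p zs"
 shows "cmp X p zs : gr X (tarity X zs) (deg X p + tdeg X zs)"
proof -
 have c: "comp2 T k (fst p) zs" and s: "snd p : gr T (arity T (fst p)) (deg T (fst p) + k)"
 using assms by (simp_all add: composable_sqz)
 show ?thesis
 using pls_gr[OF snd_cmp_gr[OF c s] D_gr[OF c]] cmp_gr[OF comp2_composable[OF c]]
 by (simp add: gr_sqz comp_def)
qed
lemma operad_sqz: "operad K X"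
proof (intro operad.intro smodule_sqz operad_axioms.intro)
 show "unt X : elts X" using unit_closed arity_unit deg_unit by (simp add: elts_pairs)
 show "arity X (unt X) = 1" "deg X (unt X) = 0" by (simp_all add: arity_unit deg_unit)
 fix p zs assume com: "composable X p zs"
 hence c: "comp2 T k (fst p) zs" and s: "snd p : gr T (arity T (fst p)) (deg T (fst p) + k)"
 by (simp_all add: composable_sqz)
 note ct = comp2_composable[OF c] and cs = composable_snd[OF c s]
 note g1 = snd_cmp_gr[OF c s] and g2 = D_gr[OF c]
 show "cmp X p zs : elts X" "arity X (cmp X p zs) = tarity X zs"
 "deg X (cmp X p zs) = deg X p + tdeg X zs"
 using cmp_X_gr[OF com] unfolding gr_iff by blast+
 { fix p' assume "p' : elts X" "same_grade X p p'"
 hence p': "fst p' : comp_of T (fst p)"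
 "snd p' : gr T (arity T (fst p)) (deg T (fst p) + k)"
 by (auto simp: elts_pairs same_grade_def gr_iff)
 hence c': "comp2 T k (fst p') zs" using c by (auto simp: comp2_def gr_iff)
 have s': "snd p' : comp_of T (snd p)" using s p' by (simp add: gr_iff)
 have g1': "cmp T (snd p') (map fst zs) : gr T (tarity T (map fst zs))
 (deg T (fst p) + tdeg T (map fst zs) + k)"
 using snd_cmp_gr[OF c', of "snd p'"] p' by (simp add: gr_iff)
 have g2': "\<Delta> (fst p') zs : gr T (tarity T (map fst zs))
 (deg T (fst p) + tdeg T (map fst zs) + k)"
 using D_gr[OF c'] p' by (simp add: gr_iff)
 show "cmp X (pls X p p') zs = pls X (cmp X p zs) (cmp X p' zs)"
 using cmp_pls_left[OF ct p'(1)] cmp_pls_left[OF cs s'] D_pls_left[OF c p'(1)]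
 pls_swap[OF g1 g1' g2 g2'] by simp }
 { fix i w assume i: "i < length zs" and w: "w : elts X" "same_grade X w (zs ! i)"
 let ?z = "zs ! i"
 have wg: "fst w : gr T (arity T (fst ?z)) (deg T (fst ?z))" "snd w : gr T (arity T (fst ?z)) (deg T (fst ?z) + k)"
 using w by (auto simp: elts_pairs same_grade_def gr_iff)
 hence wg': "w : gr (pairs T k) (arity T (fst ?z)) (deg T (fst ?z))" by (cases w) (simp add: gr_pairs)
 have c': "comp2 T k (fst p) (zs[i := w])"
 using c w(1) set_update_subset_insert[of zs i w] by (auto simp: comp2_def)
 have m: "map (arity T) (map fst (zs[i := w])) = map (arity T) (map fst zs)"
 "map (deg T) (map fst (zs[i := w])) = map (deg T) (map fst zs)"
 using i wg by (simp_all add: map_update_eq gr_iff)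
 have zi: "map fst zs ! i = fst ?z" using i by simp
 have up: "cmp T u (map fst (zs[i := pls X ?z w]))
 = pls T (cmp T u (map fst zs)) (cmp T u (map fst (zs[i := w])))" if "composable T u (map fst zs)" for u
 proof -
 have "cmp T u ((map fst zs)[i := pls T (map fst zs ! i) (fst w)])
 = pls T (cmp T u (map fst zs)) (cmp T u ((map fst zs)[i := fst w]))"
 by (rule comp_plus_right[OF that]) (use i wg in "auto simp: gr_iff same_grade_def")
 thus ?thesis using i by (simp add: map_update)
 qed
 have d: "\<Delta> (fst p) (zs[i := pls X ?z w]) = pls T (\<Delta> (fst p) zs) (\<Delta> (fst p) (zs[i := w]))"
 using D_pls_right[OF c i wg'] by simp
 show "cmp X p (zs[i := pls X ?z w]) = pls X (cmp X p zs) (cmp X p (zs[i := w]))"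
 by (simp only: sqz_sel(5,9) up[OF ct, unfolded sqz_sel(5)] up[OF cs, unfolded sqz_sel(5)]
 d[unfolded sqz_sel(5)] fst_conv snd_conv
 pls_swap[OF g1 snd_cmp_gr[OF c' s, unfolded m] g2 D_gr[OF c', unfolded m]]) }
 { fix i w assume i: "i < length zs" and w: "w : carrier K"
 have up: "cmp T u (map fst (zs[i := scale X w (zs ! i)])) = scale T w (cmp T u (map fst zs))"
 if "composable T u (map fst zs)" for u
 using comp_scale_right[OF that _ w, of i] i by (simp add: map_update)
 have d: "\<Delta> (fst p) (zs[i := scale X w (zs ! i)]) = scale T w (\<Delta> (fst p) zs)"
 using D_scale_right[OF c i w] by simp
 show "cmp X p (zs[i := scale X w (zs ! i)]) = scale X w (cmp X p zs)"
 unfolding sqz_sel(9) up[OF ct] up[OF cs] d by (simp add: scale_pls[OF w g1 g2]) }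
 { fix w assume w: "w : carrier K"
 show "cmp X (scale X w p) zs = scale X w (cmp X p zs)"
 by (simp add: comp_scale_left[OF ct w] comp_scale_left[OF cs w] D_scale_left[OF c w] scale_pls[OF w g1 g2]) }
 { fix wss assume len: "length wss = length zs" and cw: "!!i. i < length zs ==> composable X (zs ! i) (wss ! i)"
 have cw2: "comp2 T k (fst (zs ! i)) (wss ! i)" if "i < length zs" for i
 using cw[OF that] by (simp add: composable_sqz)
 let ?bs = "map fst zs" and ?css = "map (map fst) wss"
 let ?s = "\<Sum>i<length zs. \<Sum>j<i. deg T (fst (zs ! i)) * sum_list (map (deg T) (map fst (wss ! j)))"
 have s_eq: "(\<Sum>i<length ?bs. \<Sum>j<i. deg T (?bs ! i) * sum_list (map (deg T) (?css ! j))) = ?s"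
 using len by (auto intro!: sum.cong)
 have s_eq': "(\<Sum>i<length zs. \<Sum>j<i. deg X (zs ! i) * sum_list (map (deg X) (wss ! j))) = ?s"
 by (simp add: comp_def)
 have cc: "composable T (?bs ! i) (?css ! i)" if "i < length ?bs" for i
 using comp2_composable[OF cw2[of i]] that len by simp
 have as: "cmp T (cmp T u ?bs) (map fst (concat wss)) = signed K T ?s (cmp T u (map2 (cmp T) ?bs ?css))"
 if "composable T u ?bs" for u
 using assoc[OF that, of ?css] cc len s_eq by (simp add: map_concat)
 have m: "map fst (map2 (cmp X) zs wss) = map2 (cmp T) ?bs ?css"
 using len by (intro nth_equalityI) auto
 have cm: "composable T u (map2 (cmp T) ?bs ?css)" and ccm: "composable T (cmp T u ?bs) (map fst (concat wss))" if "composable T u ?bs" for u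
 using sig_alg.composable_map2_cmp[OF sig_alg that, of ?css] cc len by (auto simp: map_concat)
 have g3: "cmp T (snd p) (map2 (cmp T) ?bs ?css) : gr T (sum_list (map (arity T) (map2 (cmp T) ?bs ?css)))
 (deg T (fst p) + k + sum_list (map (deg T) (map2 (cmp T) ?bs ?css)))"
 by (rule cmp_gr[OF cm[OF cs]]) (use s in "simp_all add: gr_iff")
 have c4: "comp2 T k (fst p) (map2 (cmp X) zs wss)"
 proof -
 have "zs ! i : elts X" if "i < length zs" for i using com that by (auto simp: composable_def)
 hence "cmp X (zs ! i) (wss ! i) : elts X" if "i < length zs" for i
 using cmp_X_gr[OF cw[OF that]] by (simp add: gr_iff)
 hence "set (map2 (cmp X) zs wss) \<subseteq> elts X"
 using len by (auto simp: set_zip simp del: sqz_sel)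
 thus ?thesis using c len by (simp add: comp2_def)
 qed
 have g4: "\<Delta> (fst p) (map2 (cmp X) zs wss) : gr T (sum_list (map (arity T) (map2 (cmp T) ?bs ?css)))
 (deg T (fst p) + k + sum_list (map (deg T) (map2 (cmp T) ?bs ?css)))"
 using D_gr[OF c4] unfolding m by (simp add: algebra_simps)
 have x: "cmp T (pls T (cmp T (snd p) ?bs) (\<Delta> (fst p) zs)) (map fst (concat wss))
 = pls T (cmp T (cmp T (snd p) ?bs) (map fst (concat wss))) (cmp T (\<Delta> (fst p) zs) (map fst (concat wss)))"
 by (rule cmp_pls_left[OF ccm[OF cs]]) (use g1 g2 in "simp add: gr_iff")
 have cl: "composable T (cmp T (fst p) ?bs) (map fst (concat wss))" by (rule ccm[OF ct])
 have cl2: "comp2 T k (cmp T (fst p) ?bs) (concat wss)"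
 proof -
 have "set ws \<subseteq> elts (pairs T k)" if "ws : set wss" for ws
 using that cw2 len by (metis comp2_def in_set_conv_nth)
 thus ?thesis using cl by (auto simp: comp2_def composable_def)
 qed
 have e: "deg T (cmp T (fst p) ?bs) + sum_list (map (deg T) (map fst (concat wss))) + k
 = deg T (cmp T (snd p) ?bs) + sum_list (map (deg T) (map fst (concat wss)))"
 using g1 cmp_gr[OF ct refl refl] by (simp add: gr_iff)
 have g5: "cmp T (cmp T (snd p) ?bs) (map fst (concat wss)) : gr T (sum_list (map (arity T) (map fst (concat wss))))
 (deg T (cmp T (fst p) ?bs) + sum_list (map (deg T) (map fst (concat wss))) + k)"
 by (rule cmp_gr[OF ccm[OF cs] refl e])
 have cd: "composable T (\<Delta> (fst p) zs) (map fst (concat wss))"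
 using composable_cong[OF ccm[OF cs]] g1 g2 by (simp add: gr_iff)
 have g6: "cmp T (\<Delta> (fst p) zs) (map fst (concat wss)) : gr T (sum_list (map (arity T) (map fst (concat wss))))
 (deg T (cmp T (fst p) ?bs) + sum_list (map (deg T) (map fst (concat wss))) + k)"
 by (rule cmp_gr[OF cd refl]) (use e g1 g2 in "simp add: gr_iff")
 have snd_eq: "pls T (cmp T (pls T (cmp T (snd p) ?bs) (\<Delta> (fst p) zs)) (map fst (concat wss)))
 (\<Delta> (cmp T (fst p) ?bs) (concat wss))
 = signed K T ?s (pls T (cmp T (snd p) (map2 (cmp T) ?bs ?css)) (\<Delta> (fst p) (map2 (cmp X) zs wss)))"
 unfolding x pls_assoc[OF g5 g6 D_gr[OF cl2]]
 by (simp only: D_assoc[OF c len cw2] as[OF cs] signed_pls[OF g3 g4])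
 define M where "M = map2 (cmp X) zs wss"
 have "cmp X (cmp X p zs) (concat wss) = signed K X ?s (cmp X p M)"
 unfolding signed_sqz sqz_sel(9) fst_conv snd_conv m[folded M_def] as[OF ct] snd_eq[folded M_def] ..
 thus "cmp X (cmp X p zs) (concat wss)
 = signed K X (\<Sum>i<length zs. \<Sum>j<i. deg X (zs ! i) * sum_list (map (deg X) (wss ! j)))
 (cmp X p (map2 (cmp X) zs wss))"
 unfolding s_eq' M_def . }
 { fix \<pi> assume \<pi>: "\<pi> permutes {..<arity X p}"
 hence \<pi>': "\<pi> permutes {..<arity T (fst p)}" "\<pi> permutes {..<arity T (snd p)}"
 using s by (simp_all add: gr_iff)
 let ?bs = "map fst zs" and ?zs = "map (%j. zs ! \<pi> j) [0..<length zs]"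
 have lt: "\<pi> j < length zs" if "j < length zs" for j
 using c that permutes_in_image[OF \<pi>'(1), of j] by (simp add: comp2_def)
 hence m: "map fst ?zs = map (%j. ?bs ! \<pi> j) [0..<length ?bs]" by simp
 have B: "block_perm (map (arity T) ?bs) \<pi> permutes {..<tarity T ?bs}"
 by (rule block_perm_permutes) (use \<pi>'(1) c in "simp add: comp2_def")
 have el: "cmp T (perm T \<pi> u) ?bs = signed K T (koszul \<pi> (map (deg T) ?bs))
 (perm T (block_perm (map (arity T) ?bs) \<pi>) (cmp T u (map fst ?zs)))"
 if "composable T u ?bs" "\<pi> permutes {..<arity T u}" for u
 unfolding m by (rule equivariant_left[OF that])
 have com2: "comp2 T k (fst p) ?zs" using c lt by (auto simp: comp2_def)
 have ra: "sum_list (map f (map fst ?zs)) = sum_list (map f ?bs)" for f :: "'a => 'c::comm_monoid_add"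
 unfolding m by (rule composable_rearrange(2)[OF ct \<pi>'(1)])
 have g3: "cmp T (snd p) (map fst ?zs) : gr T (tarity T ?bs) (deg T (fst p) + tdeg T ?bs + k)"
 using snd_cmp_gr[OF com2 s] unfolding ra .
 have g4: "\<Delta> (fst p) ?zs : gr T (tarity T ?bs) (deg T (fst p) + tdeg T ?bs + k)"
 using D_gr[OF com2] unfolding ra .
 have m': "map (deg X) zs = map (deg T) ?bs" "map (arity X) zs = map (arity T) ?bs" by simp_all
 show "cmp X (perm X \<pi> p) zs = signed K X (koszul \<pi> (map (deg X) zs))
 (perm X (block_perm (map (arity X) zs) \<pi>) (cmp X p ?zs))"
 unfolding m' signed_sqz sqz_sel(7,9) fst_conv snd_conv el[OF ct \<pi>'(1)] el[OF cs \<pi>'(2)]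
 D_equivariant_left[OF c \<pi>'(1)] perm_pls[OF g3 g4 B]
 signed_pls[OF perm_gr[OF g3 B] perm_gr[OF g4 B]] .. }
 { fix \<tau>s assume len: "length \<tau>s = length zs" and \<tau>: "!!i. i < length zs ==> (\<tau>s ! i) permutes {..<arity X (zs ! i)}"
 let ?bs = "map fst zs"
 have \<tau>': "!!i. i < length zs ==> (\<tau>s ! i) permutes {..<arity T (fst (zs ! i))}" using \<tau> by simp
 have m: "map fst (map2 (perm X) \<tau>s zs) = map2 (perm T) \<tau>s ?bs"
 using len by (intro nth_equalityI) auto
 have S: "sum_perm (map (arity T) ?bs) \<tau>s permutes {..<tarity T ?bs}"
 using len \<tau>' by (intro sum_perm_permutes) auto
 have er: "cmp T u (map2 (perm T) \<tau>s ?bs) = perm T (sum_perm (map (arity T) ?bs) \<tau>s) (cmp T u ?bs)"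
 if "composable T u ?bs" for u
 using equivariant_right[OF that, of \<tau>s] len \<tau>' by simp
 have d: "\<Delta> (fst p) (map2 (perm X) \<tau>s zs) = perm T (sum_perm (map (arity T) ?bs) \<tau>s) (\<Delta> (fst p) zs)"
 using D_equivariant_right[OF c len \<tau>'] by simp
 have m': "map (arity X) zs = map (arity T) ?bs" by simp
 define M where "M = map2 (perm X) \<tau>s zs"
 have "cmp X p M = perm X (sum_perm (map (arity X) zs) \<tau>s) (cmp X p zs)"
 unfolding m' sqz_sel(7,9) fst_conv snd_conv m[folded M_def] d[folded M_def] er[OF ct] er[OF cs]
 perm_pls[OF g1 g2 S] ..
 thus "cmp X p (map2 (perm X) \<tau>s zs) = perm X (sum_perm (map (arity X) zs) \<tau>s) (cmp X p zs)"
 unfolding M_def . }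
next
 fix p assume "p : elts X"
 hence p: "fst p : elts T" "snd p : gr T (arity T (fst p)) (deg T (fst p) + k)" by (simp_all add: elts_pairs)
 have g: "cmp T (nul T (Suc 0) k) [fst p] = nul T (arity T (fst p)) (deg T (fst p) + k)"
 using cmp_nul_left[of "[fst p]" k] p by (simp add: add.commute)
 show "cmp X (unt X) [p] = p"
 using p D_unit_left[of p] by (simp add: elts_pairs unit_left g prod_eq_iff)
 have "cmp T (snd p) (replicate (arity T (fst p)) (unt T)) = snd p"
 using unit_right[of "snd p"] p by (simp add: gr_iff)
 thus "cmp X p (replicate (arity X p) (unt X)) = p"
 using p D_unit_right[OF p(1)] by (simp add: unit_right map_replicate prod_eq_iff)
qed
lemma fst_hom: "operad_hom K X T fst"
 by (rule operad_homI, rule smod_homI) (auto simp: gr_sqz)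

end

section \<open>Dual numbers and derivations\<close>

subsection \<open>Positions in a concatenation\<close>

definition offset :: "'a list list => nat => nat" where
 "offset xss i = length (concat (take i xss))"
lemma concat_split: "i < length xss ==> concat xss = concat (take i xss) @ xss ! i @ concat (drop (Suc i) xss)"
 by (metis id_take_nth_drop concat_append concat.simps(2))
lemma offset_nth: "i < length xss ==> r < length (xss ! i) ==> concat xss ! (offset xss i + r) = xss ! i ! r"
 by (subst concat_split[of i xss]) (simp_all add: offset_def nth_append)
lemma offset_update:
 assumes "i < length xss" "r < length (xss ! i)"
 shows "(concat xss)[offset xss i + r := x] = concat (xss[i := (xss ! i)[r := x]])"
proof -
 have "concat (xss[i := (xss ! i)[r := x]])
 = concat (take i xss) @ (xss ! i)[r := x] @ concat (drop (Suc i) xss)"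
 using assms by (simp add: upd_conv_take_nth_drop)
 moreover have "(concat xss)[offset xss i + r := x]
 = concat (take i xss) @ (xss ! i)[r := x] @ concat (drop (Suc i) xss)"
 using assms by (subst concat_split[of i xss]) (simp_all add: offset_def list_update_append)
 ultimately show ?thesis by simp
qed
lemma sum_list_take: "i \<le> length xs ==> (\<Sum>j<i. f (xs ! j)) = sum_list (map f (take i xs))"
 by (simp add: sum_list_sum_nth lessThan_atLeast0)
lemma offset_sum:
 fixes f :: "'a => 'b::comm_monoid_add"
 assumes "i < length xss" "r \<le> length (xss ! i)"
 shows "(\<Sum>j<offset xss i + r. f (concat xss ! j))
 = (\<Sum>j<i. sum_list (map f (xss ! j))) + (\<Sum>l<r. f (xss ! i ! l))"
proof -
 have s: "concat xss = concat (take i xss) @ xss ! i @ concat (drop (Suc i) xss)"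
 by (rule concat_split[OF assms(1)])
 have le: "offset xss i + r \<le> length (concat xss)" using assms by (subst s) (simp add: offset_def)
 have "take (offset xss i + r) (concat xss) = concat (take i xss) @ take r (xss ! i)"
 using assms by (subst s) (simp add: offset_def)
 hence "(\<Sum>j<offset xss i + r. f (concat xss ! j))
 = sum_list (map f (concat (take i xss))) + sum_list (map f (take r (xss ! i)))"
 by (simp add: sum_list_take[OF le])
 also have "sum_list (map f (concat (take i xss))) = (\<Sum>xs\<leftarrow>take i xss. sum_list (map f xs))"
 by (rule sum_list_map_concat)
 also have "... = (\<Sum>j<i. sum_list (map f (xss ! j)))"
 using assms(1) sum_list_take[of i xss "%xs. sum_list (map f xs)"] by simp
 finally show ?thesis using assms by (simp add: sum_list_take)
qed
lemma upt_concat: "[0..<length (concat xss)]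
 = concat (map (%i. map (%r. offset xss i + r) [0..<length (xss ! i)]) [0..<length xss])"
proof (induction xss rule: rev_induct)
 case (snoc xs xss)
 have A: "map (%i. map (%r. offset (xss @ [xs]) i + r) [0..<length ((xss @ [xs]) ! i)]) [0..<length (xss @ [xs])]
 = map (%i. map (%r. offset xss i + r) [0..<length (xss ! i)]) [0..<length xss]
 @ [map (%r. length (concat xss) + r) [0..<length xs]]"
 by (auto simp: offset_def nth_append)
 have B: "map (%r. length (concat xss) + r) [0..<length xs]
 = [length (concat xss)..<length (concat xss) + length xs]"
 by (intro nth_equalityI) auto
 have "[0..<length (concat (xss @ [xs]))] = [0..<length (concat xss)] @ [length (concat xss)..<length (concat xss) + length xs]"
 using upt_add_eq_append[of 0 "length (concat xss)" "length xs"] by simp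
 thus ?case by (simp only: A B concat_append concat.simps append_Nil2 snoc)
qed simp

subsection \<open>The Leibniz extension\<close>

definition mark :: "('a \<times> 'a) list => nat => 'a list" where
 "mark zs i = (map fst zs)[i := snd (zs ! i)]"

text \<open>Instances for pairs whose second entry has the degree lowered by one.\<close>

lemma gr_pairs_1: "gr (dsum P (shift 1 P)) n d = gr P n d \<times> gr P n (d - 1)"
 by (simp add: gr_dsum gr_shift)
lemma elts_pairs_1: "z : elts (dsum P (shift 1 P)) \<longleftrightarrow>
 fst z : elts P & snd z : gr P (arity P (fst z)) (deg P (fst z) - 1)"
 by (simp add: elts_dsum gr_shift)

definition pdeg :: "('k, 'a, 'm) smod_scheme => ('a \<times> 'b) list => nat => int" where
 "pdeg T zs i = (\<Sum>j<i. deg T (fst (zs ! j)))"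

definition leib_term :: "('k, 'z) ring_scheme => ('k, 'a, 'm) operad_scheme => 'a => ('a \<times> 'a) list => nat => 'a" where
 "leib_term K T a zs i = signed K T (deg T a + pdeg T zs i) (cmp T a (mark zs i))"

text \<open>The part of the Leibniz rule in which \<open>a\<close> is not differentiated: the sum of the composites of \<open>a\<close> in
  which one input is replaced by the second component of its pair, with Koszul signs.\<close>

definition leib :: "('k, 'z) ring_scheme => ('k, 'a, 'm) operad_scheme => 'a => ('a \<times> 'a) list => 'a" where
 "leib K T a zs = lsum T (tarity T (map fst zs))
 (deg T a + tdeg T (map fst zs) - 1) (map (leib_term K T a zs) [0..<length zs])"
abbreviation dual :: "('k, 'z) ring_scheme => ('k, 'a, 'm) operad_scheme => ('k, 'a \<times> 'a) operad" where
 "dual K T \<equiv> sqz T (- 1) (leib K T)"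
lemma length_mark [simp]: "length (mark zs i) = length zs"
 by (simp add: mark_def)
lemma mark_update: "i < length zs ==> j < length zs ==>
 mark (zs[i := w]) j = (mark zs j)[i := if i = j then snd w else fst w]"
 by (auto simp: mark_def map_update list_update_swap)
lemma mark_nth: "i < length zs ==> j < length zs ==> mark zs j ! i = (if i = j then snd (zs ! i) else fst (zs ! i))"
 by (auto simp: mark_def)
lemma pdeg_cong: "(!!j. j < i ==> deg T (fst (zs ! j)) = deg T (fst (ws ! j))) ==> pdeg T zs i = pdeg T ws i"
 by (simp add: pdeg_def)

context operad
begin
lemma mark_composable: "comp2 P k a zs ==> i < length zs ==> composable P a (mark zs i)"
 unfolding mark_def using comp2_nth[of P k a zs i] comp2_composable[of P k a zs]
 by (intro composable_update) (auto simp: gr_iff)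
lemma mark_arity: "comp2 P k a zs ==> i < length zs ==> map (arity P) (mark zs i) = map (arity P) (map fst zs)"
 unfolding mark_def using comp2_nth[of P k a zs i] by (intro map_update_eq) (auto simp: gr_iff)
lemma mark_deg: "comp2 P k a zs ==> i < length zs ==>
 map (deg P) (mark zs i) = (map (deg P) (map fst zs))[i := map (deg P) (map fst zs) ! i + k]"
 unfolding mark_def using comp2_nth[of P k a zs i] by (simp add: map_update gr_iff)
lemma mark_cmp_gr:
 assumes c: "comp2 P k a zs" and i: "i < length zs" and u: "u : gr P (arity P a) d"
 shows "cmp P u (mark zs i) : gr P (tarity P (map fst zs)) (d + tdeg P (map fst zs) + k)"
proof -
 have "composable P u (map fst zs)" by (rule composable_cong[OF comp2_composable[OF c] u])
 moreover have "snd (zs ! i) : gr P (arity P (map fst zs ! i)) (deg P (fst (zs ! i)) + k)"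
 using comp2_nth[OF c i] i by simp
 ultimately have "cmp P u ((map fst zs)[i := snd (zs ! i)]) : gr P (tarity P (map fst zs))
 (deg P u + tdeg P (map fst zs) - deg P (map fst zs ! i) + (deg P (fst (zs ! i)) + k))"
 using i by (intro cmp_update_gr) auto
 thus ?thesis using i u by (simp add: mark_def gr_iff)
qed
lemma leib_term_gr:
 assumes c: "comp2 P (- 1) a zs" and i: "i < length zs"
 shows "leib_term K P a zs i : gr P (tarity P (map fst zs)) (deg P a + tdeg P (map fst zs) - 1)"
 unfolding leib_term_def
 using signed_gr[OF mark_cmp_gr[OF c i elts_gr]] c by (simp add: comp2_def)
lemma leib_gr: "comp2 P (- 1) a zs ==> leib K P a zs
 : gr P (tarity P (map fst zs)) (deg P a + tdeg P (map fst zs) - 1)"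
 unfolding leib_def by (rule lsum_map_gr) (use leib_term_gr in auto)
lemma leib_pls_left:
 assumes c: "comp2 P (- 1) a zs" and a': "a' : comp_of P a"
 shows "leib K P (pls P a a') zs = pls P (leib K P a zs) (leib K P a' zs)"
proof -
 have a: "a : comp_of P a" using c by (simp add: comp2_def elts_gr)
 have c': "comp2 P (- 1) a' zs" using c a' by (simp add: comp2_def gr_iff)
 have d: "deg P (pls P a a') = deg P a" "deg P a' = deg P a" using pls_gr[OF a a'] a' by (simp_all add: gr_iff)
 have "leib_term K P (pls P a a') zs i = pls P (leib_term K P a zs i) (leib_term K P a' zs i)" if i: "i < length zs" for i
 unfolding leib_term_def d cmp_pls_left[OF mark_composable[OF c i] a']
 by (rule signed_pls[OF mark_cmp_gr[OF c i a] mark_cmp_gr[OF c i a']])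
 hence t: "map (leib_term K P (pls P a a') zs) [0..<length zs]
 = map (%i. pls P (leib_term K P a zs i) (leib_term K P a' zs i)) [0..<length zs]" by simp
 show ?thesis unfolding leib_def d t
 by (rule lsum_pls) (use leib_term_gr[OF c] leib_term_gr[OF c', unfolded d(2)] in auto)
qed
lemma leib_scale_left:
 assumes c: "comp2 P (- 1) a zs" and x: "x : carrier K"
 shows "leib K P (scale P x a) zs = scale P x (leib K P a zs)"
proof -
 have a: "a : comp_of P a" using c by (simp add: comp2_def elts_gr)
 have d: "deg P (scale P x a) = deg P a" using scale_gr[OF x a] by (simp add: gr_iff)
 have "leib_term K P (scale P x a) zs i = scale P x (leib_term K P a zs i)" if i: "i < length zs" for i
 unfolding leib_term_def d comp_scale_left[OF mark_composable[OF c i] x]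
 using mark_cmp_gr[OF c i a] x by (intro signed_scale) (auto simp: gr_iff)
 hence t: "map (leib_term K P (scale P x a) zs) [0..<length zs]
 = map (%i. scale P x (leib_term K P a zs i)) [0..<length zs]" by simp
 show ?thesis unfolding leib_def d t by (rule lsum_scale) (use leib_term_gr[OF c] x in auto)
qed
lemma mark_slot:
 assumes c: "comp2 P k a zs" and i: "i < length zs" and j: "j < length zs"
 shows "arity P (mark zs j ! i) = arity P (fst (zs ! i))"
 "deg P (mark zs j ! i) = deg P (fst (zs ! i)) + (if i = j then k else 0)"
 using comp2_nth[OF c i] comp2_nth[OF c j] by (auto simp: mark_nth[OF i j] gr_iff)
lemma comp2_update: "comp2 P k a zs ==> w : elts (pairs P k) ==> comp2 P k a (zs[i := w])"
 using set_update_subset_insert[of zs i w] by (auto simp: comp2_def)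
lemma map_fst_update_eq: "i < length zs ==> f (fst v) = f (fst (zs ! i)) ==>
 map f (map fst (zs[i := v])) = map f (map fst zs)"
 by (simp add: map_update list_update_same_conv)
lemma leib_pls_right:
 assumes c: "comp2 P (- 1) a zs" and i: "i < length zs"
 and w: "w : gr (pairs P (- 1)) (arity P (fst (zs ! i))) (deg P (fst (zs ! i)))"
 shows "leib K P a (zs[i := pls (pairs P (- 1)) (zs ! i) w]) = pls P (leib K P a zs) (leib K P a (zs[i := w]))"
proof -
 let ?z = "zs ! i" and ?p = "pls (pairs P (- 1)) (zs ! i) w"
 have wg: "fst w : gr P (arity P (fst ?z)) (deg P (fst ?z))" "snd w : gr P (arity P (fst ?z)) (deg P (fst ?z) - 1)"
 using w by (auto simp: gr_pairs_1)
 have zg: "fst ?z : gr P (arity P (fst ?z)) (deg P (fst ?z))" "snd ?z : gr P (arity P (fst ?z)) (deg P (fst ?z) - 1)"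
 using comp2_nth[OF c i] by (auto simp: gr_iff)
 have we: "w : elts (pairs P (- 1))" using wg by (simp add: elts_pairs_1 gr_iff)
 note c' = comp2_update[OF c we, of i]
 have pd: "pdeg P (zs[i := v]) j = pdeg P zs j" if "deg P (fst v) = deg P (fst ?z)" for v j
 using that i by (intro pdeg_cong) (auto simp: nth_list_update)
 have dp: "deg P (fst ?p) = deg P (fst ?z)" "arity P (fst ?p) = arity P (fst ?z)"
 "deg P (fst w) = deg P (fst ?z)" "arity P (fst w) = arity P (fst ?z)"
 using pls_gr[OF zg(1) wg(1)] wg by (auto simp: gr_iff)
 note m = map_fst_update_eq[OF i, where f = "deg P", OF dp(1)] map_fst_update_eq[OF i, where f = "arity P", OF dp(2)]
 map_fst_update_eq[OF i, where f = "deg P", OF dp(3)] map_fst_update_eq[OF i, where f = "arity P", OF dp(4)]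
 have t: "leib_term K P a (zs[i := ?p]) j = pls P (leib_term K P a zs j) (leib_term K P a (zs[i := w]) j)"
 if j: "j < length zs" for j
 proof -
 note s = mark_slot[OF c i j]
 let ?e = "deg P (fst ?z) + (if i = j then - 1 else 0)"
 let ?u = "if i = j then snd ?z else fst ?z" and ?v = "if i = j then snd w else fst w"
 have u: "?u : gr P (arity P (mark zs j ! i)) ?e" and v: "?v : gr P (arity P (mark zs j ! i)) ?e"
 using zg wg s by auto
 have ii: "i < length (mark zs j)" using i by simp
 note com = mark_composable[OF c j]
 have up: "mark (zs[i := ?p]) j = (mark zs j)[i := pls P ?u ?v]"
 by (simp add: mark_update[OF i j])
 have mz: "mark zs j = (mark zs j)[i := ?u]" using mark_nth[OF i j] by (metis list_update_id)
 have mw: "mark (zs[i := w]) j = (mark zs j)[i := ?v]"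
 by (rule mark_update[OF i j])
 have "cmp P a (mark (zs[i := ?p]) j) = pls P (cmp P a (mark zs j)) (cmp P a (mark (zs[i := w]) j))"
 unfolding up mw using cmp_pls_right[OF com ii u v] mz by simp
 thus ?thesis
 using signed_pls[OF mark_cmp_gr[OF c j elts_gr] mark_cmp_gr[OF c' _ elts_gr, of j, unfolded m(3) m(4)]] j c
 unfolding leib_term_def pd[OF dp(1)] pd[OF dp(3)] by (simp add: comp2_def)
 qed
 have tt: "map (leib_term K P a (zs[i := ?p])) [0..<length zs]
 = map (%j. pls P (leib_term K P a zs j) (leib_term K P a (zs[i := w]) j)) [0..<length zs]"
 by (rule map_upt_cong) (rule t)
 show ?thesis
 unfolding leib_def m(1) m(2) m(3) m(4) length_list_update tt
 by (rule lsum_pls) (use leib_term_gr[OF c] leib_term_gr[OF c', unfolded m(3) m(4)] in auto)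
qed
lemma leib_scale_right:
 assumes c: "comp2 P (- 1) a zs" and i: "i < length zs" and x: "x : carrier K"
 shows "leib K P a (zs[i := scale (pairs P (- 1)) x (zs ! i)]) = scale P x (leib K P a zs)"
proof -
 let ?z = "zs ! i" and ?p = "scale (pairs P (- 1)) x (zs ! i)"
 have zg: "fst ?z : gr P (arity P (fst ?z)) (deg P (fst ?z))" "snd ?z : gr P (arity P (fst ?z)) (deg P (fst ?z) - 1)"
 using comp2_nth[OF c i] by (auto simp: gr_iff)
 have pd: "pdeg P (zs[i := v]) j = pdeg P zs j" if "deg P (fst v) = deg P (fst ?z)" for v j
 using that i by (intro pdeg_cong) (auto simp: nth_list_update)
 have dp: "deg P (fst ?p) = deg P (fst ?z)" "arity P (fst ?p) = arity P (fst ?z)"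
 using scale_gr[OF x zg(1)] by (auto simp: gr_iff)
 note m = map_fst_update_eq[OF i, where f = "deg P", OF dp(1)] map_fst_update_eq[OF i, where f = "arity P", OF dp(2)]
 have t: "leib_term K P a (zs[i := ?p]) j = scale P x (leib_term K P a zs j)"
 if j: "j < length zs" for j
 proof -
 let ?u = "if i = j then snd ?z else fst ?z"
 have u: "?u : elts P" using zg by (auto simp: gr_iff)
 have ii: "i < length (mark zs j)" using i by simp
 note com = mark_composable[OF c j]
 have up: "mark (zs[i := ?p]) j = (mark zs j)[i := scale P x ?u]"
 by (simp add: mark_update[OF i j])
 have mz: "mark zs j = (mark zs j)[i := ?u]" using mark_nth[OF i j] by (metis list_update_id)
 have "cmp P a (mark (zs[i := ?p]) j) = scale P x (cmp P a (mark zs j))"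
 unfolding up using cmp_scale_right[OF com ii u x] mz by simp
 thus ?thesis
 using signed_scale[OF comp_closed[OF com] x] unfolding leib_term_def pd[OF dp(1)] by simp
 qed
 have tt: "map (leib_term K P a (zs[i := ?p])) [0..<length zs] = map (%j. scale P x (leib_term K P a zs j)) [0..<length zs]"
 by (rule map_upt_cong) (rule t)
 show ?thesis unfolding leib_def m(1) m(2) length_list_update tt
 by (rule lsum_scale) (use leib_term_gr[OF c] x in auto)
qed
lemma leib_unit_left:
 assumes "z : elts (pairs P (- 1))" shows "leib K P (unt P) [z] = snd z"
 using assms unit_left[of "snd z"] pls_nul[of "snd z" "arity P (fst z)" "deg P (fst z) - 1"]
 by (simp add: elts_pairs_1 leib_def leib_term_def mark_def pdeg_def deg_unit gr_iff)
lemma leib_unit_right: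
 assumes "a : elts P"
 shows "leib K P a (replicate (arity P a) (unt P, nul P 1 (- 1))) = nul P (arity P a) (deg P a + - 1)"
proof -
 let ?zs = "replicate (arity P a) (unt P, nul P 1 (- 1))"
 have c: "comp2 P (- 1) a ?zs"
 using assms by (auto simp: comp2_def elts_pairs_1 unit_closed arity_unit deg_unit)
 note cc = comp2_composable[OF c]
 have s: "tarity P (map fst ?zs) = arity P a" "tdeg P (map fst ?zs) = 0"
 by (simp_all add: arity_unit deg_unit map_replicate sum_list_replicate)
 have t: "leib_term K P a ?zs i = nul P (arity P a) (deg P a + - 1)" if i: "i < length ?zs" for i
 unfolding leib_term_def mark_def using cmp_nul_right[OF cc, of i "- 1"] i
 unfolding s by (simp add: arity_unit deg_unit)
 have e: "deg P a + 0 - 1 = deg P a + - 1" by simp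
 show ?thesis unfolding leib_def s e by (rule lsum_nul, rule t) simp
qed
lemma leib_equivariant_right:
 assumes c: "comp2 P (- 1) a zs" and len: "length \<tau>s = length zs"
 and \<tau>: "!!i. i < length zs ==> (\<tau>s ! i) permutes {..<arity P (fst (zs ! i))}"
 shows "leib K P a (map2 (perm (pairs P (- 1))) \<tau>s zs)
 = perm P (sum_perm (map (arity P) (map fst zs)) \<tau>s) (leib K P a zs)"
proof -
 let ?ws = "map2 (perm (pairs P (- 1))) \<tau>s zs" and ?S = "sum_perm (map (arity P) (map fst zs)) \<tau>s"
 have pg: "perm P (\<tau>s ! i) (fst (zs ! i)) : comp_of P (fst (zs ! i))" if "i < length zs" for i
 using comp2_nth[OF c that] \<tau>[OF that] by (intro perm_gr elts_gr) auto
 have m: "map (arity P) (map fst ?ws) = map (arity P) (map fst zs)" "map (deg P) (map fst ?ws) = map (deg P) (map fst zs)"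
 using pg len by (auto intro!: nth_equalityI simp: gr_iff)
 have pd: "pdeg P ?ws j = pdeg P zs j" if "j < length zs" for j
 using pg len that by (intro pdeg_cong) (auto simp: gr_iff)
 have S: "?S permutes {..<tarity P (map fst zs)}"
 using len \<tau> by (intro sum_perm_permutes) auto
 have t: "leib_term K P a ?ws i = perm P ?S (leib_term K P a zs i)" if i: "i < length zs" for i
 proof -
 have mm: "mark ?ws i = map2 (perm P) \<tau>s (mark zs i)"
 using len i by (intro nth_equalityI) (auto simp: mark_def nth_list_update)
 have tau: "\<tau>s ! j permutes {..<arity P (mark zs i ! j)}" if "j < length (mark zs i)" for j
 using that i mark_slot(1)[OF c _ i] \<tau> by simp
 have eq: "cmp P a (mark ?ws i) = perm P ?S (cmp P a (mark zs i))"
 unfolding mm using equivariant_right[OF mark_composable[OF c i], of \<tau>s] len tau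
 by (simp add: mark_arity[OF c i])
 have "a : elts P" using c by (simp add: comp2_def)
 note q = signed_perm[OF mark_cmp_gr[OF c i elts_gr[OF this]] S]
 show ?thesis unfolding leib_term_def pd[OF i] eq by (rule q)
 qed
 have tt: "map (leib_term K P a ?ws) [0..<length zs] = map (%i. perm P ?S (leib_term K P a zs i)) [0..<length zs]"
 by (rule map_upt_cong) (rule t)
 have lw: "length ?ws = length zs" using len by simp
 show ?thesis unfolding leib_def m lw tt by (rule lsum_perm[OF _ S]) (use leib_term_gr[OF c] in auto)
qed

end
lemma offset_map: "offset (map (map f) xss) i = offset xss i"
 unfolding offset_def length_concat take_map by (simp add: comp_def)

text \<open>Lowering the degree of one entry by one changes the Koszul exponent by the degrees of the entries
  that it is exchanged with.\<close>

lemma koszul_lower: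
 assumes \<pi>: "\<pi> permutes {..<length ds}" and k: "k < length ds"
 shows "even ((\<Sum>j<\<pi> k. ds ! j) + koszul \<pi> (ds[\<pi> k := ds ! \<pi> k - 1]) - koszul \<pi> ds - (\<Sum>l<k. ds ! \<pi> l))"
proof -
 let ?n = "length ds"
 define f where "f j = ds ! \<pi> j" for j
 have inj: "\<pi> i = \<pi> j \<longleftrightarrow> i = j" for i j using permutes_inj[OF \<pi>] by (auto dest: injD)
 have lt: "\<pi> j < ?n \<longleftrightarrow> j < ?n" for j using permutes_in_image[OF \<pi>, of j] by simp
 have g: "ds[\<pi> k := ds ! \<pi> k - 1] ! \<pi> j = f j - (if j = k then 1 else 0)" for j
 using lt[of k] k by (auto simp: f_def nth_list_update inj)
 let ?A = "%i j. if j = k then (if \<pi> k < \<pi> i then f i else 0) else 0"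
 let ?B = "%i j. if i = k then (if \<pi> j < \<pi> k then f j else 0) else 0"
 have k0: "koszul \<pi> ds = (\<Sum>j<?n. \<Sum>i<j. if \<pi> j < \<pi> i then f i * f j else 0)"
 unfolding koszul_def f_def ..
 have k1: "koszul \<pi> (ds[\<pi> k := ds ! \<pi> k - 1]) = (\<Sum>j<?n. \<Sum>i<j.
 if \<pi> j < \<pi> i then (f i - (if i = k then 1 else 0)) * (f j - (if j = k then 1 else 0)) else 0)"
 unfolding koszul_def g length_list_update ..
 have "koszul \<pi> (ds[\<pi> k := ds ! \<pi> k - 1]) - koszul \<pi> ds
 = (\<Sum>j<?n. \<Sum>i<j. (if \<pi> j < \<pi> i then (f i - (if i = k then 1 else 0)) * (f j - (if j = k then 1 else 0)) else 0)
 - (if \<pi> j < \<pi> i then f i * f j else 0))"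
 by (simp only: k0 k1 sum_subtractf)
 also have "... = (\<Sum>j<?n. \<Sum>i<j. - (?A i j + ?B i j))"
 by (intro sum.cong refl) (auto simp: algebra_simps)
 also have "... = - ((\<Sum>j<?n. \<Sum>i<j. ?A i j) + (\<Sum>j<?n. \<Sum>i<j. ?B i j))"
 by (simp only: sum_negf sum.distrib)
 also have "(\<Sum>j<?n. \<Sum>i<j. ?A i j) = (\<Sum>j<?n. if j = k then (\<Sum>i<k. if \<pi> k < \<pi> i then f i else 0) else 0)"
 by (intro sum.cong) auto
 also have "... = (\<Sum>i<k. if \<pi> k < \<pi> i then f i else 0)" using k by simp
 also have "(\<Sum>j<?n. \<Sum>i<j. ?B i j) = (\<Sum>j<?n. if k < j then (if \<pi> j < \<pi> k then f j else 0) else 0)"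
 by (intro sum.cong refl) simp
 also have "... = (\<Sum>j\<in>{k<..<?n}. if \<pi> j < \<pi> k then f j else 0)"
 by (simp add: sum.If_cases) (intro sum.cong, auto)
 finally have K: "koszul \<pi> (ds[\<pi> k := ds ! \<pi> k - 1]) - koszul \<pi> ds
 = - ((\<Sum>i<k. if \<pi> k < \<pi> i then f i else 0) + (\<Sum>j\<in>{k<..<?n}. if \<pi> j < \<pi> k then f j else 0))" .
 have "(\<Sum>j<\<pi> k. ds ! j) = (\<Sum>j<?n. if j < \<pi> k then ds ! j else 0)"
 using lt[of k] k by (simp add: sum.If_cases) (intro sum.cong, auto)
 also have "... = (\<Sum>m<?n. if \<pi> m < \<pi> k then f m else 0)"
 unfolding f_def by (rule sum.permute[OF \<pi>, unfolded comp_def])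
 also have "{..<?n} = {..<k} \<union> {k} \<union> {k<..<?n}" using k by auto
 also have "(\<Sum>m\<in>{..<k} \<union> {k} \<union> {k<..<?n}. if \<pi> m < \<pi> k then f m else 0)
 = (\<Sum>m<k. if \<pi> m < \<pi> k then f m else 0) + (\<Sum>m\<in>{k<..<?n}. if \<pi> m < \<pi> k then f m else 0)"
 by (subst sum.union_disjoint; (subst sum.union_disjoint)?) auto
 finally have P: "(\<Sum>j<\<pi> k. ds ! j)
 = (\<Sum>m<k. if \<pi> m < \<pi> k then f m else 0) + (\<Sum>m\<in>{k<..<?n}. if \<pi> m < \<pi> k then f m else 0)" .
 have Q: "(\<Sum>l<k. ds ! \<pi> l) = (\<Sum>l<k. if \<pi> l < \<pi> k then f l else 0) + (\<Sum>l<k. if \<pi> k < \<pi> l then f l else 0)"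
 unfolding sum.distrib[symmetric]
 by (intro sum.cong refl) (use inj in "auto simp: f_def not_less order_le_less")
 have "(\<Sum>j<\<pi> k. ds ! j) + koszul \<pi> (ds[\<pi> k := ds ! \<pi> k - 1]) - koszul \<pi> ds - (\<Sum>l<k. ds ! \<pi> l)
 = - 2 * (\<Sum>l<k. if \<pi> k < \<pi> l then f l else 0)"
 using K P Q by simp
 thus ?thesis by simp
qed

context operad
begin
lemma leib_equivariant_left:
 assumes c: "comp2 P (- 1) a zs" and \<pi>: "\<pi> permutes {..<arity P a}"
 shows "leib K P (perm P \<pi> a) zs = signed K P (koszul \<pi> (map (deg P) (map fst zs)))
 (perm P (block_perm (map (arity P) (map fst zs)) \<pi>) (leib K P a (map (%j. zs ! \<pi> j) [0..<length zs])))"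
proof -
 let ?n = "length zs" and ?bs = "map fst zs" and ?ws = "map (%j. zs ! \<pi> j) [0..<length zs]"
 let ?ds = "map (deg P) ?bs" and ?B = "block_perm (map (arity P) ?bs) \<pi>"
 let ?N = "tarity P ?bs" and ?D = "deg P a + sum_list ?ds - 1"
 have a: "a : comp_of P a" and len: "?n = arity P a" using c by (simp_all add: comp2_def elts_gr)
 have \<pi>n: "\<pi> permutes {..<?n}" using \<pi> len by simp
 have lt: "\<pi> j < ?n" if "j < ?n" for j using permutes_in_image[OF \<pi>n, of j] that by simp
 have inj: "\<pi> i = \<pi> j \<longleftrightarrow> i = j" for i j using permutes_inj[OF \<pi>] by (auto dest: injD)
 have m: "map fst ?ws = map (%j. ?bs ! \<pi> j) [0..<length ?bs]" using lt by simp
 have ra: "sum_list (map f (map fst ?ws)) = sum_list (map f ?bs)" for f :: "'a => 'c::comm_monoid_add"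
 unfolding m by (rule composable_rearrange(2)[OF comp2_composable[OF c] \<pi>])
 have cw: "comp2 P (- 1) a ?ws" using c lt by (auto simp: comp2_def)
 have B: "?B permutes {..<?N}"
 by (rule block_perm_permutes) (use \<pi>n in simp)
 have dp: "deg P (perm P \<pi> a) = deg P a" using perm_gr[OF a \<pi>] by (simp add: gr_iff)
 have cp: "comp2 P (- 1) (perm P \<pi> a) zs" using c perm_gr[OF a \<pi>] by (simp add: comp2_def gr_iff)
 have wg: "leib_term K P a ?ws k : gr P ?N ?D" if "k < ?n" for k
 using leib_term_gr[OF cw, of k] that unfolding ra by simp
 have t: "leib_term K P (perm P \<pi> a) zs (\<pi> k)
 = signed K P (koszul \<pi> ?ds) (perm P ?B (leib_term K P a ?ws k))" if k: "k < ?n" for k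
 proof -
 have sk: "\<pi> k < ?n" by (rule lt[OF k])
 have e1: "map (%j. mark zs (\<pi> k) ! \<pi> j) [0..<length (mark zs (\<pi> k))] = mark ?ws k"
 using k lt by (intro nth_equalityI) (auto simp: mark_nth mark_nth[of _ ?ws] inj)
 have g: "cmp P a (mark ?ws k) : gr P ?N (deg P a + sum_list ?ds + - 1)"
 using mark_cmp_gr[OF cw _ a, of k] k unfolding ra by simp
 have pdk: "pdeg P zs (\<pi> k) = (\<Sum>j<\<pi> k. ?ds ! j)" "pdeg P ?ws k = (\<Sum>l<k. ?ds ! \<pi> l)"
 unfolding pdeg_def using sk k lt less_trans[of _ k "length zs"] less_trans[of _ "\<pi> k" "length zs"]
 by (auto intro!: sum.cong)
 have md: "map (deg P) (mark zs (\<pi> k)) = ?ds[\<pi> k := ?ds ! \<pi> k - 1]"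
 using mark_deg[OF c sk] by simp
 have ev: "even ((\<Sum>j<\<pi> k. ?ds ! j) + koszul \<pi> (?ds[\<pi> k := ?ds ! \<pi> k - 1]) - koszul \<pi> ?ds - (\<Sum>l<k. ?ds ! \<pi> l))"
 by (rule koszul_lower) (use \<pi>n k in simp_all)
 have "cmp P (perm P \<pi> a) (mark zs (\<pi> k))
 = signed K P (koszul \<pi> (?ds[\<pi> k := ?ds ! \<pi> k - 1])) (perm P ?B (cmp P a (mark ?ws k)))"
 using equivariant_left[OF mark_composable[OF c sk] \<pi>] unfolding md mark_arity[OF c sk] e1 .
 hence "leib_term K P (perm P \<pi> a) zs (\<pi> k)
 = signed K P (deg P a + (\<Sum>j<\<pi> k. ?ds ! j) + koszul \<pi> (?ds[\<pi> k := ?ds ! \<pi> k - 1])) (perm P ?B (cmp P a (mark ?ws k)))"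
 using perm_gr[OF g B] unfolding leib_term_def dp pdk by (simp add: gr_iff)
 also have "... = signed K P (koszul \<pi> ?ds + (deg P a + (\<Sum>l<k. ?ds ! \<pi> l))) (perm P ?B (cmp P a (mark ?ws k)))"
 by (rule signed_cong) (use ev in "simp add: algebra_simps")
 also have "... = signed K P (koszul \<pi> ?ds) (perm P ?B (leib_term K P a ?ws k))"
 proof -
 have pe: "perm P ?B (cmp P a (mark ?ws k)) : elts P" using perm_gr[OF g B] by (simp only: gr_iff)
 show ?thesis unfolding leib_term_def pdk signed_perm[OF g B, symmetric]
 by (rule signed_signed[OF pe, symmetric])
 qed
 finally show ?thesis .
 qed
 have "lsum P ?N ?D (map (leib_term K P (perm P \<pi> a) zs) [0..<?n])
 = lsum P ?N ?D (map (%k. leib_term K P (perm P \<pi> a) zs (\<pi> k)) [0..<?n])"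
 by (rule lsum_reindex[OF \<pi>n, symmetric]) (use leib_term_gr[OF cp] dp in auto)
 also have "map (%k. leib_term K P (perm P \<pi> a) zs (\<pi> k)) [0..<?n]
 = map (%k. signed K P (koszul \<pi> ?ds) (perm P ?B (leib_term K P a ?ws k))) [0..<?n]"
 by (rule map_upt_cong) (rule t)
 also have "lsum P ?N ?D ... = signed K P (koszul \<pi> ?ds) (lsum P ?N ?D (map (%k. perm P ?B (leib_term K P a ?ws k)) [0..<?n]))"
 by (rule lsum_signed) (use perm_gr[OF wg B] in auto)
 also have "lsum P ?N ?D (map (%k. perm P ?B (leib_term K P a ?ws k)) [0..<?n])
 = perm P ?B (lsum P ?N ?D (map (leib_term K P a ?ws) [0..<?n]))"
 by (rule lsum_perm[OF _ B]) (use wg in auto)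
 finally show ?thesis unfolding leib_def dp ra by simp
qed

text \<open>The terms on both sides are indexed by the entries of the concatenated list, that is, by a block and
  a position in it.  It remains to compare the signs.\<close>

lemma leib_assoc:
 assumes c: "comp2 P (- 1) a zs" and len: "length wss = length zs"
 and cw: "!!i. i < length zs ==> comp2 P (- 1) (fst (zs ! i)) (wss ! i)"
 shows "pls P (cmp P (leib K P a zs) (map fst (concat wss))) (leib K P (cmp P a (map fst zs)) (concat wss))
 = signed K P (\<Sum>i<length zs. \<Sum>j<i. deg P (fst (zs ! i)) * sum_list (map (deg P) (map fst (wss ! j))))
 (leib K P a (map2 (cmp (dual K P)) zs wss))"
proof -
 let ?n = "length zs" and ?bs = "map fst zs" and ?css = "map (map fst) wss"
 define C where "C j = sum_list (map (deg P) (map fst (wss ! j)))" for j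
 define s where "s = (\<Sum>i<?n. \<Sum>j<i. deg P (fst (zs ! i)) * C j)"
 define N where "N = sum_list (map (arity P) (concat ?css))"
 define D where "D = deg P a + tdeg P ?bs + sum_list (map (deg P) (concat ?css)) - 1"
 define ms where "ms = map2 (cmp P) ?bs ?css"
 have a: "a : elts P" "a : comp_of P a" and lena: "?n = arity P a"
 using c by (simp_all add: comp2_def elts_gr)
 note cb = comp2_composable[OF c]
 have ccs: "composable P (?bs ! i) (?css ! i)" if "i < ?n" for i
 using comp2_composable[OF cw[OF that]] that len by simp
 have bg: "fst (zs ! i) : comp_of P (fst (zs ! i))"
 and yg: "snd (zs ! i) : gr P (arity P (fst (zs ! i))) (deg P (fst (zs ! i)) - 1)" if "i < ?n" for i
 using comp2_nth[OF c that] by (auto simp: gr_iff)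
 have len_ms: "length ms = ?n" using len by (simp add: ms_def)
 have ms_nth: "ms ! i = cmp P (fst (zs ! i)) (map fst (wss ! i))" if "i < ?n" for i
 using that len by (simp add: ms_def)
 have cms: "composable P a ms" "composable P (cmp P a ?bs) (concat ?css)"
 unfolding ms_def using sig_alg.composable_map2_cmp[OF sig_alg cb, of ?css] ccs len by auto
 have msg: "ms ! i : gr P (sum_list (map (arity P) (map fst (wss ! i)))) (deg P (fst (zs ! i)) + C i)" if "i < ?n" for i
 unfolding ms_nth[OF that] C_def using ccs[OF that] that len by (intro cmp_gr) auto
 \<comment> \<open>the value of one summand in the total expression\<close>
 have gN: "tarity P ms = N" "deg P a + tdeg P ms - 1 = D"
 proof -
 have "N = arity P (cmp P (cmp P a ?bs) (concat ?css))" unfolding N_def by (simp only: arity_comp[OF cms(2)])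
 also have "cmp P (cmp P a ?bs) (concat ?css) = signed K P (\<Sum>i<length ?bs. \<Sum>j<i. deg P (?bs ! i) * sum_list (map (deg P) (?css ! j))) (cmp P a ms)"
 unfolding ms_def by (rule assoc[OF cb]) (use ccs len in auto)
 also have "arity P ... = tarity P ms"
 using signed_gr[OF cmp_gr[OF cms(1) refl refl]] by (simp add: gr_iff)
 finally show "tarity P ms = N" by simp
 have "D = deg P (cmp P (cmp P a ?bs) (concat ?css)) - 1" unfolding D_def
 by (simp only: deg_comp[OF cms(2)] deg_comp[OF cb])
 also have "cmp P (cmp P a ?bs) (concat ?css) = signed K P (\<Sum>i<length ?bs. \<Sum>j<i. deg P (?bs ! i) * sum_list (map (deg P) (?css ! j))) (cmp P a ms)"
 unfolding ms_def by (rule assoc[OF cb]) (use ccs len in auto)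
 also have "deg P ... = deg P a + tdeg P ms"
 using signed_gr[OF cmp_gr[OF cms(1) refl refl]] by (simp add: gr_iff)
 finally show "deg P a + tdeg P ms - 1 = D" by simp
 qed
 have slot: "cmp P a (ms[i := x]) : gr P N D"
 if i: "i < ?n" and x: "x : gr P (sum_list (map (arity P) (map fst (wss ! i)))) (deg P (fst (zs ! i)) + C i - 1)" for i x
 proof -
 have "x : gr P (arity P (ms ! i)) (deg P (fst (zs ! i)) + C i - 1)" using x msg[OF i] by (simp add: gr_iff)
 from cmp_update_gr[OF cms(1) _ this] i len_ms msg[OF i]
 show ?thesis unfolding gN(1) gN(2)[symmetric] by (simp add: gr_iff algebra_simps)
 qed
 have sb: "(\<Sum>i<?n. \<Sum>j<i. d i * C j) = s + (\<Sum>j<i0. e * C j)"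
 if "i0 < ?n" "!!i. i < ?n ==> d i = deg P (fst (zs ! i)) + (if i = i0 then e else 0)" for d i0 e
 proof -
 have "(\<Sum>i<?n. \<Sum>j<i. d i * C j) = (\<Sum>i<?n. (\<Sum>j<i. deg P (fst (zs ! i)) * C j) + (if i = i0 then \<Sum>j<i0. e * C j else 0))"
 using that(2) by (intro sum.cong refl) (auto simp: sum.distrib[symmetric] algebra_simps)
 also have "... = s + (\<Sum>j<i0. e * C j)" using that(1) by (simp add: sum.distrib s_def)
 finally show ?thesis .
 qed
 have sc: "(\<Sum>i<?n. \<Sum>j<i. deg P (fst (zs ! i)) * c j) = s + e * (\<Sum>i\<in>{j0<..<?n}. deg P (fst (zs ! i)))"
 if "j0 < ?n" "!!j. j < ?n ==> c j = C j + (if j = j0 then e else 0)" for c j0 e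
 proof -
 have "(\<Sum>i<?n. \<Sum>j<i. deg P (fst (zs ! i)) * c j)
 = (\<Sum>i<?n. (\<Sum>j<i. deg P (fst (zs ! i)) * C j) + (if j0 < i then e * deg P (fst (zs ! i)) else 0))"
 proof (rule sum.cong[OF refl])
 fix i assume i: "i : {..<?n}"
 have "(\<Sum>j<i. deg P (fst (zs ! i)) * c j) = (\<Sum>j<i. deg P (fst (zs ! i)) * C j + (if j = j0 then e * deg P (fst (zs ! i)) else 0))"
 using that(2) i by (intro sum.cong refl) (auto simp: algebra_simps)
 thus "(\<Sum>j<i. deg P (fst (zs ! i)) * c j) = (\<Sum>j<i. deg P (fst (zs ! i)) * C j) + (if j0 < i then e * deg P (fst (zs ! i)) else 0)"
 by (simp add: sum.distrib)
 qed
 also have "... = s + (\<Sum>i<?n. if j0 < i then e * deg P (fst (zs ! i)) else 0)" by (simp add: sum.distrib s_def)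
 also have "(\<Sum>i<?n. if j0 < i then e * deg P (fst (zs ! i)) else 0) = e * (\<Sum>i\<in>{j0<..<?n}. deg P (fst (zs ! i)))"
 unfolding sum_distrib_left by (simp add: sum.If_cases) (intro sum.cong, auto)
 finally show ?thesis .
 qed
 define U where "U i = cmp P a (ms[i := cmp P (snd (zs ! i)) (map fst (wss ! i))])" for i
 define V where "V i r = cmp P a (ms[i := cmp P (fst (zs ! i)) (mark (wss ! i) r)])" for i r
 define E where "E i = s + deg P a + pdeg P zs i + (\<Sum>j<i. C j)" for i
 have Ug: "cmp P (snd (zs ! i)) (map fst (wss ! i)) : gr P (sum_list (map (arity P) (map fst (wss ! i)))) (deg P (fst (zs ! i)) + C i - 1)"
 and U: "U i : gr P N D" if i: "i < ?n" for i
 proof -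
 have "composable P (snd (zs ! i)) (map fst (wss ! i))" by (rule composable_cong[OF comp2_composable[OF cw[OF i]] yg[OF i]])
 thus g: "cmp P (snd (zs ! i)) (map fst (wss ! i)) : gr P (sum_list (map (arity P) (map fst (wss ! i)))) (deg P (fst (zs ! i)) + C i - 1)"
 by (rule cmp_gr) (use yg[OF i] in "auto simp: C_def gr_iff")
 show "U i : gr P N D" unfolding U_def by (rule slot[OF i g])
 qed
 have Vg: "cmp P (fst (zs ! i)) (mark (wss ! i) r) : gr P (sum_list (map (arity P) (map fst (wss ! i)))) (deg P (fst (zs ! i)) + C i - 1)"
 and V: "V i r : gr P N D" if i: "i < ?n" and r: "r < length (wss ! i)" for i r
 proof -
 show g: "cmp P (fst (zs ! i)) (mark (wss ! i) r) : gr P (sum_list (map (arity P) (map fst (wss ! i)))) (deg P (fst (zs ! i)) + C i - 1)"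
 using mark_cmp_gr[OF cw[OF i] r bg[OF i]] by (simp add: C_def)
 show "V i r : gr P N D" unfolding V_def by (rule slot[OF i g])
 qed
 \<comment> \<open>first summand on the left: the marked entry is one of the \<open>bs\<close>\<close>
 have T1: "cmp P (leib K P a zs) (map fst (concat wss)) = lsum P N D (map (%i. signed K P (E i) (U i)) [0..<?n])"
 proof -
 have lc: "length (concat ?css) = tarity P ?bs" using cms(2) by (simp add: composable_def arity_comp[OF cb])
 have "cmp P (leib K P a zs) (concat ?css) = lsum P N D (map (%i. cmp P (leib_term K P a zs i) (concat ?css)) [0..<?n])"
 using cmp_lsum_left[of "concat ?css" "[0..<?n]" "leib_term K P a zs" "deg P a + tdeg P ?bs - 1"]
 cms(2) leib_term_gr[OF c]
 unfolding leib_def N_def D_def lc by (simp add: composable_def algebra_simps)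
 also have "map (%i. cmp P (leib_term K P a zs i) (concat ?css)) [0..<?n] = map (%i. signed K P (E i) (U i)) [0..<?n]"
 proof (rule map_upt_cong)
 fix i assume i: "i < ?n"
 note cm = mark_composable[OF c i]
 have cm2: "composable P (mark zs i ! j) (?css ! j)" if "j < length (mark zs i)" for j
 using that ccs[of j] mark_slot(1)[OF c _ i, of j] composable_nth[OF cm, of j] by (simp add: composable_def)
 have "composable P (cmp P a (mark zs i)) (concat ?css)"
 using sig_alg.composable_map2_cmp(2)[OF sig_alg cm, of ?css] cm2 len by simp
 hence "cmp P (leib_term K P a zs i) (concat ?css)
 = signed K P (deg P a + pdeg P zs i) (cmp P (cmp P a (mark zs i)) (concat ?css))"
 unfolding leib_term_def by (rule cmp_signed_left)
 also have "cmp P (cmp P a (mark zs i)) (concat ?css)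
 = signed K P (\<Sum>i'<length (mark zs i). \<Sum>j<i'. deg P (mark zs i ! i') * sum_list (map (deg P) (?css ! j)))
 (cmp P a (map2 (cmp P) (mark zs i) ?css))"
 by (rule assoc[OF cm]) (use cm2 len in auto)
 also have "map2 (cmp P) (mark zs i) ?css = ms[i := cmp P (snd (zs ! i)) (map fst (wss ! i))]"
 using len len_ms i by (intro nth_equalityI) (auto simp: nth_list_update ms_nth mark_nth)
 also have "cmp P a (ms[i := cmp P (snd (zs ! i)) (map fst (wss ! i))]) = U i" by (simp only: U_def)
 also have "(\<Sum>i'<length (mark zs i). \<Sum>j<i'. deg P (mark zs i ! i') * sum_list (map (deg P) (?css ! j)))
 = (\<Sum>i'<?n. \<Sum>j<i'. deg P (mark zs i ! i') * C j)"
 using len by (auto simp: C_def intro!: sum.cong)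
 also have "... = s + (\<Sum>j<i. - 1 * C j)"
 by (rule sb[OF i]) (use mark_slot(2)[OF c _ i] in auto)
 also have "signed K P (deg P a + pdeg P zs i) (signed K P (s + (\<Sum>j<i. - 1 * C j)) (U i))
 = signed K P (deg P a + pdeg P zs i + (s + (\<Sum>j<i. - 1 * C j))) (U i)"
 using U[OF i] by (simp add: gr_iff)
 also have "... = signed K P (E i) (U i)"
 by (rule signed_cong) (simp add: E_def sum_negf)
 finally show "cmp P (leib_term K P a zs i) (concat ?css) = signed K P (E i) (U i)" .
 qed
 finally show ?thesis by (simp add: map_concat)
 qed
 \<comment> \<open>second summand: the marked entry is one of the \<open>cs\<close>\<close>
 have T2: "leib K P (cmp P a ?bs) (concat wss)
 = lsum P N D (map (%i. lsum P N D (map (%r. signed K P (E i + (deg P (fst (zs ! i)) + pdeg P (wss ! i) r)) (V i r)) [0..<length (wss ! i)])) [0..<?n])"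
 proof -
 let ?t = "leib_term K P (cmp P a ?bs) (concat wss)"
 have t: "?t (offset wss i + r) = signed K P (E i + (deg P (fst (zs ! i)) + pdeg P (wss ! i) r)) (V i r)"
 if i: "i < ?n" and r: "r < length (wss ! i)" for i r
 proof -
 let ?dss = "?css[i := mark (wss ! i) r]"
 have iw: "i < length wss" using i len by simp
 have mk: "mark (concat wss) (offset wss i + r) = concat ?dss"
 proof -
 have "mark (concat wss) (offset wss i + r) = (concat ?css)[offset ?css i + r := snd (wss ! i ! r)]"
 unfolding mark_def offset_nth[OF iw r] offset_map by (simp add: map_concat)
 also have "... = concat (?css[i := (?css ! i)[r := snd (wss ! i ! r)]])"
 by (rule offset_update) (use iw r in auto)
 also have "(?css ! i)[r := snd (wss ! i ! r)] = mark (wss ! i) r" using iw by (simp add: mark_def)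
 finally show ?thesis .
 qed
 have pd: "pdeg P (concat wss) (offset wss i + r) = (\<Sum>j<i. C j) + pdeg P (wss ! i) r"
 using offset_sum[OF iw, of r "%z. deg P (fst z)"] r by (simp add: pdeg_def C_def comp_def)
 have cm: "composable P (fst (zs ! i)) (mark (wss ! i) r)" by (rule mark_composable[OF cw[OF i] r])
 have cd: "composable P (?bs ! j) (?dss ! j)" if "j < length ?bs" for j
 using that ccs[of j] cm len by (cases "j = i") auto
 have "cmp P (cmp P a ?bs) (concat ?dss)
 = signed K P (\<Sum>i'<length ?bs. \<Sum>j<i'. deg P (?bs ! i') * sum_list (map (deg P) (?dss ! j))) (cmp P a (map2 (cmp P) ?bs ?dss))"
 by (rule assoc[OF cb]) (use cd len in auto)
 also have "map2 (cmp P) ?bs ?dss = ms[i := cmp P (fst (zs ! i)) (mark (wss ! i) r)]"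
 using len len_ms i by (intro nth_equalityI) (auto simp: nth_list_update ms_nth)
 also have "(\<Sum>i'<length ?bs. \<Sum>j<i'. deg P (?bs ! i') * sum_list (map (deg P) (?dss ! j)))
 = (\<Sum>i'<?n. \<Sum>j<i'. deg P (fst (zs ! i')) * sum_list (map (deg P) (?dss ! j)))"
 by (auto intro!: sum.cong)
 also have "... = s + - 1 * (\<Sum>i'\<in>{i<..<?n}. deg P (fst (zs ! i')))"
 proof (rule sc[OF i])
 fix j assume j: "j < ?n"
 have "sum_list (map (deg P) (mark (wss ! i) r)) = C i - 1"
 proof -
 have r': "r < length (map (deg P) (map fst (wss ! i)))" using r by simp
 have "sum_list (xs[r := xs ! r + - 1]) = sum_list xs - 1" if "r < length xs" for xs :: "int list"
 using that by (induction xs arbitrary: r) (auto split: nat.splits)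
 from this[OF r'] show ?thesis unfolding mark_deg[OF cw[OF i] r] C_def .
 qed
 thus "sum_list (map (deg P) (?dss ! j)) = C j + (if j = i then - 1 else 0)"
 using j len by (simp add: nth_list_update C_def)
 qed
 finally have e: "cmp P (cmp P a ?bs) (concat ?dss)
 = signed K P (s + - 1 * (\<Sum>i'\<in>{i<..<?n}. deg P (fst (zs ! i')))) (V i r)" by (simp add: V_def)
 have split: "tdeg P ?bs = pdeg P zs i + deg P (fst (zs ! i)) + (\<Sum>i'\<in>{i<..<?n}. deg P (fst (zs ! i')))"
 proof -
 have "tdeg P ?bs = (\<Sum>j<?n. deg P (fst (zs ! j)))" by (simp add: sum_list_sum_nth lessThan_atLeast0)
 also have "{..<?n} = insert i ({..<i} \<union> {i<..<?n})" using i by auto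
 also have "(\<Sum>j\<in>insert i ({..<i} \<union> {i<..<?n}). deg P (fst (zs ! j)))
 = deg P (fst (zs ! i)) + ((\<Sum>j<i. deg P (fst (zs ! j))) + (\<Sum>j\<in>{i<..<?n}. deg P (fst (zs ! j))))"
 by (subst sum.insert; (subst sum.union_disjoint)?) auto
 finally show ?thesis by (simp add: pdeg_def)
 qed
 have "?t (offset wss i + r) = signed K P (deg P (cmp P a ?bs) + ((\<Sum>j<i. C j) + pdeg P (wss ! i) r)
 + (s + - 1 * (\<Sum>i'\<in>{i<..<?n}. deg P (fst (zs ! i'))))) (V i r)"
 unfolding leib_term_def mk pd e using V[OF i r] by (simp add: gr_iff)
 also have "... = signed K P (E i + (deg P (fst (zs ! i)) + pdeg P (wss ! i) r)) (V i r)"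
 by (rule signed_cong) (simp add: deg_comp[OF cb] split[simplified] E_def)
 finally show ?thesis .
 qed
 have g: "signed K P e (V i r) : gr P N D" if "i < ?n" "r < length (wss ! i)" for i r e
 using V[OF that] by (rule signed_gr)
 have ar: "sum_list (map (arity P) (map fst (concat wss))) = N"
 "deg P (cmp P a ?bs) + sum_list (map (deg P) (map fst (concat wss))) - 1 = D"
 by (simp_all add: N_def D_def map_concat deg_comp[OF cb])
 have "map ?t [0..<length (concat wss)]
 = concat (map (%i. map (%r. ?t (offset wss i + r)) [0..<length (wss ! i)]) [0..<?n])"
 unfolding upt_concat len by (simp add: map_concat comp_def)
 also have "map (%i. map (%r. ?t (offset wss i + r)) [0..<length (wss ! i)]) [0..<?n]
 = map (%i. map (%r. signed K P (E i + (deg P (fst (zs ! i)) + pdeg P (wss ! i) r)) (V i r)) [0..<length (wss ! i)]) [0..<?n]"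
 using t by simp
 finally have "leib K P (cmp P a ?bs) (concat wss) = lsum P N D (concat (map (%i. map (%r.
 signed K P (E i + (deg P (fst (zs ! i)) + pdeg P (wss ! i) r)) (V i r)) [0..<length (wss ! i)]) [0..<?n]))"
 unfolding leib_def ar by simp
 also have "... = lsum P N D (map (lsum P N D) (map (%i. map (%r.
 signed K P (E i + (deg P (fst (zs ! i)) + pdeg P (wss ! i) r)) (V i r)) [0..<length (wss ! i)]) [0..<?n]))"
 by (rule lsum_concat) (use g in auto)
 finally show ?thesis by (simp add: comp_def)
 qed
 \<comment> \<open>the right-hand side\<close>
 define Z where "Z = map2 (cmp (dual K P)) zs wss"
 have lenZ: "length Z = ?n" using len by (simp add: Z_def)
 have Znth: "Z ! i = (ms ! i, pls P (cmp P (snd (zs ! i)) (map fst (wss ! i))) (leib K P (fst (zs ! i)) (wss ! i)))" if "i < ?n" for i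
 using that len by (simp add: Z_def ms_nth)
 have fZ: "map fst Z = ms" using Znth lenZ len_ms by (intro nth_equalityI) auto
 have pdZ: "pdeg P Z i = pdeg P zs i + (\<Sum>j<i. C j)" if "i < ?n" for i
 using that msg Znth unfolding pdeg_def by (simp add: gr_iff sum.distrib)
 have R: "leib_term K P a Z i = signed K P (- s) (pls P (signed K P (E i) (U i))
 (lsum P N D (map (%r. signed K P (E i + (deg P (fst (zs ! i)) + pdeg P (wss ! i) r)) (V i r)) [0..<length (wss ! i)])))"
 if i: "i < ?n" for i
 proof -
 let ?A = "sum_list (map (arity P) (map fst (wss ! i)))" and ?d = "deg P (fst (zs ! i)) + C i - 1"
 have im: "i < length ms" using i len_ms by simp
 have ai: "?A = arity P (ms ! i)" using msg[OF i] by (simp add: gr_iff)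
 have lg: "leib_term K P (fst (zs ! i)) (wss ! i) r : gr P (arity P (ms ! i)) ?d" if "r < length (wss ! i)" for r
 using leib_term_gr[OF cw[OF i] that] by (simp add: C_def ai[symmetric])
 have lg': "leib K P (fst (zs ! i)) (wss ! i) : gr P (arity P (ms ! i)) ?d"
 using leib_gr[OF cw[OF i]] by (simp add: C_def ai[symmetric])
 have dd: "deg P a + tdeg P ms - deg P (ms ! i) + ?d = D"
 using msg[OF i] gN(2) by (simp add: gr_iff)
 have "mark Z i = ms[i := pls P (cmp P (snd (zs ! i)) (map fst (wss ! i))) (leib K P (fst (zs ! i)) (wss ! i))]"
 using Znth[OF i] fZ by (simp add: mark_def)
 hence "cmp P a (mark Z i) = pls P (U i) (cmp P a (ms[i := leib K P (fst (zs ! i)) (wss ! i)]))"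
 using cmp_pls_right[OF cms(1) im Ug[OF i, unfolded ai] lg'] by (simp add: U_def)
 also have "leib K P (fst (zs ! i)) (wss ! i) = lsum P (arity P (ms ! i)) ?d (map (leib_term K P (fst (zs ! i)) (wss ! i)) [0..<length (wss ! i)])"
 unfolding leib_def C_def ai[symmetric] by simp
 also have "cmp P a (ms[i := ...]) = lsum P N D (map (%r. cmp P a (ms[i := leib_term K P (fst (zs ! i)) (wss ! i) r])) [0..<length (wss ! i)])"
 using cmp_lsum_right[OF cms(1) im, of "[0..<length (wss ! i)]" "leib_term K P (fst (zs ! i)) (wss ! i)" ?d] lg
 unfolding dd gN(1) by simp
 also have "map (%r. cmp P a (ms[i := leib_term K P (fst (zs ! i)) (wss ! i) r])) [0..<length (wss ! i)]
 = map (%r. signed K P (deg P (fst (zs ! i)) + pdeg P (wss ! i) r) (V i r)) [0..<length (wss ! i)]"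
 proof (rule map_upt_cong)
 fix r assume r: "r < length (wss ! i)"
 show "cmp P a (ms[i := leib_term K P (fst (zs ! i)) (wss ! i) r]) = signed K P (deg P (fst (zs ! i)) + pdeg P (wss ! i) r) (V i r)"
 unfolding leib_term_def V_def
 by (rule cmp_signed_right[OF cms(1) im]) (use Vg[OF i r] in "simp add: gr_iff")
 qed
 finally have cm: "cmp P a (mark Z i) = pls P (U i)
 (lsum P N D (map (%r. signed K P (deg P (fst (zs ! i)) + pdeg P (wss ! i) r) (V i r)) [0..<length (wss ! i)]))" .
 have vg: "signed K P e (V i r) : gr P N D" if "r : set [0..<length (wss ! i)]" for r e
 using V[OF i, of r] that signed_gr by simp
 have eE: "deg P a + pdeg P Z i = - s + E i" by (simp add: pdZ[OF i] E_def)
 have "signed K P (E i) (cmp P a (mark Z i)) = pls P (signed K P (E i) (U i))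
 (lsum P N D (map (%r. signed K P (E i) (signed K P (deg P (fst (zs ! i)) + pdeg P (wss ! i) r) (V i r))) [0..<length (wss ! i)]))"
 proof -
 let ?h = "%r. signed K P (deg P (fst (zs ! i)) + pdeg P (wss ! i) r) (V i r)"
 have ls: "lsum P N D (map (%r. signed K P (E i) (?h r)) [0..<length (wss ! i)])
 = signed K P (E i) (lsum P N D (map ?h [0..<length (wss ! i)]))"
 by (rule lsum_signed) (rule vg)
 have lg: "lsum P N D (map ?h [0..<length (wss ! i)]) : gr P N D" by (rule lsum_map_gr) (rule vg)
 show ?thesis unfolding cm signed_pls[OF U[OF i] lg] ls ..
 qed
 also have "map (%r. signed K P (E i) (signed K P (deg P (fst (zs ! i)) + pdeg P (wss ! i) r) (V i r))) [0..<length (wss ! i)]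
 = map (%r. signed K P (E i + (deg P (fst (zs ! i)) + pdeg P (wss ! i) r)) (V i r)) [0..<length (wss ! i)]"
 using V[OF i] by (simp add: gr_iff)
 finally have "signed K P (E i) (cmp P a (mark Z i)) = pls P (signed K P (E i) (U i))
 (lsum P N D (map (%r. signed K P (E i + (deg P (fst (zs ! i)) + pdeg P (wss ! i) r)) (V i r)) [0..<length (wss ! i)]))" .
 moreover have "cmp P a (mark Z i) : elts P"
 proof -
 have "pls P (U i) (lsum P N D (map (%r. signed K P (deg P (fst (zs ! i)) + pdeg P (wss ! i) r) (V i r)) [0..<length (wss ! i)]))
 : gr P N D" by (rule pls_gr[OF U[OF i] lsum_map_gr]) (rule vg)
 thus ?thesis unfolding cm by (simp only: gr_iff)
 qed
 ultimately show ?thesis unfolding leib_term_def eE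
 using signed_signed[of "cmp P a (mark Z i)" "- s" "E i"] by simp
 qed
 have T1g: "signed K P (E i) (U i) : gr P N D" if "i : set [0..<?n]" for i
 using U[of i] that signed_gr by simp
 have T2g: "lsum P N D (map (%r. signed K P (E i + (deg P (fst (zs ! i)) + pdeg P (wss ! i) r)) (V i r)) [0..<length (wss ! i)]) : gr P N D"
 if "i : set [0..<?n]" for i using V[of i] that by (intro lsum_map_gr signed_gr) simp
 let ?F = "%i. pls P (signed K P (E i) (U i))
 (lsum P N D (map (%r. signed K P (E i + (deg P (fst (zs ! i)) + pdeg P (wss ! i) r)) (V i r)) [0..<length (wss ! i)]))"
 have Fg: "?F i : gr P N D" if "i : set [0..<?n]" for i by (rule pls_gr[OF T1g[OF that] T2g[OF that]])
 have "leib K P a Z = lsum P N D (map (%i. signed K P (- s) (?F i)) [0..<?n])"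
 unfolding leib_def fZ gN lenZ using R by (intro arg_cong[where f = "lsum P N D"] map_upt_cong) blast
 also have "... = signed K P (- s) (lsum P N D (map ?F [0..<?n]))" by (rule lsum_signed[OF Fg])
 finally have "signed K P s (leib K P a Z) = lsum P N D (map ?F [0..<?n])"
 using lsum_map_gr[of "[0..<?n]" ?F N D] Fg by (simp add: gr_iff)
 also have "... = pls P (cmp P (leib K P a zs) (map fst (concat wss))) (leib K P (cmp P a ?bs) (concat wss))"
 unfolding T1 T2 by (rule lsum_pls[OF T1g T2g])
 finally show ?thesis by (simp add: s_def C_def Z_def)
qed
lemma square_zero_leib: "square_zero K P (- 1) (leib K P)"
 using leib_gr leib_pls_left leib_scale_left leib_pls_right leib_scale_right leib_unit_left leib_unit_right
 leib_assoc leib_equivariant_left leib_equivariant_right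
 by (intro square_zero.intro square_zero_axioms.intro operad_axioms) simp_all

end
lemma (in operad) leib_term_nth:
 assumes "i < length bs"
 shows "leib_term K P a (map (%b. (f b, g b)) bs) i
 = signed K P (deg P a + (\<Sum>j<i. deg P (f (bs ! j)))) (cmp P a ((map f bs)[i := g (bs ! i)]))"
 using assms by (simp add: leib_term_def mark_def pdeg_def comp_def)
lemma (in operad) comp2_pairs:
 assumes "composable P a (map f bs)" "!!b. b : set bs ==> g b : gr P (arity P (f b)) (deg P (f b) + k)"
 shows "comp2 P k a (map (%b. (f b, g b)) bs)"
 using assms by (auto simp: comp2_def composable_def elts_pairs)
lemma (in operad) leib_eq_finsum:
 assumes c: "composable P a (map f bs)" and g: "!!b. b : set bs ==> g b : gr P (arity P (f b)) (deg P (f b) - 1)"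
 and t: "!!i. i < length bs ==> t i = signed K P (deg P a + (\<Sum>j<i. deg P (f (bs ! j)))) (cmp P a ((map f bs)[i := g (bs ! i)]))"
 and n: "n = sum_list (map (arity P) (map f bs))" and d: "d = deg P a + sum_list (map (deg P) (map f bs)) - 1"
 shows "(\<Oplus>\<^bsub>component P n d\<^esub> i\<in>{..<length bs}. t i) = leib K P a (map (%b. (f b, g b)) bs)"
proof -
 let ?zs = "map (%b. (f b, g b)) bs"
 have z: "comp2 P (- 1) a ?zs" by (rule comp2_pairs[OF c]) (use g in simp)
 have m: "map fst ?zs = map f bs" by simp
 have tt: "t i = leib_term K P a ?zs i" if "i < length bs" for i
 using t[OF that] leib_term_nth[OF that] by simp
 have g: "t i : gr P n d" if "i < length bs" for i
 using leib_term_gr[OF z, of i] that unfolding tt[OF that] m n d by simp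
 have "(\<Oplus>\<^bsub>component P n d\<^esub> i\<in>{..<length bs}. t i) = lsum P n d (map t [0..<length bs])"
 by (rule finsum_eq_lsum[OF g])
 also have "map t [0..<length bs] = map (leib_term K P a ?zs) [0..<length bs]" by (rule map_upt_cong) (rule tt)
 finally show ?thesis unfolding leib_def m n d by simp
qed

text \<open>The Leibniz rule, and the formulation of derivations as morphisms to the dual numbers.\<close>

context operad
begin
lemma derivation_iff:
 assumes D: "smod_hom K P (shift 1 P) D"
 shows "derivation K P D \<longleftrightarrow> (\<forall>a bs. composable P a bs -->
 D (cmp P a bs) = pls P (cmp P (D a) bs) (leib K P a (graph D bs)))"
proof -
 have g: "D b : gr P (arity P b) (deg P b - 1)" if "b : elts P" for b
 using smod_hom_gr[OF D elts_gr[OF that]] by (simp add: gr_shift)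
 have "(\<Oplus>\<^bsub>component P (tarity P bs) (deg P a + tdeg P bs - 1)\<^esub>
 i\<in>{..<length bs}. signed K P (deg P a + (\<Sum>j<i. deg P (bs ! j))) (cmp P a (bs[i := D (bs ! i)])))
 = leib K P a (graph D bs)" if "composable P a bs" for a bs
 by (rule leib_eq_finsum) (use that g in "auto simp: composable_def")
 thus ?thesis using D by (simp add: derivation_def)
qed
lemma derivation_gr: "derivation K P D ==> x : gr P n d ==> D x : gr P n (d - 1)"
 using smod_hom_gr[of K P "shift 1 P" D x n d] by (simp add: derivation_def gr_shift)
lemma derivation_cmp: "derivation K P D ==> composable P a bs ==>
 D (cmp P a bs) = pls P (cmp P (D a) bs) (leib K P a (graph D bs))"
 using derivation_iff[of D] by (simp add: derivation_def)
lemma derivation_unt: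
 assumes "derivation K P D" shows "D (unt P) = nul P 1 (- 1)"
proof -
 have g: "D (unt P) : gr P 1 (- 1)" using derivation_gr[OF assms unt_gr] by simp
 have "D (cmp P (unt P) [unt P]) = pls P (cmp P (D (unt P)) [unt P]) (leib K P (unt P) (map (%b. (b, D b)) [unt P]))"
 by (rule derivation_cmp[OF assms]) (simp add: composable_def unit_closed arity_unit)
 also have "cmp P (D (unt P)) [unt P] = D (unt P)"
 using unit_right[of "D (unt P)"] g by (simp add: gr_iff)
 also have "leib K P (unt P) (map (%b. (b, D b)) [unt P]) = D (unt P)"
 using leib_unit_left[of "(unt P, D (unt P))"] g by (simp add: elts_pairs_1 unit_closed arity_unit deg_unit)
 finally have "pls P (D (unt P)) (D (unt P)) = D (unt P)" by (simp add: unit_left unit_closed)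
 hence "pls P (D (unt P)) (D (unt P)) = pls P (D (unt P)) (nul P 1 (- 1))" using g by simp
 thus ?thesis by (rule pls_left_cancel[OF g g nul_gr])
qed
lemma operad_dual: "operad K (dual K P)"
 using square_zero.operad_sqz[OF square_zero_leib] .
lemma derivation_hom:
 assumes "derivation K P D" shows "operad_hom K P (dual K P) (%x. (x, D x))"
proof (rule operad_homI)
 have D: "smod_hom K P (shift 1 P) D" using assms by (simp add: derivation_def)
 show "smod_hom K P (dual K P) (%x. (x, D x))"
 using smod_hom_pls[OF D] smod_hom_perm[OF D] smod_hom_scale[OF D] derivation_gr[OF assms]
 by (intro smod_homI) (auto simp: gr_sqz gr_iff[of _ P])
 show "(unt P, D (unt P)) = unt (dual K P)" using derivation_unt[OF assms] by simp
 fix a bs assume "composable P a bs"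
 thus "(cmp P a bs, D (cmp P a bs)) = cmp (dual K P) (a, D a) (map (%x. (x, D x)) bs)"
 using derivation_cmp[OF assms] by (simp add: comp_def)
qed
lemma hom_derivation:
 assumes \<phi>: "operad_hom K P (dual K P) \<phi>" and fst: "!!x. x : elts P ==> fst (\<phi> x) = x"
 shows "derivation K P (%x. snd (\<phi> x))"
proof -
 note s = operad_hom_smod[OF \<phi>]
 have D: "smod_hom K P (shift 1 P) (%x. snd (\<phi> x))"
 using smod_hom_gr[OF s] smod_hom_pls[OF s] smod_hom_scale[OF s] smod_hom_perm[OF s]
 by (intro smod_homI) (auto simp: gr_sqz gr_shift gr_iff[of _ P] mem_Times_iff)
 have p: "\<phi> x = (x, snd (\<phi> x))" if "x : elts P" for x using fst[OF that] by (metis prod.collapse)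
 have "snd (\<phi> (cmp P a bs)) = pls P (cmp P (snd (\<phi> a)) bs) (leib K P a (map (%b. (b, snd (\<phi> b))) bs))"
 if c: "composable P a bs" for a bs
 proof -
 have m: "map \<phi> bs = map (%b. (b, snd (\<phi> b))) bs" using c p by (auto simp: composable_def)
 have "a : elts P" using c by (simp add: composable_def)
 thus ?thesis unfolding operad_hom_cmp[OF \<phi> c] m using fst by (simp add: comp_def)
 qed
 thus ?thesis using derivation_iff[OF D] by blast
qed
lemma derivation_eq_on_opspan:
 assumes "derivation K P D" "derivation K P D'" "X \<subseteq> elts P" "!!x. x : X ==> D x = D' x" "x : opspan K P X"
 shows "D x = D' x"
 using hom_eq_on_opspan[OF op_homI[OF operad_axioms operad_dual derivation_hom[OF assms(1)]]
 op_homI[OF operad_axioms operad_dual derivation_hom[OF assms(2)]] assms(3) _ assms(5)] assms(4) by simp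
lemma derivation_cong:
 assumes "derivation K P D" "!!x. x : elts P ==> D' x = D x" shows "derivation K P D'"
proof -
 have D: "smod_hom K P (shift 1 P) D'"
 using smod_hom_cong[of K P "shift 1 P" D D'] assms smodule_axioms by (simp add: derivation_def)
 have "D' (cmp P a bs) = pls P (cmp P (D' a) bs) (leib K P a (map (%b. (b, D' b)) bs))" if c: "composable P a bs" for a bs
 proof -
 have m: "map (%b. (b, D' b)) bs = graph D bs" using c assms(2) by (auto simp: composable_def)
 show ?thesis
 by (simp only: m derivation_cmp[OF assms(1) c] assms(2)[OF comp_closed[OF c]] assms(2)[OF composable_elts[OF c]])
 qed
 thus ?thesis using derivation_iff[OF D] by blast
qed

end
lemma (in op_hom) hom_leib:
 assumes c: "comp2 P (- 1) a zs"
 shows "f (leib K P a zs) = leib K Q (f a) (map (map_prod f f) zs)" (is "_ = leib K Q (f a) ?ws")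
proof -
 note cb = comp2_composable[OF c]
 have m: "map fst ?ws = map f (map fst zs)" by simp
 have a: "a : elts P" using c by (simp add: comp2_def)
 have t: "f (leib_term K P a zs i) = leib_term K Q (f a) ?ws i" if i: "i < length zs" for i
 proof -
 have mk: "mark ?ws i = map f (mark zs i)" using i by (simp add: mark_def map_update)
 have pd: "pdeg Q ?ws i = pdeg P zs i"
 using i comp2_nth[OF c] unfolding pdeg_def by (intro sum.cong) (auto simp: hom_grade)
 have "cmp P a (mark zs i) : elts P" using P.comp_closed[OF P.mark_composable[OF c i]] .
 thus ?thesis unfolding leib_term_def mk pd
 using sm.hom_signed hom_cmp[OF P.mark_composable[OF c i]] hom_grade(2)[OF a] by simp
 qed
 have e: "map f (map (leib_term K P a zs) [0..<length zs]) = map (leib_term K Q (f a) ?ws) [0..<length ?ws]"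
 using t by simp
 have "f (leib K P a zs) = lsum Q (tarity P (map fst zs)) (deg P a + tdeg P (map fst zs) - 1)
 (map f (map (leib_term K P a zs) [0..<length zs]))"
 unfolding leib_def by (rule sm.hom_lsum) (use P.leib_term_gr[OF c] in auto)
 thus ?thesis unfolding leib_def[of K Q] m e map_hom_grade'[OF cb] hom_grade(2)[OF a] .
qed
lemma (in op_hom) dual_hom: "operad_hom K (dual K P) (dual K Q) (map_prod f f)"
proof (rule operad_homI)
 show "smod_hom K (dual K P) (dual K Q) (map_prod f f)"
 by (rule smod_homI) (auto simp: gr_sqz hom_gr hom_pls[of _ _ _] hom_perm hom_scale gr_iff[of _ P])
 show "map_prod f f (unt (dual K P)) = unt (dual K Q)" by (simp add: hom_unt)
 fix p zs assume "composable (dual K P) p zs"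
 hence c: "comp2 P (- 1) (fst p) zs" and s: "snd p : gr P (arity P (fst p)) (deg P (fst p) + - 1)"
 by (simp_all only: composable_sqz)
 interpret sz: square_zero K P "- 1" "leib K P" by (rule P.square_zero_leib)
 note cs = sz.composable_snd[OF c s]
 show "map_prod f f (cmp (dual K P) p zs) = cmp (dual K Q) (map_prod f f p) (map (map_prod f f) zs)"
 using hom_cmp[OF comp2_composable[OF c]] hom_cmp[OF cs] hom_leib[OF c]
 hom_pls[OF sz.snd_cmp_gr[OF c s] sz.D_gr[OF c]]
 by (simp add: comp_def)
qed

text \<open>Applying the Leibniz rule twice gives zero: the terms with two marked entries cancel in pairs,
  because the second differentiation passes over one more odd symbol in one of the two orders.\<close>

lemma (in operad) leib_square:
 assumes c: "comp2 P (- 1) a zs" and x: "x : gr P (arity P a) (deg P a - 1)"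
 and n: "n = tarity P (map fst zs)" and d: "d = deg P a + tdeg P (map fst zs) - 2"
 shows "pls P (leib K P x zs) (lsum P n d (map (%i. signed K P (deg P a + pdeg P zs i)
 (pls P (cmp P x (mark zs i))
 (leib K P a (zs[i := (snd (zs ! i), nul P (arity P (fst (zs ! i))) (deg P (fst (zs ! i)) - 2))])))) [0..<length zs]))
 = nul P n d"
proof -
 let ?z = "%i. zs[i := (snd (zs ! i), nul P (arity P (fst (zs ! i))) (deg P (fst (zs ! i)) - 2))]"
 let ?e = "%i. deg P a + pdeg P zs i" and ?r = "[0..<length zs]"
 have a: "a : comp_of P a" using c by (simp add: comp2_def elts_gr)
 have cx: "comp2 P (- 1) x zs" using c x by (simp add: comp2_def gr_iff)
 have yg: "snd (zs ! i) : gr P (arity P (fst (zs ! i))) (deg P (fst (zs ! i)) - 1)" if "i < length zs" for i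
 using comp2_nth[OF c that] by simp
 have cz: "comp2 P (- 1) a (?z i)" if i: "i < length zs" for i
 by (rule comp2_update[OF c]) (use yg[OF i] in "simp add: elts_pairs_1 gr_iff")
 have mz: "map (arity P) (map fst (?z i)) = map (arity P) (map fst zs)"
 "sum_list (map (deg P) (map fst (?z i))) = tdeg P (map fst zs) - 1" if i: "i < length zs" for i
 proof -
 show "map (arity P) (map fst (?z i)) = map (arity P) (map fst zs)"
 by (rule map_fst_update_eq[OF i]) (use yg[OF i] in "simp add: gr_iff")
 have A: "map (deg P) (map fst (?z i)) = (map (deg P) (map fst zs))[i := map (deg P) (map fst zs) ! i + - 1]"
 using i yg[OF i] by (simp add: map_update gr_iff)
 have B: "sum_list (xs[i := xs ! i + - 1]) = sum_list xs - 1" if "i < length xs" for xs :: "int list"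
 using that by (induction xs arbitrary: i) (auto split: nat.splits)
 show "sum_list (map (deg P) (map fst (?z i))) = tdeg P (map fst zs) - 1"
 unfolding A by (rule B) (use i in simp)
 qed
 have xg: "cmp P x (mark zs i) : gr P n d" if i: "i < length zs" for i
 using mark_cmp_gr[OF c i x] unfolding n d by (simp add: algebra_simps)
 have tg: "leib_term K P a (?z i) j : gr P n d" if "i < length zs" "j < length zs" for i j
 using leib_term_gr[OF cz[OF that(1)], of j] that(2) unfolding mz[OF that(1)] n d by (simp add: algebra_simps)
 have lz: "leib K P a (?z i) = lsum P n d (map (leib_term K P a (?z i)) ?r)" if i: "i < length zs" for i
 proof -
 have "deg P a + (tdeg P (map fst zs) - 1) - 1 = d" by (simp add: d)
 thus ?thesis unfolding leib_def mz[OF i] n[symmetric] by simp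
 qed
 have lg: "leib K P a (?z i) : gr P n d" if i: "i < length zs" for i
 unfolding lz[OF i] by (rule lsum_map_gr) (use tg[OF i] in simp)
 let ?f = "%i j. signed K P (?e i) (leib_term K P a (?z i) j)"
 have fg: "?f i j : gr P n d" if "i < length zs" "j < length zs" for i j using tg[OF that] by (rule signed_gr)
 have anti: "lsum P n d (map (%i. lsum P n d (map (?f i) ?r)) ?r) = nul P n d"
 proof (rule lsum_antisymmetric)
 show "?f i j : gr P n d" if "i < length zs" "j < length zs" for i j by (rule fg[OF that])
 show "?f i i = nul P n d" if i: "i < length zs" for i
 proof -
 have cb: "composable P a (mark zs i)" by (rule mark_composable[OF c i])
 have "mark (?z i) i = (mark zs i)[i := nul P (arity P (mark zs i ! i)) (deg P (fst (zs ! i)) - 2)]"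
 using mark_slot(1)[OF c i i] by (simp add: mark_update[OF i i])
 hence m: "cmp P a (mark (?z i) i) = nul P (tarity P (mark zs i))
 (deg P a + tdeg P (mark zs i) - deg P (mark zs i ! i) + (deg P (fst (zs ! i)) - 2))"
 using cmp_nul_right[OF cb, of i] i by simp
 have "leib_term K P a (?z i) i = nul P (tarity P (mark zs i))
 (deg P a + tdeg P (mark zs i) - deg P (mark zs i ! i) + (deg P (fst (zs ! i)) - 2))"
 unfolding leib_term_def m by simp
 moreover from this have "leib_term K P a (?z i) i = nul P n d" using tg[OF i i]
 by (metis arity_nul deg_nul gr_iff)
 ultimately show ?thesis by simp
 qed
 fix i j assume ij: "i < j" "j < length zs"
 hence i: "i < length zs" and j: "j < length zs" by auto
 have m1: "mark (?z i) j = (mark zs j)[i := snd (zs ! i)]" and m2: "mark (?z j) i = (mark zs i)[j := snd (zs ! j)]"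
 using ij mark_update[OF i j] mark_update[OF j i] by auto
 have m: "mark (?z i) j = mark (?z j) i"
 unfolding m1 m2 using ij by (simp add: mark_def list_update_swap)
 have p1: "pdeg P (?z i) j = pdeg P zs j - 1"
 proof -
 have "pdeg P (?z i) j = (\<Sum>l<j. deg P (fst (zs ! l)) + (if l = i then - 1 else 0))"
 unfolding pdeg_def using ij yg[OF i] by (intro sum.cong) (auto simp: nth_list_update gr_iff)
 thus ?thesis using ij by (simp add: sum.distrib pdeg_def)
 qed
 have p2: "pdeg P (?z j) i = pdeg P zs i"
 using ij by (intro pdeg_cong) auto
 have g: "cmp P a (mark (?z j) i) : gr P n d"
 using mark_cmp_gr[OF cz[OF j] _ a, of i] i unfolding mz[OF j] n d by (simp add: algebra_simps)
 have "pls P (?f i j) (?f j i) = pls P (signed K P (?e i + (deg P a + (pdeg P zs j - 1))) (cmp P a (mark (?z j) i)))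
 (signed K P (?e j + (deg P a + pdeg P zs i)) (cmp P a (mark (?z j) i)))"
 unfolding leib_term_def m p1 p2 using g by (simp add: gr_iff)
 also have "... = nul P n d" by (rule signed_opposite[OF g]) simp
 finally show "pls P (?f i j) (?f j i) = nul P n d" .
 qed
 have s1: "signed K P (?e i) (pls P (cmp P x (mark zs i)) (leib K P a (?z i)))
 = pls P (signed K P (?e i) (cmp P x (mark zs i))) (lsum P n d (map (?f i) ?r))" if i: "i < length zs" for i
 proof -
 have "signed K P (?e i) (leib K P a (?z i)) = lsum P n d (map (?f i) ?r)"
 unfolding lz[OF i] by (rule lsum_signed[symmetric]) (use tg[OF i] in simp)
 thus ?thesis using signed_pls[OF xg[OF i] lg[OF i]] by simp
 qed
 have "lsum P n d (map (%i. signed K P (?e i) (pls P (cmp P x (mark zs i)) (leib K P a (?z i)))) ?r)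
 = lsum P n d (map (%i. pls P (signed K P (?e i) (cmp P x (mark zs i))) (lsum P n d (map (?f i) ?r))) ?r)"
 by (intro arg_cong[where f = "lsum P n d"] map_upt_cong) (rule s1)
 also have "... = pls P (lsum P n d (map (%i. signed K P (?e i) (cmp P x (mark zs i))) ?r))
 (lsum P n d (map (%i. lsum P n d (map (?f i) ?r)) ?r))"
 by (rule lsum_pls) (use xg signed_gr fg in "auto intro!: lsum_map_gr")
 also have "... = lsum P n d (map (%i. signed K P (?e i) (cmp P x (mark zs i))) ?r)"
 unfolding anti by (rule pls_nul, rule lsum_map_gr) (use xg signed_gr in auto)
 finally have A: "lsum P n d (map (%i. signed K P (?e i) (pls P (cmp P x (mark zs i)) (leib K P a (?z i)))) ?r)
 = lsum P n d (map (%i. signed K P (?e i) (cmp P x (mark zs i))) ?r)" .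
 have dx: "deg P x = deg P a - 1" using x by (simp add: gr_iff)
 have "deg P x + tdeg P (map fst zs) - 1 = d" by (simp add: dx d)
 hence B: "leib K P x zs = lsum P n d (map (leib_term K P x zs) ?r)" unfolding leib_def n by simp
 have lxg: "leib_term K P x zs i : gr P n d" if "i < length zs" for i
 unfolding leib_term_def using xg[OF that] by (rule signed_gr)
 have "pls P (leib K P x zs) (lsum P n d (map (%i. signed K P (?e i) (cmp P x (mark zs i))) ?r))
 = lsum P n d (map (%i. pls P (leib_term K P x zs i) (signed K P (?e i) (cmp P x (mark zs i)))) ?r)"
 unfolding B by (rule lsum_pls[symmetric]) (use lxg xg signed_gr in auto)
 also have "... = nul P n d"
 proof (rule lsum_nul)
 fix i assume "i : set ?r"
 hence i: "i < length zs" by simp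
 show "pls P (leib_term K P x zs i) (signed K P (?e i) (cmp P x (mark zs i))) = nul P n d"
 unfolding leib_term_def dx by (rule signed_opposite[OF xg[OF i]]) presburger
 qed
 finally show ?thesis unfolding A .
qed

section \<open>Chainification\<close>

lemma smod_hom_sqzI:
 assumes u: "smod_hom K M X u" and v: "smod_hom K (shift k M) X v"
 shows "smod_hom K M (sqz X k \<Delta>) (%a. (u a, v a))"
proof (rule smod_homI)
 fix n d x assume x: "x : gr M n d"
 have x': "y : gr (shift k M) n (d + k)" if "y : gr M n d" for y using that by (simp add: gr_shift)
 show "(u x, v x) : gr (sqz X k \<Delta>) n d"
 using smod_hom_gr[OF u x] smod_hom_gr[OF v x'[OF x]] by (simp add: gr_sqz)
 show "(u (pls M x y), v (pls M x y)) = pls (sqz X k \<Delta>) (u x, v x) (u y, v y)" if y: "y : gr M n d" for y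
 using smod_hom_pls[OF u x y] smod_hom_pls[OF v x'[OF x] x'[OF y]] by simp
 show "(u (scale M c x), v (scale M c x)) = scale (sqz X k \<Delta>) c (u x, v x)" if c: "c : carrier K" for c
 using smod_hom_scale[OF u c, of x] smod_hom_scale[OF v c, of x] x by (simp add: gr_iff)
 show "(u (perm M \<pi> x), v (perm M \<pi> x)) = perm (sqz X k \<Delta>) \<pi> (u x, v x)" if s: "\<pi> permutes {..<n}" for \<pi>
 using smod_hom_perm[OF u x s] smod_hom_perm[OF v x'[OF x] s] by simp
qed
lemma smod_hom_dualD:
 assumes s: "smod_hom K P (dual K X) F"
 shows "smod_hom K P X (%a. fst (F a))" "smod_hom K (shift (- 1) P) X (%a. snd (F a))"
proof -
 show "smod_hom K P X (%a. fst (F a))"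
 proof (rule smod_homI)
 fix n d x assume x: "x : gr P n d"
 show "fst (F x) : gr X n d" using smod_hom_gr[OF s x] by (simp add: gr_sqz mem_Times_iff)
 show "fst (F (pls P x y)) = pls X (fst (F x)) (fst (F y))" if "y : gr P n d" for y
 using smod_hom_pls[OF s x that] by simp
 show "fst (F (scale P c x)) = scale X c (fst (F x))" if "c : carrier K" for c
 using smod_hom_scale[OF s that, of x] x by (simp add: gr_iff)
 show "fst (F (perm P \<pi> x)) = perm X \<pi> (fst (F x))" if "\<pi> permutes {..<n}" for \<pi>
 using smod_hom_perm[OF s x that] by simp
 qed
 show "smod_hom K (shift (- 1) P) X (%a. snd (F a))"
 proof (rule smod_homI)
 fix n d x assume "x : gr (shift (- 1) P) n d"
 hence x: "x : gr P n (d + 1)" by (simp add: gr_shift)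
 show "snd (F x) : gr X n d" using smod_hom_gr[OF s x] by (simp add: gr_sqz mem_Times_iff)
 show "snd (F (pls (shift (- 1) P) x y)) = pls X (snd (F x)) (snd (F y))" if "y : gr (shift (- 1) P) n d" for y
 using smod_hom_pls[OF s x, of y] that by (simp add: gr_shift)
 show "snd (F (scale (shift (- 1) P) c x)) = scale X c (snd (F x))" if "c : carrier K" for c
 using smod_hom_scale[OF s that, of x] x by (simp add: gr_iff)
 show "snd (F (perm (shift (- 1) P) \<pi> x)) = perm X \<pi> (snd (F x))" if "\<pi> permutes {..<n}" for \<pi>
 using smod_hom_perm[OF s x that] by simp
 qed
qed

locale chainification = operad K P for K :: "('k, 'z) ring_scheme" (structure)
 and P :: "('k, 'a, 'm) operad_scheme"
begin
abbreviation "N \<equiv> dsum P (shift (- 1) P)"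
abbreviation "B \<equiv> ch_base K P"
abbreviation "C \<equiv> quotient_op K B (ch_rels K P)"
abbreviation "\<iota>0 \<equiv> ch_iota0 K P"
abbreviation "\<delta>0 \<equiv> ch_del0 K P"
abbreviation "\<iota> \<equiv> ch_iota K P"
abbreviation "\<delta> \<equiv> ch_del K P"
lemma sP: "smodule K (shift (- 1) P)" by (rule smodule_shift[OF smodule_axioms])
sublocale N: smodule K N by (rule smodule_dsum[OF smodule_axioms sP])
sublocale B: operad K B unfolding ch_base_def by (rule N.operad_free)
lemma iota0_hom: "smod_hom K P B \<iota>0"
 unfolding ch_base_def ch_iota0_def[abs_def]
 by (rule smod_hom_comp[OF smod_hom_inj1[OF smodule_axioms sP] N.gen_smod_hom])
lemma del0_hom: "smod_hom K (shift (- 1) P) B \<delta>0"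
 unfolding ch_base_def ch_del0_def[abs_def]
 by (rule smod_hom_comp[OF smod_hom_inj2[OF smodule_axioms sP] N.gen_smod_hom])
lemma iota0_gr: "a : gr P n d ==> \<iota>0 a : gr B n d"
 by (rule smod_hom_gr[OF iota0_hom])
lemma del0_gr: "a : gr P n d ==> \<delta>0 a : gr B n (d - 1)"
 by (rule smod_hom_gr[OF del0_hom]) (simp add: gr_shift)
lemma iota0_composable: "composable P a bs ==> composable B (\<iota>0 a) (map \<iota>0 bs)"
 by (rule smod_hom_composable[OF iota0_hom])
lemma iota0_map: "composable P a bs ==> map (arity B) (map \<iota>0 bs) = map (arity P) bs"
 "composable P a bs ==> map (deg B) (map \<iota>0 bs) = map (deg P) bs"
 using iota0_hom by (auto simp: smod_hom_def composable_def)
lemma del0_composable: "composable P a bs ==> composable B (\<delta>0 a) (map \<iota>0 bs)"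
 by (rule composable_cong[OF iota0_composable])
 (use iota0_gr[OF composable_gr] del0_gr[OF composable_gr] in "auto simp: gr_iff")
lemma pairs0_comp2: "composable P a bs ==> comp2 B (- 1) (\<iota>0 a) (map (%b. (\<iota>0 b, \<delta>0 b)) bs)"
proof (rule B.comp2_pairs[OF iota0_composable])
 fix b assume "composable P a bs" "b : set bs"
 hence "b : comp_of P b" by (auto simp: composable_def elts_gr)
 from iota0_gr[OF this] del0_gr[OF this] show "\<delta>0 b : gr B (arity B (\<iota>0 b)) (deg B (\<iota>0 b) + - 1)"
 by (simp add: gr_iff)
qed
lemma ch_rels_eq: "ch_rels K P =
 {mns K B (\<delta>0 (cmp P a bs)) (pls B (cmp B (\<delta>0 a) (map \<iota>0 bs)) (leib K B (\<iota>0 a) (map (%b. (\<iota>0 b, \<delta>0 b)) bs)))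
 | a bs. composable P a bs} \<union>
 {mns K B (\<iota>0 (cmp P a bs)) (cmp B (\<iota>0 a) (map \<iota>0 bs)) | a bs. composable P a bs} \<union>
 {mns K B (\<iota>0 (unt P)) (unt B)}"
proof -
 have "(\<Oplus>\<^bsub>component B (tarity P bs) (deg P a + tdeg P bs - 1)\<^esub>
 i\<in>{..<length bs}. signed K B (deg P a + (\<Sum>j<i. deg P (bs ! j)))
 (cmp B (\<iota>0 a) (map (%j. if i = j then \<delta>0 (bs ! j) else \<iota>0 (bs ! j)) [0..<length bs])))
 = leib K B (\<iota>0 a) (map (%b. (\<iota>0 b, \<delta>0 b)) bs)" if c: "composable P a bs" for a bs
 proof (rule B.leib_eq_finsum[OF iota0_composable[OF c]])
 have bg: "b : comp_of P b" if "b : set bs" for b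
 using c that by (auto simp: composable_def elts_gr)
 have ag: "deg B (\<iota>0 a) = deg P a" using iota0_gr[OF composable_gr[OF c]] by (simp add: gr_iff)
 show "\<delta>0 b : gr B (arity B (\<iota>0 b)) (deg B (\<iota>0 b) - 1)" if "b : set bs" for b
 using iota0_gr[OF bg[OF that]] del0_gr[OF bg[OF that]] by (simp add: gr_iff)
 fix i assume i: "i < length bs"
 have "(\<Sum>j<i. deg P (bs ! j)) = (\<Sum>j<i. deg B (\<iota>0 (bs ! j)))"
 proof (rule sum.cong[OF refl])
 fix j assume "j : {..<i}"
 thus "deg P (bs ! j) = deg B (\<iota>0 (bs ! j))" using i iota0_gr[OF bg[of "bs ! j"]] by (simp add: gr_iff)
 qed
 moreover have "map (%j. if i = j then \<delta>0 (bs ! j) else \<iota>0 (bs ! j)) [0..<length bs] = (map \<iota>0 bs)[i := \<delta>0 (bs ! i)]"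
 using i by (intro nth_equalityI) (auto simp: nth_list_update)
 ultimately show "signed K B (deg P a + (\<Sum>j<i. deg P (bs ! j)))
 (cmp B (\<iota>0 a) (map (%j. if i = j then \<delta>0 (bs ! j) else \<iota>0 (bs ! j)) [0..<length bs]))
 = signed K B (deg B (\<iota>0 a) + (\<Sum>j<i. deg B (\<iota>0 (bs ! j)))) (cmp B (\<iota>0 a) ((map \<iota>0 bs)[i := \<delta>0 (bs ! i)]))"
 by (simp only: ag)
 next
 show "tarity P bs = sum_list (map (arity B) (map \<iota>0 bs))" by (simp only: iota0_map[OF c])
 show "deg P a + tdeg P bs - 1 = deg B (\<iota>0 a) + sum_list (map (deg B) (map \<iota>0 bs)) - 1"
 using iota0_gr[OF composable_gr[OF c]] unfolding iota0_map[OF c] by (simp add: gr_iff)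
 qed
 thus ?thesis unfolding ch_rels_def Let_def
 by (intro arg_cong2[where f = "(\<union>)"] refl Collect_cong) (metis (no_types, lifting))
qed
lemma rel_gr:
 assumes c: "composable P a bs"
 defines "n \<equiv> tarity P bs" and "d \<equiv> deg P a + tdeg P bs"
 shows "\<delta>0 (cmp P a bs) : gr B n (d - 1)"
 "pls B (cmp B (\<delta>0 a) (map \<iota>0 bs)) (leib K B (\<iota>0 a) (map (%b. (\<iota>0 b, \<delta>0 b)) bs)) : gr B n (d - 1)"
 "cmp B (\<delta>0 a) (map \<iota>0 bs) : gr B n (d - 1)"
 "leib K B (\<iota>0 a) (map (%b. (\<iota>0 b, \<delta>0 b)) bs) : gr B n (d - 1)"
 "\<iota>0 (cmp P a bs) : gr B n d" "cmp B (\<iota>0 a) (map \<iota>0 bs) : gr B n d"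
proof -
 have g: "cmp P a bs : gr P n d" unfolding n_def d_def by (rule cmp_gr[OF c refl refl])
 show "\<delta>0 (cmp P a bs) : gr B n (d - 1)" "\<iota>0 (cmp P a bs) : gr B n d"
 by (rule del0_gr[OF g], rule iota0_gr[OF g])
 have dg: "deg B (\<delta>0 a) = deg P a - 1" "deg B (\<iota>0 a) = deg P a"
 using del0_gr[OF composable_gr[OF c]] iota0_gr[OF composable_gr[OF c]] by (simp_all add: gr_iff)
 show a: "cmp B (\<delta>0 a) (map \<iota>0 bs) : gr B n (d - 1)"
 by (rule B.cmp_gr[OF del0_composable[OF c]]) (simp_all only: iota0_map[OF c] n_def d_def dg)
 have m: "map fst (map (%b. (\<iota>0 b, \<delta>0 b)) bs) = map \<iota>0 bs" by simp
 show b: "leib K B (\<iota>0 a) (map (%b. (\<iota>0 b, \<delta>0 b)) bs) : gr B n (d - 1)"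
 using B.leib_gr[OF pairs0_comp2[OF c]] unfolding m iota0_map[OF c] dg n_def d_def .
 show "pls B (cmp B (\<delta>0 a) (map \<iota>0 bs)) (leib K B (\<iota>0 a) (map (%b. (\<iota>0 b, \<delta>0 b)) bs)) : gr B n (d - 1)"
 by (rule B.pls_gr[OF a b])
 show "cmp B (\<iota>0 a) (map \<iota>0 bs) : gr B n d"
 by (rule B.cmp_gr[OF iota0_composable[OF c]]) (simp_all only: iota0_map[OF c] n_def d_def dg)
qed
lemma ch_rels_elts: "ch_rels K P \<subseteq> elts B"
 unfolding ch_rels_eq
 using B.mns_gr[OF rel_gr(1,2)] B.mns_gr[OF rel_gr(5,6)] B.mns_gr[OF iota0_gr[OF unt_gr] B.unt_gr]
 by (auto simp: gr_iff)
sublocale q: quotient_operad K B "ch_rels K P"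
 by (intro quotient_operad.intro quotient_operad_axioms.intro B.operad_axioms ch_rels_elts)
lemma iota_hom: "smod_hom K P C \<iota>" and del_hom: "smod_hom K (shift (- 1) P) C \<delta>"
 unfolding ch_iota_def[abs_def] ch_del_def[abs_def]
 by (rule smod_hom_comp[OF iota0_hom q.p.shom], rule smod_hom_comp[OF del0_hom q.p.shom])
lemma iota_gr: "a : gr P n d ==> \<iota> a : gr C n d"
 by (rule smod_hom_gr[OF iota_hom])
lemma del_gr: "a : gr P n d ==> \<delta> a : gr C n (d - 1)"
 by (rule smod_hom_gr[OF del_hom]) (simp add: gr_shift)
lemma iota_unt: "\<iota> (unt P) = unt C"
 unfolding ch_iota_def q.p.hom_unt[symmetric]
 by (rule q.proj_eq[OF _ iota0_gr[OF unt_gr] B.unt_gr]) (simp add: ch_rels_eq)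
lemma iota_operad_hom: "operad_hom K P C \<iota>"
proof (rule operad_homI[OF iota_hom iota_unt])
 fix a bs assume c: "composable P a bs"
 have "quotient_proj K B (ch_rels K P) (\<iota>0 (cmp P a bs)) = quotient_proj K B (ch_rels K P) (cmp B (\<iota>0 a) (map \<iota>0 bs))"
 by (rule q.proj_eq[OF _ rel_gr(5,6)[OF c]]) (use c in "auto simp: ch_rels_eq")
 thus "\<iota> (cmp P a bs) = cmp C (\<iota> a) (map \<iota> bs)"
 unfolding ch_iota_def q.p.hom_cmp[OF iota0_composable[OF c]] by (simp add: comp_def)
qed
lemma del_cmp:
 assumes c: "composable P a bs"
 shows "\<delta> (cmp P a bs) = pls C (cmp C (\<delta> a) (map \<iota> bs)) (leib K C (\<iota> a) (map (%b. (\<iota> b, \<delta> b)) bs))"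
proof -
 have "quotient_proj K B (ch_rels K P) (\<delta>0 (cmp P a bs)) = quotient_proj K B (ch_rels K P)
 (pls B (cmp B (\<delta>0 a) (map \<iota>0 bs)) (leib K B (\<iota>0 a) (map (%b. (\<iota>0 b, \<delta>0 b)) bs)))"
 by (rule q.proj_eq[OF _ rel_gr(1,2)[OF c]]) (use c in "auto simp: ch_rels_eq")
 thus ?thesis
 unfolding ch_iota_def ch_del_def q.p.hom_pls[OF rel_gr(3,4)[OF c]] q.p.hom_cmp[OF del0_composable[OF c]]
 q.p.hom_leib[OF pairs0_comp2[OF c]] by (simp add: comp_def)
qed

text \<open>The relations of the chainification say that \<open>(\<iota>, \<partial>)\<close> is a morphism to the dual numbers, and
  the chainification is universal with this property.\<close>

lemma J_hom: "operad_hom K P (dual K C) (%a. (\<iota> a, \<delta> a))"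
proof (rule operad_homI)
 show "smod_hom K P (dual K C) (%a. (\<iota> a, \<delta> a))"
 by (rule smod_hom_sqzI[OF iota_hom del_hom])
 have c: "composable P (unt P) [unt P]" by (simp add: composable_def unit_closed arity_unit)
 have g: "\<delta> (unt P) : gr C 1 (- 1)" using del_gr[OF unt_gr] by simp
 have "\<delta> (unt P) = pls C (\<delta> (unt P)) (\<delta> (unt P))"
 using del_cmp[OF c] q.p.Q.unit_right[of "\<delta> (unt P)"] q.p.Q.leib_unit_left[of "(unt C, \<delta> (unt P))"] g
 by (simp add: unit_left unit_closed iota_unt elts_pairs_1 q.p.Q.unit_closed q.p.Q.arity_unit q.p.Q.deg_unit gr_iff[of _ C])
 hence "pls C (\<delta> (unt P)) (\<delta> (unt P)) = pls C (\<delta> (unt P)) (nul C 1 (- 1))" using g by simp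
 hence "\<delta> (unt P) = nul C 1 (- 1)" by (rule q.p.Q.pls_left_cancel[OF g g q.p.Q.nul_gr])
 thus "(\<iota> (unt P), \<delta> (unt P)) = unt (dual K C)" by (simp add: iota_unt)
 fix a bs assume "composable P a bs"
 thus "(\<iota> (cmp P a bs), \<delta> (cmp P a bs)) = cmp (dual K C) (\<iota> a, \<delta> a) (map (%a. (\<iota> a, \<delta> a)) bs)"
 using del_cmp operad_hom_cmp[OF iota_operad_hom] by (simp add: comp_def)
qed
lemma ch_universal:
 assumes X: "operad K X" and F: "operad_hom K P (dual K X) F"
 shows "\<exists>h. operad_hom K C X h & (\<forall>a\<in>elts P. h (\<iota> a) = fst (F a) & h (\<delta> a) = snd (F a))"
proof -
 interpret X: operad K X by fact
 note s = operad_hom_smod[OF F]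
 have Fg: "fst (F a) : gr X n d" "snd (F a) : gr X n (d - 1)" if "a : gr P n d" for a n d
 using smod_hom_gr[OF s that] by (auto simp: gr_sqz mem_Times_iff)
 note u = smod_hom_dualD(1)[OF s] and v = smod_hom_dualD(2)[OF s]
 obtain h0 where h0: "operad_hom K B X h0"
 "!!p. p : elts N ==> h0 (gen K N p) = pls X (fst (F (fst p))) (snd (F (snd p)))"
 using N.free_universal[OF X smod_hom_copair[OF X.smodule_axioms u v]] unfolding ch_base_def by blast
 interpret h0: op_hom K B X h0 by (rule op_homI[OF B.operad_axioms X h0(1)])
 interpret u: smodule_hom K P X "%a. fst (F a)"
 by (intro smodule_hom.intro smodule_hom_axioms.intro smodule_axioms X.smodule_axioms u)
 interpret v: smodule_hom K "shift (- 1) P" X "%a. snd (F a)"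
 by (intro smodule_hom.intro smodule_hom_axioms.intro sP X.smodule_axioms v)
 have i1: "h0 (\<iota>0 a) = fst (F a)" if a: "a : elts P" for a
 proof -
 have "inj1 P (shift (- 1) P) a : elts N" using smod_hom_gr[OF smod_hom_inj1[OF smodule_axioms sP] elts_gr[OF a]] by (simp add: gr_iff)
 thus ?thesis using h0(2) v.hom_nul[of "arity P a" "deg P a"] Fg[OF elts_gr[OF a]]
 by (simp add: ch_iota0_def inj1_def)
 qed
 have i2: "h0 (\<delta>0 a) = snd (F a)" if a: "a : elts P" for a
 proof -
 have g: "a : gr (shift (- 1) P) (arity P a) (deg P a - 1)" using a by (simp add: gr_iff)
 have "inj2 P (shift (- 1) P) a : elts N" using smod_hom_gr[OF smod_hom_inj2[OF smodule_axioms sP] g] by (simp add: gr_iff)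
 thus ?thesis using h0(2) u.hom_nul[of "arity P a" "deg P a - 1"] Fg[OF elts_gr[OF a]]
 by (simp add: ch_del0_def inj2_def)
 qed
 have rel: "h0 x = nul X (arity B x) (deg B x)" if "x : ch_rels K P" for x
 proof -
 have eq: "h0 (mns K B y z) = nul X (arity B (mns K B y z)) (deg B (mns K B y z))"
 if "y : gr B n d" "z : gr B n d" "h0 y = h0 z" for y z n d
 using h0.hom_eq_iff[OF that(1,2)] that(3) B.mns_gr[OF that(1,2)] by (simp add: gr_iff)
 have *: "map (%b. h0 (\<iota>0 b)) bs = map (%b. fst (F b)) bs" "map (%b. (h0 (\<iota>0 b), h0 (\<delta>0 b))) bs = map F bs"
 "h0 (\<iota>0 a) = fst (F a)" "h0 (\<delta>0 a) = snd (F a)" if "composable P a bs" for a bs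
 using that i1 i2 by (auto simp: composable_def)
 have r1: "h0 (\<delta>0 (cmp P a bs)) = h0 (pls B (cmp B (\<delta>0 a) (map \<iota>0 bs)) (leib K B (\<iota>0 a) (map (%b. (\<iota>0 b, \<delta>0 b)) bs)))"
 if c: "composable P a bs" for a bs
 using i2[OF comp_closed[OF c]] operad_hom_cmp[OF F c]
 unfolding h0.hom_pls[OF rel_gr(3,4)[OF c]] h0.hom_cmp[OF del0_composable[OF c]]
 h0.hom_leib[OF pairs0_comp2[OF c]] by (simp add: comp_def *[OF c])
 have r2: "h0 (\<iota>0 (cmp P a bs)) = h0 (cmp B (\<iota>0 a) (map \<iota>0 bs))" if c: "composable P a bs" for a bs
 using i1[OF comp_closed[OF c]] operad_hom_cmp[OF F c]
 unfolding h0.hom_cmp[OF iota0_composable[OF c]] by (simp add: comp_def *[OF c])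
 have r3: "h0 (\<iota>0 (unt P)) = h0 (unt B)"
 using i1[OF unit_closed] operad_hom_unt[OF F] h0.hom_unt by simp
 show ?thesis
 using \<open>x : ch_rels K P\<close> eq[OF rel_gr(1,2) r1] eq[OF rel_gr(5,6) r2] eq[OF iota0_gr[OF unt_gr] B.unt_gr r3]
 unfolding ch_rels_eq by blast
 qed
 obtain h where h: "operad_hom K C X h" "!!x. x : elts B ==> h (quotient_proj K B (ch_rels K P) x) = h0 x"
 using q.quotient_factor[OF X h0(1) rel] by blast
 have "h (\<iota> a) = fst (F a)" "h (\<delta> a) = snd (F a)" if a: "a : elts P" for a
 using h(2) i1[OF a] i2[OF a] iota0_gr[OF elts_gr[OF a]] del0_gr[OF elts_gr[OF a]]
 unfolding ch_iota_def ch_del_def by (simp_all add: gr_iff)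
 thus ?thesis using h(1) by blast
qed
abbreviation "gens \<equiv> \<iota> ` elts P \<union> \<delta> ` elts P"
lemma gens_elts: "gens \<subseteq> elts C"
 using iota_gr[OF elts_gr] del_gr[OF elts_gr] by (auto simp: gr_iff)
lemma generated: "elts C \<subseteq> opspan K C gens"
proof -
 let ?p = "quotient_proj K B (ch_rels K P)"
 have g: "?p y : opspan K C gens" if y: "y : gen K N ` elts N" for y
 proof -
 obtain p where p: "p : elts N" "y = gen K N p" using y by blast
 have f: "fst p : elts P" "snd p : elts P" "snd p : gr P (arity P (fst p)) (deg P (fst p) + 1)"
 using p(1) by (auto simp: elts_dsum gr_shift gr_iff)
 have i: "inj1 P (shift (- 1) P) (fst p) : gr N (arity P (fst p)) (deg P (fst p))"
 by (rule smod_hom_gr[OF smod_hom_inj1[OF smodule_axioms sP] elts_gr[OF f(1)]])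
 have j: "inj2 P (shift (- 1) P) (snd p) : gr N (arity P (fst p)) (deg P (fst p))"
 by (rule smod_hom_gr[OF smod_hom_inj2[OF smodule_axioms sP]]) (use f(3) in "simp add: gr_shift")
 have "y = pls B (\<iota>0 (fst p)) (\<delta>0 (snd p))"
 using dsum_decompose[OF smodule_axioms sP p(1)] smod_hom_pls[OF N.gen_smod_hom i j]
 unfolding p(2) ch_base_def ch_iota0_def ch_del0_def by simp
 moreover have a: "\<iota>0 (fst p) : gr B (arity P (fst p)) (deg P (fst p))"
 and b: "\<delta>0 (snd p) : gr B (arity P (fst p)) (deg P (fst p))"
 using iota0_gr[OF elts_gr[OF f(1)]] del0_gr[OF f(3)] by simp_all
 ultimately have py: "?p y = pls C (\<iota> (fst p)) (\<delta> (snd p))"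
 using q.p.hom_pls[OF a b] by (simp add: ch_iota_def ch_del_def)
 have "same_grade C (\<iota> (fst p)) (\<delta> (snd p))"
 using iota_gr[OF elts_gr[OF f(1)]] del_gr[OF f(3)] by (simp add: same_grade_def gr_iff)
 thus ?thesis unfolding py by (intro opspan.pls opspan.gen) (use f in auto)
 qed
 have "?p x : opspan K C gens" if "x : elts B" for x
 proof -
 have xs: "x : opspan K B (gen K N ` elts N)" using that N.free_generated unfolding ch_base_def by blast
 have ge: "gen K N ` elts N \<subseteq> elts B" using N.gens_elts unfolding ch_base_def .
 from xs ge show ?thesis
 proof (induction rule: B.opspan_induct)
 case (gen x)
 thus ?case by (rule g)
 next
 case (pls n d x y)
 thus ?case using q.p.hom_gr[OF pls(1)] q.p.hom_gr[OF pls(2)]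
 by (auto simp: q.p.hom_pls[OF pls(1,2)] gr_iff same_grade_def intro!: opspan.pls)
 next
 case (perm \<pi> x)
 thus ?case using q.p.hom_perm[OF elts_gr[OF perm(1)] perm(2)]
 by (auto intro!: opspan.perm simp: q.p.hom_grade)
 next
 case (cmp a bs)
 thus ?case using q.p.hom_composable[OF cmp(1)]
 by (auto simp: q.p.hom_cmp[OF cmp(1)] composable_def intro!: opspan.cmp)
 qed (auto simp: q.p.hom_unt q.p.hom_scale intro: opspan.intros)
 qed
 thus ?thesis unfolding q.proj_surj[symmetric] by (rule image_subsetI)
qed
lemma hom_eq:
 assumes "operad K X" "operad_hom K C X f" "operad_hom K C X g"
 "!!a. a : elts P ==> f (\<iota> a) = g (\<iota> a)" "!!a. a : elts P ==> f (\<delta> a) = g (\<delta> a)" "x : elts C"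
 shows "f x = g x"
 by (rule hom_eq_on_opspan[OF op_homI[OF q.p.Q.operad_axioms assms(1,2)] op_homI[OF q.p.Q.operad_axioms assms(1,3)] gens_elts])
 (use assms generated in auto)

text \<open>The differential sends \<open>\<iota> a\<close> to \<open>\<partial> a\<close> and \<open>\<partial> a\<close> to zero.  It exists because \<open>a\<close> goes to
  \<open>((\<iota> a, \<partial> a), (\<partial> a, 0))\<close> under a morphism to the dual numbers over the dual numbers: this is the
  substitution of \<open>\<epsilon>\<^sub>1 + \<epsilon>\<^sub>2\<close> for \<open>\<epsilon>\<close>, whose square is zero.\<close>

lemma twice_hom:
 "operad_hom K P (dual K (dual K C)) (%a. ((\<iota> a, \<delta> a), (\<delta> a, nul C (arity P a) (deg P a - 2))))"
proof -
 let ?F = "%a. ((\<iota> a, \<delta> a), (\<delta> a, nul C (arity P a) (deg P a - 2)))"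
 interpret dC: operad K "dual K C" by (rule q.p.Q.operad_dual)
 interpret ddC: operad K "dual K (dual K C)" by (rule dC.operad_dual)
 interpret fs: op_hom K "dual K C" C fst
 by (rule op_homI[OF dC.operad_axioms q.p.Q.operad_axioms square_zero.fst_hom[OF q.p.Q.square_zero_leib]])
 note Js = operad_hom_smod[OF J_hom]
 have d2: "\<delta> a : gr C n (d - 1)" "nul C (arity P a) (deg P a - 2) : gr C n (d - 2)" if "a : gr P n d" for a n d
 using del_gr[OF that] that by (simp_all add: gr_iff)
 show ?thesis
 proof (rule operad_homI)
 have e: "arity P (pls P x y) = arity P x" "deg P (pls P x y) = deg P x" if "x : gr P n d" "y : gr P n d" for x y n d
 using pls_gr[OF that] that by (simp_all add: gr_iff)
 have e2: "arity P (scale P c x) = arity P x" "deg P (scale P c x) = deg P x" if "c : carrier K" "x : gr P n d" for c x n d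
 using scale_gr[OF that] that by (simp_all add: gr_iff)
 have e3: "arity P (perm P \<pi> x) = arity P x" "deg P (perm P \<pi> x) = deg P x" if "x : gr P n d" "\<pi> permutes {..<n}" for \<pi> x n d
 using perm_gr[OF that] that by (simp_all add: gr_iff)
 show "smod_hom K P (dual K (dual K C)) ?F"
 proof (rule smod_homI)
 fix n d x assume x: "x : gr P n d"
 show "?F x : gr (dual K (dual K C)) n d" using iota_gr[OF x] d2[OF x] by (simp add: gr_sqz)
 { fix y assume y: "y : gr P n d"
 show "?F (pls P x y) = pls (dual K (dual K C)) (?F x) (?F y)"
 using smod_hom_pls[OF Js x y] e[OF x y] x y by (simp add: gr_iff q.p.Q.nul_pls[OF q.p.Q.nul_gr]) }
 { fix c assume c: "c : carrier K"
 show "?F (scale P c x) = scale (dual K (dual K C)) c (?F x)"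
 using smod_hom_scale[OF Js c, of x] e2[OF c x] x c by (simp add: gr_iff) }
 { fix \<pi> assume s: "\<pi> permutes {..<n}"
 show "?F (perm P \<pi> x) = perm (dual K (dual K C)) \<pi> (?F x)"
 using smod_hom_perm[OF Js x s] e3[OF x s] x s by (simp add: gr_iff) }
 qed
 show "?F (unt P) = unt (dual K (dual K C))"
 using operad_hom_unt[OF J_hom] by (simp add: arity_unit deg_unit)
 fix a bs assume c: "composable P a bs"
 let ?zs = "map (%b. (\<iota> b, \<delta> b)) bs" and ?n = "tarity P bs"
 and ?d = "deg P a + tdeg P bs"
 let ?ws = "map ?F bs"
 have bg: "b : comp_of P b" if "b : set bs" for b
 using c that by (auto simp: composable_def elts_gr)
 have ag: "a : comp_of P a" by (rule composable_gr[OF c])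
 have ca: "composable C (\<iota> a) (map \<iota> bs)" by (rule smod_hom_composable[OF iota_hom c])
 have am: "map (arity C) (map \<iota> bs) = map (arity P) bs" "map (deg C) (map \<iota> bs) = map (deg P) bs"
 using iota_gr[OF bg] by (auto simp: gr_iff)
 have da: "arity C (\<iota> a) = arity P a" "deg C (\<iota> a) = deg P a" using iota_gr[OF ag] by (simp_all add: gr_iff)
 have c2: "comp2 C (- 1) (\<iota> a) ?zs"
 by (rule q.p.Q.comp2_pairs[OF ca]) (use iota_gr[OF bg] del_gr[OF bg] in "simp add: gr_iff")
 have cw: "comp2 (dual K C) (- 1) (\<iota> a, \<delta> a) ?ws"
 using dC.comp2_pairs[where f = "%b. (\<iota> b, \<delta> b)" and g = "%b. (\<delta> b, nul C (arity P b) (deg P b - 2))" and bs = bs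
 and a = "(\<iota> a, \<delta> a)" and k = "- 1"]
 smod_hom_composable[OF Js c] iota_gr[OF bg] d2[OF bg] by (simp add: gr_sqz gr_iff[of "\<iota> _"])
 have m: "map fst ?zs = map \<iota> bs" "map fst ?ws = ?zs" by simp_all
 have dg: "\<delta> a : gr C (arity C (\<iota> a)) (deg C (\<iota> a) - 1)" using del_gr[OF ag] da by simp
 let ?t = "leib_term K (dual K C) (\<iota> a, \<delta> a) ?ws"
 have aD: "map (arity (dual K C)) (map fst ?ws) = map (arity P) bs" "map (deg (dual K C)) (map fst ?ws) = map (deg P) bs"
 using am by (simp_all add: comp_def)
 have lD: "leib K (dual K C) (\<iota> a, \<delta> a) ?ws = lsum (dual K C) ?n (?d - 1) (map ?t [0..<length bs])"
 unfolding leib_def aD using da by simp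
 have tg: "?t i : gr (dual K C) ?n (?d - 1)" if "i < length bs" for i
 using dC.leib_term_gr[OF cw, of i] that unfolding aD using da by simp
 have pdw: "pdeg (dual K C) ?ws i = pdeg C ?zs i" if "i < length bs" for i
 unfolding pdeg_def using that by (intro sum.cong) auto
 have mk: "mark ?ws i = ?zs[i := (snd (?zs ! i), nul C (arity C (fst (?zs ! i))) (deg C (fst (?zs ! i)) - 2))]"
 if i: "i < length bs" for i
 using i iota_gr[OF bg[of "bs ! i"]] unfolding mark_def m by (simp add: gr_iff)
 have mkf: "map fst (mark ?ws i) = mark ?zs i" if i: "i < length bs" for i
 unfolding mk[OF i] by (simp add: mark_def map_update comp_def)
 have tv: "?t i = (leib_term K C (\<iota> a) ?zs i, signed K C (deg C (\<iota> a) + pdeg C ?zs i) (pls C (cmp C (\<delta> a) (mark ?zs i))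
 (leib K C (\<iota> a) (?zs[i := (snd (?zs ! i), nul C (arity C (fst (?zs ! i))) (deg C (fst (?zs ! i)) - 2))]))))"
 if i: "i < length bs" for i
 unfolding leib_term_def pdw[OF i] signed_sqz sqz_sel(9) mkf[OF i] mk[OF i, symmetric] by simp
 have fst_lsum: "fst (lsum (dual K C) n d xs) = lsum C n d (map fst xs)" for n d xs
 by (induction xs) simp_all
 have snd_lsum: "snd (lsum (dual K C) n d xs) = lsum C n (d - 1) (map snd xs)" for n d xs
 by (induction xs) simp_all
 have f1: "fst (leib K (dual K C) (\<iota> a, \<delta> a) ?ws) = leib K C (\<iota> a) ?zs"
 proof -
 have e1: "map fst (map ?t [0..<length bs]) = map (leib_term K C (\<iota> a) ?zs) [0..<length ?zs]"
 using tv by simp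
 have e2: "leib K C (\<iota> a) ?zs = lsum C ?n (?d - 1) (map (leib_term K C (\<iota> a) ?zs) [0..<length ?zs])"
 unfolding leib_def m am da ..
 show ?thesis unfolding lD fst_lsum e1 e2 ..
 qed
 have s1: "pls C (leib K C (\<delta> a) ?zs) (snd (leib K (dual K C) (\<iota> a, \<delta> a) ?ws)) = nul C ?n (?d - 2)"
 proof -
 have e1: "map snd (map ?t [0..<length bs]) = map (%i. signed K C (deg C (\<iota> a) + pdeg C ?zs i) (pls C (cmp C (\<delta> a) (mark ?zs i))
 (leib K C (\<iota> a) (?zs[i := (snd (?zs ! i), nul C (arity C (fst (?zs ! i))) (deg C (fst (?zs ! i)) - 2))])))) [0..<length ?zs]"
 using tv by simp
 have d2: "?d - 1 - 1 = ?d - 2" by simp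
 show ?thesis unfolding lD snd_lsum e1 d2
 by (rule q.p.Q.leib_square[OF c2 dg]) (simp_all only: m am da)
 qed
 have cd: "composable C (\<delta> a) (map \<iota> bs)" by (rule composable_cong[OF ca]) (use dg in simp)
 have n1: "cmp C (nul C (arity P a) (deg P a - 2)) (map \<iota> bs) = nul C ?n (?d - 2)"
 using q.p.Q.cmp_nul_left'[OF cd, of "deg P a - 2"] dg unfolding am by (simp add: gr_iff da algebra_simps)
 have lg: "leib K C (\<delta> a) ?zs : gr C ?n (?d - 2)"
 proof -
 have "comp2 C (- 1) (\<delta> a) ?zs" using c2 dg by (simp add: comp2_def gr_iff)
 from q.p.Q.leib_gr[OF this] show ?thesis unfolding m am using dg da by (simp add: gr_iff algebra_simps)
 qed
 have "cmp (dual K (dual K C)) (?F a) ?ws = (cmp (dual K C) (\<iota> a, \<delta> a) ?zs,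
 pls (dual K C) (cmp (dual K C) (\<delta> a, nul C (arity P a) (deg P a - 2)) ?zs) (leib K (dual K C) (\<iota> a, \<delta> a) ?ws))"
 unfolding sqz_sel(9)[of "dual K C"] m by simp
 also have "pls (dual K C) (cmp (dual K C) (\<delta> a, nul C (arity P a) (deg P a - 2)) ?zs) (leib K (dual K C) (\<iota> a, \<delta> a) ?ws)
 = (\<delta> (cmp P a bs), nul C ?n (?d - 2))"
 using s1 lg del_cmp[OF c] unfolding sqz_sel(5,9) f1 m(1) fst_conv snd_conv n1 by simp
 also have "cmp (dual K C) (\<iota> a, \<delta> a) ?zs = (\<iota> (cmp P a bs), \<delta> (cmp P a bs))"
 using operad_hom_cmp[OF J_hom c] by simp
 finally show "?F (cmp P a bs) = cmp (dual K (dual K C)) (?F a) ?ws"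
 using c by (simp add: arity_comp deg_comp)
 qed
qed
lemma ch_derivation:
 "\<exists>D. derivation K C D & (\<forall>a\<in>elts P. D (\<iota> a) = \<delta> a & D (\<delta> a) = nul C (arity P a) (deg P a - 2))"
proof -
 obtain \<phi> where \<phi>: "operad_hom K C (dual K C) \<phi>"
 "!!a. a : elts P ==> \<phi> (\<iota> a) = (\<iota> a, \<delta> a)" "!!a. a : elts P ==> \<phi> (\<delta> a) = (\<delta> a, nul C (arity P a) (deg P a - 2))"
 using ch_universal[OF q.p.Q.operad_dual twice_hom] by auto
 have "fst (\<phi> x) = x" if "x : elts C" for x
 by (rule hom_eq[OF q.p.Q.operad_axioms operad_hom_comp[OF \<phi>(1) square_zero.fst_hom[OF q.p.Q.square_zero_leib]] _ _ _ that])
 (use \<phi> in "auto simp: operad_hom_def smod_hom_id")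
 from q.p.Q.hom_derivation[OF \<phi>(1) this] \<phi>(2,3) show ?thesis by (intro exI[of _ "%x. snd (\<phi> x)"]) simp
qed

end

section \<open>Operads with a differential\<close>

lemma with_dif_sel [simp]:
 "elts (with_dif P D) = elts P" "arity (with_dif P D) = arity P" "deg (with_dif P D) = deg P"
 "nul (with_dif P D) = nul P" "pls (with_dif P D) = pls P" "scale (with_dif P D) = scale P"
 "perm (with_dif P D) = perm P" "unt (with_dif P D) = unt P" "cmp (with_dif P D) = cmp P"
 "dif (with_dif P D) = D"
 by (simp_all add: with_dif_def operad.extend_def operad.truncate_def dgoperad.fields_def)
lemma with_dif_basic [simp]:
 "composable (with_dif P D) = composable P" "same_grade (with_dif P D) = same_grade P"
 "gr (with_dif P D) = gr P" "component (with_dif P D) = component P"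
 "signed K (with_dif P D) = signed K P"
 by (auto simp: fun_eq_iff composable_def same_grade_def gr_def component_def signed_def)
lemma smod_hom_with_dif [simp]:
 "smod_hom K (with_dif P D) Q f \<longleftrightarrow> smod_hom K P Q f" "smod_hom K Q' (with_dif P D) g \<longleftrightarrow> smod_hom K Q' P g"
 by (simp_all add: smod_hom_def)
lemma operad_hom_with_dif [simp]:
 "operad_hom K (with_dif P D) Q f \<longleftrightarrow> operad_hom K P Q f" "operad_hom K Q' (with_dif P D) g \<longleftrightarrow> operad_hom K Q' P g"
 by (simp_all add: operad_hom_def)
lemma shift_with_dif [simp]: "shift k (with_dif P D) = shift k P"
 by (simp add: shift_def)
lemma derivation_with_dif [simp]: "derivation K (with_dif P D) E \<longleftrightarrow> derivation K P E"
 by (simp add: derivation_def)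
lemma operad_with_dif: assumes "operad K P" shows "operad K (with_dif P D)"
proof -
 interpret operad K P by fact
 have s: "smodule K (with_dif P D)" by (rule smodule_cong[OF smodule_axioms]) simp_all
 show ?thesis
 by (intro operad.intro s, insert operad_axioms) (simp add: operad_def operad_axioms_def)
qed
lemma opspan_with_dif [simp]: "opspan K (with_dif P D) X = opspan K P X"
proof (intro equalityI subsetI)
 fix x assume "x : opspan K (with_dif P D) X"
 thus "x : opspan K P X"
 by (induction rule: opspan.induct) (auto intro: opspan.intros)
next
 fix x assume "x : opspan K P X"
 thus "x : opspan K (with_dif P D) X"
 proof (induction rule: opspan.induct)
 case unt
 thus ?case using opspan.unt[of "with_dif P D" K X] by simp
 next
 case (nul n d)
 thus ?case using opspan.nul[of "with_dif P D" n d K X] by simp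
 next
 case (pls x y)
 thus ?case using opspan.pls[of x K "with_dif P D" X y] by simp
 next
 case (scale x c)
 thus ?case using opspan.scale[of x K "with_dif P D" X c] by simp
 next
 case (perm x \<pi>)
 thus ?case using opspan.perm[of x K "with_dif P D" X \<pi>] by simp
 next
 case (cmp a bs)
 thus ?case using opspan.cmp[of a K "with_dif P D" X bs] by simp
 qed (rule opspan.gen)
qed

text \<open>The square of an odd derivation is a derivation, since the mixed terms have opposite signs, so it
  is determined by its values on generators.\<close>

lemma (in operad) derivation_square:
 assumes D: "derivation K P D" and X: "X \<subseteq> elts P" "elts P \<subseteq> opspan K P X"
 and DD: "!!x. x : X ==> D (D x) = nul P (arity P x) (deg P x - 2)" and x: "x : elts P"
 shows "D (D x) = nul P (arity P x) (deg P x - 2)"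
proof -
 have Ds: "smod_hom K P (shift 1 P) D" using D by (simp add: derivation_def)
 interpret D: smodule_hom K P "shift 1 P" D
 by (intro smodule_hom.intro smodule_hom_axioms.intro smodule_axioms smodule_shift Ds)
 have nul: "D (nul P n d) = nul P n (d - 1)" for n d using D.hom_nul[of n d] by simp
 have Dg: "D y : gr P n (d - 1)" if "y : gr P n d" for y n d by (rule derivation_gr[OF D that])
 have x': "x : opspan K P X" using x X by blast
 from x' X(1) show ?thesis
 proof (induction rule: opspan_induct)
 case (gen x)
 thus ?case by (rule DD)
 next
 case unt
 show ?case using derivation_unt[OF D] nul[of 1 "- 1"] by (simp add: arity_unit deg_unit)
 next
 case (nul n d)
 show ?case using D.hom_nul[of n d] D.hom_nul[of n "d - 1"] by simp
 next
 case (pls n d x y)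
 have "D (pls P x y) = pls P (D x) (D y)" using D.hom_pls[OF pls(1,2)] by simp
 hence "D (D (pls P x y)) = pls P (D (D x)) (D (D y))"
 using D.hom_pls[OF Dg[OF pls(1)] Dg[OF pls(2)]] by simp
 thus ?case using pls pls_gr[OF pls(1,2)] by (simp add: gr_iff nul_pls[OF nul_gr])
 next
 case (scale c x)
 have "D x : elts P" using Dg[OF elts_gr[OF scale(2)]] by (simp add: gr_iff)
 thus ?case using scale scale_gr[OF scale(1) elts_gr[OF scale(2)]] D.hom_scale[OF scale(1)]
 by (simp add: gr_iff)
 next
 case (perm \<pi> x)
 note g = elts_gr[OF perm(1)]
 thus ?case using perm perm_gr[OF g perm(2)] D.hom_perm[OF g perm(2)] D.hom_perm[OF Dg[OF g] perm(2)]
 by (simp add: gr_iff)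
 next
 case (cmp a bs)
 let ?zs = "graph D bs" and ?n = "tarity P bs"
 and ?d = "deg P a + tdeg P bs"
 have ag: "a : comp_of P a" by (rule composable_gr[OF cmp(1)])
 have bg: "b : comp_of P b" if "b : set bs" for b
 using cmp(1) that by (auto simp: composable_def elts_gr)
 have m: "map fst ?zs = bs" by (simp add: comp_def)
 have c2: "comp2 P (- 1) a ?zs"
 using comp2_pairs[where f = "%b. b" and g = D and bs = bs and a = a and k = "- 1"] cmp(1) Dg[OF bg] by simp
 have cD: "composable P (D a) bs" by (rule composable_cong[OF cmp(1) Dg[OF ag]])
 have t: "D (leib_term K P a ?zs i) = signed K P (deg P a + pdeg P ?zs i) (pls P (cmp P (D a) (mark ?zs i))
 (leib K P a (?zs[i := (snd (?zs ! i), nul P (arity P (fst (?zs ! i))) (deg P (fst (?zs ! i)) - 2))])))"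
 if i: "i < length ?zs" for i
 proof -
 note cm = mark_composable[OF c2 i]
 have "map (%b. (b, D b)) (mark ?zs i) = ?zs[i := (snd (?zs ! i), nul P (arity P (fst (?zs ! i))) (deg P (fst (?zs ! i)) - 2))]"
 using i cmp(3)[of "bs ! i"] unfolding mark_def m by (simp add: map_update)
 hence "D (cmp P a (mark ?zs i)) = pls P (cmp P (D a) (mark ?zs i))
 (leib K P a (?zs[i := (snd (?zs ! i), nul P (arity P (fst (?zs ! i))) (deg P (fst (?zs ! i)) - 2))]))"
 using derivation_cmp[OF D cm] by simp
 thus ?thesis unfolding leib_term_def using D.hom_signed[OF comp_closed[OF cm]] by simp
 qed
 have lt: "leib_term K P a ?zs i : gr P ?n (?d - 1)" if "i < length ?zs" for i
 using leib_term_gr[OF c2 that] unfolding m .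
 have l: "leib K P a ?zs : gr P ?n (?d - 1)" using leib_gr[OF c2] unfolding m .
 have c: "cmp P (D a) bs : gr P ?n (?d - 1)"
 by (rule cmp_gr[OF cD]) (use Dg[OF ag] in "simp_all add: gr_iff")
 have lD: "D (leib K P a ?zs) = lsum P ?n (?d - 2) (map (%i. D (leib_term K P a ?zs i)) [0..<length ?zs])"
 proof -
 have "D (leib K P a ?zs) = lsum (shift 1 P) ?n (?d - 1) (map D (map (leib_term K P a ?zs) [0..<length ?zs]))"
 unfolding leib_def m by (rule D.hom_lsum) (use lt in auto)
 thus ?thesis by (simp add: comp_def)
 qed
 have "D (cmp P (D a) bs) = pls P (cmp P (nul P (arity P a) (deg P a - 2)) bs) (leib K P (D a) ?zs)"
 using derivation_cmp[OF D cD] cmp(2) by simp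
 also have "cmp P (nul P (arity P a) (deg P a - 2)) bs = nul P ?n (?d - 2)"
 using cmp_nul_left'[OF cmp(1), of "deg P a - 2"] by (simp add: algebra_simps)
 also have "pls P (nul P ?n (?d - 2)) (leib K P (D a) ?zs) = leib K P (D a) ?zs"
 proof (rule nul_pls)
 have "comp2 P (- 1) (D a) ?zs" using c2 Dg[OF ag] by (simp add: comp2_def gr_iff)
 from leib_gr[OF this] show "leib K P (D a) ?zs : gr P ?n (?d - 2)"
 unfolding m using Dg[OF ag] by (simp add: gr_iff algebra_simps)
 qed
 finally have A: "D (cmp P (D a) bs) = leib K P (D a) ?zs" .
 have "D (D (cmp P a bs)) = D (pls P (cmp P (D a) bs) (leib K P a ?zs))"
 using derivation_cmp[OF D cmp(1)] by simp
 also have "... = pls P (leib K P (D a) ?zs) (D (leib K P a ?zs))" using D.hom_pls[OF c l] A by simp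
 also have "D (leib K P a ?zs) = lsum P ?n (?d - 2) (map (%i. signed K P (deg P a + pdeg P ?zs i) (pls P (cmp P (D a) (mark ?zs i))
 (leib K P a (?zs[i := (snd (?zs ! i), nul P (arity P (fst (?zs ! i))) (deg P (fst (?zs ! i)) - 2))])))) [0..<length ?zs])"
 unfolding lD by (intro arg_cong[where f = "lsum P ?n (?d - 2)"] map_upt_cong) (rule t)
 also have "pls P (leib K P (D a) ?zs) ... = nul P ?n (?d - 2)"
 by (rule leib_square[OF c2 Dg[OF ag]]) (simp_all only: m)
 finally show ?case using cmp(1) by (simp add: arity_comp deg_comp)
 qed
qed
lemma dg_homI: "operad_hom K P Q f ==> (!!x. x : elts P ==> f (dif P x) = dif Q (f x)) ==> dg_hom K P Q f"
 by (simp add: dg_hom_def)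

text \<open>A morphism that commutes with the differentials on generators is a morphism of dg operads.\<close>

lemma dg_hom_from_generators:
 assumes P: "operad K P" "derivation K P (dif P)" and Q: "operad K Q" "derivation K Q (dif Q)"
 and f: "operad_hom K P Q f" and X: "X \<subseteq> elts P" "elts P \<subseteq> opspan K P X"
 and c: "!!x. x : X ==> f (dif P x) = dif Q (f x)"
 shows "dg_hom K P Q f"
proof (rule dg_homI[OF f])
 interpret P: operad K P by fact
 interpret Q: operad K Q by fact
 interpret f: op_hom K P Q f by (rule op_homI[OF P(1) Q(1) f])
 fix x assume x: "x : elts P"
 have "(%x. map_prod f f (x, dif P x)) x = (%x. (f x, dif Q (f x))) x"
 by (rule hom_eq_on_opspan[OF op_homI[OF P(1) Q.operad_dual operad_hom_comp[OF P.derivation_hom[OF P(2)] f.dual_hom]]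
 op_homI[OF P(1) Q.operad_dual operad_hom_comp[OF f Q.derivation_hom[OF Q(2)]]] X(1)])
 (use c x X in auto)
 thus "f (dif P x) = dif Q (f x)" by simp
qed
lemma dg_hom_cong:
 assumes "dg_hom K P Q f" "dg_operad K P" "!!x. x : elts P ==> g x = f x" shows "dg_hom K P Q g"
proof -
 interpret dg_operad K P by fact
 have "dif P x : elts P" if "x : elts P" for x
 using derivation_gr[OF dif_derivation elts_gr[OF that]] by (simp add: gr_iff)
 thus ?thesis using assms operad_hom_cong[of K P Q f g] operad_axioms by (simp add: dg_hom_def)
qed

subsection \<open>The differential of the chainification\<close>

context chainification
begin
lemma ch_dif_properties:
 "dif (ch K P) : extensional (elts C) & derivation K C (dif (ch K P)) &
 (\<forall>a\<in>elts P. dif (ch K P) (\<iota> a) = \<delta> a & dif (ch K P) (\<delta> a) = nul C (arity P a) (deg P a - 2)) &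
 ch K P = with_dif C (dif (ch K P))"
proof -
 let ?Pr = "%D. D : extensional (elts C) & derivation K C D &
 (\<forall>a\<in>elts P. D (\<iota> a) = \<delta> a & D (\<delta> a) = nul C (arity P a) (deg P a - 2))"
 obtain D where D: "derivation K C D" "!!a. a : elts P ==> D (\<iota> a) = \<delta> a"
 "!!a. a : elts P ==> D (\<delta> a) = nul C (arity P a) (deg P a - 2)"
 using ch_derivation by blast
 have r: "?Pr (restrict D (elts C))"
 using D q.p.Q.derivation_cong[OF D(1), of "restrict D (elts C)"] gens_elts by auto
 have u: "D1 = D2" if "?Pr D1" "?Pr D2" for D1 D2
 proof (rule extensionalityI[of _ "elts C"])
 fix x assume x: "x : elts C"
 show "D1 x = D2 x"
 proof (rule q.p.Q.derivation_eq_on_opspan[where D = D1 and D' = D2, OF _ _ gens_elts])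
 show "derivation K C D1" "derivation K C D2" using that by auto
 show "D1 y = D2 y" if "y : gens" for y using that \<open>?Pr D1\<close> \<open>?Pr D2\<close> by auto
 show "x : opspan K C gens" using x generated by blast
 qed
 qed (use that in auto)
 have "\<exists>!D. ?Pr D" by (rule ex1I[of ?Pr, OF r u[OF _ r]])
 hence t: "?Pr (THE D. ?Pr D)" by (rule theI')
 have e: "ch K P = with_dif C (THE D. ?Pr D)" by (simp add: ch_def Let_def)
 have d: "dif (ch K P) = (THE D. ?Pr D)" by (simp only: e with_dif_sel)
 show ?thesis using t e unfolding d[symmetric] by blast
qed
lemma dif_ch: "derivation K C (dif (ch K P))" "dif (ch K P) : extensional (elts C)"
 "a : elts P ==> dif (ch K P) (\<iota> a) = \<delta> a"
 "a : elts P ==> dif (ch K P) (\<delta> a) = nul C (arity P a) (deg P a - 2)"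
 and ch_with_dif: "ch K P = with_dif C (dif (ch K P))"
 using ch_dif_properties by blast+
lemma ch_sel [simp]:
 "elts (ch K P) = elts C" "arity (ch K P) = arity C" "deg (ch K P) = deg C" "nul (ch K P) = nul C"
 "unt (ch K P) = unt C" "gr (ch K P) = gr C" "opspan K (ch K P) = opspan K C" "derivation K (ch K P) = derivation K C"
 "operad_hom K (ch K P) Q h = operad_hom K C Q h" "operad_hom K Q' (ch K P) h' = operad_hom K Q' C h'"
 "smod_hom K M' (ch K P) u = smod_hom K M' C u"
 "composable (ch K P) = composable C" "pls (ch K P) = pls C" "scale (ch K P) = scale C" "cmp (ch K P) = cmp C"
 "perm (ch K P) = perm C"
proof -
 note e = ch_with_dif
 show "operad_hom K (ch K P) Q h = operad_hom K C Q h" by (subst e) simp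
 show "operad_hom K Q' (ch K P) h' = operad_hom K Q' C h'" by (subst e) simp
 show "smod_hom K M' (ch K P) u = smod_hom K M' C u" by (subst e) simp
 show "derivation K (ch K P) = derivation K C" by (rule ext) (subst e, simp)
 show "opspan K (ch K P) = opspan K C" by (rule ext) (subst e, simp)
qed (subst ch_with_dif, simp)+
lemma operad_ch: "operad K (ch K P)"
 by (subst ch_with_dif) (rule operad_with_dif[OF q.operad_quotient])
lemma dg_operad_ch: "dg_operad K (ch K P)"
proof (intro dg_operad.intro dg_operad_axioms.intro operad_ch)
 show "derivation K (ch K P) (dif (ch K P))" using dif_ch(1) by simp
 fix x assume x: "x : elts (ch K P)"
 have "dif (ch K P) (dif (ch K P) x) = nul C (arity C x) (deg C x - 2)"
 proof (rule q.p.Q.derivation_square[where D = "dif (ch K P)", OF dif_ch(1) gens_elts generated])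
 show "x : elts C" using x by simp
 interpret d: smodule_hom K C "shift 1 C" "dif (ch K P)"
 using dif_ch(1) q.p.Q.smodule_axioms smodule_shift[OF q.p.Q.smodule_axioms]
 by (intro smodule_hom.intro smodule_hom_axioms.intro) (auto simp: derivation_def)
 fix y assume "y : gens"
 then consider a where "a : elts P" "y = \<iota> a" | a where "a : elts P" "y = \<delta> a" by blast
 thus "dif (ch K P) (dif (ch K P) y) = nul C (arity C y) (deg C y - 2)"
 proof cases
 case 1
 thus ?thesis using dif_ch(3,4) iota_gr[OF elts_gr[OF 1(1)]] by (simp add: gr_iff)
 next
 case 2
 thus ?thesis using dif_ch(4)[OF 2(1)] d.hom_nul[of "arity P a" "deg P a - 2"] del_gr[OF elts_gr[OF 2(1)]]
 by (simp add: gr_iff)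
 qed
 qed
 thus "dif (ch K P) (dif (ch K P) x) = nul (ch K P) (arity (ch K P) x) (deg (ch K P) x - 2)"
 by (simp only: ch_sel)
qed
lemma ch_dg_universal:
 assumes "dg_operad K Q" "operad_hom K P Q F"
 shows "\<exists>h. dg_hom K (ch K P) Q h & (\<forall>a\<in>elts P. h (\<iota> a) = F a)"
proof -
 interpret Q: dg_operad K Q by fact
 obtain h where h: "operad_hom K C Q h" "!!a. a : elts P ==> h (\<iota> a) = F a" "!!a. a : elts P ==> h (\<delta> a) = dif Q (F a)"
 using ch_universal[OF Q.operad_axioms operad_hom_comp[OF assms(2) Q.derivation_hom[OF Q.dif_derivation]]] by auto
 interpret F: op_hom K P Q F by (rule op_homI[OF operad_axioms Q.operad_axioms assms(2)])
 interpret h: op_hom K C Q h by (rule op_homI[OF q.operad_quotient Q.operad_axioms h(1)])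
 have "dg_hom K (ch K P) Q h"
 proof (rule dg_hom_from_generators[OF operad_ch _ Q.operad_axioms Q.dif_derivation])
 fix x assume "x : gens"
 thus "h (dif (ch K P) x) = dif Q (h x)"
 using h dif_ch(3,4) Q.dif_dif F.hom_grade by auto
 qed (use h gens_elts generated dif_ch in auto)
 thus ?thesis using h by blast
qed
lemma ch_dg_unique:
 assumes "dg_operad K Q" "dg_hom K (ch K P) Q h" "dg_hom K (ch K P) Q h'"
 and "Y \<subseteq> elts P" "elts P \<subseteq> opspan K P Y" "!!y. y : Y ==> h (\<iota> y) = h' (\<iota> y)" "x : elts C"
 shows "h x = h' x"
proof -
 interpret Q: dg_operad K Q by fact
 have hs: "operad_hom K C Q h" "operad_hom K C Q h'" using assms by (simp_all add: dg_hom_def)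
 have i: "h (\<iota> a) = h' (\<iota> a)" if "a : elts P" for a
 by (rule hom_eq_on_opspan[OF op_homI[OF operad_axioms Q.operad_axioms operad_hom_comp[OF iota_operad_hom hs(1)]]
 op_homI[OF operad_axioms Q.operad_axioms operad_hom_comp[OF iota_operad_hom hs(2)]] assms(4)])
 (use assms that in auto)
 have j: "h (\<delta> a) = h' (\<delta> a)" if a: "a : elts P" for a
 proof -
 have "\<iota> a : elts (ch K P)" using iota_gr[OF elts_gr[OF a]] by (simp add: gr_iff)
 hence "h (dif (ch K P) (\<iota> a)) = h' (dif (ch K P) (\<iota> a))"
 using assms(2,3) i[OF a] unfolding dg_hom_def by metis
 thus ?thesis using dif_ch(3)[OF a] by simp
 qed
 show ?thesis by (rule hom_eq[OF Q.operad_axioms hs i j assms(7)])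
qed

end
lemma (in smodule) ch_free_map_properties:
 assumes "dg_operad K Q" "smod_hom K M Q f"
 shows "dg_hom K (ch K (free K M)) Q (ch_free_map K M Q f)"
 "x : elts M ==> ch_free_map K M Q f (ch_iota K (free K M) (gen K M x)) = f x"
proof -
 interpret c: chainification K "free K M" by (simp add: chainification_def operad_free)
 interpret Q: dg_operad K Q by fact
 let ?Pr = "%h. h : extensional (elts (ch K (free K M))) & dg_hom K (ch K (free K M)) Q h &
 (\<forall>x\<in>elts M. h (ch_iota K (free K M) (gen K M x)) = f x)"
 obtain F where F: "operad_hom K (free K M) Q F" "!!x. x : elts M ==> F (gen K M x) = f x"
 using free_universal[OF Q.operad_axioms assms(2)] by blast
 obtain h where h: "dg_hom K (ch K (free K M)) Q h" "!!a. a : elts (free K M) ==> h (c.\<iota> a) = F a"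
 using c.ch_dg_universal[OF assms(1) F(1)] by blast
 have ge: "gen K M x : elts (free K M)" if "x : elts M" for x using gens_elts that by auto
 have ie: "c.\<iota> (gen K M x) : elts (ch K (free K M))" if "x : elts M" for x
 using c.gens_elts ge[OF that] by auto
 have r: "?Pr (restrict h (elts (ch K (free K M))))"
 using dg_hom_cong[OF h(1) c.dg_operad_ch, of "restrict h (elts (ch K (free K M)))"] h(2) F(2) ge ie by simp
 have u: "h1 = h2" if "?Pr h1" "?Pr h2" for h1 h2
 proof (rule extensionalityI[of _ "elts (ch K (free K M))"])
 fix x assume x: "x : elts (ch K (free K M))"
 show "h1 x = h2 x"
 proof (rule c.ch_dg_unique[where h = h1 and h' = h2, OF assms(1) _ _ gens_elts free_generated])
 show "dg_hom K (ch K (free K M)) Q h1" "dg_hom K (ch K (free K M)) Q h2" using that by auto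
 show "h1 (c.\<iota> y) = h2 (c.\<iota> y)" if "y : gen K M ` elts M" for y using that \<open>?Pr h1\<close> \<open>?Pr h2\<close> by auto
 qed (use x in simp)
 qed (use that in auto)
 have "\<exists>!h. ?Pr h" by (rule ex1I[of ?Pr, OF r u[OF _ r]])
 hence "?Pr (THE h. ?Pr h)" by (rule theI')
 thus "dg_hom K (ch K (free K M)) Q (ch_free_map K M Q f)"
 "x : elts M ==> ch_free_map K M Q f (ch_iota K (free K M) (gen K M x)) = f x"
 by (simp_all add: ch_free_map_def Let_def)
qed

section \<open>Pushouts of dg operads\<close>

lemma opspan_subset: assumes "X \<subseteq> opspan K P Y" shows "opspan K P X \<subseteq> opspan K P Y"
proof
 fix x assume "x : opspan K P X"
 thus "x : opspan K P Y"
 by (induction rule: opspan.induct) (use assms in "auto intro: opspan.intros")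
qed

locale pushout_data = A: dg_operad K A + P: dg_operad K P + Q: dg_operad K Q
 for K :: "('k, 'z) ring_scheme" (structure) and A :: "('k, 'c, 'l) dgoperad_scheme"
 and P :: "('k, 'a, 'm) dgoperad_scheme" and Q :: "('k, 'b, 'n) dgoperad_scheme" and f g +
 assumes f_hom: "dg_hom K A P f" and g_hom: "dg_hom K A Q g"
begin
abbreviation "N \<equiv> dsum P Q"
abbreviation "B \<equiv> po_base K P Q"
abbreviation "T \<equiv> quotient_op K B (po_rels K A P Q f g)"
abbreviation "L \<equiv> pushout K A P Q f g"
abbreviation "i0 x \<equiv> gen K N (inj1 P Q x)"
abbreviation "j0 y \<equiv> gen K N (inj2 P Q y)"
abbreviation "in1 \<equiv> po_in1 K A P Q f g"
abbreviation "in2 \<equiv> po_in2 K A P Q f g"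
sublocale N: smodule K N by (rule smodule_dsum[OF P.smodule_axioms Q.smodule_axioms])
sublocale B: operad K B unfolding po_base_def by (rule N.operad_free)
lemma i0_hom: "smod_hom K P B (%x. i0 x)" and j0_hom: "smod_hom K Q B (%y. j0 y)"
 unfolding po_base_def
 by (rule smod_hom_comp[OF smod_hom_inj1[OF P.smodule_axioms Q.smodule_axioms] N.gen_smod_hom],
 rule smod_hom_comp[OF smod_hom_inj2[OF P.smodule_axioms Q.smodule_axioms] N.gen_smod_hom])
lemma i0_cmp_gr:
 assumes "composable P a bs"
 shows "cmp B (i0 a) (map (%x. i0 x) bs) : gr B (tarity P bs) (deg P a + tdeg P bs)"
 "i0 (cmp P a bs) : gr B (tarity P bs) (deg P a + tdeg P bs)"
 "composable B (i0 a) (map (%x. i0 x) bs)"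
proof -
 show c: "composable B (i0 a) (map (%x. i0 x) bs)" by (rule smod_hom_composable[OF i0_hom assms])
 have m: "map (arity B) (map (%x. i0 x) bs) = map (arity P) bs" "map (deg B) (map (%x. i0 x) bs) = map (deg P) bs"
 "deg B (i0 a) = deg P a"
 using i0_hom assms by (auto simp: smod_hom_def composable_def)
 show "cmp B (i0 a) (map (%x. i0 x) bs) : gr B (tarity P bs) (deg P a + tdeg P bs)"
 by (rule B.cmp_gr[OF c]) (simp_all only: m)
 show "i0 (cmp P a bs) : gr B (tarity P bs) (deg P a + tdeg P bs)"
 by (rule smod_hom_gr[OF i0_hom P.cmp_gr[OF assms refl refl]])
qed
lemma j0_cmp_gr:
 assumes "composable Q a bs"
 shows "cmp B (j0 a) (map (%x. j0 x) bs) : gr B (tarity Q bs) (deg Q a + tdeg Q bs)"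
 "j0 (cmp Q a bs) : gr B (tarity Q bs) (deg Q a + tdeg Q bs)"
 "composable B (j0 a) (map (%x. j0 x) bs)"
proof -
 show c: "composable B (j0 a) (map (%x. j0 x) bs)" by (rule smod_hom_composable[OF j0_hom assms])
 have m: "map (arity B) (map (%x. j0 x) bs) = map (arity Q) bs" "map (deg B) (map (%x. j0 x) bs) = map (deg Q) bs"
 "deg B (j0 a) = deg Q a"
 using j0_hom assms by (auto simp: smod_hom_def composable_def)
 show "cmp B (j0 a) (map (%x. j0 x) bs) : gr B (tarity Q bs) (deg Q a + tdeg Q bs)"
 by (rule B.cmp_gr[OF c]) (simp_all only: m)
 show "j0 (cmp Q a bs) : gr B (tarity Q bs) (deg Q a + tdeg Q bs)"
 by (rule smod_hom_gr[OF j0_hom Q.cmp_gr[OF assms refl refl]])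
qed
lemma fg_gr:
 assumes "x : elts A"
 shows "i0 (f x) : gr B (arity A x) (deg A x)" "j0 (g x) : gr B (arity A x) (deg A x)"
proof -
 have s: "smod_hom K A P f" "smod_hom K A Q g" using f_hom g_hom by (simp_all add: dg_hom_def operad_hom_def)
 show "i0 (f x) : gr B (arity A x) (deg A x)"
 by (rule smod_hom_gr[OF i0_hom smod_hom_gr[OF s(1) elts_gr[OF assms]]])
 show "j0 (g x) : gr B (arity A x) (deg A x)"
 by (rule smod_hom_gr[OF j0_hom smod_hom_gr[OF s(2) elts_gr[OF assms]]])
qed
lemma po_rels_eq: "po_rels K A P Q f g =
 {mns K B (i0 (cmp P a bs)) (cmp B (i0 a) (map (%x. i0 x) bs)) | a bs. composable P a bs} \<union>
 {mns K B (j0 (cmp Q a bs)) (cmp B (j0 a) (map (%x. j0 x) bs)) | a bs. composable Q a bs} \<union>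
 {mns K B (i0 (unt P)) (unt B), mns K B (j0 (unt Q)) (unt B)} \<union>
 {mns K B (i0 (f x)) (j0 (g x)) | x. x : elts A}"
 unfolding po_rels_def Let_def ..
lemma unt_gr0: "i0 (unt P) : gr B 1 0" "j0 (unt Q) : gr B 1 0"
 by (rule smod_hom_gr[OF i0_hom P.unt_gr], rule smod_hom_gr[OF j0_hom Q.unt_gr])
lemma po_rels_elts: "po_rels K A P Q f g \<subseteq> elts B"
proof -
 have e: "x : gr B n d ==> y : gr B n d ==> mns K B x y : elts B" for x y n d
 using B.mns_gr[of x n d y] by (simp add: gr_iff)
 show ?thesis unfolding po_rels_eq
 proof (intro Un_least subsetI; (elim CollectE exE conjE insertE emptyE)?; hypsubst)
 show "mns K B (i0 (cmp P a bs)) (cmp B (i0 a) (map (%x. i0 x) bs)) : elts B" if "composable P a bs" for a bs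
 by (rule e[OF i0_cmp_gr(2,1)[OF that]])
 show "mns K B (j0 (cmp Q a bs)) (cmp B (j0 a) (map (%x. j0 x) bs)) : elts B" if "composable Q a bs" for a bs
 by (rule e[OF j0_cmp_gr(2,1)[OF that]])
 show "mns K B (i0 (unt P)) (unt B) : elts B" by (rule e[OF unt_gr0(1) B.unt_gr])
 show "mns K B (j0 (unt Q)) (unt B) : elts B" by (rule e[OF unt_gr0(2) B.unt_gr])
 show "mns K B (i0 (f x)) (j0 (g x)) : elts B" if "x : elts A" for x
 by (rule e[OF fg_gr[OF that]])
 qed
qed
sublocale q: quotient_operad K B "po_rels K A P Q f g"
 by (intro quotient_operad.intro quotient_operad_axioms.intro B.operad_axioms po_rels_elts)
lemma in1_hom: "operad_hom K P T in1"
proof (rule operad_homI)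
 show "smod_hom K P T in1" unfolding po_in1_def[abs_def] by (rule smod_hom_comp[OF i0_hom q.p.shom])
 show "in1 (unt P) = unt T" unfolding po_in1_def q.p.hom_unt[symmetric]
 by (rule q.proj_eq[OF _ unt_gr0(1) B.unt_gr]) (simp add: po_rels_eq)
 fix a bs assume c: "composable P a bs"
 have "quotient_proj K B (po_rels K A P Q f g) (i0 (cmp P a bs))
 = quotient_proj K B (po_rels K A P Q f g) (cmp B (i0 a) (map (%x. i0 x) bs))"
 by (rule q.proj_eq[OF _ i0_cmp_gr(2,1)[OF c]]) (use c in "auto simp: po_rels_eq")
 thus "in1 (cmp P a bs) = cmp T (in1 a) (map in1 bs)"
 unfolding po_in1_def q.p.hom_cmp[OF i0_cmp_gr(3)[OF c]] by (simp add: comp_def)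
qed
lemma in2_hom: "operad_hom K Q T in2"
proof (rule operad_homI)
 show "smod_hom K Q T in2" unfolding po_in2_def[abs_def] by (rule smod_hom_comp[OF j0_hom q.p.shom])
 show "in2 (unt Q) = unt T" unfolding po_in2_def q.p.hom_unt[symmetric]
 by (rule q.proj_eq[OF _ unt_gr0(2) B.unt_gr]) (simp add: po_rels_eq)
 fix a bs assume c: "composable Q a bs"
 have "quotient_proj K B (po_rels K A P Q f g) (j0 (cmp Q a bs))
 = quotient_proj K B (po_rels K A P Q f g) (cmp B (j0 a) (map (%x. j0 x) bs))"
 by (rule q.proj_eq[OF _ j0_cmp_gr(2,1)[OF c]]) (use c in "auto simp: po_rels_eq")
 thus "in2 (cmp Q a bs) = cmp T (in2 a) (map in2 bs)"
 unfolding po_in2_def q.p.hom_cmp[OF j0_cmp_gr(3)[OF c]] by (simp add: comp_def)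
qed
lemma in1_eq_in2: "x : elts A ==> in1 (f x) = in2 (g x)"
 unfolding po_in1_def po_in2_def
 by (rule q.proj_eq[OF _ fg_gr]) (auto simp: po_rels_eq)
abbreviation "gens \<equiv> in1 ` elts P \<union> in2 ` elts Q"
lemma in1_gr: "x : gr P n d ==> in1 x : gr T n d" and in2_gr: "y : gr Q n d ==> in2 y : gr T n d"
 by (rule smod_hom_gr[OF operad_hom_smod[OF in1_hom]], simp, rule smod_hom_gr[OF operad_hom_smod[OF in2_hom]])
lemma gens_elts: "gens \<subseteq> elts T"
 using in1_gr[OF elts_gr] in2_gr[OF elts_gr] by (auto simp: gr_iff)
lemma generated: "elts T \<subseteq> opspan K T gens"
proof -
 let ?p = "quotient_proj K B (po_rels K A P Q f g)"
 have ge: "gen K N ` elts N \<subseteq> elts B" using N.gens_elts unfolding po_base_def .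
 have "?p ` gen K N ` elts N \<subseteq> opspan K T gens"
 proof clarify
 fix p1 p2 assume p: "(p1, p2) : elts N"
 hence f: "p1 : elts P" "p2 : gr Q (arity P p1) (deg P p1)" by (auto simp: elts_dsum)
 have i: "inj1 P Q p1 : gr N (arity P p1) (deg P p1)"
 by (rule smod_hom_gr[OF smod_hom_inj1[OF P.smodule_axioms Q.smodule_axioms] elts_gr[OF f(1)]])
 have j: "inj2 P Q p2 : gr N (arity P p1) (deg P p1)"
 by (rule smod_hom_gr[OF smod_hom_inj2[OF P.smodule_axioms Q.smodule_axioms] f(2)])
 have "gen K N (p1, p2) = pls B (i0 p1) (j0 p2)"
 using dsum_decompose[OF P.smodule_axioms Q.smodule_axioms p] smod_hom_pls[OF N.gen_smod_hom i j]
 unfolding po_base_def by simp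
 hence py: "?p (gen K N (p1, p2)) = pls T (in1 p1) (in2 p2)"
 using q.p.hom_pls[OF smod_hom_gr[OF i0_hom elts_gr[OF f(1)]] smod_hom_gr[OF j0_hom f(2)]]
 by (simp add: po_in1_def po_in2_def)
 have "same_grade T (in1 p1) (in2 p2)"
 using in1_gr[OF elts_gr[OF f(1)]] in2_gr[OF f(2)] by (simp add: same_grade_def gr_iff)
 thus "?p (gen K N (p1, p2)) : opspan K T gens"
 unfolding py by (intro opspan.pls opspan.gen) (use f in "auto simp: gr_iff")
 qed
 note sub = opspan_subset[OF this]
 have "elts B \<subseteq> opspan K B (gen K N ` elts N)" using N.free_generated unfolding po_base_def .
 from image_mono[OF this, of ?p] have "elts T \<subseteq> ?p ` opspan K B (gen K N ` elts N)"
 unfolding q.proj_surj .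
 also have "... \<subseteq> opspan K T (?p ` gen K N ` elts N)" by (rule q.p.hom_opspan[OF ge])
 also note sub
 finally show ?thesis .
qed
lemma po_universal:
 assumes X: "operad K X" and u: "operad_hom K P X u" and v: "operad_hom K Q X v"
 and uv: "!!x. x : elts A ==> u (f x) = v (g x)"
 shows "\<exists>h. operad_hom K T X h & (\<forall>x\<in>elts P. h (in1 x) = u x) & (\<forall>y\<in>elts Q. h (in2 y) = v y)"
proof -
 interpret X: operad K X by fact
 interpret u: op_hom K P X u by (rule op_homI[OF P.operad_axioms X u])
 interpret v: op_hom K Q X v by (rule op_homI[OF Q.operad_axioms X v])
 obtain h0 where h0: "operad_hom K B X h0"
 "!!p. p : elts N ==> h0 (gen K N p) = pls X (u (fst p)) (v (snd p))"
 using N.free_universal[OF X smod_hom_copair[OF X.smodule_axioms u.shom v.shom]] unfolding po_base_def by blast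
 interpret h0: op_hom K B X h0 by (rule op_homI[OF B.operad_axioms X h0(1)])
 have i1: "h0 (i0 a) = u a" if a: "a : elts P" for a
 proof -
 have "inj1 P Q a : elts N" using smod_hom_gr[OF smod_hom_inj1[OF P.smodule_axioms Q.smodule_axioms] elts_gr[OF a]] by (simp add: gr_iff)
 thus ?thesis using h0(2) u.hom_gr[OF elts_gr[OF a]] by (simp add: inj1_def)
 qed
 have i2: "h0 (j0 a) = v a" if a: "a : elts Q" for a
 proof -
 have "inj2 P Q a : elts N" using smod_hom_gr[OF smod_hom_inj2[OF P.smodule_axioms Q.smodule_axioms] elts_gr[OF a]] by (simp add: gr_iff)
 thus ?thesis using h0(2) v.hom_gr[OF elts_gr[OF a]] by (simp add: inj2_def)
 qed
 have rel: "h0 x = nul X (arity B x) (deg B x)" if x: "x : po_rels K A P Q f g" for x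
 proof -
 let ?Z = "%x. h0 x = nul X (arity B x) (deg B x)"
 have eq: "h0 (mns K B y z) = nul X (arity B (mns K B y z)) (deg B (mns K B y z))"
 if "y : gr B n d" "z : gr B n d" "h0 y = h0 z" for y z n d
 using h0.hom_eq_iff[OF that(1,2)] that(3) B.mns_gr[OF that(1,2)] by (simp add: gr_iff)
 have r1: "h0 (i0 (cmp P a bs)) = h0 (cmp B (i0 a) (map (%x. i0 x) bs))" if c: "composable P a bs" for a bs
 proof -
 have "map (%x. h0 (i0 x)) bs = map u bs" "h0 (i0 a) = u a" using c i1 by (auto simp: composable_def)
 thus ?thesis using i1[OF P.comp_closed[OF c]] u.hom_cmp[OF c]
 unfolding h0.hom_cmp[OF i0_cmp_gr(3)[OF c]] by (simp add: comp_def del: map_eq_conv)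
 qed
 have r2: "h0 (j0 (cmp Q a bs)) = h0 (cmp B (j0 a) (map (%x. j0 x) bs))" if c: "composable Q a bs" for a bs
 proof -
 have "map (%x. h0 (j0 x)) bs = map v bs" "h0 (j0 a) = v a" using c i2 by (auto simp: composable_def)
 thus ?thesis using i2[OF Q.comp_closed[OF c]] v.hom_cmp[OF c]
 unfolding h0.hom_cmp[OF j0_cmp_gr(3)[OF c]] by (simp add: comp_def del: map_eq_conv)
 qed
 have r3: "h0 (i0 (unt P)) = h0 (unt B)" "h0 (j0 (unt Q)) = h0 (unt B)"
 using i1[OF P.unit_closed] i2[OF Q.unit_closed] u.hom_unt v.hom_unt h0.hom_unt by simp_all
 have r4: "h0 (i0 (f x)) = h0 (j0 (g x))" if "x : elts A" for x
 proof -
 have "f x : elts P" "g x : elts Q" using f_hom g_hom that by (auto simp: dg_hom_def operad_hom_def smod_hom_def)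
 thus ?thesis using i1 i2 uv[OF that] by simp
 qed
 from x show ?thesis unfolding po_rels_eq
 proof (elim UnE CollectE exE conjE insertE emptyE; hypsubst)
 show "?Z (mns K B (i0 (cmp P a bs)) (cmp B (i0 a) (map (%x. i0 x) bs)))" if "composable P a bs" for a bs
 by (rule eq[OF i0_cmp_gr(2,1)[OF that] r1[OF that]])
 show "?Z (mns K B (j0 (cmp Q a bs)) (cmp B (j0 a) (map (%x. j0 x) bs)))" if "composable Q a bs" for a bs
 by (rule eq[OF j0_cmp_gr(2,1)[OF that] r2[OF that]])
 show "?Z (mns K B (i0 (unt P)) (unt B))" by (rule eq[OF unt_gr0(1) B.unt_gr r3(1)])
 show "?Z (mns K B (j0 (unt Q)) (unt B))" by (rule eq[OF unt_gr0(2) B.unt_gr r3(2)])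
 show "?Z (mns K B (i0 (f x)) (j0 (g x)))" if "x : elts A" for x
 by (rule eq[OF fg_gr[OF that] r4[OF that]])
 qed
 qed
 obtain h where h: "operad_hom K T X h" "!!x. x : elts B ==> h (quotient_proj K B (po_rels K A P Q f g) x) = h0 x"
 using q.quotient_factor[OF X h0(1) rel] by blast
 have "h (in1 a) = u a" if a: "a : elts P" for a
 using h(2) i1[OF a] smod_hom_gr[OF i0_hom elts_gr[OF a]] unfolding po_in1_def by (simp add: gr_iff)
 moreover have "h (in2 a) = v a" if a: "a : elts Q" for a
 using h(2) i2[OF a] smod_hom_gr[OF j0_hom elts_gr[OF a]] unfolding po_in2_def by (simp add: gr_iff)
 ultimately show ?thesis using h(1) by blast
qed
lemma dif_gr: "x : gr P n d ==> dif P x : gr P n (d - 1)" "y : gr Q n d ==> dif Q y : gr Q n (d - 1)"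
 by (rule P.derivation_gr[OF P.dif_derivation], simp, rule Q.derivation_gr[OF Q.dif_derivation])
lemma dif_elts: "x : elts P ==> dif P x : elts P" "y : elts Q ==> dif Q y : elts Q"
 using dif_gr[OF elts_gr] by (auto simp: gr_iff)

text \<open>The two differentials are morphisms to the dual numbers over the pushout which agree on \<open>A\<close>; the
  universal property combines them.\<close>

lemma po_derivation:
 "\<exists>D. derivation K T D & (\<forall>x\<in>elts P. D (in1 x) = in1 (dif P x)) & (\<forall>y\<in>elts Q. D (in2 y) = in2 (dif Q y))"
proof -
 interpret i: op_hom K P T in1 by (rule op_homI[OF P.operad_axioms q.operad_quotient in1_hom])
 interpret j: op_hom K Q T in2 by (rule op_homI[OF Q.operad_axioms q.operad_quotient in2_hom])
 have u: "operad_hom K P (dual K T) (%x. map_prod in1 in1 (x, dif P x))"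
 by (rule operad_hom_comp[OF P.derivation_hom[OF P.dif_derivation] i.dual_hom])
 have v: "operad_hom K Q (dual K T) (%x. map_prod in2 in2 (x, dif Q x))"
 by (rule operad_hom_comp[OF Q.derivation_hom[OF Q.dif_derivation] j.dual_hom])
 have "map_prod in1 in1 (f x, dif P (f x)) = map_prod in2 in2 (g x, dif Q (g x))" if x: "x : elts A" for x
 proof -
 have "dif A x : elts A" using A.derivation_gr[OF A.dif_derivation elts_gr[OF x]] by (simp add: gr_iff)
 moreover have "dif P (f x) = f (dif A x)" "dif Q (g x) = g (dif A x)"
 using f_hom g_hom x by (auto simp: dg_hom_def)
 ultimately show ?thesis using in1_eq_in2 x by simp
 qed
 from po_universal[OF q.p.Q.operad_dual u v this]
 obtain \<phi> where \<phi>: "operad_hom K T (dual K T) \<phi>" "!!x. x : elts P ==> \<phi> (in1 x) = (in1 x, in1 (dif P x))"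
 "!!y. y : elts Q ==> \<phi> (in2 y) = (in2 y, in2 (dif Q y))" by auto
 have "fst (\<phi> x) = x" if "x : elts T" for x
 proof (rule hom_eq_on_opspan[where f = "%x. fst (\<phi> x)" and g = "%x. x", OF _ _ gens_elts])
 show "op_hom K T T (%x. fst (\<phi> x))"
 by (rule op_homI[OF q.operad_quotient q.operad_quotient
 operad_hom_comp[OF \<phi>(1) square_zero.fst_hom[OF q.p.Q.square_zero_leib]]])
 show "op_hom K T T (%x. x)"
 by (rule op_homI[OF q.operad_quotient q.operad_quotient]) (simp add: operad_hom_def smod_hom_id)
 show "x : opspan K T gens" using that generated by blast
 qed (use \<phi> in auto)
 from q.p.Q.hom_derivation[OF \<phi>(1) this] \<phi>(2,3) show ?thesis by (intro exI[of _ "%x. snd (\<phi> x)"]) simp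
qed
lemma pushout_dif_properties:
 "derivation K T (dif L) & (\<forall>x\<in>elts P. dif L (in1 x) = in1 (dif P x)) &
 (\<forall>y\<in>elts Q. dif L (in2 y) = in2 (dif Q y)) & L = with_dif T (dif L)"
proof -
 let ?Pr = "%D. D : extensional (elts T) & derivation K T D &
 (\<forall>x\<in>elts P. D (in1 x) = in1 (dif P x)) & (\<forall>y\<in>elts Q. D (in2 y) = in2 (dif Q y))"
 obtain D where D: "derivation K T D" "!!x. x : elts P ==> D (in1 x) = in1 (dif P x)"
 "!!y. y : elts Q ==> D (in2 y) = in2 (dif Q y)"
 using po_derivation by blast
 have r: "?Pr (restrict D (elts T))"
 using D q.p.Q.derivation_cong[OF D(1), of "restrict D (elts T)"] gens_elts by auto
 have u: "D1 = D2" if "?Pr D1" "?Pr D2" for D1 D2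
 proof (rule extensionalityI[of _ "elts T"])
 fix x assume x: "x : elts T"
 show "D1 x = D2 x"
 proof (rule q.p.Q.derivation_eq_on_opspan[where D = D1 and D' = D2, OF _ _ gens_elts])
 show "derivation K T D1" "derivation K T D2" using that by auto
 show "D1 y = D2 y" if "y : gens" for y using that \<open>?Pr D1\<close> \<open>?Pr D2\<close> by auto
 show "x : opspan K T gens" using x generated by blast
 qed
 qed (use that in auto)
 have "\<exists>!D. ?Pr D" by (rule ex1I[of ?Pr, OF r u[OF _ r]])
 hence t: "?Pr (THE D. ?Pr D)" by (rule theI')
 have e: "L = with_dif T (THE D. ?Pr D)" by (simp add: pushout_def Let_def)
 have d: "dif L = (THE D. ?Pr D)" by (simp only: e with_dif_sel)
 show ?thesis using t e unfolding d[symmetric] by blast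
qed
lemma dif_L: "derivation K T (dif L)" "x : elts P ==> dif L (in1 x) = in1 (dif P x)"
 "y : elts Q ==> dif L (in2 y) = in2 (dif Q y)" and L_with_dif: "L = with_dif T (dif L)"
 using pushout_dif_properties by blast+
lemma dg_operad_pushout: "dg_operad K L"
proof (intro dg_operad.intro dg_operad_axioms.intro)
 show "operad K L" by (subst L_with_dif) (rule operad_with_dif[OF q.operad_quotient])
 show "derivation K L (dif L)" using dif_L(1) derivation_with_dif[of K T "dif L" "dif L"] L_with_dif by simp
 have s: "elts L = elts T" "arity L = arity T" "deg L = deg T" "nul L = nul T"
 by (subst L_with_dif, simp)+
 fix x assume x: "x : elts L"
 have "dif L (dif L x) = nul T (arity T x) (deg T x - 2)"
 proof (rule q.p.Q.derivation_square[where D = "dif L", OF dif_L(1) gens_elts generated])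
 show "x : elts T" using x s by simp
 interpret i: op_hom K P T in1 by (rule op_homI[OF P.operad_axioms q.operad_quotient in1_hom])
 interpret j: op_hom K Q T in2 by (rule op_homI[OF Q.operad_axioms q.operad_quotient in2_hom])
 fix y assume "y : gens"
 then consider a where "a : elts P" "y = in1 a" | a where "a : elts Q" "y = in2 a" by blast
 thus "dif L (dif L y) = nul T (arity T y) (deg T y - 2)"
 proof cases
 case 1
 thus ?thesis using dif_L(2)[OF 1(1)] dif_L(2)[OF dif_elts(1)[OF 1(1)]] P.dif_dif[OF 1(1)] i.hom_grade[OF 1(1)] by simp
 next
 case 2
 thus ?thesis using dif_L(3)[OF 2(1)] dif_L(3)[OF dif_elts(2)[OF 2(1)]] Q.dif_dif[OF 2(1)] j.hom_grade[OF 2(1)] by simp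
 qed
 qed
 thus "dif L (dif L x) = nul L (arity L x) (deg L x - 2)" by (simp only: s)
qed
lemma in_dg_hom: "dg_hom K P L in1" "dg_hom K Q L in2"
proof -
 have "operad_hom K P L in1" "operad_hom K Q L in2"
 by (subst L_with_dif, simp add: in1_hom in2_hom)+
 thus "dg_hom K P L in1" "dg_hom K Q L in2" using dif_L by (auto simp: dg_hom_def)
qed
lemma pushout_generated: "elts L \<subseteq> opspan K L gens"
proof -
 have "elts L = elts T" "opspan K L gens = opspan K T gens" by (subst L_with_dif, simp)+
 thus ?thesis using generated by simp
qed

end

section \<open>Contraction of a chainified free operad\<close>

definition scalar :: "('k, 'z) ring_scheme => ('k, 'a, 'm) operad_scheme => 'a => bool" where
 "scalar K C y \<longleftrightarrow> y = zero_of C y \<or> (\<exists>c\<in>carrier K. y = scale C c (unt C))"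

text \<open>An endomorphism whose values are multiples of the unit.  On the chainification of a free operad it
  plays the role of the projection modulo the augmentation ideal, followed by the inclusion of the
  multiples of the unit.\<close>

locale augmentation = operad K C for K :: "('k, 'z) ring_scheme" (structure)
 and C :: "('k, 'a, 'm) operad_scheme" +
 fixes e
 assumes e_hom: "operad_hom K C C e" and e_scalar: "x : elts C ==> scalar K C (e x)"
begin
sublocale e: op_hom K C C e by (rule op_homI[OF operad_axioms operad_axioms e_hom])
lemma e_cases:
 assumes a: "a : elts C"
 obtains "e a = zero_of C a" | "arity C a = 1" "deg C a = 0"
proof (cases "e a = zero_of C a")
 case False
 then obtain c where c: "c : carrier K" "e a = scale C c (unt C)"
 using e_scalar[OF a] e.hom_grade[OF a] by (auto simp: scalar_def)
 have "e a : gr C 1 0" using scale_gr[OF c(1) unt_gr] c(2) by simp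
 thus ?thesis using that(2) e.hom_grade[OF a] by (simp add: gr_iff)
qed (rule that(1))
lemma e_nul: "a : elts C ==> arity C a ~= 1 \<or> deg C a ~= 0 ==> e a = zero_of C a"
 by (erule e_cases) auto

text \<open>Since \<open>e a\<close> is a multiple of the unit, it can be nonzero in arity one only, and there the composite
  is the second component of the single pair times a scalar.\<close>

definition hterm :: "'a => ('a \<times> 'a) list => 'a" where
 "hterm a zs = (if arity C a = 1 then cmp C (e a) (map snd zs)
 else nul C (tarity C (map fst zs)) (deg C a + tdeg C (map fst zs) + 1))"
lemma e_gr: "a : elts C ==> e a : comp_of C a"
 using e.hom_gr[OF elts_gr] .
lemma hterm_single: "arity C a = 1 ==> hterm a [z] = cmp C (e a) [snd z]"
 by (simp add: hterm_def)
lemma comp2_single: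
 assumes "comp2 C 1 a zs" "arity C a = 1"
 obtains z where "zs = [z]" "fst z : elts C" "snd z : gr C (arity C (fst z)) (deg C (fst z) + 1)" "a : elts C"
 "composable C (e a) [snd z]" "composable C (e a) [fst z]" "composable C a [fst z]"
proof -
 have l: "length zs = 1" "a : elts C" using assms by (simp_all add: comp2_def)
 then obtain z where z: "zs = [z]" by (cases zs) auto
 have f: "fst z : elts C" "snd z : gr C (arity C (fst z)) (deg C (fst z) + 1)"
 using comp2_nth[OF assms(1), of 0] z by simp_all
 show ?thesis by (rule that[OF z f l(2)]) (use f l assms e_gr[OF l(2)] in "auto simp: composable_def gr_iff")
qed
lemma hterm_nul:
 assumes c: "comp2 C 1 a zs" and n: "e a = zero_of C a"
 shows "hterm a zs = nul C (tarity C (map fst zs)) (deg C a + tdeg C (map fst zs) + 1)"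
proof (cases "arity C a = 1")
 case True
 obtain z where z: "zs = [z]" "fst z : elts C" "snd z : gr C (arity C (fst z)) (deg C (fst z) + 1)"
 using comp2_single[OF c True] by metis
 thus ?thesis using cmp_nul_left[of "[snd z]" "deg C a"] True unfolding z(1) hterm_single[OF True] n
 by (simp add: gr_iff add.assoc)
qed (simp add: hterm_def)
lemma hterm_nul': "comp2 C 1 a zs ==> arity C a ~= 1 ==>
 hterm a zs = nul C (tarity C (map fst zs)) (deg C a + tdeg C (map fst zs) + 1)"
 by (simp add: hterm_def)
lemma cmp_single_gr:
 assumes "a : gr C 1 d" "x : gr C n k" shows "cmp C a [x] : gr C n (d + k)"
 by (rule cmp_gr) (use assms in "auto simp: composable_def gr_iff")
lemma hterm_gr:
 assumes c: "comp2 C 1 a zs"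
 shows "hterm a zs : gr C (tarity C (map fst zs)) (deg C a + tdeg C (map fst zs) + 1)"
proof (cases "arity C a = 1")
 case True
 obtain z where z: "zs = [z]" "fst z : elts C" "snd z : gr C (arity C (fst z)) (deg C (fst z) + 1)" "a : elts C"
 using comp2_single[OF c True] by metis
 have "e a : gr C 1 (deg C a)" using e_gr[OF z(4)] True by simp
 from cmp_single_gr[OF this z(3)] show ?thesis unfolding z(1) hterm_single[OF True] by (simp add: add.assoc)
qed (simp add: hterm_nul'[OF c])
lemma hterm_assoc:
 assumes c: "comp2 C 1 a zs" and l: "length wss = length zs"
 and cw: "!!i. i < length zs ==> comp2 C 1 (fst (zs ! i)) (wss ! i)"
 shows "pls C (cmp C (hterm a zs) (map fst (concat wss))) (hterm (cmp C a (map fst zs)) (concat wss))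
 = signed K C (\<Sum>i<length zs. \<Sum>j<i. deg C (fst (zs ! i)) * sum_list (map (deg C) (map fst (wss ! j))))
 (hterm a (map2 (cmp (sqz C 1 hterm)) zs wss))"
proof (cases "arity C a = 1")
 case True
 obtain z where z: "zs = [z]" "fst z : elts C" "snd z : gr C (arity C (fst z)) (deg C (fst z) + 1)" "a : elts C"
 "composable C (e a) [snd z]" "composable C (e a) [fst z]" "composable C a [fst z]" using comp2_single[OF c True] by metis
 obtain ws where ws: "wss = [ws]" using l z(1) by (cases wss) auto
 have cz: "comp2 C 1 (fst z) ws" using cw[of 0] z ws by simp
 have cs: "composable C (snd z) (map fst ws)" by (rule composable_cong[OF comp2_composable[OF cz] z(3)])
 note as = e_gr[OF z(4)]
 have ar: "arity C (cmp C a [fst z]) = arity C (fst z)" using arity_comp[OF z(7)] by simp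
 have sg: "cmp C (snd z) (map fst ws) : gr C (tarity C (map fst ws))
 (deg C (fst z) + tdeg C (map fst ws) + 1)"
 by (rule cmp_gr[OF cs]) (use z(3) in "simp_all add: gr_iff")
 have A: "cmp C (cmp C (e a) [snd z]) (map fst ws) = cmp C (e a) [cmp C (snd z) (map fst ws)]"
 using assoc[OF z(5), of "[map fst ws]"] cs by simp
 have B: "hterm (cmp C a [fst z]) ws = cmp C (e a) [hterm (fst z) ws]"
 proof (cases "arity C (fst z) = 1")
 case T: True
 obtain w where w: "ws = [w]" "fst w : elts C" "snd w : gr C (arity C (fst w)) (deg C (fst w) + 1)"
 "composable C (e (fst z)) [snd w]" using comp2_single[OF cz T] by metis
 have ce: "composable C (e a) [e (fst z)]" using z e_gr[OF z(2)] by (simp add: composable_def gr_iff)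
 have "hterm (cmp C a [fst z]) ws = cmp C (cmp C (e a) [e (fst z)]) [snd w]"
 using T e.hom_cmp[OF z(7)] ar by (simp add: w(1) hterm_single)
 also have "... = cmp C (e a) [cmp C (e (fst z)) [snd w]]"
 using assoc[OF ce, of "[[snd w]]"] w(4) by simp
 finally show ?thesis using T by (simp add: w(1) hterm_single)
 next
 case F: False
 have cc: "comp2 C 1 (cmp C a [fst z]) ws" using cz comp_closed[OF z(7)] ar by (simp add: comp2_def)
 have "cmp C (e a) [nul C n k] = nul C n (deg C a + k)" for n k
 using cmp_nul_right[of "e a" "[nul C n k]" 0 k] as True by (simp add: composable_def gr_iff)
 thus ?thesis using F ar hterm_nul'[OF cz F] hterm_nul'[OF cc] deg_comp[OF z(7)] by (simp add: add.assoc)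
 qed
 have p: "cmp C (e a) [pls C (cmp C (snd z) (map fst ws)) (hterm (fst z) ws)]
 = pls C (cmp C (e a) [cmp C (snd z) (map fst ws)]) (cmp C (e a) [hterm (fst z) ws])"
 proof -
 have "composable C (e a) [cmp C (snd z) (map fst ws)]" using sg as True by (simp add: composable_def gr_iff)
 from cmp_pls_right[OF this, of 0] show ?thesis using sg hterm_gr[OF cz] by (simp add: gr_iff)
 qed
 show ?thesis unfolding z(1) ws by (simp add: hterm_single[OF True] A B p)
next
 case False
 have aC: "a : elts C" using c by (simp add: comp2_def)
 have ea: "e a = zero_of C a" by (rule e_nul[OF aC]) (use False in simp)
 note cb = comp2_composable[OF c]
 let ?A = "tarity C (map fst zs)" and ?D = "deg C a + tdeg C (map fst zs)"
 have lens: "map length wss = map (arity C) (map fst zs)"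
 using l cw by (intro nth_equalityI) (auto simp: comp2_def)
 have w2: "set (concat wss) \<subseteq> elts (pairs C 1)"
 using cw l unfolding comp2_def by (fastforce simp: in_set_conv_nth)
 have c1: "comp2 C 1 (cmp C a (map fst zs)) (concat wss)"
 using comp_closed[OF cb] arity_comp[OF cb] w2 lens by (simp add: comp2_def length_concat del: map_map)
 note cc = comp2_composable[OF c1]
 have h0: "hterm a zs = nul C ?A (?D + 1)" by (rule hterm_nul'[OF c False])
 have dg: "deg C (cmp C a (map fst zs)) = ?D" "arity C (cmp C a (map fst zs)) = ?A" by (rule deg_comp[OF cb], rule arity_comp[OF cb])
 let ?A' = "sum_list (map (arity C) (map fst (concat wss)))" and ?D' = "sum_list (map (deg C) (map fst (concat wss)))"
 have t1: "cmp C (hterm a zs) (map fst (concat wss)) = nul C ?A' (?D + 1 + ?D')"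
 unfolding h0 using cmp_nul_left'[OF cc, of "?D + 1"] dg by simp
 have "e (cmp C a (map fst zs)) = nul C ?A ?D"
 unfolding e.hom_cmp[OF cb] ea using cmp_nul_left'[OF e.hom_composable[OF cb], of "deg C a"]
 by (simp only: e.map_hom_grade'[OF cb] e.hom_grade[OF aC])
 hence t2: "hterm (cmp C a (map fst zs)) (concat wss) = nul C ?A' (?D + ?D' + 1)"
 using hterm_nul[OF c1] unfolding dg by simp
 let ?vs = "map2 (cmp (sqz C 1 hterm)) zs wss"
 have fv: "map fst ?vs = map2 (cmp C) (map fst zs) (map (map fst) wss)"
 using l by (intro nth_equalityI) auto
 have v: "hterm a ?vs = nul C (tarity C (map fst ?vs)) (deg C a + tdeg C (map fst ?vs) + 1)"
 using False by (simp add: hterm_def)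
 have gz: "arity C (cmp C (fst (zs ! i)) (map fst (wss ! i))) = sum_list (map (arity C) (map fst (wss ! i)))"
 "deg C (cmp C (fst (zs ! i)) (map fst (wss ! i))) = deg C (fst (zs ! i)) + sum_list (map (deg C) (map fst (wss ! i)))"
 if "i < length zs" for i
 by (rule arity_comp[OF comp2_composable[OF cw[OF that]]], rule deg_comp[OF comp2_composable[OF cw[OF that]]])
 have av: "map (arity C) (map fst ?vs) = map (%ws. tarity C (map fst ws)) wss"
 unfolding fv using l by (intro nth_equalityI) (auto simp: gz simp del: map_map)
 have dv: "map (deg C) (map fst ?vs) = map2 (%z ws. deg C (fst z) + tdeg C (map fst ws)) zs wss"
 unfolding fv using l by (intro nth_equalityI) (auto simp: gz simp del: map_map)
 have s1: "tarity C (map fst ?vs) = ?A'"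
 unfolding av by (induction wss) auto
 have s2: "tdeg C (map fst ?vs) = tdeg C (map fst zs) + ?D'"
 unfolding dv using l[symmetric] by (induction zs wss rule: list_induct2) auto
 have dd: "?D + 1 + ?D' = ?D + ?D' + 1" "deg C a + (tdeg C (map fst zs) + ?D') + 1 = ?D + ?D' + 1" by simp_all
 show ?thesis unfolding t1 t2 v s1 s2 dd signed_nul by (rule pls_nul[OF nul_gr])
qed
lemma block_perm_single: "block_perm [k] id = id"
 by (auto simp: block_perm_def list_perm_def block_start_def fun_eq_iff)

text \<open>In arity one, the axioms reduce to those of an operad for composites with \<open>e a\<close>.  In all other
  arities both sides are zero, because \<open>e\<close> vanishes on composites of such operations as well.\<close>

lemma square_zero_hterm: "square_zero K C 1 hterm"
proof (intro square_zero.intro square_zero_axioms.intro operad_axioms)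
 fix a zs assume c: "comp2 C 1 a zs"
 have aC: "a : elts C" using c by (simp add: comp2_def)
 show "hterm a zs : gr C (tarity C (map fst zs)) (deg C a + tdeg C (map fst zs) + 1)"
 by (rule hterm_gr[OF c])
 note n = nul_gr[of "tarity C (map fst zs)" "deg C a + tdeg C (map fst zs) + 1"]
 { fix a' assume a': "a' : comp_of C a"
 have ag: "a : comp_of C a" using aC by (rule elts_gr)
 have pg: "arity C (pls C a a') = arity C a" "deg C (pls C a a') = deg C a" using pls_gr[OF ag a'] by (simp_all add: gr_iff)
 show "hterm (pls C a a') zs = pls C (hterm a zs) (hterm a' zs)"
 proof (cases "arity C a = 1")
 case True
 obtain z where z: "zs = [z]" "composable C (e a) [snd z]" using comp2_single[OF c True] by metis
 have "e a' : comp_of C (e a)" using e.hom_gr[OF a'] e.hom_grade[OF aC] by simp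
 from cmp_pls_left[OF z(2) this] show ?thesis
 using True pg a' by (simp add: z(1) hterm_single e.hom_pls[OF ag a'] gr_iff)
 next
 case False
 thus ?thesis using a' n by (simp add: hterm_def pg gr_iff)
 qed }
 { fix k assume k: "k : carrier K"
 have pg: "arity C (scale C k a) = arity C a" "deg C (scale C k a) = deg C a" using scale_gr[OF k elts_gr[OF aC]] by (simp_all add: gr_iff)
 show "hterm (scale C k a) zs = scale C k (hterm a zs)"
 proof (cases "arity C a = 1")
 case True
 obtain z where z: "zs = [z]" "composable C (e a) [snd z]" using comp2_single[OF c True] by metis
 show ?thesis using True pg comp_scale_left[OF z(2) k] by (simp add: z(1) hterm_single e.hom_scale[OF k aC])
 qed (simp add: hterm_def pg k) }
 { fix i w assume i: "i < length zs" and w: "w : gr (pairs C 1) (arity C (fst (zs ! i))) (deg C (fst (zs ! i)))"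
 hence w2: "fst w : comp_of C (fst (zs ! i))"
 "snd w : gr C (arity C (fst (zs ! i))) (deg C (fst (zs ! i)) + 1)" by (auto simp: gr_pairs)
 have zi: "fst (zs ! i) : comp_of C (fst (zs ! i))" using comp2_nth[OF c i] by (simp add: elts_gr)
 show "hterm a (zs[i := pls (pairs C 1) (zs ! i) w]) = pls C (hterm a zs) (hterm a (zs[i := w]))"
 proof (cases "arity C a = 1")
 case True
 obtain z where z: "zs = [z]" "snd z : gr C (arity C (fst z)) (deg C (fst z) + 1)" "composable C (e a) [snd z]"
 using comp2_single[OF c True] by metis
 have i0: "i = 0" using i z by simp
 from cmp_pls_right[OF z(3), of 0 "snd z" "deg C (fst z) + 1" "snd w"] show ?thesis
 using True z w2 by (simp add: i0 hterm_single dsum_def shift_def split_beta gr_iff)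
 next
 case False
 have m: "map (arity C) (map fst (zs[i := v])) = map (arity C) (map fst zs)"
 "map (deg C) (map fst (zs[i := v])) = map (deg C) (map fst zs)"
 if "fst v : comp_of C (fst (zs ! i))" for v
 using that i by (simp_all add: map_update gr_iff list_update_same_conv)
 have fp: "fst (pls (pairs C 1) (zs ! i) w) = pls C (fst (zs ! i)) (fst w)" by (simp add: dsum_def split_beta)
 show ?thesis using m[OF w2(1)] m[of "pls (pairs C 1) (zs ! i) w"] pls_gr[OF zi w2(1)] False n
 by (simp add: hterm_def fp del: map_map)
 qed }
 { fix i k assume i: "i < length zs" and k: "k : carrier K"
 have zi: "fst (zs ! i) : comp_of C (fst (zs ! i))" using comp2_nth[OF c i] by (simp add: elts_gr)
 show "hterm a (zs[i := scale (pairs C 1) k (zs ! i)]) = scale C k (hterm a zs)"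
 proof (cases "arity C a = 1")
 case True
 obtain z where z: "zs = [z]" "snd z : gr C (arity C (fst z)) (deg C (fst z) + 1)" "composable C (e a) [snd z]"
 using comp2_single[OF c True] by metis
 have i0: "i = 0" using i z by simp
 from cmp_scale_right[OF z(3), of 0 "snd z" k] show ?thesis
 using True z k by (simp add: i0 hterm_single dsum_def shift_def map_prod_def split_beta gr_iff)
 next
 case False
 have fp: "fst (scale (pairs C 1) k (zs ! i)) = scale C k (fst (zs ! i))" by (simp add: dsum_def map_prod_def split_beta)
 have "map (arity C) (map fst (zs[i := scale (pairs C 1) k (zs ! i)])) = map (arity C) (map fst zs)"
 "map (deg C) (map fst (zs[i := scale (pairs C 1) k (zs ! i)])) = map (deg C) (map fst zs)"
 using scale_gr[OF k zi] i by (simp_all add: map_update gr_iff list_update_same_conv fp)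
 thus ?thesis using False k by (simp add: hterm_def del: map_map)
 qed }
 { fix wss assume "length wss = length zs" "!!i. i < length zs ==> comp2 C 1 (fst (zs ! i)) (wss ! i)"
 thus "pls C (cmp C (hterm a zs) (map fst (concat wss))) (hterm (cmp C a (map fst zs)) (concat wss))
 = signed K C (\<Sum>i<length zs. \<Sum>j<i. deg C (fst (zs ! i)) * sum_list (map (deg C) (map fst (wss ! j))))
 (hterm a (map2 (cmp (sqz C 1 hterm)) zs wss))" by (rule hterm_assoc[OF c]) }
 { fix \<pi> assume s: "\<pi> permutes {..<arity C a}"
 have pg: "arity C (perm C \<pi> a) = arity C a" "deg C (perm C \<pi> a) = deg C a" using perm_gr[OF elts_gr[OF aC] s] by (simp_all add: gr_iff)
 show "hterm (perm C \<pi> a) zs = signed K C (koszul \<pi> (map (deg C) (map fst zs)))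
 (perm C (block_perm (map (arity C) (map fst zs)) \<pi>) (hterm a (map (%j. zs ! \<pi> j) [0..<length zs])))"
 proof (cases "arity C a = 1")
 case True
 obtain z where z: "zs = [z]" "snd z : gr C (arity C (fst z)) (deg C (fst z) + 1)"
 using comp2_single[OF c True] by metis
 have s1: "\<pi> = id" using s True by (intro permutes_lessThan_1) simp
 have "hterm a [z] : elts C" using hterm_gr[OF c] z by (simp add: gr_iff)
 thus ?thesis by (simp add: z(1) s1 perm_id[OF aC] block_perm_single koszul_def perm_id)
 next
 case False
 have l: "length zs = arity C a" using c by (simp add: comp2_def)
 have s': "\<pi> permutes {..<length zs}" using s l by simp
 have m: "map (%j. zs ! \<pi> j) [0..<length zs] = permute_list \<pi> zs" by (simp add: permute_list_def)
 have ms: "mset (permute_list \<pi> zs) = mset zs" by (rule mset_permute_list[OF s'])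
 have su: "sum_list (map f (permute_list \<pi> zs)) = sum_list (map f zs)" for f :: "'a \<times> 'a => int"
 using ms by (metis mset_map sum_mset_sum_list)
 have su': "sum_list (map f (permute_list \<pi> zs)) = sum_list (map f zs)" for f :: "'a \<times> 'a => nat"
 using ms by (metis mset_map sum_mset_sum_list)
 have b: "block_perm (map (arity C) (map fst zs)) \<pi> permutes {..<tarity C (map fst zs)}"
 by (rule block_perm_permutes) (use s' in simp)
 show ?thesis unfolding m using False b pg by (simp add: hterm_def su su')
 qed }
 { fix \<tau>s assume t: "length \<tau>s = length zs" "!!i. i < length zs ==> (\<tau>s ! i) permutes {..<arity C (fst (zs ! i))}"
 show "hterm a (map2 (perm (pairs C 1)) \<tau>s zs) = perm C (sum_perm (map (arity C) (map fst zs)) \<tau>s) (hterm a zs)"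
 proof (cases "arity C a = 1")
 case True
 obtain z where z: "zs = [z]" "snd z : gr C (arity C (fst z)) (deg C (fst z) + 1)" "composable C (e a) [snd z]"
 using comp2_single[OF c True] by metis
 obtain \<tau> where t1: "\<tau>s = [\<tau>]" using t(1) z(1) by (cases \<tau>s) auto
 have "\<tau> permutes {..<arity C (snd z)}" using t(2)[of 0] z t1 by (simp add: gr_iff)
 hence "cmp C (e a) [perm C \<tau> (snd z)] = perm C (sum_perm [arity C (snd z)] [\<tau>]) (cmp C (e a) [snd z])"
 using equivariant_right[OF z(3), of "[\<tau>]"] by simp
 thus ?thesis using True z by (simp add: t1 hterm_single dsum_def shift_def map_prod_def split_beta gr_iff)
 next
 case False
 have fp: "fst (perm (pairs C 1) \<tau> z) = perm C \<tau> (fst z)" for \<tau> z by (simp add: dsum_def map_prod_def split_beta)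
 have pz: "perm C (\<tau>s ! i) (fst (zs ! i)) : comp_of C (fst (zs ! i))" if "i < length zs" for i
 using perm_gr[OF elts_gr t(2)[OF that]] comp2_nth[OF c that] by simp
 have m: "map (arity C) (map fst (map2 (perm (pairs C 1)) \<tau>s zs)) = map (arity C) (map fst zs)"
 "map (deg C) (map fst (map2 (perm (pairs C 1)) \<tau>s zs)) = map (deg C) (map fst zs)"
 using t(1) pz by (intro nth_equalityI; auto simp: fp gr_iff)+
 have b: "sum_perm (map (arity C) (map fst zs)) \<tau>s permutes {..<tarity C (map fst zs)}"
 by (rule sum_perm_permutes) (use t in simp_all)
 show ?thesis unfolding hterm_def m using False b by simp
 qed }
next
 fix z assume "z : elts (pairs C 1)"
 hence "snd z : elts C" by (simp add: elts_pairs gr_iff)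
 thus "hterm (unt C) [z] = snd z" by (simp add: hterm_single arity_unit e.hom_unt unit_left)
next
 fix a assume a: "a : elts C"
 show "hterm a (replicate (arity C a) (unt C, nul C 1 1)) = nul C (arity C a) (deg C a + 1)"
 proof (cases "arity C a = 1")
 case True
 have "cmp C (e a) [nul C 1 1] = nul C 1 (deg C a + 1)"
 using cmp_nul_right[of "e a" "[nul C 1 1]" 0 1] e_gr[OF a] True by (simp add: composable_def gr_iff)
 thus ?thesis using True by (simp add: hterm_def)
 next
 case False
 have "sum_list (replicate n (arity C (unt C))) = n" "sum_list (replicate n (deg C (unt C))) = 0" for n
 by (simp_all add: arity_unit deg_unit sum_list_replicate)
 thus ?thesis using False by (simp add: hterm_def map_replicate_const arity_unit deg_unit sum_list_replicate)
 qed
qed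

end

text \<open>The homotopy \<open>h\<close> is given by its compatibility with composition and by its effect on generators.\<close>

locale contraction = augmentation K C e + dg_operad K C for K :: "('k, 'z) ring_scheme" (structure)
 and C :: "('k, 'a, 'm) dgoperad_scheme" and e +
 fixes X h
 assumes X_elts: "X \<subseteq> elts C" and X_generates: "elts C \<subseteq> opspan K C X"
 and e_X: "x : X ==> e x = zero_of C x"
 and dif_X: "x : X ==> dif C x : op_ideal K C X"
 and h_hom: "operad_hom K C (sqz C 1 hterm) (%x. (x, h x))"
 and h_X: "x : X ==> pls C (dif C (h x)) (h (dif C x)) = x"
begin
abbreviation "D \<equiv> dif C"
lemma D_gr: "x : gr C n d ==> D x : gr C n (d - 1)"
 by (rule derivation_gr[OF dif_derivation])
lemma h_gr: "x : gr C n d ==> h x : gr C n (d + 1)"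
 using smod_hom_gr[OF operad_hom_smod[OF h_hom]] by (simp add: gr_sqz)
lemma h_smod: "smod_hom K C (shift (- 1) C) h"
 using smod_hom_pls[OF operad_hom_smod[OF h_hom]] smod_hom_scale[OF operad_hom_smod[OF h_hom]]
 smod_hom_perm[OF operad_hom_smod[OF h_hom]] h_gr
 by (intro smod_homI) (auto simp: gr_shift gr_iff[of _ C])
sublocale h: smodule_hom K C "shift (- 1) C" h
 by (intro smodule_hom.intro smodule_hom_axioms.intro smodule_axioms smodule_shift h_smod)
sublocale D: smodule_hom K C "shift 1 C" D
 using dif_derivation
 by (intro smodule_hom.intro smodule_hom_axioms.intro smodule_axioms smodule_shift) (simp add: derivation_def)
lemma h_nul: "h (nul C n d) = nul C n (d + 1)" and D_nul: "D (nul C n d) = nul C n (d - 1)"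
 using h.hom_nul[of n d] D.hom_nul[of n d] by simp_all
lemma h_signed: "x : elts C ==> h (signed K C k x) = signed K C k (h x)"
 by (simp add: signed_def h.hom_scale)
lemma h_unt: "h (unt C) = nul C 1 1"
 using operad_hom_unt[OF h_hom] by simp
lemma h_cmp: "composable C a bs ==> h (cmp C a bs) = pls C (cmp C (h a) bs) (hterm a (graph h bs))"
 using operad_hom_cmp[OF h_hom, of a bs] by (simp add: comp_def)
lemma comp2_h: "composable C a bs ==> comp2 C 1 a (graph h bs)"
 by (rule comp2_pairs) (use h_gr[OF elts_gr] in "auto simp: composable_def")
lemma comp2_D: "composable C a bs ==> comp2 C (- 1) a (graph D bs)"
 by (rule comp2_pairs) (use D_gr[OF elts_gr] in "auto simp: composable_def")
lemma e_ideal: "x : op_ideal K C X ==> e x = zero_of C x"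
 using op_ideal_least[OF e.kernel_ideal, of X] e_X X_elts by auto
lemma e_D: assumes x: "x : elts C" shows "e (D x) = nul C (arity C x) (deg C x - 1)" "D (e x) = nul C (arity C x) (deg C x - 1)"
proof -
 have "dg_hom K C C e"
 proof (rule dg_hom_from_generators[OF operad_axioms dif_derivation operad_axioms dif_derivation e_hom X_elts X_generates])
 fix x assume x: "x : X"
 hence "x : elts C" using X_elts by blast
 thus "e (D x) = D (e x)" using e_ideal[OF dif_X[OF x]] e_X[OF x] D_gr[OF elts_gr] by (simp add: D_nul gr_iff)
 qed
 hence "e (D x) = D (e x)" using x by (simp add: dg_hom_def)
 moreover show "D (e x) = nul C (arity C x) (deg C x - 1)"
 proof -
 have g: "D (e x) : gr C (arity C x) (deg C x - 1)" by (rule D_gr[OF e_gr[OF x]])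
 consider "e x = zero_of C (e x)" | c where "c : carrier K" "e x = scale C c (unt C)"
 using e_scalar[OF x] by (auto simp: scalar_def)
 thus ?thesis
 proof cases
 case 1
 hence "e x = zero_of C x" using e.hom_grade[OF x] by simp
 thus ?thesis by (simp add: D_nul)
 next
 case 2
 have "D (e x) = nul C 1 (- 1)" using 2 D.hom_scale[OF 2(1) unit_closed] derivation_unt[OF dif_derivation] by simp
 thus ?thesis using g by (simp add: gr_iff)
 qed
 qed
 ultimately show "e (D x) = nul C (arity C x) (deg C x - 1)" by simp
qed

text \<open>The part of the homotopy identity in which \<open>e a\<close> occurs: \<open>\<partial>\<close> and \<open>h\<close> both act on the single input,
  where the identity is known by induction.\<close>

lemma hterm_homotopy:
 assumes c: "composable C a bs" and IH: "!!b. b : set bs ==> pls C (D (h b)) (h (D b)) = mns K C b (e b)"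
 defines "n \<equiv> tarity C bs" and "d \<equiv> deg C a + tdeg C bs"
 and "ds \<equiv> graph D bs"
 shows "pls C (D (hterm a (graph h bs)))
 (lsum C n d (map (%i. signed K C (deg C a + pdeg C ds i) (hterm a (map (%b. (b, h b)) (mark ds i)))) [0..<length bs]))
 = mns K C (cmp C (e a) bs) (e (cmp C a bs))"
proof -
 have aC: "a : elts C" using c by (simp add: composable_def)
 have eb: "e (cmp C a bs) = cmp C (e a) (map e bs)" by (rule e.hom_cmp[OF c])
 from aC show ?thesis
 proof (cases rule: e_cases)
 case 1
 have m: "map fst (graph h bs) = bs" for bs by (simp add: comp_def)
 have h0: "hterm a (graph h bs) = nul C n (d + 1)"
 using hterm_nul[OF comp2_h[OF c] 1] unfolding m n_def d_def .
 have "hterm a (map (%b. (b, h b)) (mark ds i)) = nul C n d" if i: "i < length bs" for i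
 proof -
 have i': "i < length ds" using i by (simp add: ds_def)
 have cm: "composable C a (mark ds i)" unfolding ds_def by (rule mark_composable[OF comp2_D[OF c]]) (use i in simp)
 have fm: "map fst ds = bs" by (simp add: ds_def comp_def)
 have g: "cmp C a (mark ds i) : gr C n (d + - 1)"
 using mark_cmp_gr[OF comp2_D[OF c] _ elts_gr[OF aC], of i] i unfolding ds_def[symmetric] fm n_def d_def by (simp add: ds_def)
 have "tarity C (mark ds i) = n" "deg C a + tdeg C (mark ds i) = d - 1"
 using g arity_comp[OF cm] deg_comp[OF cm] by (simp_all add: gr_iff)
 thus ?thesis using hterm_nul[OF comp2_h[OF cm] 1] unfolding m by simp
 qed
 hence v: "lsum C n d (map (%i. signed K C (deg C a + pdeg C ds i) (hterm a (map (%b. (b, h b)) (mark ds i)))) [0..<length bs]) = nul C n d"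
 by (intro lsum_nul) simp
 have "cmp C (e a) bs = nul C n d" unfolding 1 n_def d_def by (rule cmp_nul_left'[OF c])
 moreover have "e (cmp C a bs) = nul C n d"
 using cmp_nul_left'[OF e.hom_composable[OF c], of "deg C a"]
 unfolding eb 1 n_def d_def by (simp only: e.map_hom_grade'[OF c] e.hom_grade[OF aC] arity_nul)
 ultimately show ?thesis unfolding v h0 by (simp add: D_nul mns_self[OF nul_gr])
 next
 case 2
 then obtain b where b: "bs = [b]" "b : elts C" using c by (cases bs) (auto simp: composable_def)
 have bg: "b : gr C n d" using b 2 by (simp add: n_def d_def gr_iff)
 have ea: "e a : gr C 1 0" using e_gr[OF aC] 2 by simp
 have ec: "composable C (e a) [x]" if "x : gr C n k" for x k using ea that by (simp add: composable_def gr_iff)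
 have Dhb: "D (h b) : gr C n d" and hDb: "h (D b) : gr C n d" and ebg: "e b : gr C n d"
 using D_gr[OF h_gr[OF bg]] h_gr[OF D_gr[OF bg]] e.hom_gr[OF bg] by simp_all
 have z: "D (e a) = nul C 1 (- 1)" using e_D(2)[OF aC] 2 by simp
 have hb: "h b : gr C n (d + 1)" by (rule h_gr[OF bg])
 have t1: "D (cmp C (e a) [h b]) = cmp C (e a) [D (h b)]"
 proof -
 have "D (cmp C (e a) [h b]) = pls C (cmp C (D (e a)) [h b]) (leib K C (e a) (map (%b. (b, D b)) [h b]))"
 by (rule derivation_cmp[OF dif_derivation ec[OF hb]])
 also have "cmp C (D (e a)) [h b] = nul C n d" unfolding z using cmp_nul_left[of "[h b]" "- 1"] hb by (simp add: gr_iff)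
 also have "leib K C (e a) (map (%b. (b, D b)) [h b]) = cmp C (e a) [D (h b)]"
 using cmp_single_gr[OF ea Dhb] ea hb by (simp add: leib_def leib_term_def mark_def pdeg_def gr_iff)
 finally show ?thesis using cmp_single_gr[OF ea Dhb] by simp
 qed
 have t2: "cmp C (e a) [h (D b)] : gr C n d" using cmp_single_gr[OF ea hDb] by simp
 have "cmp C (e a) [pls C (D (h b)) (h (D b))] = pls C (cmp C (e a) [D (h b)]) (cmp C (e a) [h (D b)])"
 using cmp_pls_right[OF ec[OF Dhb], of 0 "D (h b)" d "h (D b)"] Dhb hDb by (simp add: gr_iff)
 moreover have "cmp C (e a) [mns K C b (e b)] = mns K C (cmp C (e a) [b]) (cmp C (e a) [e b])"
 using cmp_mns_right[OF ec[OF bg], of 0 b d "e b"] bg ebg by (simp add: gr_iff)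
 ultimately show ?thesis
 using t1 t2 IH[of b] 2 by (simp add: b(1) eb[unfolded b(1)] ds_def hterm_single mark_def pdeg_def)
 qed
qed

text \<open>For a composite, the terms in which \<open>\<partial>\<close> and \<open>h\<close> act on different factors cancel, since the degrees of
  \<open>a\<close> and \<open>h a\<close> differ by one.  The remaining terms telescope: they are \<open>(a - e a) (b\<^sub>1, \<dots>, b\<^sub>n)\<close> and,
  in arity one, \<open>(e a) (b - e b)\<close>.\<close>

lemma homotopy: assumes "x : elts C" shows "pls C (D (h x)) (h (D x)) = mns K C x (e x)"
proof -
 have "x : opspan K C X" using assms X_generates by blast
 from this X_elts show ?thesis
 proof (induction rule: opspan_induct)
 case (gen x)
 hence "x : elts C" using X_elts by blast
 thus ?case using h_X[OF gen] e_X[OF gen] by (simp add: mns_def pls_nul[OF elts_gr])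
 next
 case unt
 show ?case by (simp add: h_unt derivation_unt[OF dif_derivation] D_nul h_nul e.hom_unt mns_self[OF unt_gr])
 next
 case (nul n d)
 show ?case by (simp add: D_nul h_nul e.sm.hom_nul mns_self[OF nul_gr])
 next
 case (pls n d x y)
 note g = h_gr[OF pls(1)] h_gr[OF pls(2)] D_gr[OF pls(1)] D_gr[OF pls(2)]
 have "D (h (pls C x y)) = pls C (D (h x)) (D (h y))" "h (D (pls C x y)) = pls C (h (D x)) (h (D y))"
 using h.hom_pls[OF pls(1,2)] D.hom_pls[OF pls(1,2)] D.hom_pls[OF g(1,2)] h.hom_pls[OF g(3,4)] by simp_all
 thus ?case
 using pls_swap[of "D (h x)" n d "D (h y)" "h (D x)" "h (D y)"] D_gr[OF g(1)] D_gr[OF g(2)] h_gr[OF g(3)] h_gr[OF g(4)]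
 mns_pls[OF pls(1,2) e.hom_gr[OF pls(1)] e.hom_gr[OF pls(2)]] pls(3,4)
 by (simp add: e.hom_pls[OF pls(1,2)])
 next
 case (scale c x)
 note x = elts_gr[OF scale(2)]
 note g = h_gr[OF x] D_gr[OF x]
 have "D (h (scale C c x)) = scale C c (D (h x))" "h (D (scale C c x)) = scale C c (h (D x))"
 using h.hom_scale[OF scale(1,2)] D.hom_scale[OF scale(1,2)] D.hom_scale[OF scale(1), of "h x"]
 h.hom_scale[OF scale(1), of "D x"] g by (simp_all add: gr_iff)
 thus ?case
 using scale_pls[OF scale(1), of "D (h x)" "arity C x" "deg C x" "h (D x)"] D_gr[OF g(1)] h_gr[OF g(2)] scale(3)
 mns_scale[OF x e.hom_gr[OF x] scale(1)] by (simp add: e.hom_scale[OF scale(1,2)])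
 next
 case (perm \<pi> x)
 note x = elts_gr[OF perm(1)]
 note g = h_gr[OF x] D_gr[OF x]
 have "D (h (perm C \<pi> x)) = perm C \<pi> (D (h x))" "h (D (perm C \<pi> x)) = perm C \<pi> (h (D x))"
 using h.hom_perm[OF x perm(2)] D.hom_perm[OF x perm(2)] D.hom_perm[OF g(1) perm(2)]
 h.hom_perm[OF g(2) perm(2)] by simp_all
 thus ?case
 using perm_pls[of "D (h x)" "arity C x" "deg C x" "h (D x)", OF _ _ perm(2)] D_gr[OF g(1)] h_gr[OF g(2)] perm(3)
 mns_perm[OF x e.hom_gr[OF x] perm(2)] by (simp add: e.hom_perm[OF x perm(2)])
 next
 case (cmp a bs)
 let ?n = "tarity C bs" and ?d = "deg C a + tdeg C bs"
 let ?ds = "graph D bs" and ?H = "%bs. graph h bs"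
 note c = cmp(1)
 have aC: "a : elts C" using c by (simp add: composable_def)
 note ag = elts_gr[OF aC]
 have m: "map fst (?H cs) = cs" "map fst ?ds = bs" for cs by (simp_all add: comp_def)
 have com: "composable C y bs" if "y : gr C (arity C a) k" for y k by (rule composable_cong[OF c that])
 have cg: "cmp C y bs : gr C ?n (k + tdeg C bs)" if "y : gr C (arity C a) k" for y k
 by (rule cmp_gr[OF com[OF that]]) (use that in "simp_all add: gr_iff")
 note ha = h_gr[OF ag] and Da = D_gr[OF ag]
 have Dha: "D (h a) : comp_of C a" and hDa: "h (D a) : comp_of C a"
 using D_gr[OF ha] h_gr[OF Da] by simp_all
 have dha: "deg C (h a) = deg C a + 1" "deg C (D a) = deg C a - 1" "arity C (D a) = arity C a"
 "arity C (h a) = arity C a" using ha Da by (simp_all add: gr_iff)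
 let ?p = "cmp C (D (h a)) bs" and ?q = "leib K C (h a) ?ds" and ?r = "D (hterm a (?H bs))"
 let ?s = "cmp C (h (D a)) bs"
 let ?t = "%i. signed K C (deg C a + pdeg C ?ds i) (hterm a (?H (mark ?ds i)))"
 let ?V = "lsum C ?n ?d (map ?t [0..<length bs])"
 have pg: "?p : gr C ?n ?d" and sg: "?s : gr C ?n ?d" by (rule cg[OF Dha], rule cg[OF hDa])
 have htg: "hterm a (?H bs) : gr C ?n (?d + 1)" using hterm_gr[OF comp2_h[OF c]] unfolding m .
 have rg: "?r : gr C ?n ?d" using D_gr[OF htg] by simp
 have qg: "?q : gr C ?n ?d" using leib_gr[OF comp2_D[OF com[OF ha]]] unfolding m dha by (simp add: algebra_simps)
 have e1: "D (h (cmp C a bs)) = pls C (pls C ?p ?q) ?r"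
 proof -
 have g: "cmp C (h a) bs : gr C ?n (?d + 1)" using cg[OF ha] by (simp add: algebra_simps)
 show ?thesis unfolding h_cmp[OF c] using D.hom_pls[OF g htg] derivation_cmp[OF dif_derivation com[OF ha]] by simp
 qed
 have cDa: "comp2 C 1 (D a) (?H bs)" by (rule comp2_h[OF com[OF Da]])
 have hD1: "h (cmp C (D a) bs) = ?s"
 proof -
 have "e (D a) = zero_of C (D a)" using e_D(1)[OF aC] by (simp add: dha)
 from hterm_nul[OF cDa this] have "hterm (D a) (?H bs) = nul C ?n ?d" unfolding m dha by simp
 thus ?thesis using h_cmp[OF com[OF Da]] sg by simp
 qed
 have mk: "composable C a (mark ?ds i)" "cmp C a (mark ?ds i) : gr C ?n (?d - 1)"
 "cmp C (h a) (mark ?ds i) : gr C ?n ?d" "hterm a (?H (mark ?ds i)) : gr C ?n ?d" if i: "i < length bs" for i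
 proof -
 have i': "i < length ?ds" using i by simp
 show cm: "composable C a (mark ?ds i)" by (rule mark_composable[OF comp2_D[OF c] i'])
 show g: "cmp C a (mark ?ds i) : gr C ?n (?d - 1)" using mark_cmp_gr[OF comp2_D[OF c] i' ag] unfolding m by simp
 show "cmp C (h a) (mark ?ds i) : gr C ?n ?d" using mark_cmp_gr[OF comp2_D[OF c] i' ha] unfolding m by (simp add: algebra_simps)
 have "tarity C (mark ?ds i) = ?n" "deg C a + tdeg C (mark ?ds i) = ?d - 1"
 using g arity_comp[OF cm] deg_comp[OF cm] by (simp_all add: gr_iff)
 thus "hterm a (?H (mark ?ds i)) : gr C ?n ?d" using hterm_gr[OF comp2_h[OF cm]] unfolding m by simp
 qed
 have tg: "?t i : gr C ?n ?d" if "i < length bs" for i by (rule signed_gr[OF mk(4)[OF that]])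
 have ltg: "leib_term K C (h a) ?ds i : gr C ?n ?d" if "i < length bs" for i
 unfolding leib_term_def by (rule signed_gr[OF mk(3)[OF that]])
 have Vg: "?V : gr C ?n ?d" by (rule lsum_map_gr) (use tg in simp)
 have hl: "h (leib K C a ?ds) = pls C (scale C (\<ominus> \<one>) ?q) ?V"
 proof -
 have g: "leib_term K C a ?ds i : gr C ?n (?d - 1)" if "i < length bs" for i
 unfolding leib_term_def by (rule signed_gr[OF mk(2)[OF that]])
 have sub: "set (map (leib_term K C a ?ds) [0..<length bs]) \<subseteq> gr C ?n (?d - 1)" using g by auto
 have "h (leib K C a ?ds) = lsum C ?n ?d (map (%i. h (leib_term K C a ?ds i)) [0..<length bs])"
 using h.hom_lsum[OF sub] unfolding leib_def m by (simp add: comp_def)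
 also have "map (%i. h (leib_term K C a ?ds i)) [0..<length bs]
 = map (%i. pls C (scale C (\<ominus> \<one>) (leib_term K C (h a) ?ds i)) (?t i)) [0..<length bs]"
 proof (rule map_upt_cong)
 fix i assume i: "i < length bs"
 have "h (leib_term K C a ?ds i) = signed K C (deg C a + pdeg C ?ds i) (h (cmp C a (mark ?ds i)))"
 unfolding leib_term_def by (rule h_signed) (use mk(2)[OF i] in "simp add: gr_iff")
 also have "... = pls C (signed K C (deg C a + pdeg C ?ds i) (cmp C (h a) (mark ?ds i))) (?t i)"
 unfolding h_cmp[OF mk(1)[OF i]] by (rule signed_pls[OF mk(3,4)[OF i]])
 also have "signed K C (deg C a + pdeg C ?ds i) (cmp C (h a) (mark ?ds i)) = scale C (\<ominus> \<one>) (leib_term K C (h a) ?ds i)"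
 using mk(3)[OF i] unfolding leib_term_def dha by (auto simp: signed_def gr_iff)
 finally show "h (leib_term K C a ?ds i) = pls C (scale C (\<ominus> \<one>) (leib_term K C (h a) ?ds i)) (?t i)" .
 qed
 also have "lsum C ?n ?d ... = pls C (lsum C ?n ?d (map (%i. scale C (\<ominus> \<one>) (leib_term K C (h a) ?ds i)) [0..<length bs])) ?V"
 by (rule lsum_pls) (use scale_gr[OF minus_one_K ltg] tg in auto)
 also have "lsum C ?n ?d (map (%i. scale C (\<ominus> \<one>) (leib_term K C (h a) ?ds i)) [0..<length bs])
 = scale C (\<ominus> \<one>) (lsum C ?n ?d (map (leib_term K C (h a) ?ds) [0..<length bs]))"
 by (rule lsum_scale) (use ltg in auto)
 also have "lsum C ?n ?d (map (leib_term K C (h a) ?ds) [0..<length bs]) = ?q"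
 unfolding leib_def m dha by (simp add: algebra_simps)
 finally show ?thesis .
 qed
 have qn: "scale C (\<ominus> \<one>) ?q : gr C ?n ?d" by (rule scale_gr[OF minus_one_K qg])
 have e2: "h (D (cmp C a bs)) = pls C ?s (pls C (scale C (\<ominus> \<one>) ?q) ?V)"
 proof -
 have g1: "cmp C (D a) bs : gr C ?n (?d - 1)" using cg[OF Da] by (simp add: algebra_simps)
 have g2: "leib K C a ?ds : gr C ?n (?d - 1)" using leib_gr[OF comp2_D[OF c]] unfolding m .
 show ?thesis unfolding derivation_cmp[OF dif_derivation c] using h.hom_pls[OF g1 g2] hD1 hl by simp
 qed
 have "pls C (pls C (pls C ?p ?q) ?r) (pls C ?s (pls C (scale C (\<ominus> \<one>) ?q) ?V)) = pls C (pls C ?p ?s) (pls C ?r ?V)"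
 proof -
 have "pls C (pls C (pls C ?p ?q) ?r) (pls C ?s (pls C (scale C (\<ominus> \<one>) ?q) ?V))
 = pls C (pls C (pls C ?p ?q) ?r) (pls C (pls C ?s (scale C (\<ominus> \<one>) ?q)) ?V)"
 by (simp only: pls_assoc[OF sg qn Vg])
 also have "... = pls C (pls C (pls C ?p ?q) (pls C ?s (scale C (\<ominus> \<one>) ?q))) (pls C ?r ?V)"
 by (rule pls_swap[OF pls_gr[OF pg qg] rg pls_gr[OF sg qn] Vg])
 also have "pls C (pls C ?p ?q) (pls C ?s (scale C (\<ominus> \<one>) ?q)) = pls C (pls C ?p ?s) (pls C ?q (scale C (\<ominus> \<one>) ?q))"
 by (rule pls_swap[OF pg qg sg qn])
 also have "... = pls C ?p ?s" unfolding pls_neg[OF qg] by (rule pls_nul[OF pls_gr[OF pg sg]])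
 finally show ?thesis .
 qed
 moreover have "pls C ?p ?s = mns K C (cmp C a bs) (cmp C (e a) bs)"
 proof -
 have Dha': "h (D a) : gr C (arity C (D (h a))) (deg C (D (h a)))" using Dha hDa by (simp add: gr_iff)
 show ?thesis using cmp_pls_left[OF com[OF Dha] Dha'] cmp(2) cmp_mns_left[OF c e_gr[OF aC]] by simp
 qed
 moreover have "pls C ?r ?V = mns K C (cmp C (e a) bs) (e (cmp C a bs))" by (rule hterm_homotopy[OF c cmp(3)])
 ultimately have "pls C (D (h (cmp C a bs))) (h (D (cmp C a bs)))
 = pls C (mns K C (cmp C a bs) (cmp C (e a) bs)) (mns K C (cmp C (e a) bs) (e (cmp C a bs)))"
 unfolding e1 e2 by simp
 also have "... = mns K C (cmp C a bs) (e (cmp C a bs))"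
 by (rule mns_mns[OF cg[OF ag] cg[OF e_gr[OF aC]] e.hom_gr[OF cg[OF ag]]])
 finally show ?case .
 qed
qed
lemma cycle_decompose:
 assumes "x : gr C n d" "D x = nul C n (d - 1)"
 shows "x = pls C (D (h x)) (e x)"
proof -
 have xe: "x : elts C" using assms(1) by (simp add: gr_iff)
 have eg: "e x : gr C n d" by (rule e.hom_gr[OF assms(1)])
 have "mns K C x (e x) = D (h x)" using homotopy[OF xe] D_gr[OF h_gr[OF assms(1)]] by (simp add: assms(2) h_nul)
 thus ?thesis using mns_pls_cancel[OF assms(1) eg] by simp
qed
lemma cycle_boundary:
 assumes "x : op_ideal K C X" "x : gr C n d" "D x = nul C n (d - 1)"
 shows "x = D (h x)"
 using cycle_decompose[OF assms(2,3)] e_ideal[OF assms(1)] D_gr[OF h_gr[OF assms(2)]] assms(2) by (simp add: gr_iff)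
lemma D_ideal: assumes "x : elts C" shows "D x : op_ideal K C X"
proof -
 let ?I = "op_ideal K C X"
 interpret I: operad_ideal K C ?I
 by (intro operad_ideal.intro operad_ideal_axioms.intro operad_axioms op_ideal_closed X_elts)
 have sum: "set xs \<subseteq> ?I \<inter> gr C n d ==> lsum C n d xs : ?I" for xs n d
 proof (induction xs)
 case Nil
 show ?case by (simp add: I.I_nul)
 next
 case (Cons x xs)
 hence "lsum C n d xs : gr C n d" by (intro lsum_gr) auto
 hence "same_grade C x (lsum C n d xs)" using Cons by (simp add: same_grade_def gr_iff)
 thus ?case using Cons by (simp add: I.I_pls)
 qed
 have "x : opspan K C X" using assms X_generates by blast
 from this X_elts show ?thesis
 proof (induction rule: opspan_induct)
 case (pls n d x y)
 thus ?case using D.hom_pls[OF pls(1,2)] D_gr[OF pls(1)] D_gr[OF pls(2)]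
 by (simp add: I.I_pls same_grade_def gr_iff)
 next
 case (perm \<pi> x)
 thus ?case using D.hom_perm[OF elts_gr[OF perm(1)] perm(2)] D_gr[OF elts_gr[OF perm(1)]]
 by (simp add: I.I_perm gr_iff)
 next
 case (scale c x)
 thus ?case using D.hom_scale[OF scale(1,2)] by (simp add: I.I_scale)
 next
 case (cmp a bs)
 note c = cmp(1)
 let ?ds = "graph D bs"
 have m: "map fst ?ds = bs" by (simp add: comp_def)
 have ag: "a : comp_of C a" by (rule composable_gr[OF c])
 have 1: "cmp C (D a) bs : ?I" by (rule I.I_cmp_left[OF cmp(2) composable_cong[OF c D_gr[OF ag]]])
 have "leib_term K C a ?ds i : ?I" if i: "i < length bs" for i
 proof -
 have cm: "composable C a (mark ?ds i)" by (rule mark_composable[OF comp2_D[OF c]]) (use i in simp)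
 have "mark ?ds i ! i = D (bs ! i)" "i < length (mark ?ds i)" using i by (simp_all add: mark_def)
 hence "D (bs ! i) : set (mark ?ds i)" by (metis nth_mem)
 hence "cmp C a (mark ?ds i) : ?I" using cmp(3)[of "bs ! i"] i by (intro I.I_cmp_right[OF _ _ cm]) auto
 thus ?thesis by (auto simp: leib_term_def signed_def I.I_scale)
 qed
 moreover have "leib_term K C a ?ds i : gr C (tarity C bs) (deg C a + tdeg C bs - 1)"
 if "i < length bs" for i using leib_term_gr[OF comp2_D[OF c], of i] that unfolding m by simp
 ultimately have 2: "leib K C a ?ds : ?I" unfolding leib_def m by (intro sum) auto
 have g: "D (cmp C a bs) : elts C" using D_gr[OF elts_gr[OF comp_closed[OF c]]] by (simp add: gr_iff)
 have "cmp C (D a) bs : gr C (tarity C bs) (deg C a - 1 + tdeg C bs)"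
 by (rule cmp_gr[OF composable_cong[OF c D_gr[OF ag]]]) (use D_gr[OF ag] in "simp_all add: gr_iff")
 hence "same_grade C (cmp C (D a) bs) (leib K C a ?ds)"
 using leib_gr[OF comp2_D[OF c]] unfolding m by (simp add: same_grade_def gr_iff)
 thus ?case unfolding derivation_cmp[OF dif_derivation c] by (rule I.I_pls[OF 1 2])
 qed (simp_all add: dif_X derivation_unt[OF dif_derivation] D_nul I.I_nul)
qed

end

context operad
begin
lemma opspan_lsum:
 "(!!x. x : set xs ==> x : opspan K P X & x : gr P n d) ==> lsum P n d xs : opspan K P X"
proof (induction xs)
 case Nil
 show ?case by (simp add: opspan.nul)
next
 case (Cons x xs)
 hence "lsum P n d xs : gr P n d" by (intro lsum_gr) auto
 hence "same_grade P x (lsum P n d xs)" using Cons(2)[of x] by (simp add: same_grade_def gr_iff)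
 thus ?case using Cons by (simp add: opspan.pls)
qed
lemma opspan_leib:
 assumes c: "comp2 P (- 1) a zs" and a: "a : opspan K P X"
 and z: "!!z. z : set zs ==> fst z : opspan K P X & snd z : opspan K P X"
 shows "leib K P a zs : opspan K P X"
 unfolding leib_def
proof (rule opspan_lsum)
 fix x assume "x : set (map (leib_term K P a zs) [0..<length zs])"
 then obtain i where i: "i < length zs" "x = leib_term K P a zs i" by auto
 have "set (mark zs i) \<subseteq> insert (snd (zs ! i)) (set (map fst zs))"
 unfolding mark_def by (rule set_update_subset_insert)
 moreover have "snd (zs ! i) : opspan K P X" using z[OF nth_mem[OF i(1)]] by simp
 moreover have "\<forall>b\<in>set (map fst zs). b : opspan K P X" using z by auto
 ultimately have m: "\<forall>b\<in>set (mark zs i). b : opspan K P X" by blast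
 have "length (mark zs i) = arity P a" using c by (simp add: comp2_def)
 hence "cmp P a (mark zs i) : opspan K P X" by (rule opspan.cmp[OF a m])
 hence "x : opspan K P X" unfolding i(2) leib_term_def by (auto simp: signed_def opspan.scale)
 thus "x : opspan K P X & x : gr P (tarity P (map fst zs))
 (deg P a + tdeg P (map fst zs) - 1)"
 using leib_term_gr[OF c i(1)] i(2) by blast
qed

end

text \<open>The multiples of the unit and the zeros are closed under all operations.\<close>

lemma augmentationI:
 assumes "operad K C" "operad_hom K C C e" and X: "X \<subseteq> elts C" "elts C \<subseteq> opspan K C X"
 "!!x. x : X ==> e x = zero_of C x"
 shows "augmentation K C e"
proof -
 interpret C: operad K C by fact
 interpret e: op_hom K C C e by (rule op_homI[OF assms(1,1,2)])
 let ?n = "nul C" and ?u = "unt C"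
 have s0: "?n 1 0 = scale C \<zero>\<^bsub>K\<^esub> ?u" using C.scale_zero[OF C.unt_gr] by simp
 have sc: "if arity C x = 1 & deg C x = 0 then \<exists>k\<in>carrier K. e x = scale C k ?u
 else e x = ?n (arity C x) (deg C x)" (is "?S x") if x: "x : elts C" for x
 proof -
 have nulS: "?S x" if "e x = ?n (arity C x) (deg C x)" for x
 using that s0 C.zero_K by auto
 have "x : opspan K C X" using x X(2) by blast
 from this X(1) show ?thesis
 proof (induction rule: C.opspan_induct)
 case (gen x)
 thus ?case by (intro nulS X(3))
 next
 case unt
 show ?case using C.arity_unit C.deg_unit e.hom_unt C.scale_one[OF C.unit_closed] C.one_K by (auto intro!: bexI[of _ "\<one>\<^bsub>K\<^esub>"])
 next
 case (nul n d)
 show ?case by (rule nulS) (simp only: e.sm.hom_nul C.arity_nul C.deg_nul)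
 next
 case (pls n d x y)
 have g: "arity C (pls C x y) = n" "deg C (pls C x y) = d"
 "arity C x = n" "deg C x = d" "arity C y = n" "deg C y = d"
 using pls(1,2) C.pls_gr[OF pls(1,2)] by (simp_all only: gr_iff)
 show ?case
 proof (cases "n = 1 & d = 0")
 case True
 then obtain k l where k: "k : carrier K" "e x = scale C k ?u" "l : carrier K" "e y = scale C l ?u"
 using pls(3,4) unfolding g by auto
 interpret cring K by (rule C.cring_K)
 have "e (pls C x y) = scale C (k \<oplus>\<^bsub>K\<^esub> l) ?u"
 unfolding e.hom_pls[OF pls(1,2)] k C.scale_add[OF k(1,3) C.unt_gr] ..
 thus ?thesis using True k unfolding g by (auto intro!: bexI[of _ "k \<oplus>\<^bsub>K\<^esub> l"])
 next
 case False
 hence "e x = ?n n d" "e y = ?n n d" using pls(3,4) unfolding g by auto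
 thus ?thesis using False e.hom_pls[OF pls(1,2)] C.nul_pls[OF C.nul_gr, of n d] unfolding g by auto
 qed
 next
 case (scale k x)
 have g: "arity C (scale C k x) = arity C x" "deg C (scale C k x) = deg C x"
 using C.scale_gr[OF scale(1) elts_gr[OF scale(2)]] by (simp_all only: gr_iff)
 show ?case
 proof (cases "arity C x = 1 & deg C x = 0")
 case True
 then obtain l where l: "l : carrier K" "e x = scale C l ?u" using scale(3) by auto
 interpret cring K by (rule C.cring_K)
 have "e (scale C k x) = scale C (k \<otimes>\<^bsub>K\<^esub> l) ?u"
 unfolding e.hom_scale[OF scale(1,2)] l by (rule C.scale_scale[OF scale(1) l(1) C.unit_closed])
 thus ?thesis using True scale(1) l unfolding g by (auto intro!: bexI[of _ "k \<otimes>\<^bsub>K\<^esub> l"])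
 next
 case False
 thus ?thesis using scale(3) e.hom_scale[OF scale(1,2)] C.scale_nul[OF scale(1)] unfolding g by auto
 qed
 next
 case (perm \<pi> x)
 note x = elts_gr[OF perm(1)]
 have g: "arity C (perm C \<pi> x) = arity C x" "deg C (perm C \<pi> x) = deg C x"
 using C.perm_gr[OF x perm(2)] by (simp_all only: gr_iff)
 show ?case
 proof (cases "arity C x = 1 & deg C x = 0")
 case True
 hence "\<pi> = id" using perm(2) by (intro permutes_lessThan_1) simp
 thus ?thesis using perm(3) C.perm_id[OF perm(1)] by simp
 next
 case False
 thus ?thesis using perm(3) e.hom_perm[OF x perm(2)] C.perm_nul[OF perm(2)] unfolding g by auto
 qed
 next
 case (cmp a bs)
 note cc = cmp(1)
 have aC: "a : elts C" by (rule C.composable_elts[OF cc])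
 show ?case
 proof (cases "arity C a = 1 & deg C a = 0")
 case True
 then obtain l where l: "l : carrier K" "e a = scale C l ?u" using cmp(2) by auto
 obtain b where b: "bs = [b]" "b : elts C" using cc True by (cases bs) (auto simp: composable_def)
 have eb: "e b : elts C" using e.hom_gr[OF elts_gr[OF b(2)]] by (simp only: gr_iff)
 have cu: "composable C ?u [e b]" using eb C.unit_closed C.arity_unit by (simp add: composable_def)
 have "e (cmp C a bs) = scale C l (e b)"
 using e.hom_cmp[OF cc] C.comp_scale_left[OF cu l(1)] C.unit_left[OF eb] by (simp add: b(1) l(2))
 moreover have g: "arity C (cmp C a bs) = arity C b" "deg C (cmp C a bs) = deg C b"
 using C.arity_comp[OF cc] C.deg_comp[OF cc] True b(1) by (simp_all)
 ultimately show ?thesis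
 proof (cases "arity C b = 1 & deg C b = 0")
 case T: True
 then obtain k where k: "k : carrier K" "e b = scale C k ?u" using cmp(3)[of b] b(1) by auto
 interpret cring K by (rule C.cring_K)
 have "e (cmp C a bs) = scale C (l \<otimes>\<^bsub>K\<^esub> k) ?u"
 unfolding \<open>e (cmp C a bs) = scale C l (e b)\<close> k by (rule C.scale_scale[OF l(1) k(1) C.unit_closed])
 thus ?thesis using T k l unfolding g by (auto intro!: bexI[of _ "l \<otimes>\<^bsub>K\<^esub> k"])
 next
 case False
 hence "e b = ?n (arity C b) (deg C b)" using cmp(3)[of b] b(1) by auto
 thus ?thesis using \<open>e (cmp C a bs) = scale C l (e b)\<close> False C.scale_nul[OF l(1)] unfolding g by auto
 qed
 next
 case False
 hence ea: "e a = ?n (arity C a) (deg C a)" using cmp(2) by auto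
 have "e (cmp C a bs) = ?n (tarity C bs) (deg C a + tdeg C bs)"
 unfolding e.hom_cmp[OF cc] ea
 using C.cmp_nul_left'[OF e.hom_composable[OF cc], of "deg C a"]
 by (simp only: e.map_hom_grade'[OF cc] e.hom_grade[OF aC])
 thus ?thesis by (intro nulS) (simp only: C.arity_comp[OF cc] C.deg_comp[OF cc])
 qed
 qed
 qed
 have "scalar K C (e x)" if "x : elts C" for x
 using sc[OF that] e.hom_grade[OF that] unfolding scalar_def by (cases "arity C x = 1 & deg C x = 0") auto
 thus ?thesis by (intro augmentation.intro augmentation_axioms.intro assms(1,2))
qed

locale free_chainification = smodule K M for K :: "('k, 'z) ring_scheme" (structure)
 and M :: "('k, 'a, 'm) smod_scheme"
begin
abbreviation "F \<equiv> free K M"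
abbreviation "CF \<equiv> ch K F"
abbreviation "igen x \<equiv> ch_iota K F (gen K M x)"
abbreviation "dgen x \<equiv> ch_del K F (gen K M x)"
abbreviation "ch_gens \<equiv> (%x. igen x) ` elts M \<union> (%x. dgen x) ` elts M"
lemma chainification_free: "chainification K F"
 by (simp add: chainification_def operad_free)
lemma ch_gen_gr: "x : gr M n d ==> igen x : gr CF n d" "x : gr M n d ==> dgen x : gr CF n (d - 1)"
proof -
 interpret c: chainification K F by (rule chainification_free)
 assume x: "x : gr M n d"
 show "igen x : gr CF n d" "dgen x : gr CF n (d - 1)"
 using c.iota_gr[OF gen_gr[OF x]] c.del_gr[OF gen_gr[OF x]] by simp_all
qed
lemma ch_gens_elts: "ch_gens \<subseteq> elts CF"
 using ch_gen_gr(1)[OF elts_gr] ch_gen_gr(2)[OF elts_gr] by (auto simp: gr_iff)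
lemma ch_free_universal:
 assumes X: "operad K X" and u: "smod_hom K M X u" and v: "smod_hom K (shift (- 1) M) X v"
 shows "\<exists>h. operad_hom K CF X h & (\<forall>x\<in>elts M. h (igen x) = u x & h (dgen x) = v x)"
proof -
 interpret X: operad K X by fact
 interpret c: chainification K F by (rule chainification_free)
 obtain f where f: "operad_hom K F (dual K X) f" "!!x. x : elts M ==> f (gen K M x) = (u x, v x)"
 using free_universal[OF X.operad_dual smod_hom_sqzI[OF u v]] by blast
 have "gen K M x : elts F" if "x : elts M" for x using gen_gr[OF elts_gr[OF that]] by (simp add: gr_iff)
 thus ?thesis using c.ch_universal[OF X f(1)] f(2) by fastforce
qed

text \<open>The elements \<open>\<iota> a\<close> and \<open>\<partial> a\<close> generate, for all \<open>a\<close>, and the relations express them by the values at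
  the generators of the free operad.\<close>

lemma ch_free_generated: "elts CF \<subseteq> opspan K CF ch_gens"
proof -
 interpret c: chainification K F by (rule chainification_free)
 interpret C: operad K "CF" by (rule c.operad_ch)
 let ?S = "opspan K CF ch_gens"
 note ih = operad_hom_cmp[OF c.iota_operad_hom] operad_hom_unt[OF c.iota_operad_hom]
 have main: "ch_iota K F a : ?S & ch_del K F a : ?S" if "a : opspan K F (gen K M ` elts M)" for a
 using that gens_elts
 proof (induction rule: c.opspan_induct)
 case (gen x)
 thus ?case by (auto intro!: opspan.gen)
 next
 case unt
 have "ch_del K F (unt F) = nul CF 1 (- 1)" using operad_hom_unt[OF c.J_hom] by simp
 thus ?case using ih(2) opspan.unt[of "CF" K ch_gens] opspan.nul[of "CF" 1 "- 1" K ch_gens] by simp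
 next
 case (nul n d)
 interpret i: smodule_hom K F "CF" "ch_iota K F"
 by (intro smodule_hom.intro smodule_hom_axioms.intro c.smodule_axioms C.smodule_axioms) (simp add: c.iota_hom)
 interpret d: smodule_hom K "shift (- 1) F" "CF" "ch_del K F"
 by (intro smodule_hom.intro smodule_hom_axioms.intro c.sP C.smodule_axioms) (simp add: c.del_hom)
 show ?case using i.hom_nul[of n d] d.hom_nul[of n "d - 1"] opspan.nul[of "CF" _ _ K ch_gens] by simp
 next
 case (pls n d x y)
 have x: "x : gr (shift (- 1) F) n (d - 1)" "y : gr (shift (- 1) F) n (d - 1)" using pls by (simp_all add: gr_shift)
 show ?case
 using pls(3,4) smod_hom_pls[OF c.iota_hom pls(1,2)] smod_hom_pls[OF c.del_hom x]
 c.iota_gr[OF pls(1)] c.iota_gr[OF pls(2)] c.del_gr[OF pls(1)] c.del_gr[OF pls(2)]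
 opspan.pls[of _ K "CF" ch_gens] by (simp add: same_grade_def gr_iff)
 next
 case (scale k x)
 thus ?case using smod_hom_scale[OF c.iota_hom, of k x] smod_hom_scale[OF c.del_hom, of k x]
 opspan.scale[of _ K "CF" ch_gens k] by simp
 next
 case (perm \<pi> x)
 note x = elts_gr[OF perm(1)]
 have x': "x : gr (shift (- 1) F) (arity F x) (deg F x - 1)" using x by (simp add: gr_shift)
 show ?case using perm(3) smod_hom_perm[OF c.iota_hom x perm(2)] smod_hom_perm[OF c.del_hom x' perm(2)]
 opspan.perm[of _ K "CF" ch_gens \<pi>] perm(2) c.iota_gr[OF x] c.del_gr[OF x] by (simp add: gr_iff)
 next
 case (cmp a bs)
 note cc = cmp(1)
 have bg: "b : comp_of F b" if "b : set bs" for b using cc that by (auto simp: composable_def elts_gr)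
 have ag: "a : comp_of F a" by (rule c.composable_gr[OF cc])
 have l: "length bs = arity F a" using cc by (simp add: composable_def)
 have ia: "ch_iota K F a : gr CF (arity F a) (deg F a)" "ch_del K F a : gr CF (arity F a) (deg F a - 1)"
 using c.iota_gr[OF ag] c.del_gr[OF ag] by simp_all
 have ci: "composable CF (ch_iota K F a) (map (ch_iota K F) bs)"
 using smod_hom_composable[OF c.iota_hom cc] by simp
 have c2: "comp2 CF (- 1) (ch_iota K F a) (map (%b. (ch_iota K F b, ch_del K F b)) bs)"
 by (rule C.comp2_pairs[OF ci]) (use c.iota_gr[OF bg] c.del_gr[OF bg] in "simp add: gr_iff")
 have 1: "cmp CF (ch_iota K F a) (map (ch_iota K F) bs) : ?S"
 using cmp ia l by (intro opspan.cmp) (auto simp: gr_iff)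
 have 2: "cmp CF (ch_del K F a) (map (ch_iota K F) bs) : ?S"
 using cmp ia l by (intro opspan.cmp) (auto simp: gr_iff)
 have 3: "leib K CF (ch_iota K F a) (map (%b. (ch_iota K F b, ch_del K F b)) bs) : ?S"
 by (rule C.opspan_leib[OF c2]) (use cmp in auto)
 have lt: "leib_term K CF = leib_term K c.C" by (simp add: fun_eq_iff leib_term_def pdeg_def signed_def)
 have le: "leib K CF = leib K c.C" by (simp add: fun_eq_iff leib_def lt lsum_def)
 have cd: "composable CF (ch_del K F a) (map (ch_iota K F) bs)"
 by (rule composable_cong[OF ci, of _ "deg F a - 1"]) (use ia in "simp add: gr_iff")
 have am: "map (arity CF) (map (ch_iota K F) bs) = map (arity F) bs"
 "map (deg CF) (map (ch_iota K F) bs) = map (deg F) bs"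
 using c.iota_gr[OF bg] by (auto simp: gr_iff)
 have g2: "cmp CF (ch_del K F a) (map (ch_iota K F) bs)
 : gr CF (tarity F bs) (deg F a - 1 + tdeg F bs)"
 by (rule C.cmp_gr[OF cd]) (use ia in "simp_all only: am gr_iff")
 have "map fst (map (%b. (ch_iota K F b, ch_del K F b)) bs) = map (ch_iota K F) bs" by simp
 hence g3: "leib K CF (ch_iota K F a) (map (%b. (ch_iota K F b, ch_del K F b)) bs)
 : gr CF (tarity F bs) (deg F a + tdeg F bs - 1)"
 using C.leib_gr[OF c2] ia(1) by (simp only: am gr_iff)
 have sg: "same_grade CF (cmp CF (ch_del K F a) (map (ch_iota K F) bs))
 (leib K CF (ch_iota K F a) (map (%b. (ch_iota K F b, ch_del K F b)) bs))"
 using g2 g3 unfolding same_grade_def gr_iff by simp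
 have "ch_del K F (cmp F a bs) = pls CF (cmp CF (ch_del K F a) (map (ch_iota K F) bs))
 (leib K CF (ch_iota K F a) (map (%b. (ch_iota K F b, ch_del K F b)) bs))"
 unfolding le by (simp only: c.ch_sel c.del_cmp[OF cc])
 moreover have "ch_iota K F (cmp F a bs) = cmp CF (ch_iota K F a) (map (ch_iota K F) bs)"
 by (simp only: c.ch_sel ih(1)[OF cc])
 ultimately show ?case using 1 opspan.pls[OF 2 3 sg] by simp
 qed
 have "c.gens \<subseteq> ?S" using main free_generated by auto
 from opspan_subset[OF this] c.generated show ?thesis by simp
qed
lemma ch_free_augmentation:
 "\<exists>e. augmentation K CF e & (\<forall>x\<in>ch_gens. e x = zero_of CF x)"
proof -
 interpret c: chainification K F by (rule chainification_free)
 interpret C: operad K "CF" by (rule c.operad_ch)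
 obtain e where e: "operad_hom K CF CF e"
 "!!x. x : elts M ==> e (igen x) = nul CF (arity M x) (deg M x)"
 "!!x. x : elts M ==> e (dgen x) = nul CF (arity M x) (deg M x - 1)"
 using ch_free_universal[OF c.operad_ch smod_hom_nul_fun[OF smodule_axioms C.smodule_axioms]
 smod_hom_nul_fun[OF smodule_shift[OF smodule_axioms, of "- 1"] C.smodule_axioms]] by auto
 interpret e: op_hom K "CF" "CF" e by (rule op_homI[OF c.operad_ch c.operad_ch e(1)])
 have nul: "e x = zero_of CF x" if x: "x : ch_gens" for x
 using x e(2,3) ch_gen_gr(1)[OF elts_gr] ch_gen_gr(2)[OF elts_gr] by (auto simp: gr_iff)
 have "augmentation K CF e"
 by (rule augmentationI[OF c.operad_ch e(1) ch_gens_elts ch_free_generated nul])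
 thus ?thesis using nul by blast
qed

text \<open>A morphism on the chainification of a free operad can be prescribed on all \<open>\<iota> x\<close> and \<open>\<partial> x\<close>.  The first
  components of the values chosen here give the identity, and the second ones give \<open>h\<close>.\<close>

lemma ch_free_contraction: "\<exists>e h. contraction K CF e ch_gens h"
proof -
 interpret c: chainification K F by (rule chainification_free)
 interpret C: dg_operad K "CF" by (rule c.dg_operad_ch)
 obtain e where a: "augmentation K CF e & (\<forall>x\<in>ch_gens. e x = zero_of CF x)"
 using ch_free_augmentation by (rule exE)
 note en = bspec[OF conjunct2[OF a]]
 interpret augmentation K "CF" e by (rule conjunct1[OF a])
 let ?S = "sqz CF 1 hterm"
 interpret S: square_zero K "CF" 1 hterm by (rule square_zero_hterm)
 have genF: "gen K M x : elts F" if "x : elts M" for x using gen_gr[OF elts_gr[OF that]] by (simp add: gr_iff)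
 have ih: "smod_hom K M CF (%x. igen x)"
 by (rule smod_hom_comp[OF gen_smod_hom, where g = "ch_iota K F"]) (simp add: c.iota_hom)
 have dh: "smod_hom K (shift (- 1) M) CF (%x. dgen x)"
 proof -
 have "smod_hom K (shift (- 1) M) (shift (- 1) F) (gen K M)" using gen_smod_hom by (simp add: smod_hom_def same_grade_def)
 thus ?thesis by (rule smod_hom_comp[where g = "ch_del K F"]) (simp add: c.del_hom)
 qed
 have ih': "smod_hom K (shift 1 (shift (- 1) M)) CF (%x. igen x)"
 using ih by (simp add: shift_shift smod_hom_def same_grade_def)
 have u: "smod_hom K M ?S (%x. (igen x, nul CF (arity M x) (deg M x + 1)))"
 by (rule smod_hom_sqzI[OF ih])
 (use smod_hom_nul_fun[OF smodule_shift[OF smodule_axioms, of 1] C.smodule_axioms] in simp)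
 have v: "smod_hom K (shift (- 1) M) ?S (%x. (dgen x, igen x))" by (rule smod_hom_sqzI[OF dh ih'])
 obtain H where H: "operad_hom K CF ?S H"
 "!!x. x : elts M ==> H (igen x) = (igen x, nul CF (arity M x) (deg M x + 1))"
 "!!x. x : elts M ==> H (dgen x) = (dgen x, igen x)"
 using ch_free_universal[OF S.operad_sqz u v] by blast
 have f: "fst (H x) = x" if x: "x : elts CF" for x
 proof (rule hom_eq_on_opspan[where f = "%x. fst (H x)" and g = "%x. x", OF _ _ ch_gens_elts])
 show "op_hom K CF CF (%x. fst (H x))"
 by (rule op_homI[OF C.operad_axioms C.operad_axioms operad_hom_comp[OF H(1) S.fst_hom]])
 show "op_hom K CF CF (%x. x)"
 by (rule op_homI[OF C.operad_axioms C.operad_axioms]) (simp only: operad_hom_def smod_hom_id list.map_ident simp_thms)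
 show "x : opspan K CF ch_gens" using x ch_free_generated by blast
 qed (use H in auto)
 define h where "h = (%x. snd (H x))"
 have hH: "operad_hom K CF ?S (%x. (x, h x))"
 by (rule operad_hom_cong[OF H(1) C.operad_axioms]) (simp only: h_def prod_eq_iff fst_conv snd_conv f simp_thms)
 have hi: "h (igen x) = nul CF (arity M x) (deg M x + 1)" and hd: "h (dgen x) = igen x" if "x : elts M" for x
 using H(2,3)[OF that] by (simp_all add: h_def)
 have di: "dif CF (igen x) = dgen x" and dd: "dif CF (dgen x) = nul CF (arity M x) (deg M x - 2)" if x: "x : elts M" for x
 using c.dif_ch(3,4)[OF genF[OF x]] gen_gr[OF elts_gr[OF x]] by (simp_all add: gr_iff)
 interpret Dh: smodule_hom K "CF" "shift 1 CF" "dif CF"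
 by (intro smodule_hom.intro smodule_hom_axioms.intro C.smodule_axioms smodule_shift) (use C.dif_derivation in "unfold derivation_def, blast")
 interpret sh: op_hom K "CF" ?S "%x. (x, h x)" by (rule op_homI[OF C.operad_axioms S.operad_sqz hH])
 have Dn: "dif CF (nul CF n d) = nul CF n (d - 1)" for n d using Dh.hom_nul[of n d] by simp
 have hn: "h (nul CF n d) = nul CF n (d + 1)" for n d using sh.sm.hom_nul[of n d] by simp
 have "contraction K CF e ch_gens h"
 proof (intro contraction.intro contraction_axioms.intro)
 show "augmentation K CF e" by (rule augmentation_axioms)
 show "dg_operad K CF" by (rule C.dg_operad_axioms)
 show "ch_gens \<subseteq> elts CF" by (rule ch_gens_elts)
 show "elts CF \<subseteq> opspan K CF ch_gens" by (rule ch_free_generated)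
 show "operad_hom K CF (sqz CF 1 hterm) (%x. (x, h x))" by (rule hH)
 fix x assume x: "x : ch_gens"
 thus "e x = zero_of CF x" by (rule en)
 consider m where "m : elts M" "x = igen m" | m where "m : elts M" "x = dgen m" using x by blast
 hence "dif CF x : op_ideal K CF ch_gens & pls CF (dif CF (h x)) (h (dif CF x)) = x"
 proof cases
 case 1
 have g: "igen m : gr CF (arity M m) (deg M m)" by (rule ch_gen_gr(1)[OF elts_gr[OF 1(1)]])
 have "dgen m : op_ideal K CF ch_gens" using 1 by (intro op_ideal.generator) blast
 thus ?thesis unfolding 1(2) di[OF 1(1)] hi[OF 1(1)] hd[OF 1(1)] Dn using C.nul_pls[OF g] by simp
 next
 case 2
 have g: "dgen m : gr CF (arity M m) (deg M m - 1)" by (rule ch_gen_gr(2)[OF elts_gr[OF 2(1)]])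
 have "deg M m - 2 + 1 = deg M m - 1" by simp
 thus ?thesis unfolding 2(2) di[OF 2(1)] dd[OF 2(1)] hd[OF 2(1)] hn
 using C.pls_nul[OF g] op_ideal.nul[of "CF" _ _ K ch_gens] by (simp only: simp_thms)
 qed
 thus "dif CF x : op_ideal K CF ch_gens" "pls CF (dif CF (h x)) (h (dif CF x)) = x"
 by blast+
 qed
 thus ?thesis by blast
qed

end

section \<open>Suboperads and homology\<close>

definition submod :: "('k, 'z) ring_scheme => ('k, 'a, 'm) smod_scheme => 'a set => bool" where
 "submod K M S \<longleftrightarrow> S \<subseteq> elts M & (\<forall>n d. nul M n d : S) &
 (\<forall>x\<in>S. \<forall>y\<in>S. same_grade M x y --> pls M x y : S) &
 (\<forall>c\<in>carrier K. \<forall>x\<in>S. scale M c x : S) &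
 (\<forall>x\<in>S. \<forall>\<pi>. \<pi> permutes {..<arity M x} --> perm M \<pi> x : S)"
lemma submodD:
 assumes "submod K M S"
 shows "x : S ==> x : elts M" "nul M n d : S" "x : S ==> y : S ==> same_grade M x y ==> pls M x y : S"
 "c : carrier K ==> x : S ==> scale M c x : S" "x : S ==> \<pi> permutes {..<arity M x} ==> perm M \<pi> x : S"
 using assms unfolding submod_def by blast+
lemma submod_Int: "submod K M S ==> submod K M S' ==> submod K M (S \<inter> S')"
 unfolding submod_def by blast
lemma (in smodule_hom) submod_kernel: "submod K M {x : elts M. f x = nul N (arity M x) (deg M x)}"
 unfolding submod_def
proof (intro conjI allI ballI impI)
 fix x y assume a: "x : {x : elts M. f x = nul N (arity M x) (deg M x)}" "y : {x : elts M. f x = nul N (arity M x) (deg M x)}"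
 "same_grade M x y"
 hence g: "x : comp_of M x" "y : comp_of M x" by (auto simp: gr_iff same_grade_def)
 show "pls M x y : {x : elts M. f x = nul N (arity M x) (deg M x)}"
 using M.pls_gr[OF g] hom_pls[OF g] a by (simp add: gr_iff same_grade_def N.nul_pls[OF N.nul_gr])
next
 fix c x assume "c : carrier K" "x : {x : elts M. f x = nul N (arity M x) (deg M x)}"
 thus "scale M c x : {x : elts M. f x = nul N (arity M x) (deg M x)}"
 using M.scale_gr[OF _ elts_gr, of c x] hom_scale[of c x] by (simp add: gr_iff)
next
 fix x \<pi> assume "x : {x : elts M. f x = nul N (arity M x) (deg M x)}" "\<pi> permutes {..<arity M x}"
 thus "perm M \<pi> x : {x : elts M. f x = nul N (arity M x) (deg M x)}"
 using M.perm_gr[OF elts_gr, of x \<pi>] hom_perm[OF elts_gr, of x \<pi>] by (simp add: gr_iff)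
qed auto
lemma gr_restrict: "gr (M\<lparr>elts := S\<rparr>) n d = {x : S. arity M x = n & deg M x = d}"
 by (simp add: gr_def)

context smodule
begin
lemma smodule_restrict: assumes S: "submod K M S" shows "smodule K (M\<lparr>elts := S\<rparr>)"
proof -
 let ?Z = "M\<lparr>elts := S\<rparr>"
 note s = submodD[OF S]
 have sub: "x : gr M n d" if "x : gr ?Z n d" for x n d using that s(1) by (simp add: gr_restrict gr_iff)
 have inS: "x : S" if "x : gr ?Z n d" for x n d using that by (simp add: gr_restrict)
 have gZ: "x : gr ?Z n d" if "x : S" "x : gr M n d" for x n d using that by (simp add: gr_restrict gr_iff)
 have sg: "same_grade M x y" if "x : gr ?Z n d" "y : gr ?Z n d" for x y n d
 using that by (simp add: gr_restrict same_grade_def)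
 show ?thesis
 proof (rule smoduleI[OF cring_K])
 fix n d
 show "nul ?Z n d : gr ?Z n d" using gZ[OF s(2) nul_gr] by simp
 fix x assume x: "x : gr ?Z n d"
 note xM = sub[OF x]
 have xe: "x : elts M" using xM by (simp add: gr_iff)
 show "pls ?Z (nul ?Z n d) x = x" "scale ?Z \<one> x = x" "perm ?Z id x = x"
 by (simp_all add: nul_pls[OF xM] scale_one[OF xe] perm_id[OF xe])
 show "pls ?Z (scale ?Z (\<ominus> \<one>) x) x = nul ?Z n d"
 using pls_neg[OF xM] pls_comm[OF xM scale_gr[OF minus_one_K xM]] by simp
 { fix y assume y: "y : gr ?Z n d"
 note yM = sub[OF y]
 show "pls ?Z x y : gr ?Z n d" using gZ[OF s(3)[OF inS[OF x] inS[OF y] sg[OF x y]] pls_gr[OF xM yM]] by simp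
 show "pls ?Z x y = pls ?Z y x" using pls_comm[OF xM yM] by simp
 { fix z assume z: "z : gr ?Z n d"
 show "pls ?Z (pls ?Z x y) z = pls ?Z x (pls ?Z y z)" using pls_assoc[OF xM yM sub[OF z]] by simp }
 { fix a assume a: "a : carrier K"
 show "scale ?Z a (pls ?Z x y) = pls ?Z (scale ?Z a x) (scale ?Z a y)" using scale_pls[OF a xM yM] by simp }
 { fix \<pi> assume p: "\<pi> permutes {..<n}"
 show "perm ?Z \<pi> (pls ?Z x y) = pls ?Z (perm ?Z \<pi> x) (perm ?Z \<pi> y)" using perm_pls[OF xM yM p] by simp } }
 { fix a assume a: "a : carrier K"
 show "scale ?Z a x : gr ?Z n d" using gZ[OF s(4)[OF a inS[OF x]] scale_gr[OF a xM]] by simp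
 { fix b assume b: "b : carrier K"
 show "scale ?Z (a \<oplus> b) x = pls ?Z (scale ?Z a x) (scale ?Z b x)" using scale_add[OF a b xM] by simp
 show "scale ?Z (a \<otimes> b) x = scale ?Z a (scale ?Z b x)" using scale_scale[OF a b xe] by simp }
 { fix \<pi> assume "\<pi> permutes {..<n}"
 hence p: "\<pi> permutes {..<arity M x}" using xM by (simp add: gr_iff)
 show "perm ?Z \<pi> (scale ?Z a x) = scale ?Z a (perm ?Z \<pi> x)" using perm_scale[OF a xe p] by simp } }
 { fix \<pi> assume p: "\<pi> permutes {..<n}"
 hence p': "\<pi> permutes {..<arity M x}" using xM by (simp add: gr_iff)
 show "perm ?Z \<pi> x : gr ?Z n d" using gZ[OF s(5)[OF inS[OF x] p'] perm_gr[OF xM p]] by simp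
 { fix \<tau> assume "\<tau> permutes {..<n}"
 hence t: "\<tau> permutes {..<arity M x}" using xM by (simp add: gr_iff)
 show "perm ?Z \<pi> (perm ?Z \<tau> x) = perm ?Z (\<pi> \<circ> \<tau>) x" using perm_comp[OF xe p' t] by simp } }
 qed
qed

end

context operad
begin
lemma operad_restrict:
 assumes S: "submod K P S" and u: "unt P : S" and c: "!!a bs. composable P a bs ==> a : S ==> set bs \<subseteq> S ==> cmp P a bs : S"
 shows "operad K (P\<lparr>elts := S\<rparr>)"
proof -
 let ?Z = "P\<lparr>elts := S\<rparr>"
 note s = submodD[OF S]
 have co: "composable P a bs" "a : S" "set bs \<subseteq> S" if "composable ?Z a bs" for a bs
 using that s(1) by (auto simp: composable_def)
 have sg: "same_grade ?Z = same_grade P" by (simp add: fun_eq_iff same_grade_def)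
 have sn: "signed K ?Z = signed K P" by (simp add: fun_eq_iff signed_def)
 show ?thesis
 proof (intro operad.intro smodule_restrict[OF S] operad_axioms.intro)
 show "unt ?Z : elts ?Z" "arity ?Z (unt ?Z) = 1" "deg ?Z (unt ?Z) = 0" by (simp_all add: u arity_unit deg_unit)
 fix a assume "a : elts ?Z"
 hence "a : elts P" using s(1) by simp
 thus "cmp ?Z (unt ?Z) [a] = a" "cmp ?Z a (replicate (arity ?Z a) (unt ?Z)) = a" by (simp_all add: unit_left unit_right)
 next
 fix a bs assume "composable ?Z a bs"
 note k = co[OF this]
 show "cmp ?Z a bs : elts ?Z" using c[OF k] by simp
 show "arity ?Z (cmp ?Z a bs) = tarity ?Z bs" "deg ?Z (cmp ?Z a bs) = deg ?Z a + tdeg ?Z bs"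
 by (simp_all add: arity_comp[OF k(1)] deg_comp[OF k(1)])
 { fix a' assume "a' : elts ?Z" "same_grade ?Z a a'"
 thus "cmp ?Z (pls ?Z a a') bs = pls ?Z (cmp ?Z a bs) (cmp ?Z a' bs)" using comp_plus_left[OF k(1)] s(1) by (simp add: sg) }
 { fix r assume "r : carrier K"
 thus "cmp ?Z (scale ?Z r a) bs = scale ?Z r (cmp ?Z a bs)" using comp_scale_left[OF k(1)] by simp }
 { fix i b assume "i < length bs" "b : elts ?Z" "same_grade ?Z b (bs ! i)"
 thus "cmp ?Z a (bs[i := pls ?Z (bs ! i) b]) = pls ?Z (cmp ?Z a bs) (cmp ?Z a (bs[i := b]))"
 using comp_plus_right[OF k(1)] s(1) by (simp add: sg) }
 { fix i r assume "i < length bs" "r : carrier K"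
 thus "cmp ?Z a (bs[i := scale ?Z r (bs ! i)]) = scale ?Z r (cmp ?Z a bs)" using comp_scale_right[OF k(1)] by simp }
 { fix css assume l: "length css = length bs" and cc: "!!i. i < length bs ==> composable ?Z (bs ! i) (css ! i)"
 have "cmp P (cmp P a bs) (concat css)
 = signed K P (\<Sum>i<length bs. \<Sum>j<i. deg P (bs ! i) * sum_list (map (deg P) (css ! j))) (cmp P a (map2 (cmp P) bs css))"
 by (rule assoc[OF k(1) l co(1)[OF cc]])
 thus "cmp ?Z (cmp ?Z a bs) (concat css)
 = signed K ?Z (\<Sum>i<length bs. \<Sum>j<i. deg ?Z (bs ! i) * sum_list (map (deg ?Z) (css ! j))) (cmp ?Z a (map2 (cmp ?Z) bs css))"
 by (simp add: sn) }
 { fix \<pi> assume "\<pi> permutes {..<arity ?Z a}"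
 thus "cmp ?Z (perm ?Z \<pi> a) bs = signed K ?Z (koszul \<pi> (map (deg ?Z) bs))
 (perm ?Z (block_perm (map (arity ?Z) bs) \<pi>) (cmp ?Z a (map (%j. bs ! \<pi> j) [0..<length bs])))"
 using equivariant_left[OF k(1)] by (simp add: sn) }
 { fix \<tau>s assume "length \<tau>s = length bs" "!!i. i < length bs ==> (\<tau>s ! i) permutes {..<arity ?Z (bs ! i)}"
 thus "cmp ?Z a (map2 (perm ?Z) \<tau>s bs) = perm ?Z (sum_perm (map (arity ?Z) bs) \<tau>s) (cmp ?Z a bs)"
 using equivariant_right[OF k(1)] by simp }
 qed
qed
lemma opspan_restrict:
 assumes "operad K (P\<lparr>elts := S\<rparr>)" "X \<subseteq> S" shows "opspan K P X \<subseteq> S"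
proof
 interpret Z: operad K "P\<lparr>elts := S\<rparr>" by fact
 fix x assume "x : opspan K P X"
 hence "x : opspan K (P\<lparr>elts := S\<rparr>) X"
 proof (induction rule: opspan.induct)
 case (pls x y)
 thus ?case using opspan.pls[of x K "P\<lparr>elts := S\<rparr>" X y] by (simp add: same_grade_def)
 next
 case (cmp a bs)
 thus ?case using opspan.cmp[of a K "P\<lparr>elts := S\<rparr>" X bs] by simp
 qed (use opspan.gen[of _ X K "P\<lparr>elts := S\<rparr>"] opspan.unt[of "P\<lparr>elts := S\<rparr>" K X] opspan.nul[of "P\<lparr>elts := S\<rparr>" _ _ K X]
 opspan.scale[of _ K "P\<lparr>elts := S\<rparr>" X] opspan.perm[of _ K "P\<lparr>elts := S\<rparr>" X] in simp_all)
 thus "x : S" using Z.opspan_elts[of X] assms(2) by auto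
qed
lemma leib_nul:
 assumes c: "composable P a bs"
 shows "leib K P a (map (%b. (b, nul P (arity P b) (deg P b - 1))) bs)
 = nul P (tarity P bs) (deg P a + tdeg P bs - 1)"
proof -
 let ?ds = "map (%b. (b, nul P (arity P b) (deg P b - 1))) bs"
 have m: "map fst ?ds = bs" by (simp add: comp_def)
 have "leib_term K P a ?ds i = nul P (tarity P bs) (deg P a + tdeg P bs - 1)" if i: "i < length bs" for i
 using cmp_nul_right[OF c i, of "deg P (bs ! i) - 1"] i by (simp add: leib_term_def mark_def comp_def add_diff_eq)
 thus ?thesis unfolding leib_def m by (intro lsum_nul) simp
qed
lemma derivation_nul: "derivation K P (%x. nul P (arity P x) (deg P x - 1))"
proof -
 let ?O = "%x. nul P (arity P x) (deg P x - 1)"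
 have s: "smod_hom K P (shift 1 P) ?O"
 using smod_hom_nul_fun[OF smodule_axioms smodule_shift[OF smodule_axioms, of 1]] by simp
 have "?O (cmp P a bs) = pls P (cmp P (?O a) bs) (leib K P a (map (%b. (b, ?O b)) bs))" if c: "composable P a bs" for a bs
 unfolding leib_nul[OF c] cmp_nul_left'[OF c] arity_comp[OF c] deg_comp[OF c]
 using nul_pls[OF nul_gr, of "tarity P bs" "deg P a + tdeg P bs - 1"] by (simp add: algebra_simps)
 thus ?thesis using derivation_iff[OF s] by blast
qed
lemma dg_operad_trivial_dif: "dg_operad K (trivial_dif P)"
 unfolding trivial_dif_def
 by (intro dg_operad.intro dg_operad_axioms.intro operad_with_dif operad_axioms)
 (simp_all only: derivation_with_dif with_dif_sel derivation_nul arity_nul deg_nul, simp)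

end

context dg_operad
begin
sublocale d: smodule_hom K P "shift 1 P" "dif P"
 using dif_derivation
 by (intro smodule_hom.intro smodule_hom_axioms.intro smodule_axioms smodule_shift) (simp add: derivation_def)
lemma dif_gr: "x : gr P n d ==> dif P x : gr P n (d - 1)"
 by (rule derivation_gr[OF dif_derivation])
lemma dif_nul: "dif P (nul P n d) = nul P n (d - 1)"
 using d.hom_nul[of n d] by simp
lemma dif_signed: "x : elts P ==> dif P (signed K P k x) = signed K P k (dif P x)"
 by (simp add: signed_def d.hom_scale)
abbreviation "Z \<equiv> P\<lparr>elts := cycles P\<rparr>"
abbreviation "B \<equiv> dif P ` elts P"
lemma submod_cycles: "submod K P (cycles P)"
 using d.submod_kernel by (simp add: cycles_def)
lemma dif_cmp_cycles:
 assumes c: "composable P a bs" and z: "!!b. b : set bs ==> b : cycles P"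
 shows "dif P (cmp P a bs) = cmp P (dif P a) bs"
proof -
 have m: "map (%b. (b, dif P b)) bs = map (%b. (b, nul P (arity P b) (deg P b - 1))) bs" using z by (simp add: cycles_def)
 have ag: "a : comp_of P a" by (rule composable_gr[OF c])
 have "cmp P (dif P a) bs : gr P (tarity P bs) (deg P a + tdeg P bs - 1)"
 by (rule cmp_gr[OF composable_cong[OF c dif_gr[OF ag]]]) (use dif_gr[OF ag] in "simp_all add: gr_iff")
 thus ?thesis unfolding derivation_cmp[OF dif_derivation c] m leib_nul[OF c] by (rule pls_nul)
qed
lemma operad_cycles: "operad K Z"
proof (rule operad_restrict[OF submod_cycles])
 show "unt P : cycles P" using derivation_unt[OF dif_derivation] by (simp add: cycles_def unit_closed arity_unit deg_unit)
 fix a bs assume c: "composable P a bs" "a : cycles P" "set bs \<subseteq> cycles P"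
 have "dif P (cmp P a bs) = cmp P (nul P (arity P a) (deg P a - 1)) bs"
 using dif_cmp_cycles[OF c(1)] c(2,3) by (auto simp: cycles_def)
 also have "... = nul P (tarity P bs) (deg P a - 1 + tdeg P bs)" by (rule cmp_nul_left'[OF c(1)])
 finally show "cmp P a bs : cycles P"
 using comp_closed[OF c(1)] arity_comp[OF c(1)] deg_comp[OF c(1)] by (simp add: cycles_def algebra_simps)
qed
lemma boundaries_cycles: "B \<subseteq> cycles P"
 using dif_dif dif_gr[OF elts_gr] by (auto simp: cycles_def gr_iff)

text \<open>If \<open>a\<close> and all inputs are cycles and one input is \<open>\<partial> y\<close>, then the composite is, up to sign, the
  differential of the composite with \<open>y\<close> in this place: all other terms of the Leibniz rule vanish.\<close>

lemma ideal_boundaries: "ideal_closed K Z B"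
 unfolding ideal_closed_def
proof (intro conjI allI ballI impI)
 show "B \<subseteq> elts Z" using boundaries_cycles by simp
 show "nul Z n d : B" for n d using dif_nul[of n "d + 1"] by (auto intro!: image_eqI[of _ _ "nul P n (d + 1)"])
 { fix x y assume "x : B" "y : B" and s: "same_grade Z x y"
 then obtain u v where u: "u : elts P" "x = dif P u" "v : elts P" "y = dif P v" by blast
 hence g: "u : comp_of P u" "v : comp_of P u"
 using s dif_gr[OF elts_gr[OF u(1)]] dif_gr[OF elts_gr[OF u(3)]] by (auto simp: same_grade_def gr_iff)
 show "pls Z x y : B" using d.hom_pls[OF g] pls_gr[OF g] u by (auto simp: gr_iff intro!: image_eqI[of _ _ "pls P u v"]) }
 { fix c x assume c: "c : carrier K" and "x : B"
 then obtain u where u: "u : elts P" "x = dif P u" by blast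
 thus "scale Z c x : B" using d.hom_scale[OF c u(1)] scale_gr[OF c elts_gr[OF u(1)]]
 by (auto simp: gr_iff intro!: image_eqI[of _ _ "scale P c u"]) }
 { fix x \<pi> assume "x : B" and s: "\<pi> permutes {..<arity Z x}"
 then obtain u where u: "u : elts P" "x = dif P u" by blast
 hence s': "\<pi> permutes {..<arity P u}" using s dif_gr[OF elts_gr[OF u(1)]] by (simp add: gr_iff)
 thus "perm Z \<pi> x : B" using d.hom_perm[OF elts_gr[OF u(1)] s'] perm_gr[OF elts_gr[OF u(1)] s'] u
 by (auto simp: gr_iff intro!: image_eqI[of _ _ "perm P \<pi> u"]) }
 { fix a bs assume "a : B" and c: "composable Z a bs"
 then obtain u where u: "u : elts P" "a = dif P u" by blast
 have z: "b : cycles P" if "b : set bs" for b using c that by (auto simp: composable_def)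
 have "composable P u bs" using c u submodD(1)[OF submod_cycles] dif_gr[OF elts_gr[OF u(1)]] by (auto simp: composable_def gr_iff)
 from dif_cmp_cycles[OF this z] comp_closed[OF this] show "cmp Z a bs : B"
 by (auto simp: u(2) intro!: image_eqI[of _ _ "cmp P u bs"]) }
 { fix a bs b assume "b : B" and b: "b : set bs" and cz: "composable Z a bs"
 then obtain y where y: "y : elts P" "b = dif P y" by blast
 obtain i where i: "i < length bs" "b = bs ! i" using b by (auto simp: in_set_conv_nth)
 have z: "b : cycles P" if "b : set bs" for b using cz that by (auto simp: composable_def)
 have za: "a : cycles P" using cz by (simp add: composable_def)
 have c: "composable P a bs" using cz submodD(1)[OF submod_cycles] by (auto simp: composable_def)
 have yg: "y : gr P (arity P (bs ! i)) (deg P (bs ! i) + 1)"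
 using dif_gr[OF elts_gr[OF y(1)]] y i by (simp add: gr_iff)
 let ?cs = "bs[i := y]" and ?n = "tarity P bs" and ?d = "deg P a + tdeg P bs"
 have cc: "composable P a ?cs" using c yg by (auto intro!: composable_update simp: gr_iff)
 let ?ds = "map (%b. (b, dif P b)) ?cs"
 have m: "map fst ?ds = ?cs" by (simp add: comp_def)
 have u: "cmp P a ?cs : gr P ?n (?d + 1)" using cmp_update_gr[OF c i(1) yg] by (simp add: algebra_simps)
 have am: "tarity P ?cs = ?n" "deg P a + tdeg P ?cs = ?d + 1"
 using u arity_comp[OF cc] deg_comp[OF cc] by (simp_all add: gr_iff)
 have ti: "leib_term K P a ?ds i = signed K P (deg P a + pdeg P ?ds i) (cmp P a bs)"
 using i y by (simp add: leib_term_def mark_def map_update comp_def list_update_same_conv)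
 have tj: "leib_term K P a ?ds j = nul P ?n ?d" if j: "j < length bs" "j ~= i" for j
 proof -
 have "dif P (bs ! j) = nul P (arity P (bs ! j)) (deg P (bs ! j) - 1)" using z[OF nth_mem[OF j(1)]] by (simp add: cycles_def)
 hence "mark ?ds j = ?cs[j := nul P (arity P (?cs ! j)) (deg P (?cs ! j) - 1)]"
 using j by (simp add: mark_def comp_def)
 thus ?thesis using cmp_nul_right[OF cc, of j "deg P (?cs ! j) - 1"] j am by (simp add: leib_term_def)
 qed
 have cb: "cmp P a bs : gr P ?n ?d" by (rule cmp_gr[OF c refl refl])
 have "leib K P a ?ds = leib_term K P a ?ds i"
 unfolding leib_def m am using i tj ti signed_gr[OF cb] by (intro lsum_single) auto
 moreover have "cmp P (dif P a) ?cs = nul P ?n ?d"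
 using za cmp_nul_left'[OF cc, of "deg P a - 1"] am by (simp add: cycles_def algebra_simps)
 ultimately have "dif P (cmp P a ?cs) = signed K P (deg P a + pdeg P ?ds i) (cmp P a bs)"
 using derivation_cmp[OF dif_derivation cc] ti signed_gr[OF cb] by simp
 hence "dif P (signed K P (deg P a + pdeg P ?ds i) (cmp P a ?cs))
 = signed K P (deg P a + pdeg P ?ds i) (signed K P (deg P a + pdeg P ?ds i) (cmp P a bs))"
 by (simp only: dif_signed[OF comp_closed[OF cc]])
 also have "... = cmp P a bs" using cb by (simp add: gr_iff signed_even)
 finally show "cmp Z a bs : B" using signed_elts[OF comp_closed[OF cc]] by (simp add: image_iff) metis }
qed
sublocale hom: operad_ideal K Z B
 by (intro operad_ideal.intro operad_ideal_axioms.intro operad_cycles ideal_boundaries)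
abbreviation "cls x \<equiv> ideal_rel K Z B `` {x}"
lemma homology_eq: "homology K P = quot Z (ideal_rel K Z B)"
 by (simp add: homology_def Let_def)
lemma operad_homology: "operad K (homology K P)"
 unfolding homology_eq by (rule hom.operad_quot)
lemma cls_hom: "operad_hom K Z (homology K P) (%x. cls x)"
 unfolding homology_eq by (rule hom.quot_hom)
lemma cls_nul: "x : gr Z n d ==> cls x = nul (homology K P) n d \<longleftrightarrow> x : B"
 unfolding homology_eq by (rule hom.cls_nul_iff)
lemma homology_elts: "elts (homology K P) = (%x. cls x) ` cycles P"
 unfolding homology_eq by (simp add: hom.quot_elts)

end
lemma operad_iso_inverse:
 assumes P: "operad K P" and Q: "operad K Q" and f: "operad_iso K P Q f"
 shows "\<exists>g. operad_iso K Q P g"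
proof
 interpret P: operad K P by fact
 interpret Q: operad K Q by fact
 have h: "operad_hom K P Q f" and b: "bij_betw f (elts P) (elts Q)" using f by (simp_all add: operad_iso_def)
 interpret f: op_hom K P Q f by (rule op_homI[OF P Q h])
 let ?g = "inv_into (elts P) f"
 have fg: "f (?g y) = y" "?g y : elts P" if "y : elts Q" for y
 using b that by (auto simp: bij_betw_def f_inv_into_f inv_into_into)
 have gf: "?g (f x) = x" if "x : elts P" for x using b that by (simp add: bij_betw_def inv_into_f_f)
 have eq: "x = ?g y" if "x : elts P" "f x = y" for x y using gf that by auto
 have gg: "?g y : gr P n d" if "y : gr Q n d" for y n d
 using that fg[of y] f.hom_grade[of "?g y"] by (simp add: gr_iff)
 show "operad_iso K Q P ?g" unfolding operad_iso_def
 proof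
 show "bij_betw ?g (elts Q) (elts P)" by (rule bij_betw_inv_into[OF b])
 show "operad_hom K Q P ?g"
 proof (rule operad_homI)
 show "smod_hom K Q P ?g"
 proof (rule smod_homI)
 fix n d y assume y: "y : gr Q n d"
 hence yQ: "y : elts Q" by (simp add: gr_iff)
 show "?g y : gr P n d" by (rule gg[OF y])
 show "?g (pls Q y z) = pls P (?g y) (?g z)" if z: "z : gr Q n d" for z
 by (rule eq[symmetric])
 (use P.pls_gr[OF gg[OF y] gg[OF z]] f.hom_pls[OF gg[OF y] gg[OF z]] fg y z in "simp_all add: gr_iff")
 show "?g (scale Q c y) = scale P c (?g y)" if c: "c : carrier K" for c
 by (rule eq[symmetric]) (use P.scale_gr[OF c gg[OF y]] f.hom_scale[OF c fg(2)[OF yQ]] fg yQ in "simp_all add: gr_iff")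
 show "?g (perm Q \<pi> y) = perm P \<pi> (?g y)" if s: "\<pi> permutes {..<n}" for \<pi>
 by (rule eq[symmetric]) (use P.perm_gr[OF gg[OF y] s] f.hom_perm[OF gg[OF y] s] fg yQ in "simp_all add: gr_iff")
 qed
 show "?g (unt Q) = unt P" by (rule eq[symmetric, OF P.unit_closed f.hom_unt])
 fix a bs assume c: "composable Q a bs"
 have aQ: "a : elts Q" and bQ: "set bs \<subseteq> elts Q" using c by (simp_all add: composable_def)
 have c': "composable P (?g a) (map ?g bs)"
 using c fg gg[OF elts_gr[OF aQ]] bQ by (auto simp: composable_def gr_iff)
 have "map f (map ?g bs) = bs" using bQ fg(1) by (induction bs) auto
 thus "?g (cmp Q a bs) = cmp P (?g a) (map ?g bs)"
 by (intro eq[symmetric] P.comp_closed[OF c']) (simp only: f.hom_cmp[OF c'] fg(1)[OF aQ])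
 qed
 qed
qed

section \<open>Homology of a quotient of a contractible operad\<close>

text \<open>The dg operad \<open>L\<close> is a quotient of the contractible dg operad \<open>C\<close>, and \<open>\<rho>\<close> chooses, linearly, an
  element with differential \<open>x\<close> for every cycle \<open>x\<close> in the kernel of \<open>p\<close>.\<close>

locale contractible_cover = contraction K C e X h + L: dg_operad K L + R: smodule K R
 for K :: "('k, 'z) ring_scheme" (structure) and C :: "('k, 'a, 'm) dgoperad_scheme" and e X h
 and L :: "('k, 'b, 'n) dgoperad_scheme" and R :: "('k, 'r, 'p) smod_scheme" +
 fixes p \<rho>
 assumes p_hom: "dg_hom K C L p" and p_surj: "elts L \<subseteq> p ` elts C"
 and rho_hom: "smod_hom K R C \<rho>"
 and rho_nul: "r : elts R ==> p (D (\<rho> r)) = nul L (arity R r) (deg R r - 1)"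
 and rho_onto: "[|x : gr C n d; D x = nul C n (d - 1); p x = nul L n d|] ==>
 \<exists>r\<in>gr R n (d + 1). D (\<rho> r) = x"
begin
abbreviation "F \<equiv> free K R"
abbreviation "g \<equiv> free_map K R C \<rho>"
abbreviation "H \<equiv> homology K L"

text \<open>The projection to the free operad of the pullback by which the cokernel is defined.\<close>

definition kernel_set :: "('k, 'r) tm set set" where
 "kernel_set = {x : elts F. \<exists>k\<in>gr C (arity F x) (deg F x). \<exists>z\<in>gr C (arity F x) (deg F x).
 p k = nul L (arity F x) (deg F x) & D z = nul C (arity F x) (deg F x - 1) & z : op_ideal K C X &
 g x = pls C k z}"
sublocale p: op_hom K C L p
 using p_hom by (intro op_homI operad_axioms L.operad_axioms) (simp add: dg_hom_def)
lemma p_dif: "x : elts C ==> p (D x) = dif L (p x)"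
 using p_hom by (simp add: dg_hom_def)
sublocale F: operad K F by (rule R.operad_free)

lemmas g_props = R.free_map_properties[OF operad_axioms rho_hom]
sublocale g: op_hom K F C g by (rule op_homI[OF F.operad_axioms operad_axioms g_props(2)])
abbreviation "q x \<equiv> p (g x)"
lemma q_hom: "operad_hom K F L (%x. q x)" by (rule operad_hom_comp[OF g_props(2) p.op_hom])
sublocale q: op_hom K F L "%x. q x" by (rule op_homI[OF F.operad_axioms L.operad_axioms q_hom])
lemma q_cycles: assumes "x : elts F" shows "q x : cycles L"
proof -
 have "(%x. q x) ` gen K R ` elts R \<subseteq> cycles L"
 proof clarify
 fix r assume r: "r : elts R"
 have rg: "\<rho> r : gr C (arity R r) (deg R r)" by (rule smod_hom_gr[OF rho_hom elts_gr[OF r]])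
 hence re: "\<rho> r : elts C" by (simp add: gr_iff)
 have "q (gen K R r) = p (\<rho> r)" by (simp add: g_props(3)[OF r])
 moreover have "p (\<rho> r) : gr L (arity R r) (deg R r)" by (rule p.hom_gr[OF rg])
 ultimately show "q (gen K R r) : cycles L" using p_dif[OF re] rho_nul[OF r] by (simp add: cycles_def gr_iff)
 qed
 note cl = L.opspan_restrict[OF L.operad_cycles this]
 have "q x : (%x. q x) ` opspan K F (gen K R ` elts R)" using assms R.free_generated by blast
 thus ?thesis using q.hom_opspan[OF R.gens_elts] cl by blast
qed
lemma q_gr: assumes "x : gr F n d" shows "q x : gr L.Z n d"
proof -
 have "x : elts F" using assms by (simp add: gr_iff)
 from q_cycles[OF this] q.hom_gr[OF assms] show ?thesis by (simp add: gr_restrict gr_iff)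
qed
lemma q_hom_Z: "operad_hom K F L.Z (%x. q x)"
proof (rule operad_homI)
 show "smod_hom K F L.Z (%x. q x)"
 proof (rule smod_homI)
 fix n d x assume x: "x : gr F n d"
 show "q x : gr L.Z n d" by (rule q_gr[OF x])
 show "q (pls F x y) = pls L.Z (q x) (q y)" if "y : gr F n d" for y using q.hom_pls[OF x that] by simp
 show "q (scale F c x) = scale L.Z c (q x)" if "c : carrier K" for c using q.hom_scale[OF that, of x] x by (simp add: gr_iff)
 show "q (perm F \<pi> x) = perm L.Z \<pi> (q x)" if "\<pi> permutes {..<n}" for \<pi> using q.hom_perm[OF x that] by simp
 qed
 show "q (unt F) = unt L.Z" using q.hom_unt by simp
 show "q (cmp F a bs) = cmp L.Z (q a) (map (%x. q x) bs)" if "composable F a bs" for a bs using q.hom_cmp[OF that] by simp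
qed
abbreviation "k x \<equiv> L.cls (q x)"
lemma k_hom: "operad_hom K F H (%x. k x)"
 by (rule operad_hom_comp[OF q_hom_Z L.cls_hom])
sublocale c: op_hom K L.Z H "%x. L.cls x"
 by (rule op_homI[OF L.operad_cycles L.operad_homology L.cls_hom])
sublocale k: op_hom K F H "%x. k x"
 by (rule op_homI[OF F.operad_axioms L.operad_homology k_hom])

text \<open>The image of \<open>x\<close> in \<open>L\<close> is a boundary \<open>p (\<partial> c)\<close> if and only if \<open>g x\<close> differs by an element of the
  kernel of \<open>p\<close> from a boundary \<open>\<partial> c\<close>, and the boundaries of \<open>C\<close> are the cycles of its augmentation ideal.\<close>

lemma k_nul_iff: assumes x: "x : gr F n d" shows "k x = nul H n d \<longleftrightarrow> x : kernel_set"
proof -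
 have xe: "x : elts F" "arity F x = n" "deg F x = d" using x by (simp_all add: gr_iff)
 have "k x = nul H n d \<longleftrightarrow> q x : L.B" by (rule L.cls_nul[OF q_gr[OF x]])
 also have "... \<longleftrightarrow> x : kernel_set"
 proof
 assume "x : kernel_set"
 then obtain u z where u: "u : gr C n d" "z : gr C n d" "p u = nul L n d" "D z = nul C n (d - 1)" "z : op_ideal K C X"
 "g x = pls C u z" unfolding kernel_set_def xe(2,3)[symmetric] by blast
 have hz: "h z : elts C" using h_gr[OF u(2)] by (simp add: gr_iff)
 have "q x = p z" unfolding u(6) p.hom_pls[OF u(1,2)] u(3) by (rule L.nul_pls[OF p.hom_gr[OF u(2)]])
 also have "p z = p (D (h z))" using cycle_boundary[OF u(5,2,4)] by simp
 also have "... = dif L (p (h z))" by (rule p_dif[OF hz])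
 finally show "q x : L.B" using p.hom_gr[OF elts_gr[OF hz]] by (auto simp: gr_iff)
 next
 assume "q x : L.B"
 then obtain y where y: "y : elts L" "q x = dif L y" by blast
 obtain c where c: "c : elts C" "y = p c" using p_surj y(1) by blast
 have yg: "y : gr L n (d + 1)" using L.dif_gr[OF elts_gr[OF y(1)]] q.hom_gr[OF x] y by (simp add: gr_iff)
 have cg: "c : gr C n (d + 1)" using yg c p.hom_grade[OF c(1)] by (simp add: gr_iff)
 have Dc: "D c : gr C n d" using D_gr[OF cg] by simp
 have gx: "g x : gr C n d" by (rule g.hom_gr[OF x])
 let ?u = "mns K C (g x) (D c)"
 have "p (D c) = q x" using p_dif[OF c(1)] c y by simp
 hence "p ?u = nul L n d" using p.sm.hom_mns[OF gx Dc] L.mns_self[OF q.hom_gr[OF x]] by simp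
 moreover have "D (D c) = nul C n (d - 1)" using dif_dif[OF c(1)] cg by (simp add: gr_iff)
 ultimately show "x : kernel_set"
 unfolding kernel_set_def using xe mns_gr[OF gx Dc] Dc D_ideal[OF c(1)] mns_pls_cancel[OF gx Dc]
 by (intro CollectI conjI bexI[of _ ?u] bexI[of _ "D c"]) simp_all
 qed
 finally show ?thesis .
qed
lemma scalar_lift: assumes "x : gr C n d" shows "\<exists>s\<in>gr F n d. g s = e x"
proof -
 have xe: "x : elts C" using assms by (simp add: gr_iff)
 have eg: "e x : gr C n d" by (rule e.hom_gr[OF assms])
 consider "e x = nul C n d" | c where "c : carrier K" "e x = scale C c (unt C)"
 using e_scalar[OF xe] eg by (auto simp: scalar_def gr_iff)
 thus ?thesis
 proof cases
 case 1
 thus ?thesis by (intro bexI[of _ "nul F n d"]) (simp_all add: g.sm.hom_nul)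
 next
 case 2
 have u: "scale F c (unt F) : gr F 1 0" by (rule F.scale_gr[OF 2(1) F.unt_gr])
 have gu: "g (scale F c (unt F)) = e x" using g.hom_scale[OF 2(1) F.unit_closed] g.hom_unt 2(2) by simp
 have "n = 1" "d = 0" using eg g.hom_gr[OF u] gu by (simp_all add: gr_iff)
 thus ?thesis using u gu by blast
 qed
qed

text \<open>A representative \<open>c\<close> in \<open>C\<close> of a cycle of \<open>L\<close> is corrected by \<open>\<rho> r\<close> to a cycle of \<open>C\<close>, where \<open>r\<close>
  corresponds to \<open>\<partial> c\<close>; the corrected cycle is a boundary plus a multiple of the unit.\<close>

lemma k_surj: "(%x. k x) ` elts F = elts H"
proof (intro equalityI subsetI)
 fix Y assume "Y : (%x. k x) ` elts F"
 thus "Y : elts H" using q_cycles unfolding L.homology_elts by blast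
next
 fix Y assume "Y : elts H"
 then obtain y where y: "y : cycles L" "Y = L.cls y" unfolding L.homology_elts by blast
 define n d where "n = arity L y" and "d = deg L y"
 have yL: "y : elts L" and yD: "dif L y = nul L n (d - 1)" and yg: "y : gr L n d"
 using y by (simp_all add: cycles_def n_def d_def gr_iff)
 obtain c where c: "c : elts C" "y = p c" using p_surj yL by blast
 have cg: "c : gr C n d" using yg c p.hom_grade[OF c(1)] by (simp add: gr_iff)
 have Dc: "D c : gr C n (d - 1)" by (rule D_gr[OF cg])
 have "D (D c) = nul C n (d - 1 - 1)" using dif_dif[OF c(1)] cg by (simp add: gr_iff)
 moreover have "p (D c) = nul L n (d - 1)" using p_dif[OF c(1)] c(2) yD by simp
 ultimately obtain r where r: "r : gr R n (d - 1 + 1)" "D (\<rho> r) = D c" using rho_onto[OF Dc] by blast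
 hence rg: "r : gr R n d" and re: "r : elts R" by (simp_all add: gr_iff)
 have rr: "\<rho> r : gr C n d" by (rule smod_hom_gr[OF rho_hom rg])
 let ?c = "mns K C c (\<rho> r)"
 have c': "?c : gr C n d" by (rule mns_gr[OF cg rr])
 have "D ?c = nul C n (d - 1)" using d.hom_mns[OF cg rr] r(2) mns_self[OF Dc] by (simp add: mns_def)
 from cycle_decompose[OF c' this] have dec: "?c = pls C (D (h ?c)) (e ?c)" .
 have hg: "h ?c : gr C n (d + 1)" by (rule h_gr[OF c'])
 hence he: "h ?c : elts C" by (simp add: gr_iff)
 have Dh: "D (h ?c) : gr C n d" using D_gr[OF hg] by simp
 obtain s where s: "s : gr F n d" "g s = e ?c" using scalar_lift[OF c'] by blast
 have gr: "gen K R r : gr F n d" by (rule R.gen_gr[OF rg])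
 have eg: "e ?c : gr C n d" by (rule e.hom_gr[OF c'])
 let ?x = "pls F s (gen K R r)" and ?b = "dif L (p (h ?c))"
 have xg: "?x : gr F n d" by (rule F.pls_gr[OF s(1) gr])
 have gx: "g ?x = pls C (e ?c) (\<rho> r)" using g.hom_pls[OF s(1) gr] s(2) g_props(3)[OF re] by simp
 have bB: "?b : L.B" using p.hom_gr[OF hg] by (auto simp: gr_iff)
 have bg: "?b : gr L.Z n d"
 using L.hom.I_elts[OF bB] L.dif_gr[OF p.hom_gr[OF hg]] by (simp add: gr_restrict gr_iff)
 have "c = pls C ?c (\<rho> r)" by (rule mns_pls_cancel[OF cg rr, symmetric])
 also have "... = pls C (pls C (D (h ?c)) (e ?c)) (\<rho> r)" using dec by (rule arg_cong)
 also have "... = pls C (D (h ?c)) (g ?x)" unfolding gx by (rule pls_assoc[OF Dh eg rr])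
 finally have "y = pls L.Z ?b (q ?x)"
 using c(2) p.hom_pls[OF Dh g.hom_gr[OF xg]] p_dif[OF he] by simp
 hence "Y = pls H (L.cls ?b) (k ?x)" using y(2) c.hom_pls[OF bg q_gr[OF xg]] by simp
 also have "L.cls ?b = nul H n d" using L.cls_nul[OF bg] bB by simp
 also have "pls H (nul H n d) (k ?x) = k ?x"
 by (rule smodule.nul_pls[OF operad.axioms(1)[OF L.operad_homology] k.hom_gr[OF xg]])
 finally have "Y = k ?x" .
 thus "Y : (%x. k x) ` elts F" using xg by (auto simp: gr_iff)
qed
lemma homology_iso: "\<exists>f. operad_iso K H (quotient_op K F kernel_set) f"
proof -
 interpret Q: quotient_operad K F kernel_set
 by (intro quotient_operad.intro quotient_operad_axioms.intro F.operad_axioms) (simp add: kernel_set_def)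
 have nul: "k x = nul H (arity F x) (deg F x)" if "x : kernel_set" for x
 proof -
 have "x : elts F" using that by (simp add: kernel_set_def)
 thus ?thesis using k_nul_iff[OF elts_gr] that by simp
 qed
 let ?Q = "quotient_op K F kernel_set" and ?p = "quotient_proj K F kernel_set"
 obtain f where f: "operad_hom K ?Q H f" "!!x. x : elts F ==> f (?p x) = k x"
 using Q.quotient_factor[OF L.operad_homology k_hom nul] by blast
 interpret f: op_hom K ?Q H f by (rule op_homI[OF Q.operad_quotient L.operad_homology f(1)])
 have "f ` elts ?Q = elts H"
 unfolding Q.proj_surj[symmetric] k_surj[symmetric] image_image by (rule image_cong[OF refl f(2)])
 moreover have "inj_on f (elts ?Q)"
 proof (rule inj_onI)
 fix A B assume AB: "A : elts ?Q" "B : elts ?Q" "f A = f B"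
 obtain x y where xy: "x : elts F" "A = ?p x" "y : elts F" "B = ?p y"
 using AB(1,2) unfolding Q.proj_surj[symmetric] by blast
 have kk: "k x = k y" using AB(3) f(2)[OF xy(1)] f(2)[OF xy(3)] xy by simp
 hence g: "x : comp_of F x" "y : comp_of F x"
 using xy k.hom_grade[OF xy(1)] k.hom_grade[OF xy(3)] by (simp_all add: gr_iff)
 have "k (mns K F x y) = nul H (arity F x) (deg F x)" using k.hom_eq_iff[OF g] kk by simp
 hence "mns K F x y : kernel_set" using k_nul_iff[OF F.mns_gr[OF g]] by simp
 from Q.proj_eq[OF this g] show "A = B" using xy by simp
 qed
 ultimately have "operad_iso K ?Q H f" using f(1) by (simp add: operad_iso_def bij_betw_def)
 from operad_iso_inverse[OF Q.operad_quotient L.operad_homology this] show ?thesis .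
qed

end

section \<open>The universal linking operad\<close>

lemma shift_inverse: "shift (- 1) (shift 1 (G :: ('k, 'g) smod)) = G"
 by (simp add: shift_shift shift_0 smod_truncate_id)
lemma restrict_sel:
 "elts (M\<lparr>elts := S\<rparr>) = S" "arity (M\<lparr>elts := S\<rparr>) = arity M" "deg (M\<lparr>elts := S\<rparr>) = deg M"
 by simp_all

theorem proposition3p1:
  fixes K :: "('k, 'z) ring_scheme"
    and G :: "('k, 'g) smod"
    and Q :: "('k, 'a) operad"
    and \<gamma> :: "'g \<Rightarrow> 'a"
  assumes "field K"
    and "generated_by K G \<gamma> Q"
    and "linking_choice K G \<gamma> Q \<iota>"
  shows "\<exists>h. operad_iso K (homology K (lu_gen K G \<gamma> Q)) (R_op K G \<gamma> Q \<iota>) h"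
proof -
 interpret GQ: generated_by K G \<gamma> Q by fact
 let ?M = "shift 1 G"
 let ?C = "ch K (free K ?M)" and ?A = "ch K (free K G)" and ?T = "trivial_dif Q"
 interpret M: free_chainification K ?M
 by (intro free_chainification.intro smodule_shift GQ.G.smodule_axioms)
 interpret A: free_chainification K G by (intro free_chainification.intro GQ.G.smodule_axioms)
 interpret cM: chainification K "free K ?M" by (rule M.chainification_free)
 interpret cA: chainification K "free K G" by (rule A.chainification_free)
 interpret T: dg_operad K ?T by (rule GQ.O.dg_operad_trivial_dif)
 let ?f = "lu_left K ?M G \<gamma> ?T (gen K G)" and ?r = "lu_right K ?M (gen K ?M) (free K ?M)"
 have gT: "smod_hom K G ?T \<gamma>" using GQ.gamma_hom by (simp add: trivial_dif_def)
 note fm = GQ.G.free_map_properties[OF T.operad_axioms gT]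
 have "smod_hom K G ?T (%x. free_map K G ?T \<gamma> (gen K G x))"
 by (rule smod_hom_cong[OF gT GQ.G.smodule_axioms]) (rule fm(3))
 note fp = GQ.G.ch_free_map_properties[OF T.dg_operad_axioms this]
 have f: "dg_hom K ?A ?T ?f" "!!x. x : elts G ==> ?f (ch_iota K (free K G) (gen K G x)) = \<gamma> x"
 using fp fm(3) by (simp_all only: lu_left_def shift_inverse)
 have "smod_hom K (shift (- 1) ?M) (shift (- 1) (free K ?M)) (gen K ?M)"
 using M.gen_smod_hom by (simp add: smod_hom_def same_grade_def)
 hence "smod_hom K (shift (- 1) ?M) ?C (%x. M.dgen x)"
 by (rule smod_hom_comp[where g = "ch_del K (free K ?M)"]) (simp add: cM.del_hom)
 hence "smod_hom K G ?C (%x. M.dgen x)" unfolding shift_inverse .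
 note rp = GQ.G.ch_free_map_properties[OF cM.dg_operad_ch this]
 have r: "dg_hom K ?A ?C ?r" using rp(1) by (simp only: lu_right_def shift_inverse)
 interpret po: pushout_data K ?A ?T ?C ?f ?r
 by (intro pushout_data.intro pushout_data_axioms.intro cA.dg_operad_ch T.dg_operad_axioms cM.dg_operad_ch f(1) r)
 let ?p = "lu_proj K G \<gamma> Q" and ?L = "lu_gen K G \<gamma> Q"
 have L: "?L = pushout K ?A ?T ?C ?f ?r" by (simp only: lu_gen_def lu_def shift_inverse)
 have p: "?p = po_in2 K ?A ?T ?C ?f ?r" by (rule ext) (simp only: lu_proj_def lu_in2_def shift_inverse)
 have dgL: "dg_operad K ?L" unfolding L by (rule po.dg_operad_pushout)
 interpret L: dg_operad K ?L by (rule dgL)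
 have p_hom: "dg_hom K ?C ?L ?p" unfolding L p by (rule po.in_dg_hom(2))
 interpret p: op_hom K ?C ?L ?p
 using p_hom by (intro op_homI cM.operad_ch L.operad_axioms) (simp only: dg_hom_def)
 let ?i = "po_in1 K ?A ?T ?C ?f ?r"
 have i_hom: "operad_hom K ?T ?L ?i" using po.in_dg_hom(1) unfolding L dg_hom_def by blast
 have p_surj: "elts ?L \<subseteq> ?p ` elts ?C"
 proof -
 have j: "operad_hom K (free K G) ?L (%y. ?i (free_map K G ?T \<gamma> y))" by (rule operad_hom_comp[OF fm(2) i_hom])
 interpret j: op_hom K "free K G" ?L "%y. ?i (free_map K G ?T \<gamma> y)"
 by (rule op_homI[OF GQ.G.operad_free L.operad_axioms j])
 have "(%y. ?i (free_map K G ?T \<gamma> y)) ` gen K G ` elts G \<subseteq> ?p ` elts ?C"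
 proof clarify
 fix x assume x: "x : elts G"
 have xi: "ch_iota K (free K G) (gen K G x) : elts ?A" using A.ch_gen_gr(1)[OF elts_gr[OF x]] by (simp only: gr_iff)
 have "?i (free_map K G ?T \<gamma> (gen K G x)) = ?i (?f (ch_iota K (free K G) (gen K G x)))" by (simp only: fm(3)[OF x] f(2)[OF x])
 also have "... = ?p (?r (ch_iota K (free K G) (gen K G x)))" unfolding p by (rule po.in1_eq_in2[OF xi])
 finally have 1: "?i (free_map K G ?T \<gamma> (gen K G x)) = ?p (?r (ch_iota K (free K G) (gen K G x)))" .
 have "?r (ch_iota K (free K G) (gen K G x)) : elts ?C"
 using r xi unfolding dg_hom_def operad_hom_def smod_hom_def by blast
 thus "?i (free_map K G ?T \<gamma> (gen K G x)) : ?p ` elts ?C" unfolding 1 by (rule imageI)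
 qed
 from p.opspan_image[OF this] j.hom_opspan[OF GQ.G.gens_elts]
 have sub: "(%y. ?i (free_map K G ?T \<gamma> y)) ` opspan K (free K G) (gen K G ` elts G) \<subseteq> ?p ` elts ?C" by (rule order_trans[rotated])
 have fr: "free_map K G ?T \<gamma> y = free_map K G Q \<gamma> y" if y: "y : elts (free K G)" for y
 proof -
 note fq = GQ.G.free_map_properties[OF GQ.O.operad_axioms GQ.gamma_hom]
 have t: "operad_hom K (free K G) Q (free_map K G ?T \<gamma>)" using fm(2) by (simp add: trivial_dif_def)
 show ?thesis
 proof (rule hom_eq_on_opspan[OF _ _ GQ.G.gens_elts])
 show "op_hom K (free K G) Q (free_map K G ?T \<gamma>)" by (rule op_homI[OF GQ.G.operad_free GQ.O.operad_axioms t])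
 show "op_hom K (free K G) Q (free_map K G Q \<gamma>)" by (rule op_homI[OF GQ.G.operad_free GQ.O.operad_axioms fq(2)])
 show "y : opspan K (free K G) (gen K G ` elts G)" using y GQ.G.free_generated by blast
 qed (use fm(3) fq(3) in auto)
 qed
 have "?i ` elts ?T \<subseteq> ?p ` elts ?C"
 proof clarify
 fix t assume "t : elts ?T"
 hence "t : elts Q" by (simp add: trivial_dif_def)
 then obtain y where y: "y : elts (free K G)" "t = free_map K G Q \<gamma> y" using GQ.generates by blast
 have "y : opspan K (free K G) (gen K G ` elts G)" using y(1) GQ.G.free_generated by blast
 from subsetD[OF sub imageI[OF this]] show "?i t : ?p ` elts ?C" by (simp only: y(2) fr[OF y(1)])
 qed
 hence "?i ` elts ?T \<union> ?p ` elts ?C \<subseteq> ?p ` elts ?C" by (rule Un_least[OF _ subset_refl])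
 from p.opspan_image[OF this] show ?thesis using po.pushout_generated unfolding L p by (rule order_trans[rotated])
 qed
 obtain e h where con: "contraction K ?C e M.ch_gens h" using M.ch_free_contraction by (elim exE)
 have chs: "chs K G = ?C" by (simp only: chs_def)
 have gens: "chs_gens K G = M.ch_gens" by (simp only: chs_gens_def shift_simps)
 let ?R = "susp_R K G \<gamma> Q" and ?dR = "del_R K G \<gamma> Q"
 let ?S = "cycles ?C \<inter> {x : elts ?C. ?p x = nul ?L (arity ?C x) (deg ?C x)}"
 have dR: "?dR = ?C\<lparr>elts := ?S\<rparr>" unfolding del_R_def ker_p_def chs by (simp only: restrict_sel)
 have R: "?R = shift 1 (?C\<lparr>elts := ?S\<rparr>)" by (simp only: susp_R_def dR)
 have sub: "submod K ?C ?S" by (rule submod_Int[OF dg_operad.submod_cycles[OF cM.dg_operad_ch] smodule_hom.submod_kernel[OF p.sm.smodule_hom_axioms]])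
 have smdR: "smodule K ?dR" unfolding dR by (rule smodule.smodule_restrict[OF operad.axioms(1)[OF cM.operad_ch] sub])
 have smR: "smodule K ?R" unfolding susp_R_def by (rule smodule_shift[OF smdR])
 let ?\<rho> = "%r. \<iota> (inj1 ?R ?dR r)"
 have lc: "smod_hom K (dsum ?R ?dR) ?C \<iota>" "!!z. z : elts (dsum ?R ?dR) ==> dif ?C (\<iota> z) = \<iota> (inj2 ?R ?dR (fst z))"
 "!!x. x : elts ?dR ==> \<iota> (inj2 ?R ?dR x) = x"
 using assms(3) unfolding linking_choice_def Let_def chs by blast+
 note i1 = smod_hom_inj1[OF smR smdR]
 have rho: "smod_hom K ?R ?C ?\<rho>" by (rule smod_hom_comp[OF i1 lc(1)])
 have Re: "elts ?R = ?S" "elts ?dR = ?S" by (simp_all only: R dR shift_simps restrict_sel)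
 have Drho: "dif ?C (?\<rho> r) = r" if rS: "r : ?S" for r
 proof -
 have "r : elts ?R" using rS by (simp only: Re)
 hence "inj1 ?R ?dR r : elts (dsum ?R ?dR)" using smod_hom_gr[OF i1 elts_gr] by (simp only: gr_iff)
 from lc(2)[OF this] have "dif ?C (?\<rho> r) = \<iota> (inj2 ?R ?dR r)" by (simp only: inj1_def fst_conv)
 also have "... = r" by (rule lc(3)) (use rS in "simp only: Re")
 finally show ?thesis .
 qed
 have Rar: "arity ?R r = arity ?C r" "deg ?R r = deg ?C r + 1" for r by (simp_all only: R shift_simps restrict_sel)
 interpret cov: contractible_cover K ?C e M.ch_gens h ?L ?R ?p ?\<rho>
 proof (intro contractible_cover.intro contractible_cover_axioms.intro con dgL smR p_hom p_surj rho)
 fix r assume "r : elts ?R"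
 hence rS: "r : ?S" by (simp only: Re)
 have "deg ?C r + 1 - 1 = deg ?C r" by simp
 thus "?p (dif ?C (?\<rho> r)) = nul ?L (arity ?R r) (deg ?R r - 1)"
 using rS by (simp only: Drho[OF rS] Rar Int_iff mem_Collect_eq)
 next
 fix x n d assume x: "x : gr ?C n d" "dif ?C x = nul ?C n (d - 1)" "?p x = nul ?L n d"
 hence x': "x : elts ?C" "arity ?C x = n" "deg ?C x = d" by (simp_all only: gr_iff)
 have xS: "x : ?S" using x(2,3) x' by (simp only: cycles_def Int_iff mem_Collect_eq simp_thms)
 have "x : gr ?R n (d + 1)" unfolding gr_iff Rar Re using xS x' by (simp only: simp_thms)
 thus "\<exists>r\<in>gr ?R n (d + 1). dif ?C (?\<rho> r) = x" using Drho[OF xS] by (rule rev_bexI)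
 qed
 have "R_op K G \<gamma> Q \<iota> = quotient_op K (free K ?R) cov.kernel_set"
 proof -
 let ?g = "free_map K ?R ?C ?\<rho>" and ?F = "free K ?R"
 let ?kp = "ker_p K G \<gamma> Q" and ?kd = "ker_del K G"
 have kp: "elts ?kp = {x : elts ?C. ?p x = nul ?L (arity ?C x) (deg ?C x)}" "arity ?kp = arity ?C" "deg ?kp = deg ?C"
 by (simp_all only: ker_p_def chs restrict_sel)
 have kd: "elts ?kd = cycles ?C \<inter> op_ideal K ?C M.ch_gens" "arity ?kd = arity ?C" "deg ?kd = deg ?C"
 by (simp_all only: ker_del_def chs gens restrict_sel)
 have "pullback_image ?F ?g (dsum ?kp ?kd) (%(x, y). pls ?C x y) = cov.kernel_set"
 proof (rule Set.set_eqI)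
 fix x
 have "x : pullback_image ?F ?g (dsum ?kp ?kd) (%(x, y). pls ?C x y) \<longleftrightarrow>
 x : elts ?F & (\<exists>u z. u : elts ?kp & z : elts ?kd & arity ?kp u = arity ?kd z & deg ?kp u = deg ?kd z &
 arity ?F x = arity ?kp u & deg ?F x = deg ?kp u & ?g x = pls ?C u z)"
 by (auto simp: pullback_image_def elts_dsum image_iff dsum_def simp del: cM.ch_sel)
 also have "... \<longleftrightarrow> x : cov.kernel_set" (is "?l \<longleftrightarrow> _")
 proof
 assume ?l
 then obtain u z where a: "x : elts ?F" "u : elts ?C" "?p u = nul ?L (arity ?C u) (deg ?C u)" "z : elts ?C"
 "dif ?C z = nul ?C (arity ?C z) (deg ?C z - 1)" "z : op_ideal K ?C M.ch_gens"
 "arity ?C z = arity ?F x" "deg ?C z = deg ?F x" "arity ?C u = arity ?F x" "deg ?C u = deg ?F x" "?g x = pls ?C u z"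
 unfolding kp kd cycles_def Int_iff mem_Collect_eq by metis
 show "x : cov.kernel_set"
 unfolding cov.kernel_set_def
 by (intro CollectI conjI bexI[of _ u] bexI[of _ z]) (simp_all only: gr_iff a simp_thms)
 next
 assume "x : cov.kernel_set"
 then obtain u z where a: "x : elts ?F" "u : gr ?C (arity ?F x) (deg ?F x)" "z : gr ?C (arity ?F x) (deg ?F x)"
 "?p u = nul ?L (arity ?F x) (deg ?F x)" "dif ?C z = nul ?C (arity ?F x) (deg ?F x - 1)"
 "z : op_ideal K ?C M.ch_gens" "?g x = pls ?C u z"
 unfolding cov.kernel_set_def mem_Collect_eq by (elim conjE bexE) (rule that)
 have b: "u : elts ?C" "arity ?C u = arity ?F x" "deg ?C u = deg ?F x" "z : elts ?C" "arity ?C z = arity ?F x" "deg ?C z = deg ?F x"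
 using a(2,3) by (simp_all only: gr_iff)
 show ?l unfolding kp kd cycles_def Int_iff mem_Collect_eq
 by (intro conjI exI[of _ u] exI[of _ z]) (simp_all only: a(1,4-7) b)
 qed
 finally show "x : pullback_image ?F ?g (dsum ?kp ?kd) (%(x, y). pls ?C x y) \<longleftrightarrow> x : cov.kernel_set" .
 qed
 thus ?thesis unfolding R_op_def Let_def chs by (rule arg_cong)
 qed
 thus ?thesis using cov.homology_iso by (simp only:)
qed

end
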